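(* Let $K$ be a field of characteristic zero with infinite transcendence degree over $\mathbb{Q}$. Then: (1) If there is a gt-henselian topology on $K$, then there are $2^{2^{|K|}}$ pairwise incomparable gt-henselian topologies on $K$, and there are $2^{|K|}$ pairwise incomparable gt-henselian topologies of weight $\le |K|$ on $K$. (2) If $\tau$ is a gt-henselian topology of weight $\le |K|$ on $K$, then there are $2^{2^{|K|}}$ pairwise incomparable gt-henselian topologies on $K$ refining $\tau$. (3) If $\tau$ is a locally bounded gt-henselian topology on $K$, then there are $2^{|K|}$ pairwise incomparable locally bounded gt-henselian topologies on $K$ refining $\tau$. (4) If $K$ is large and countable, then there are $2^{2^{\aleph_0}}$ pairwise incomparable gt-henselian topologies on $K$, and there are $2^{\aleph_0}$ pairwise incomparable second countable gt-henselian topologies on $K$.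
   Context: All field topologies are assumed to be Hausdorff. A gt-henselian topology on a field $K$ is a non-discrete field topology such that for every neighborhood $U$ of $-1$ and every $d \in \mathbb{N}$ there is a neighborhood $V$ of $0$ such that $x^{d+2} + x^{d+1} + a_d x^d + \cdots + a_1 x + a_0$ has a simple root in $U$ whenever $a_0,\ldots,a_d \in V$. The weight of a topology is the minimal cardinality of a basis. A topology $\tau'$ refines $\tau$ if every $\tau$-open set is $\tau'$-open; two topologies are incomparable if neither refines the other. Given a field topology on $K$, a set $X \subseteq K$ is bounded if for every neighborhood $U$ of $0$ there is $\lambda \in K^\times$ with $\lambda X \subseteq U$; the topology is locally bounded if some nonempty open set is bounded. A field $K$ is large if every smooth $1$-dimensional $K$-variety with a $K$-point has infinitely many $K$-points. *)

theory Defs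
  imports
    "HOL-Analysis.Analysis"
    "HOL-Library.Poly_Mapping"
    "HOL-Library.Function_Algebras"
    "HOL-Algebra.Algebraic_Closure_Type"
begin

unbundle cardinal_syntax

section \<open>Field topologies\<close>

text \<open>Continuity of negation and of subtraction follows from that of multiplication and addition.\<close>

definition field_topology :: "'a::field topology \<Rightarrow> bool" where
  "field_topology T \<longleftrightarrow>
     topspace T = UNIV \<and> Hausdorff_space T \<and>
     continuous_map (prod_topology T T) T (\<lambda>(x, y). x + y) \<and>
     continuous_map (prod_topology T T) T (\<lambda>(x, y). x * y) \<and>
     continuous_map (subtopology T (- {0})) T inverse"

definition nbhd :: "'a topology \<Rightarrow> 'a \<Rightarrow> 'a set \<Rightarrow> bool" where
  "nbhd T x U \<longleftrightarrow> U \<subseteq> topspace T \<and> (\<exists>W. openin T W \<and> x \<in> W \<and> W \<subseteq> U)"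

definition gt_poly :: "nat \<Rightarrow> (nat \<Rightarrow> 'a::field) \<Rightarrow> 'a poly" where
  "gt_poly d a =
     Polynomial.monom 1 (d + 2) + Polynomial.monom 1 (d + 1) + (\<Sum>i\<le>d. Polynomial.monom (a i) i)"

definition gt_henselian :: "'a::field topology \<Rightarrow> bool" where
  "gt_henselian T \<longleftrightarrow>
     field_topology T \<and> T \<noteq> discrete_topology UNIV \<and>
     (\<forall>U d. nbhd T (-1) U \<longrightarrow>
        (\<exists>V. nbhd T 0 V \<and>
          (\<forall>a. (\<forall>i\<le>d. a i \<in> V) \<longrightarrow>
             (\<exists>x\<in>U. Polynomial.order x (gt_poly d a) = 1))))"

definition field_bounded :: "'a::field topology \<Rightarrow> 'a set \<Rightarrow> bool" where
  "field_bounded T S \<longleftrightarrow> (\<forall>U. nbhd T 0 U \<longrightarrow> (\<exists>c. c \<noteq> 0 \<and> (\<lambda>x. c * x) ` S \<subseteq> U))"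

definition locally_bounded :: "'a::field topology \<Rightarrow> bool" where
  "locally_bounded T \<longleftrightarrow> (\<exists>U. openin T U \<and> U \<noteq> {} \<and> field_bounded T U)"

definition topology_basis :: "'a topology \<Rightarrow> 'a set set \<Rightarrow> bool" where
  "topology_basis T B \<longleftrightarrow>
     (\<forall>V\<in>B. openin T V) \<and> (\<forall>U. openin T U \<longrightarrow> (\<exists>C\<subseteq>B. U = \<Union>C))"

definition weight :: "'a topology \<Rightarrow> 'a set rel" where
  "weight T = |SOME B. topology_basis T B \<and> (\<forall>B'. topology_basis T B' \<longrightarrow> |B| \<le>o |B'| )|"

definition refines_topology :: "'a topology \<Rightarrow> 'a topology \<Rightarrow> bool" where
  "refines_topology T' T \<longleftrightarrow> (\<forall>U. openin T U \<longrightarrow> openin T' U)"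

definition incomparable :: "'a topology \<Rightarrow> 'a topology \<Rightarrow> bool" where
  "incomparable T T' \<longleftrightarrow> \<not> refines_topology T T' \<and> \<not> refines_topology T' T"

definition exist_pairwise_incomparable :: "'b rel \<Rightarrow> ('a topology \<Rightarrow> bool) \<Rightarrow> bool" where
  "exist_pairwise_incomparable \<kappa> P \<longleftrightarrow>
     (\<exists>F. |F| =o \<kappa> \<and> (\<forall>T\<in>F. P T) \<and> pairwise incomparable F)"

section \<open>Polynomials in several variables\<close>

text \<open>
  Polynomials with variables indexed by \<open>'v\<close> and coefficients in \<open>'b\<close> are finitely supported
  functions on monomials, which are themselves finitely supported exponent functions.
  In evaluations the coefficients are mapped along a homomorphism \<open>h\<close>.
\<close>

type_synonym ('v, 'b) mpolynomial = "('v \<Rightarrow>\<^sub>0 nat) \<Rightarrow>\<^sub>0 'b"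

definition mp_vars :: "('v, 'b::zero) mpolynomial \<Rightarrow> 'v set" where
  "mp_vars p = (\<Union>m\<in>Poly_Mapping.keys p. Poly_Mapping.keys m)"

definition mp_eval ::
    "('b::zero \<Rightarrow> 'c::comm_ring_1) \<Rightarrow> ('v \<Rightarrow> 'c) \<Rightarrow> ('v, 'b) mpolynomial \<Rightarrow> 'c" where
  "mp_eval h x p =
     (\<Sum>m\<in>Poly_Mapping.keys p. h (Poly_Mapping.lookup p m) *
        (\<Prod>i\<in>Poly_Mapping.keys m. x i ^ Poly_Mapping.lookup m i))"

text \<open>The value at \<open>x\<close> of the formal partial derivative with respect to the variable \<open>j\<close>:\<close>

definition mp_partial_eval ::
    "('b::zero \<Rightarrow> 'c::comm_ring_1) \<Rightarrow> 'v \<Rightarrow> ('v \<Rightarrow> 'c) \<Rightarrow> ('v, 'b) mpolynomial \<Rightarrow> 'c" where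
  "mp_partial_eval h j x p =
     (\<Sum>m\<in>Poly_Mapping.keys p. h (Poly_Mapping.lookup p m) *
        (of_nat (Poly_Mapping.lookup m j) * x j ^ (Poly_Mapping.lookup m j - 1)) *
        (\<Prod>i\<in>Poly_Mapping.keys m - {j}. x i ^ Poly_Mapping.lookup m i))"

definition mp_homogeneous :: "('v, 'b::zero) mpolynomial \<Rightarrow> bool" where
  "mp_homogeneous p \<longleftrightarrow>
     (\<exists>d. \<forall>m\<in>Poly_Mapping.keys p. (\<Sum>i\<in>Poly_Mapping.keys m. Poly_Mapping.lookup m i) = d)"

section \<open>Transcendence degree over the rationals\<close>

definition alg_independent :: "'a::field_char_0 set \<Rightarrow> bool" where
  "alg_independent S \<longleftrightarrow>
     (\<forall>p :: ('a, rat) mpolynomial. mp_vars p \<subseteq> S \<longrightarrow> mp_eval of_rat (\<lambda>s. s) p = 0 \<longrightarrow> p = 0)"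

definition transcendence_basis :: "'a::field_char_0 set \<Rightarrow> bool" where
  "transcendence_basis B \<longleftrightarrow>
     alg_independent B \<and> (\<forall>S. alg_independent S \<longrightarrow> B \<subseteq> S \<longrightarrow> S = B)"

definition infinite_transcendence_degree :: "'a::field_char_0 itself \<Rightarrow> bool" where
  "infinite_transcendence_degree _ \<longleftrightarrow> (\<exists>B :: 'a set. transcendence_basis B \<and> infinite B)"

section \<open>Varieties over a field of characteristic zero\<close>

text \<open>
  A \<open>K\<close>-variety is an irreducible, locally closed subset of projective space over the algebraic
  closure, for the Zariski topology whose closed sets are cut out by homogeneous polynomials with
  coefficients in \<open>K\<close>. Irreducibility is over \<open>K\<close>, not geometric. For curves, quasi-projectivity
  is no restriction: every separated one-dimensional scheme of finite type over a field is
  quasi-projective.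

  A point of projective \<open>n\<close>-space is the set of its homogeneous coordinate vectors, which are
  functions on \<open>nat\<close> vanishing beyond \<open>n\<close>.
\<close>

definition proj_point :: "(nat \<Rightarrow> 'c::field) \<Rightarrow> (nat \<Rightarrow> 'c) set" where
  "proj_point v = {(\<lambda>i. c * v i) | c. c \<noteq> 0}"

definition proj_space :: "nat \<Rightarrow> (nat \<Rightarrow> 'c::field) set set" where
  "proj_space n = {proj_point v | v. (\<exists>i. v i \<noteq> 0) \<and> (\<forall>i>n. v i = 0)}"

definition homog_polys :: "nat \<Rightarrow> (nat, 'a::field) mpolynomial set" where
  "homog_polys n = {f. mp_homogeneous f \<and> mp_vars f \<subseteq> {..n}}"

definition zariski :: "nat \<Rightarrow> (nat \<Rightarrow> 'a::field alg_closure) set topology" where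
  "zariski n = topology_generated_by
     {{P \<in> proj_space n. \<forall>v\<in>P. mp_eval to_ac v f \<noteq> 0} | f. f \<in> homog_polys n}"

definition irreducible_space :: "'p topology \<Rightarrow> bool" where
  "irreducible_space T \<longleftrightarrow>
     topspace T \<noteq> {} \<and>
     (\<forall>A B. closedin T A \<longrightarrow> closedin T B \<longrightarrow> A \<union> B = topspace T \<longrightarrow>
        A = topspace T \<or> B = topspace T)"

definition krull_dimension :: "'p topology \<Rightarrow> enat" where
  "krull_dimension T =
     Sup {enat d | d. \<exists>Z :: nat \<Rightarrow> 'p set.
        (\<forall>i\<le>d. closedin T (Z i) \<and> irreducible_space (subtopology T (Z i))) \<and>
        (\<forall>i<d. Z i \<subset> Z (Suc i))}"

definition variety :: "nat \<Rightarrow> (nat \<Rightarrow> 'a::field alg_closure) set set \<Rightarrow> bool" where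
  "variety n S \<longleftrightarrow>
     (\<exists>U C. openin (zariski n) U \<and> closedin (zariski n) C \<and> S = U \<inter> C) \<and>
     irreducible_space (subtopology (zariski n) S)"

definition variety_dimension :: "nat \<Rightarrow> (nat \<Rightarrow> 'a::field alg_closure) set set \<Rightarrow> enat" where
  "variety_dimension n S = krull_dimension (subtopology (zariski n) S)"

definition vanishing_polys ::
    "nat \<Rightarrow> (nat \<Rightarrow> 'a::field alg_closure) set set \<Rightarrow> (nat, 'a) mpolynomial set" where
  "vanishing_polys n S = {f \<in> homog_polys n. \<forall>P\<in>S. \<forall>v\<in>P. mp_eval to_ac v f = 0}"

text \<open>
  The rank of the Jacobian matrix of the homogeneous ideal of \<open>S\<close>, i.e. the dimension of the
  space spanned by the gradients of its homogeneous elements.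
\<close>

definition jacobian_rank ::
    "nat \<Rightarrow> (nat \<Rightarrow> 'a::field alg_closure) set set \<Rightarrow> (nat \<Rightarrow> 'a alg_closure) \<Rightarrow> nat" where
  "jacobian_rank n S v =
     vector_space.dim (\<lambda>(c :: 'a alg_closure) w (i :: nat). c * w i)
       ((\<lambda>f j. mp_partial_eval to_ac j v f) ` vanishing_polys n S)"

text \<open>
  The Jacobian criterion at all geometric points. Since \<open>K\<close> has characteristic zero, a reduced
  \<open>K\<close>-scheme is geometrically reduced, so this is smoothness over \<open>K\<close>.
\<close>

definition smooth_variety ::
    "nat \<Rightarrow> (nat \<Rightarrow> 'a::field_char_0 alg_closure) set set \<Rightarrow> bool" where
  "smooth_variety n S \<longleftrightarrow>
     variety n S \<and>
     (\<forall>P\<in>S. \<forall>v\<in>P. enat (jacobian_rank n S v) + variety_dimension n S = enat n)"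

definition rational_points ::
    "(nat \<Rightarrow> 'a::field alg_closure) set set \<Rightarrow> (nat \<Rightarrow> 'a alg_closure) set set" where
  "rational_points S = {P \<in> S. \<exists>v\<in>P. \<forall>i. v i \<in> range to_ac}"

definition large_field :: "'a::field_char_0 itself \<Rightarrow> bool" where
  "large_field _ \<longleftrightarrow>
     (\<forall>n (S :: (nat \<Rightarrow> 'a alg_closure) set set).
        smooth_variety n S \<longrightarrow> variety_dimension n S = 1 \<longrightarrow>
        rational_points S \<noteq> {} \<longrightarrow> infinite (rational_points S))"

end

(*
  Incomparable topologies come from derivations. If D_i are derivations of K that can be prescribed
  independently on arbitrarily small elements, the sets {x in U. D_i x in U for i in F} with F a finite
  subset of J form a neighbourhood base of a gt-henselian topology T_J, because a simple root moves
  differentiably with the coefficients, and T_J refines T_J' only if J' is a subset of J. Infinite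
  transcendence degree yields 2^|K| such derivations for a family of |K| neighbourhoods, since no
  neighbourhood lies in a proper subfield. Letting J choose one of a pair of derivations per index gives
  2^(2^|K|) topologies, single derivations give 2^|K| topologies of small weight that stay locally bounded.

  On a countable large field a first gt-henselian topology is built from finite approximations of its
  neighbourhoods. To insert a nonzero element, adjoin the variable t of K[[t]] and close up finitely
  often inside the algebraic power series, where Hensel's lemma supplies the roots. The finitely many
  series involved live on a smooth curve with a rational point, and since K is large the curve has
  another rational point at which the series specialize to K with all required non-vanishing.
*)
theory Submission
  imports Defs
begin

hide_const (open) up_ring.coeff up_ring.monom Coset.order Polynomials.degree module.smult

text \<open>Two cardinal constraints shape the construction. The derivations come from a transfinite
  recursion of length |K| that picks an element of a prescribed neighbourhood at each step, so the
  neighbourhood base has to be indexed by K; when the topology has no such base, closing one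
  neighbourhood under |K| many witness functions gives a coarser topology that has one. The chosen
  element must be transcendental over fewer than |K| predecessors. For uncountable K this is a
  count; for countable K the predecessors are finite in number, and infinite transcendence degree is
  what provides a new element.

  Only |K| elements are chosen, yet 2^|K| independent derivations result: the values follow
  Hausdorff's independent family, where the derivation attached to a subset Y is 1 at an element
  labelled by finite lists xs, ys exactly when Y meets xs in ys.

  Largeness speaks of one smooth curve, whereas a stage of the approximation involves many series. A
  primitive element reduces them to a single series, and a substitution makes its equation smooth at
  t = 0.\<close>

section \<open>Neighbourhood bases at 0 and the field topologies they generate\<close>

text \<open>Axioms at 0 suffice because the topology is recovered by translation; inversion is then
  only required near 1. As \<open>inverse 0 = 0\<close>, a set U without -1 forces the corresponding
  V in the inversion clause to avoid -1.\<close>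

definition field_base :: "'a::field set set \<Rightarrow> bool" where
  "field_base B \<longleftrightarrow> B \<noteq> {} \<and> (\<forall>U\<in>B. 0 \<in> U) \<and>
     (\<forall>U\<in>B. \<forall>V\<in>B. \<exists>W\<in>B. W \<subseteq> U \<and> W \<subseteq> V) \<and>
     (\<forall>U\<in>B. \<exists>V\<in>B. \<forall>x\<in>V. \<forall>y\<in>V. x - y \<in> U) \<and>
     (\<forall>U\<in>B. \<exists>V\<in>B. \<forall>x\<in>V. \<forall>y\<in>V. x * y \<in> U) \<and>
     (\<forall>U\<in>B. \<forall>a. \<exists>V\<in>B. \<forall>x\<in>V. a * x \<in> U) \<and>
     (\<forall>U\<in>B. \<exists>V\<in>B. \<forall>x\<in>V. inverse (1 + x) - 1 \<in> U) \<and>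
     (\<forall>x. x \<noteq> 0 \<longrightarrow> (\<exists>U\<in>B. x \<notin> U))"

definition gt_base :: "'a::field set set \<Rightarrow> bool" where
  "gt_base B \<longleftrightarrow> field_base B \<and> (\<forall>U\<in>B. \<exists>x\<in>U. x \<noteq> 0) \<and>
     (\<forall>U\<in>B. \<forall>d. \<exists>V\<in>B. \<forall>a. (\<forall>i\<le>d. a i \<in> V) \<longrightarrow>
        (\<exists>x. x + 1 \<in> U \<and> order x (gt_poly d a) = 1))"

definition zero_filter :: "'a::field set set \<Rightarrow> 'a filter" where
  "zero_filter B = (INF U\<in>B. principal U)"

text \<open>Convergence along a filter without a topology on the type. Continuity of a rational
  expression becomes a composition of the rules below.\<close>

definition base_conv :: "'a::field set set \<Rightarrow> ('b \<Rightarrow> 'a) \<Rightarrow> 'a \<Rightarrow> 'b filter \<Rightarrow> bool" where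
  "base_conv B f c F \<longleftrightarrow> (\<forall>U\<in>B. eventually (\<lambda>x. f x - c \<in> U) F)"

lemma field_baseD:
  assumes "field_base B"
  shows "B \<noteq> {}" "U \<in> B \<Longrightarrow> 0 \<in> U"
    "U \<in> B \<Longrightarrow> V \<in> B \<Longrightarrow> \<exists>W\<in>B. W \<subseteq> U \<and> W \<subseteq> V"
    "U \<in> B \<Longrightarrow> \<exists>V\<in>B. \<forall>x\<in>V. \<forall>y\<in>V. x - y \<in> U"
    "U \<in> B \<Longrightarrow> \<exists>V\<in>B. \<forall>x\<in>V. \<forall>y\<in>V. x * y \<in> U"
    "U \<in> B \<Longrightarrow> \<exists>V\<in>B. \<forall>x\<in>V. a * x \<in> U"
    "U \<in> B \<Longrightarrow> \<exists>V\<in>B. \<forall>x\<in>V. inverse (1 + x) - 1 \<in> U"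
    "z \<noteq> 0 \<Longrightarrow> \<exists>U\<in>B. z \<notin> U"
proof -
  note f = assms[unfolded field_base_def]
  note f0 = f[THEN conjunct1]
  note f1 = f[THEN conjunct2, THEN conjunct1]
  note f2 = f[THEN conjunct2, THEN conjunct2, THEN conjunct1]
  note f3 = f[THEN conjunct2, THEN conjunct2, THEN conjunct2, THEN conjunct1]
  note f4 = f[THEN conjunct2, THEN conjunct2, THEN conjunct2, THEN conjunct2, THEN conjunct1]
  note f5 = f[THEN conjunct2, THEN conjunct2, THEN conjunct2, THEN conjunct2, THEN conjunct2, THEN conjunct1]
  note f6 = f[THEN conjunct2, THEN conjunct2, THEN conjunct2, THEN conjunct2, THEN conjunct2, THEN conjunct2, THEN conjunct1]
  note f7 = f[THEN conjunct2, THEN conjunct2, THEN conjunct2, THEN conjunct2, THEN conjunct2, THEN conjunct2, THEN conjunct2]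
  show "B \<noteq> {}" by (rule f0)
  show "U \<in> B \<Longrightarrow> 0 \<in> U" by (rule bspec[OF f1])
  show "U \<in> B \<Longrightarrow> V \<in> B \<Longrightarrow> \<exists>W\<in>B. W \<subseteq> U \<and> W \<subseteq> V"
    by (rule bspec[OF bspec[OF f2]])
  show "U \<in> B \<Longrightarrow> \<exists>V\<in>B. \<forall>x\<in>V. \<forall>y\<in>V. x - y \<in> U" by (rule bspec[OF f3])
  show "U \<in> B \<Longrightarrow> \<exists>V\<in>B. \<forall>x\<in>V. \<forall>y\<in>V. x * y \<in> U" by (rule bspec[OF f4])
  show "U \<in> B \<Longrightarrow> \<exists>V\<in>B. \<forall>x\<in>V. a * x \<in> U" by (rule spec[OF bspec[OF f5]])
  show "U \<in> B \<Longrightarrow> \<exists>V\<in>B. \<forall>x\<in>V. inverse (1 + x) - 1 \<in> U" by (rule bspec[OF f6])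
  show "z \<noteq> 0 \<Longrightarrow> \<exists>U\<in>B. z \<notin> U" by (rule mp[OF spec[OF f7]])
qed

lemma eventually_directed:
  assumes "field_base B"
    and mono: "\<And>U V. U \<subseteq> V \<Longrightarrow> S U \<subseteq> S V"
  shows "eventually P (INF U\<in>B. principal (S U)) \<longleftrightarrow> (\<exists>U\<in>B. \<forall>x\<in>S U. P x)"
proof -
  have "eventually P (INF U\<in>B. principal (S U)) \<longleftrightarrow> (\<exists>U\<in>B. eventually P (principal (S U)))"
  proof (rule eventually_INF_base)
    show "B \<noteq> {}" using field_baseD(1)[OF assms(1)] .
    fix U V assume "U \<in> B" "V \<in> B"
    then obtain W where "W \<in> B" "W \<subseteq> U" "W \<subseteq> V" using field_baseD(3)[OF assms(1)] by blast
    then show "\<exists>x\<in>B. principal (S x) \<le> inf (principal (S U)) (principal (S V))"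
      using mono[of W U] mono[of W V] by (intro bexI[of _ W]) auto
  qed
  then show ?thesis by (simp add: eventually_principal)
qed

context
  fixes B :: "'a::field set set"
  assumes B: "field_base B"
begin

lemma base_conv_const: "base_conv B (\<lambda>x. c) c F"
  using field_baseD(2)[OF B] by (simp add: base_conv_def)

lemma base_conv_diff:
  assumes "base_conv B f c F" "base_conv B g d F"
  shows "base_conv B (\<lambda>x. f x - g x) (c - d) F"
  unfolding base_conv_def
proof
  fix U assume "U \<in> B"
  then obtain V where V: "V \<in> B" "\<And>x y. x \<in> V \<Longrightarrow> y \<in> V \<Longrightarrow> x - y \<in> U"
    using field_baseD(4)[OF B] by blast
  have "eventually (\<lambda>x. f x - c \<in> V) F" "eventually (\<lambda>x. g x - d \<in> V) F"
    using assms V(1) by (auto simp: base_conv_def)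
  then show "eventually (\<lambda>x. f x - g x - (c - d) \<in> U) F"
  proof eventually_elim
    case (elim x)
    from V(2)[OF this] show ?case by (simp add: algebra_simps)
  qed
qed

lemma base_conv_add:
  assumes "base_conv B f c F" "base_conv B g d F"
  shows "base_conv B (\<lambda>x. f x + g x) (c + d) F"
  using base_conv_diff[OF assms(1) base_conv_diff[OF base_conv_const[of 0] assms(2)]] by simp

lemma base_conv_cmult:
  assumes "base_conv B f c F"
  shows "base_conv B (\<lambda>x. a * f x) (a * c) F"
  unfolding base_conv_def
proof
  fix U assume "U \<in> B"
  then obtain V where V: "V \<in> B" "\<And>x. x \<in> V \<Longrightarrow> a * x \<in> U"
    using field_baseD(6)[OF B] by blast
  have "eventually (\<lambda>x. f x - c \<in> V) F" 
    using assms V(1) by (auto simp: base_conv_def)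
  then show "eventually (\<lambda>x. a * f x - a * c \<in> U) F"
  proof eventually_elim
    case (elim x)
    from V(2)[OF this] show ?case by (simp add: algebra_simps)
  qed
qed

lemma base_conv_0_mult:
  assumes "base_conv B f 0 F" "base_conv B g 0 F"
  shows "base_conv B (\<lambda>x. f x * g x) 0 F"
  unfolding base_conv_def
proof
  fix U assume "U \<in> B"
  then obtain V where V: "V \<in> B" "\<And>x y. x \<in> V \<Longrightarrow> y \<in> V \<Longrightarrow> x * y \<in> U"
    using field_baseD(5)[OF B] by blast
  have "eventually (\<lambda>x. f x - 0 \<in> V) F" "eventually (\<lambda>x. g x - 0 \<in> V) F"
    using assms V(1) by (auto simp: base_conv_def)
  then show "eventually (\<lambda>x. f x * g x - 0 \<in> U) F"
    by eventually_elim (use V in auto)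
qed

lemma base_conv_0_iff: "base_conv B (\<lambda>x. f x - c) 0 F \<longleftrightarrow> base_conv B f c F"
  by (simp add: base_conv_def)

lemma base_conv_mult:
  assumes f: "base_conv B f c F" and g: "base_conv B g d F"
  shows "base_conv B (\<lambda>x. f x * g x) (c * d) F"
proof -
  have "base_conv B (\<lambda>x. (f x - c) * (g x - d)) 0 F"
    using base_conv_0_mult[of "\<lambda>x. f x - c" F "\<lambda>x. g x - d"] f g by (simp add: base_conv_0_iff)
  from base_conv_add[OF base_conv_add[OF this base_conv_cmult[OF g, of c]] base_conv_cmult[OF f, of d]]
  have "base_conv B (\<lambda>x. f x * g x + c * d) (c * d + c * d) F"
    by (simp add: algebra_simps)
  from base_conv_diff[OF this base_conv_const[of "c * d"]] show ?thesis by simp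
qed

text \<open>Dividing by the limit c moves the question to the point 1, where
  \<open>field_base\<close> has its inversion clause; the factor is restored at the end.\<close>

lemma base_conv_inverse:
  assumes f: "base_conv B f c F" and c: "c \<noteq> 0"
  shows "base_conv B (\<lambda>x. inverse (f x)) (inverse c) F"
proof -
  have "base_conv B (\<lambda>x. inverse c * (f x - c)) 0 F"
    using base_conv_cmult[of "\<lambda>x. f x - c" 0 F "inverse c"] f base_conv_0_iff by auto
  then have g: "base_conv B (\<lambda>x. inverse c * f x - 1) 0 F" using c by (simp add: algebra_simps)
  have "base_conv B (\<lambda>x. inverse (inverse c * f x)) 1 F"
    unfolding base_conv_def
  proof
    fix U assume "U \<in> B"
    then obtain V where V: "V \<in> B" "\<And>x. x \<in> V \<Longrightarrow> inverse (1 + x) - 1 \<in> U"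
      using field_baseD(7)[OF B] by blast
    have "eventually (\<lambda>x. inverse c * f x - 1 - 0 \<in> V) F" 
      using g V(1) by (auto simp: base_conv_def)
    then show "eventually (\<lambda>x. inverse (inverse c * f x) - 1 \<in> U) F"
    proof eventually_elim
      case (elim x)
      from V(2)[OF this] show ?case by simp
    qed
  qed
  have *: "inverse c * inverse (inverse c * f x) = inverse (f x)" for x
    unfolding inverse_mult_distrib inverse_inverse_eq mult.assoc[symmetric] left_inverse[OF c] by (rule mult_1_left)
  from base_conv_cmult[OF \<open>base_conv B (\<lambda>x. inverse (inverse c * f x)) 1 F\<close>, of "inverse c"] show ?thesis
    unfolding * mult_1_right .
qed

lemma base_conv_sum:
  assumes "\<And>i. i \<in> I \<Longrightarrow> base_conv B (f i) (c i) F"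
  shows "base_conv B (\<lambda>x. \<Sum>i\<in>I. f i x) (\<Sum>i\<in>I. c i) F"
  using assms
proof (induction I rule: infinite_finite_induct)
  case (insert i I)
  then show ?case by (simp add: base_conv_add)
qed (auto simp: base_conv_const)

lemma base_conv_power:
  assumes "base_conv B f c F"
  shows "base_conv B (\<lambda>x. f x ^ n) (c ^ n) F"
  by (induction n) (auto intro: base_conv_mult assms base_conv_const)

definition near :: "'a \<Rightarrow> 'a filter" where
  "near x = (INF U\<in>B. principal {y. y - x \<in> U})"

lemma eventually_near: "eventually P (near x) \<longleftrightarrow> (\<exists>U\<in>B. \<forall>y. y - x \<in> U \<longrightarrow> P y)"
  using eventually_directed[OF B, of "\<lambda>U. {y. y - x \<in> U}"] by (simp add: near_def subset_iff)

lemma near_self: "eventually P (near x) \<Longrightarrow> P x"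
  using field_baseD(2)[OF B] by (auto simp: eventually_near)

text \<open>If V - V lies in U and -W in V, then moving by V and then by W stays within U. This
  makes the interiors \<open>{x. eventually P (near x)}\<close> open.\<close>

lemma near_near:
  assumes "eventually P (near x)"
  shows "eventually (\<lambda>y. eventually P (near y)) (near x)"
proof -
  from assms obtain U where U: "U \<in> B" "\<And>y. y - x \<in> U \<Longrightarrow> P y" by (auto simp: eventually_near)
  obtain V where V: "V \<in> B" "\<And>x y. x \<in> V \<Longrightarrow> y \<in> V \<Longrightarrow> x - y \<in> U"
    using U(1) field_baseD(4)[OF B] by blast
  obtain W where W: "W \<in> B" "\<And>x. x \<in> W \<Longrightarrow> - x \<in> V"
    using field_baseD(6)[OF B V(1), of "-1"] by auto
  have "P z" if "y - x \<in> V" "z - y \<in> W" for y z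
    using V(2)[OF that(1) W(2)[OF that(2)]] by (intro U(2)) simp
  then show ?thesis unfolding eventually_near using V(1) W(1) by blast
qed

definition base_topology :: "'a topology" where
  "base_topology = topology (\<lambda>U. \<forall>x\<in>U. eventually (\<lambda>y. y \<in> U) (near x))"

lemma openin_base_topology:
  "openin base_topology U \<longleftrightarrow> (\<forall>x\<in>U. eventually (\<lambda>y. y \<in> U) (near x))"
proof -
  have "istopology (\<lambda>U. \<forall>x\<in>U. eventually (\<lambda>y. y \<in> U) (near x))"
    unfolding istopology_def
  proof (intro conjI allI impI ballI)
    fix S T x assume "\<forall>x\<in>S. eventually (\<lambda>y. y \<in> S) (near x)" "\<forall>x\<in>T. eventually (\<lambda>y. y \<in> T) (near x)" "x \<in> S \<inter> T"
    then show "eventually (\<lambda>y. y \<in> S \<inter> T) (near x)" by (simp add: eventually_conj)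
  next
    fix K x assume K: "\<forall>S\<in>K. \<forall>x\<in>S. eventually (\<lambda>y. y \<in> S) (near x)" and "x \<in> \<Union>K"
    then obtain S where "S \<in> K" "x \<in> S" by auto
    then have "eventually (\<lambda>y. y \<in> S) (near x)" using K by auto
    then show "eventually (\<lambda>y. y \<in> \<Union>K) (near x)"
      by (rule eventually_mono) (use \<open>S \<in> K\<close> in auto)
  qed
  then show ?thesis by (simp add: base_topology_def)
qed

lemma openin_near: "openin base_topology {x. eventually P (near x)}"
  using near_near by (auto simp: openin_base_topology)

lemma topspace_base_topology [simp]: "topspace base_topology = UNIV"
  using openin_base_topology[of UNIV] openin_subset by fastforce

lemma nbhd_base_topology: "nbhd base_topology x U \<longleftrightarrow> eventually (\<lambda>y. y \<in> U) (near x)"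
proof
  assume "nbhd base_topology x U"
  then obtain W where "openin base_topology W" "x \<in> W" "W \<subseteq> U" by (auto simp: nbhd_def)
  then show "eventually (\<lambda>y. y \<in> U) (near x)"
    unfolding openin_base_topology by (auto elim!: eventually_mono)
next
  assume "eventually (\<lambda>y. y \<in> U) (near x)"
  then show "nbhd base_topology x U"
    unfolding nbhd_def using openin_near[of "\<lambda>y. y \<in> U"] near_self by fastforce
qed

lemma nbhd_base_topology_0: "nbhd base_topology 0 U \<longleftrightarrow> (\<exists>V\<in>B. V \<subseteq> U)"
  by (auto simp: nbhd_base_topology eventually_near)

text \<open>Subspaces are allowed because inversion is continuous only away from 0.\<close>

lemma continuous_at_near:
  assumes "\<And>x y. x \<in> A \<Longrightarrow> y \<in> C \<Longrightarrow> base_conv B (\<lambda>(x, y). f x y) (f x y) (near x \<times>\<^sub>F near y)"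
    and A: "openin base_topology A" "openin base_topology C"
  shows "continuous_map (prod_topology (subtopology base_topology A) (subtopology base_topology C)) base_topology (\<lambda>(x, y). f x y)"
  unfolding continuous_map
proof (intro conjI allI impI)
  show "(\<lambda>(x, y). f x y) ` topspace (prod_topology (subtopology base_topology A) (subtopology base_topology C)) \<subseteq> topspace base_topology" by simp
  fix U assume U: "openin base_topology U"
  show "openin (prod_topology (subtopology base_topology A) (subtopology base_topology C)) {x \<in> topspace (prod_topology (subtopology base_topology A) (subtopology base_topology C)). (case x of (x, y) \<Rightarrow> f x y) \<in> U}"
    unfolding openin_prod_topology_alt
  proof (intro allI impI)
    fix x y assume *: "(x, y) \<in> {x \<in> topspace (prod_topology (subtopology base_topology A) (subtopology base_topology C)). (case x of (x, y) \<Rightarrow> f x y) \<in> U}"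
    then have xy: "x \<in> A" "y \<in> C" "f x y \<in> U" by auto
    then obtain V where V: "V \<in> B" "\<And>z. z - f x y \<in> V \<Longrightarrow> z \<in> U"
      using U by (auto simp: openin_base_topology eventually_near)
    have "eventually (\<lambda>(u, v). f u v - f x y \<in> V) (near x \<times>\<^sub>F near y)"
      using assms(1)[OF xy(1,2)] V(1) unfolding base_conv_def by (auto simp: case_prod_unfold)
    then obtain P Q where PQ: "eventually P (near x)" "eventually Q (near y)"
      "\<And>u v. P u \<Longrightarrow> Q v \<Longrightarrow> f u v - f x y \<in> V"
      by (auto simp: eventually_prod_filter)
    show "\<exists>U' V'. openin (subtopology base_topology A) U' \<and> openin (subtopology base_topology C) V' \<and> x \<in> U' \<and> y \<in> V' \<and>
      U' \<times> V' \<subseteq> {x \<in> topspace (prod_topology (subtopology base_topology A) (subtopology base_topology C)). (case x of (x, y) \<Rightarrow> f x y) \<in> U}"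
    proof (intro exI conjI)
      show "openin (subtopology base_topology A) ({x. eventually P (near x)} \<inter> A)"
        "openin (subtopology base_topology C) ({x. eventually Q (near x)} \<inter> C)"
        using openin_near openin_subtopology by blast+
      show "x \<in> {x. eventually P (near x)} \<inter> A" "y \<in> {x. eventually Q (near x)} \<inter> C"
        using PQ(1,2) xy by auto
      have "f u v \<in> U" if "eventually P (near u)" "eventually Q (near v)" for u v
        using V(2)[OF PQ(3)[OF near_self[OF that(1)] near_self[OF that(2)]]] .
      then show "({x. eventually P (near x)} \<inter> A) \<times> ({x. eventually Q (near x)} \<inter> C)
         \<subseteq> {x \<in> topspace (prod_topology (subtopology base_topology A) (subtopology base_topology C)). (case x of (x, y) \<Rightarrow> f x y) \<in> U}"
        by auto
    qed
  qed
qed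

lemma base_conv_near_fst: "base_conv B fst x (near x \<times>\<^sub>F F)"
  unfolding base_conv_def
proof
  fix U assume "U \<in> B"
  then have "eventually (\<lambda>y. y - x \<in> U) (near x)" by (auto simp: eventually_near)
  then show "eventually (\<lambda>y. fst y - x \<in> U) (near x \<times>\<^sub>F F)"
    unfolding eventually_prod_filter
    by (intro exI[of _ "\<lambda>y. y - x \<in> U"] exI[of _ "\<lambda>_. True"]) simp
qed

lemma base_conv_near_snd: "base_conv B snd x (F \<times>\<^sub>F near x)"
  unfolding base_conv_def
proof
  fix U assume "U \<in> B"
  then have "eventually (\<lambda>y. y - x \<in> U) (near x)" by (auto simp: eventually_near)
  then show "eventually (\<lambda>y. snd y - x \<in> U) (F \<times>\<^sub>F near x)"
    unfolding eventually_prod_filter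
    by (intro exI[of _ "\<lambda>y. y - x \<in> U"] exI[of _ "\<lambda>_. True"]) simp
qed

lemma field_topology_base: "field_topology base_topology"
  unfolding field_topology_def
proof (intro conjI)
  show "topspace base_topology = UNIV" by simp
  have sub: "subtopology base_topology UNIV = base_topology" by (simp add: subtopology_UNIV)
  have op: "openin base_topology UNIV" by (simp add: openin_base_topology)
  show "continuous_map (prod_topology base_topology base_topology) base_topology (\<lambda>(x, y). x + y)"
    using continuous_at_near[of UNIV UNIV "(+)", OF _ op op] base_conv_add[OF base_conv_near_fst base_conv_near_snd]
    by (simp add: sub case_prod_unfold)
  show "continuous_map (prod_topology base_topology base_topology) base_topology (\<lambda>(x, y). x * y)"
    using continuous_at_near[of UNIV UNIV "(*)", OF _ op op] base_conv_mult[OF base_conv_near_fst base_conv_near_snd]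
    by (simp add: sub case_prod_unfold)
  have sep: "eventually (\<lambda>y. y \<noteq> 0) (near x)" if "x \<noteq> 0" for x
  proof -
    from field_baseD(8)[OF B, of "-x"] that obtain U where "U \<in> B" "-x \<notin> U" by auto
    then show ?thesis by (auto simp: eventually_near intro!: bexI[of _ U])
  qed
  have op': "openin base_topology (- {0})"
    using sep unfolding openin_base_topology by simp
  have inv: "base_conv B (\<lambda>(x, y). inverse x) (inverse x) (near x \<times>\<^sub>F near y)" if "x \<in> - {0}" for x y
    using base_conv_inverse[OF base_conv_near_fst] that by (simp add: case_prod_unfold)
  \<comment> \<open>Inversion is treated as a function of a pair that ignores its second coordinate,
    and is then composed with the diagonal.\<close>
  have c1: "continuous_map (prod_topology (subtopology base_topology (- {0})) (subtopology base_topology (-{0})))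
     base_topology (\<lambda>(x, y). inverse x)"
    by (rule continuous_at_near[OF inv op' op'])
  have c2: "continuous_map (subtopology base_topology (- {0}))
      (prod_topology (subtopology base_topology (- {0})) (subtopology base_topology (-{0}))) (\<lambda>x. (x, x))"
    using continuous_map_id[of "subtopology base_topology (- {0})"] unfolding id_def
    by (simp add: continuous_map_pairwise comp_def)
  from continuous_map_compose[OF c2 c1]
  show "continuous_map (subtopology base_topology (- {0})) base_topology inverse"
    by (simp add: comp_def)
  show "Hausdorff_space base_topology"
    unfolding Hausdorff_space_def
  proof (intro allI impI)
    fix x y assume "x \<in> topspace base_topology \<and> y \<in> topspace base_topology \<and> x \<noteq> y"
    then have "y - x \<noteq> 0" by simp
    then obtain U where U: "U \<in> B" "y - x \<notin> U" using field_baseD(8)[OF B] by blast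
    then obtain V where V: "V \<in> B" "\<And>x y. x \<in> V \<Longrightarrow> y \<in> V \<Longrightarrow> x - y \<in> U"
      using field_baseD(4)[OF B] by blast
    let ?I = "\<lambda>x. {z. eventually (\<lambda>y. y - x \<in> V) (near z)}"
    have "disjnt (?I x) (?I y)"
    proof (rule ccontr)
      assume "\<not> disjnt (?I x) (?I y)"
      then obtain z where "z - x \<in> V" "z - y \<in> V" using near_self by (auto simp: disjnt_def)
      from V(2)[OF this] U(2) show False by simp
    qed
    moreover have "x \<in> ?I x" "y \<in> ?I y" using V(1) by (auto simp: eventually_near)
    ultimately show "\<exists>U V. openin base_topology U \<and> openin base_topology V \<and> x \<in> U \<and> y \<in> V \<and> disjnt U V"
      using openin_near[of "\<lambda>y. y - x \<in> V"] openin_near[of "\<lambda>z. z - y \<in> V"] by blast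
  qed
qed

end

lemma gt_henselian_base:
  assumes "gt_base B"
  shows "gt_henselian (base_topology B)"
proof -
  have B: "field_base B" using assms by (simp add: gt_base_def)
  have ne: "base_topology B \<noteq> discrete_topology UNIV"
  proof
    assume "base_topology B = discrete_topology UNIV"
    then have "openin (base_topology B) {0}" by simp
    then obtain U where "U \<in> B" "U \<subseteq> {0}"
      by (auto simp: openin_base_topology[OF B] eventually_near[OF B])
    then show False using assms by (auto simp: gt_base_def)
  qed
  show ?thesis unfolding gt_henselian_def
  proof (intro conjI allI impI field_topology_base[OF B] ne)
    fix U d assume "nbhd (base_topology B) (-1) U"
    then have "\<exists>W\<in>B. \<forall>y. y - (-1) \<in> W \<longrightarrow> y \<in> U"
      unfolding nbhd_base_topology[OF B] eventually_near[OF B] .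
    then obtain W where W: "W \<in> B" "\<And>y. y + 1 \<in> W \<Longrightarrow> y \<in> U"
      by (elim bexE) simp
    have "\<exists>V\<in>B. \<forall>a. (\<forall>i\<le>d. a i \<in> V) \<longrightarrow> (\<exists>x. x + 1 \<in> W \<and> order x (gt_poly d a) = 1)"
      using assms W(1) unfolding gt_base_def by simp
    then obtain V where V: "V \<in> B" "\<And>a. (\<forall>i\<le>d. a i \<in> V) \<Longrightarrow>
        (\<exists>x. x + 1 \<in> W \<and> order x (gt_poly d a) = 1)"
      by (elim bexE) simp
    show "\<exists>V. nbhd (base_topology B) 0 V \<and>
            (\<forall>a. (\<forall>i\<le>d. a i \<in> V) \<longrightarrow> (\<exists>x\<in>U. order x (gt_poly d a) = 1))"
    proof (intro exI[of _ V] conjI allI impI)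
      show "nbhd (base_topology B) 0 V" using V(1) by (auto simp: nbhd_base_topology_0[OF B])
      fix a :: "nat \<Rightarrow> 'a" assume "\<forall>i\<le>d. a i \<in> V"
      from V(2)[OF this] obtain x where "x + 1 \<in> W" "order x (gt_poly d a) = 1" by (elim exE conjE)
      then show "\<exists>x\<in>U. order x (gt_poly d a) = 1" using W(2)[of x] by (intro bexI[of _ x])
    qed
  qed
qed

text \<open>Both topologies are translation invariant, so comparing the neighbourhoods of 0 is
  enough.\<close>

lemma refines_base:
  assumes "field_base B" "field_base C"
  shows "refines_topology (base_topology C) (base_topology B) \<longleftrightarrow> (\<forall>U\<in>B. \<exists>V\<in>C. V \<subseteq> U)"
proof
  assume r: "refines_topology (base_topology C) (base_topology B)"
  show "\<forall>U\<in>B. \<exists>V\<in>C. V \<subseteq> U"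
  proof
    fix U assume "U \<in> B"
    then have "nbhd (base_topology B) 0 U" using nbhd_base_topology_0[OF assms(1)] by auto
    then have "nbhd (base_topology C) 0 U" using r by (fastforce simp: nbhd_def refines_topology_def
      topspace_base_topology[OF assms(1)] topspace_base_topology[OF assms(2)])
    then show "\<exists>V\<in>C. V \<subseteq> U" using nbhd_base_topology_0[OF assms(2)] by auto
  qed
next
  assume r: "\<forall>U\<in>B. \<exists>V\<in>C. V \<subseteq> U"
  show "refines_topology (base_topology C) (base_topology B)"
    unfolding refines_topology_def openin_base_topology[OF assms(1)] openin_base_topology[OF assms(2)]
      eventually_near[OF assms(1)] eventually_near[OF assms(2)]
    using r by (meson subsetD)
qed

section \<open>Dual numbers, subfields and graphs of derivations\<close>

text \<open>\<open>Dual a b\<close> is a + b \<epsilon> with \<epsilon>^2 = 0. The product rule is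
  the multiplication of this ring, so the Leibniz rule for D says that x + D(x) \<epsilon> is
  multiplicative in x.\<close>

datatype 'a dual = Dual (dfst: 'a) (dsnd: 'a)

instantiation dual :: (comm_ring_1) comm_ring_1
begin
definition "0 = Dual 0 0"
definition "1 = Dual 1 0"
definition "x + y = Dual (dfst x + dfst y) (dsnd x + dsnd y)"
definition "x - y = Dual (dfst x - dfst y) (dsnd x - dsnd y)"
definition "- x = Dual (- dfst x) (- dsnd x)"
definition "x * y = Dual (dfst x * dfst y) (dfst x * dsnd y + dsnd x * dfst y)"
instance
  by standard
    (auto simp: zero_dual_def one_dual_def plus_dual_def minus_dual_def uminus_dual_def times_dual_def
      algebra_simps intro: dual.expand)
end

lemma dual_sel [simp]:
  "dfst 0 = 0" "dsnd 0 = 0" "dfst 1 = 1" "dsnd 1 = 0"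
  "dfst (x + y) = dfst x + dfst y" "dsnd (x + y) = dsnd x + dsnd y"
  "dfst (x - y) = dfst x - dfst y" "dsnd (x - y) = dsnd x - dsnd y"
  "dfst (- x) = - dfst x" "dsnd (- x) = - dsnd x"
  "dfst (x * y) = dfst x * dfst y" "dsnd (x * y) = dfst x * dsnd y + dsnd x * dfst y"
  by (simp_all add: zero_dual_def one_dual_def plus_dual_def minus_dual_def uminus_dual_def times_dual_def)

lemma dual_eq_iff: "x = y \<longleftrightarrow> dfst x = dfst y \<and> dsnd x = dsnd y"
  by (cases x; cases y) simp

lemma dual_unit:
  fixes y :: "'a::field dual"
  assumes "dfst y \<noteq> 0"
  obtains w where "y * w = 1"
proof
  show "y * Dual (inverse (dfst y)) (- dsnd y * inverse (dfst y) * inverse (dfst y)) = 1"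
    using assms by (simp add: dual_eq_iff algebra_simps)
qed

lemma dual_cancel:
  fixes y :: "'a::field dual"
  assumes "dfst y \<noteq> 0" "z * y = 0"
  shows "z = 0"
proof -
  obtain w where "y * w = 1" using dual_unit[OF assms(1)] .
  then have "z = z * y * w" by (simp add: mult.assoc)
  then show ?thesis using assms(2) by simp
qed

definition subring_set :: "'a::comm_ring_1 set \<Rightarrow> bool" where
  "subring_set S \<longleftrightarrow> 1 \<in> S \<and> (\<forall>x\<in>S. \<forall>y\<in>S. x - y \<in> S \<and> x * y \<in> S)"

lemma subring_setD:
  assumes "subring_set S"
  shows "1 \<in> S" "0 \<in> S" "x \<in> S \<Longrightarrow> - x \<in> S" "x \<in> S \<Longrightarrow> y \<in> S \<Longrightarrow> x - y \<in> S"
    "x \<in> S \<Longrightarrow> y \<in> S \<Longrightarrow> x + y \<in> S" "x \<in> S \<Longrightarrow> y \<in> S \<Longrightarrow> x * y \<in> S"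
    "x \<in> S \<Longrightarrow> x ^ n \<in> S" "of_nat n \<in> S"
proof -
  show one: "1 \<in> S" and diff: "x \<in> S \<Longrightarrow> y \<in> S \<Longrightarrow> x - y \<in> S"
    and mult: "x \<in> S \<Longrightarrow> y \<in> S \<Longrightarrow> x * y \<in> S" for x y
    using assms by (auto simp: subring_set_def)
  show zero: "0 \<in> S" using diff[OF one one] by simp
  show neg: "x \<in> S \<Longrightarrow> - x \<in> S" for x using diff[OF zero, of x] by simp
  show add: "x \<in> S \<Longrightarrow> y \<in> S \<Longrightarrow> x + y \<in> S" for x y using diff[of x "-y"] neg[of y] by simp
  show "x \<in> S \<Longrightarrow> x ^ n \<in> S" by (induction n) (auto intro: one mult)
  show "of_nat n \<in> S" by (induction n) (auto intro: zero add one)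
qed

lemma subring_set_sum:
  assumes "subring_set S" "\<And>i. i \<in> I \<Longrightarrow> f i \<in> S"
  shows "(\<Sum>i\<in>I. f i) \<in> S"
  using assms(2) by (induction I rule: infinite_finite_induct) (auto intro: subring_setD[OF assms(1)])

lemma subring_set_poly:
  assumes "subring_set S" "\<And>i. coeff p i \<in> S" "x \<in> S"
  shows "poly p x \<in> S"
  unfolding poly_altdef using assms by (intro subring_set_sum subring_setD(6,7)[OF assms(1)]) auto

definition subfield_set :: "'a::field set \<Rightarrow> bool" where
  "subfield_set S \<longleftrightarrow> subring_set S \<and> (\<forall>x\<in>S. inverse x \<in> S)"

definition field_gen :: "'a::field set \<Rightarrow> 'a set" where
  "field_gen S = \<Inter>{L. subfield_set L \<and> S \<subseteq> L}"

lemma subfield_set_gen: "subfield_set (field_gen S)"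
  unfolding field_gen_def subfield_set_def subring_set_def by blast

lemma field_gen_superset: "S \<subseteq> field_gen S"
  unfolding field_gen_def by blast

lemma field_gen_least: "subfield_set L \<Longrightarrow> S \<subseteq> L \<Longrightarrow> field_gen S \<subseteq> L"
  unfolding field_gen_def by blast

lemma field_gen_mono: "S \<subseteq> T \<Longrightarrow> field_gen S \<subseteq> field_gen T"
  unfolding field_gen_def by blast

definition transcendental_over :: "'a::field set \<Rightarrow> 'a \<Rightarrow> bool" where
  "transcendental_over L x \<longleftrightarrow> (\<forall>p. (\<forall>i. coeff p i \<in> L) \<longrightarrow> poly p x = 0 \<longrightarrow> p = 0)"

lemma transcendental_over_mono:
  "L \<subseteq> L' \<Longrightarrow> transcendental_over L' x \<Longrightarrow> transcendental_over L x"
  unfolding transcendental_over_def by blast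

lemma transcendental_over_notin:
  assumes "subring_set L" "transcendental_over L x"
  shows "x \<notin> L"
proof
  assume x: "x \<in> L"
  have "coeff [:-x, 1:] i \<in> L" for i
    using subring_setD[OF assms(1)] x by (auto simp: coeff_pCons split: nat.split)
  then show False
    using assms(2)[unfolded transcendental_over_def, rule_format, of "[:-x, 1:]"] by simp
qed

text \<open>The derivative again has coefficients in L, and in characteristic zero it is nonzero of
  smaller degree, so minimality keeps it from vanishing at x. L is merely a subring: nothing is
  divided, and m need not be monic.\<close>

lemma minimal_annihilator:
  fixes x :: "'a::field_char_0"
  assumes L: "subring_set L" and x: "\<not> transcendental_over L x"
  obtains m where "\<forall>i. coeff m i \<in> L" "poly m x = 0" "m \<noteq> 0" "poly (pderiv m) x \<noteq> 0"
    "\<forall>p. (\<forall>i. coeff p i \<in> L) \<longrightarrow> poly p x = 0 \<longrightarrow> p \<noteq> 0 \<longrightarrow> degree m \<le> degree p"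
proof -
  define A where "A = (\<lambda>p. (\<forall>i. coeff p i \<in> L) \<and> poly p x = 0 \<and> p \<noteq> 0)"
  have "\<exists>p. A p" using x by (auto simp: transcendental_over_def A_def)
  then obtain p where "A p" ..
  define m where "m = arg_min degree A"
  have m: "A m" and min: "\<And>p. A p \<Longrightarrow> degree m \<le> degree p"
    using arg_min_nat_lemma[of A p degree] \<open>A p\<close> by (auto simp: m_def)
  have d: "degree m \<noteq> 0"
  proof
    assume "degree m = 0"
    then obtain c where "m = [:c:]" by (rule degree_eq_zeroE)
    then show False using m by (simp add: A_def)
  qed
  have "coeff (pderiv m) i \<in> L" for i
    unfolding coeff_pderiv using m subring_setD(6,8)[OF L] by (simp add: A_def del: of_nat_Suc)
  moreover have "pderiv m \<noteq> 0" using d by (simp add: pderiv_eq_0_iff)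
  moreover have "degree (pderiv m) < degree m" using d by (simp add: degree_pderiv)
  ultimately have nz: "poly (pderiv m) x \<noteq> 0" using min[of "pderiv m"] by (auto simp: A_def)
  show ?thesis by (rule that[OF _ _ _ nz]) (use m min in \<open>auto simp: A_def\<close>)
qed

text \<open>A derivation \<open>D\<close> on a subfield \<open>L\<close> is encoded by the subring
  \<open>{x + D(x) \<epsilon> | x \<in> L}\<close> of the dual numbers.\<close>

definition functional_set :: "'a::field dual set \<Rightarrow> bool" where
  "functional_set G \<longleftrightarrow> (\<forall>z\<in>G. dfst z = 0 \<longrightarrow> z = 0)"

text \<open>In a subring, \<open>functional_set\<close> means single-valued: two elements with the
  same first coordinate have a difference with first coordinate 0. The clause on units makes the
  domain a field.\<close>

definition derivation_graph :: "'a::field dual set \<Rightarrow> bool" where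
  "derivation_graph G \<longleftrightarrow> subring_set G \<and> functional_set G \<and> (\<forall>z\<in>G. dfst z \<noteq> 0 \<longrightarrow> (\<exists>w\<in>G. z * w = 1))"

lemma subring_set_dfst: "subring_set G \<Longrightarrow> subring_set (dfst ` G)"
  unfolding subring_set_def by (auto simp flip: dual_sel(7,11)) (metis dual_sel(3) image_eqI)

text \<open>The quotient rule happens inside the dual numbers: a denominator with nonzero first
  coordinate is a unit there. Functionality survives because such a denominator can be
  cancelled.\<close>

lemma derivation_graph_fractions:
  assumes G: "subring_set G" "functional_set G"
  shows "derivation_graph {z. \<exists>y\<in>G. dfst y \<noteq> 0 \<and> z * y \<in> G}" (is "derivation_graph ?F")
proof -
  note r = subring_setD[OF G(1)]
  have sub: "subring_set ?F"
    unfolding subring_set_def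
  proof (intro conjI ballI)
    show "1 \<in> ?F" using r(1) by (auto intro!: bexI[of _ 1])
    fix z1 z2 assume "z1 \<in> ?F" "z2 \<in> ?F"
    then obtain y1 y2 where y: "y1 \<in> G" "y2 \<in> G" "dfst y1 \<noteq> 0" "dfst y2 \<noteq> 0" "z1 * y1 \<in> G" "z2 * y2 \<in> G"
      by auto
    have y12: "y1 * y2 \<in> G" "dfst (y1 * y2) \<noteq> 0" using y r(6) by auto
    have "(z1 - z2) * (y1 * y2) = (z1 * y1) * y2 - (z2 * y2) * y1" by (simp add: algebra_simps)
    also have "\<dots> \<in> G" using y r by auto
    finally show "z1 - z2 \<in> ?F" using y12 by blast
    have "(z1 * z2) * (y1 * y2) = (z1 * y1) * (z2 * y2)" by (simp add: algebra_simps)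
    also have "\<dots> \<in> G" using y r by auto
    finally show "z1 * z2 \<in> ?F" using y12 by blast
  qed
  have fn0: "z = 0" if z: "z \<in> ?F" "dfst z = 0" for z
  proof -
    from z obtain y where y: "y \<in> G" "dfst y \<noteq> 0" "z * y \<in> G" by auto
    have "dfst (z * y) = 0" using z by simp
    then have "z * y = 0" using G(2) y by (auto simp: functional_set_def)
    then show ?thesis using dual_cancel y by blast
  qed
  have inv: "\<exists>w\<in>?F. z * w = 1" if z: "z \<in> ?F" "dfst z \<noteq> 0" for z
  proof -
    from z obtain y where y: "y \<in> G" "dfst y \<noteq> 0" "z * y \<in> G" by auto
    obtain w where w: "z * w = 1" using dual_unit[OF z(2)] .
    have "w * (z * y) = y" using w by (simp add: mult.assoc[symmetric] mult.commute[of w])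
    moreover have "dfst (z * y) \<noteq> 0" using z y by simp
    ultimately have "w \<in> ?F" using y by (intro CollectI bexI[of _ "z * y"]) auto
    then show ?thesis using w by (rule bexI[rotated])
  qed
  show ?thesis unfolding derivation_graph_def
    using sub fn0 inv unfolding functional_set_def by simp
qed

definition adjoin :: "'a::comm_ring_1 set \<Rightarrow> 'a \<Rightarrow> 'a set" where
  "adjoin G \<xi> = {poly P \<xi> | P. \<forall>i. coeff P i \<in> G}"

lemma subring_set_adjoin:
  assumes "subring_set G"
  shows "subring_set (adjoin G \<xi>)" "G \<subseteq> adjoin G \<xi>" "\<xi> \<in> adjoin G \<xi>"
proof -
  note r = subring_setD[OF assms]
  show "G \<subseteq> adjoin G \<xi>"
  proof
    fix g assume "g \<in> G"
    then have "\<forall>i. coeff [:g:] i \<in> G" using r by (auto simp: coeff_pCons split: nat.split)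
    then show "g \<in> adjoin G \<xi>" unfolding adjoin_def by (force intro!: exI[of _ "[:g:]"])
  qed
  then have one: "1 \<in> adjoin G \<xi>" using r(1) by auto
  have "\<forall>i. coeff [:0,1:] i \<in> G" using r by (auto simp: coeff_pCons split: nat.split)
  then show "\<xi> \<in> adjoin G \<xi>" unfolding adjoin_def by (force intro!: exI[of _ "[:0,1:]"])
  show "subring_set (adjoin G \<xi>)"
    unfolding subring_set_def
  proof (intro conjI ballI one)
    fix x y assume "x \<in> adjoin G \<xi>" "y \<in> adjoin G \<xi>"
    then obtain P Q where PQ: "x = poly P \<xi>" "y = poly Q \<xi>" "\<forall>i. coeff P i \<in> G" "\<forall>i. coeff Q i \<in> G"
      by (auto simp: adjoin_def)
    have "\<forall>i. coeff (P - Q) i \<in> G" using PQ r by simp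
    moreover have "x - y = poly (P - Q) \<xi>" using PQ by simp
    ultimately show "x - y \<in> adjoin G \<xi>" unfolding adjoin_def by blast
    have "\<forall>i. coeff (P * Q) i \<in> G" using PQ r by (auto simp: coeff_mult intro!: subring_set_sum assms)
    moreover have "x * y = poly (P * Q) \<xi>" using PQ by simp
    ultimately show "x * y \<in> adjoin G \<xi>" unfolding adjoin_def by blast
  qed
qed

lemma dfst_poly: "dfst (poly P \<xi>) = poly (map_poly dfst P) (dfst \<xi>)"
  by (induction P) (simp_all add: map_poly_pCons)

text \<open>The second coordinate of P(x + c \<epsilon>) is affine in c with slope p'(x). This is
  why c can be solved for at a simple root.\<close>

lemma dsnd_poly:
  "dsnd (poly P (Dual x c)) = dsnd (poly P (Dual x 0)) + c * poly (pderiv (map_poly dfst P)) x"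
  by (induction P) (simp_all add: map_poly_pCons pderiv_pCons dfst_poly algebra_simps)

lemma lift_poly_dual:
  assumes "0 \<in> G" "\<forall>i. coeff p i \<in> dfst ` G" "functional_set G"
  obtains P where "map_poly dfst P = p" "\<forall>i. coeff P i \<in> G"
proof -
  define g where "g = (\<lambda>a. SOME z. z \<in> G \<and> dfst z = a)"
  have g: "g a \<in> G \<and> dfst (g a) = a" if "a \<in> dfst ` G" for a
    unfolding g_def by (rule someI_ex) (use that in auto)
  have "0 \<in> dfst ` G" using assms(1) by (metis dual_sel(1) image_eqI)
  then have g0: "g 0 = 0" using g[of 0] assms(3) by (auto simp: functional_set_def)
  have c: "coeff (map_poly g p) i = g (coeff p i)" for i by (simp add: coeff_map_poly g0)
  have "map_poly dfst (map_poly g p) = p"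
    using g assms(2) c by (intro poly_eqI) (simp add: coeff_map_poly)
  moreover have "\<forall>i. coeff (map_poly g p) i \<in> G" using g assms(2) c by auto
  ultimately show ?thesis by (rule that)
qed

text \<open>At a transcendental x the value c of the derivation is free: a first coordinate that
  vanishes forces all coefficients of the polynomial to vanish.\<close>

lemma functional_adjoin_transcendental:
  assumes "functional_set G" "transcendental_over (dfst ` G) x"
  shows "functional_set (adjoin G (Dual x c))"
  unfolding functional_set_def
proof (intro ballI impI)
  fix z assume "z \<in> adjoin G (Dual x c)" "dfst z = 0"
  then obtain P where P: "z = poly P (Dual x c)" "\<forall>i. coeff P i \<in> G" by (auto simp: adjoin_def)
  have "poly (map_poly dfst P) x = 0" using \<open>dfst z = 0\<close> P by (simp add: dfst_poly)
  moreover have "\<forall>i. coeff (map_poly dfst P) i \<in> dfst ` G" using P(2) by (simp add: coeff_map_poly)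
  ultimately have "map_poly dfst P = 0" using assms(2) by (auto simp: transcendental_over_def)
  then have "dfst (coeff P i) = 0" for i by (metis coeff_0 coeff_map_poly dual_sel(1))
  then have "coeff P i = 0" for i using P(2) assms(1) by (auto simp: functional_set_def)
  then have "P = 0" by (intro poly_eqI) simp
  then show "z = 0" using P by simp
qed

text \<open>At an algebraic x the value is forced by lifting an annihilator m of minimal degree to M
  over G and requiring M(x + c \<epsilon>) = 0. Pseudo-division by M shows that every other relation
  then vanishes in both coordinates.\<close>

lemma functional_adjoin_algebraic:
  fixes x :: "'a::field_char_0"
  assumes G: "subring_set G" "functional_set G" and x: "\<not> transcendental_over (dfst ` G) x"
  obtains c where "functional_set (adjoin G (Dual x c))"
proof -
  note r = subring_setD[OF G(1)]
  have L: "subring_set (dfst ` G)" using subring_set_dfst[OF G(1)] .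
  obtain m where mL: "\<forall>i. coeff m i \<in> dfst ` G" and mx: "poly m x = 0" and m0: "m \<noteq> 0"
    and d: "poly (pderiv m) x \<noteq> 0"
    and min: "\<forall>p. (\<forall>i. coeff p i \<in> dfst ` G) \<longrightarrow> poly p x = 0 \<longrightarrow> p \<noteq> 0 \<longrightarrow> degree m \<le> degree p"
    by (rule minimal_annihilator[OF L x])
  obtain M where M: "map_poly dfst M = m" "\<forall>i. coeff M i \<in> G"
    using lift_poly_dual[OF r(2) mL G(2)] by blast
  \<comment> \<open>The solution of the affine equation of \<open>dsnd_poly\<close>; the slope is
    nonzero by minimality of m.\<close>
  define c where "c = - dsnd (poly M (Dual x 0)) / poly (pderiv m) x"
  have M0: "poly M (Dual x c) = 0"
  proof -
    have "c * poly (pderiv m) x = - dsnd (poly M (Dual x 0))" using d by (simp add: c_def)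
    then have "dsnd (poly M (Dual x c)) = 0" using dsnd_poly[of M x c] M(1) by simp
    then show ?thesis using mx by (simp add: dual_eq_iff dfst_poly M(1))
  qed
  have *: "poly P (Dual x c) = 0"
    if "\<forall>i. coeff P i \<in> G" "poly (map_poly dfst P) x = 0" for P
    using that
  \<comment> \<open>The length of the coefficient list, unlike the degree, also drops when a
    constant becomes the zero polynomial.\<close>
  proof (induction "length (coeffs (map_poly dfst P))" arbitrary: P rule: less_induct)
    case less
    let ?p = "map_poly dfst P"
    have cp: "coeff ?p i = dfst (coeff P i)" for i by (simp add: coeff_map_poly)
    have cm: "coeff m i = dfst (coeff M i)" for i unfolding M(1)[symmetric] by (simp add: coeff_map_poly)
    show ?case
    proof (cases "?p = 0")
      case True
      then have "dfst (coeff P i) = 0" for i using cp by (metis coeff_0)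
      then have "coeff P i = 0" for i using less.prems(1) G(2) by (auto simp: functional_set_def)
      then have "P = 0" by (intro poly_eqI) simp
      then show ?thesis by simp
    next
      case False
      then have deg: "degree m \<le> degree ?p" using less.prems cp by (intro min[rule_format]) auto
      define k where "k = degree ?p - degree m"
      define lM where "lM = coeff M (degree m)"
      define lP where "lP = coeff P (degree ?p)"
      \<comment> \<open>Cross-multiplication cancels the leading term without dividing; the factor
        \<open>lM\<close> is removed at the end because its first coordinate is nonzero.\<close>
      define Q where "Q = smult lM P - smult lP (monom 1 k * M)"
      have QG: "\<forall>i. coeff Q i \<in> G"
        unfolding Q_def using less.prems(1) M(2) r by (auto simp: coeff_monom_mult lM_def lP_def)
      have q: "map_poly dfst Q = smult (dfst lM) ?p - smult (dfst lP) (monom 1 k * m)"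
        by (rule poly_eqI) (simp add: coeff_map_poly Q_def coeff_monom_mult cm)
      have 1: "poly (map_poly dfst Q) x = 0" using less.prems(2) mx by (simp add: q)
      have degle: "degree (map_poly dfst Q) \<le> degree ?p"
        unfolding q using deg by (intro degree_diff_le order.trans[OF degree_smult_le] order.trans[OF degree_mult_le])
          (auto simp: k_def degree_monom_eq)
      have "coeff (map_poly dfst Q) (degree ?p) = 0"
        unfolding q using deg by (simp add: coeff_monom_mult k_def lM_def lP_def cp cm)
      then have "length (coeffs (map_poly dfst Q)) < length (coeffs ?p)"
        using False degle leading_coeff_0_iff[of "map_poly dfst Q"]
        by (cases "map_poly dfst Q = 0"; cases "degree (map_poly dfst Q) = degree ?p")
          (simp_all add: length_coeffs_degree)
      from less.hyps[OF this QG 1] have "poly Q (Dual x c) = 0" .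
      then have "poly P (Dual x c) * lM = 0" by (simp add: Q_def M0 mult.commute)
      have "dfst lM \<noteq> 0" unfolding lM_def cm[symmetric] using m0 by simp
      then show ?thesis using \<open>poly P (Dual x c) * lM = 0\<close> by (rule dual_cancel)
    qed
  qed
  have "functional_set (adjoin G (Dual x c))"
    unfolding functional_set_def adjoin_def using * by (auto simp: dfst_poly)
  then show ?thesis by (rule that)
qed

text \<open>The last clause bounds the new domain by the field generated by the old one and x. The
  construction along a well-order needs it to know that the next element is still transcendental
  over the domain.\<close>

lemma derivation_graph_extend:
  assumes G: "derivation_graph G" and fn0: "functional_set (adjoin G (Dual x c))"
  obtains G' where "derivation_graph G'" "G \<subseteq> G'" "Dual x c \<in> G'"
    "\<forall>L. subfield_set L \<longrightarrow> dfst ` G \<subseteq> L \<longrightarrow> x \<in> L \<longrightarrow> dfst ` G' \<subseteq> L"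
proof -
  let ?A = "adjoin G (Dual x c)"
  have Gr: "subring_set G" using G by (auto simp: derivation_graph_def)
  note A = subring_set_adjoin[OF Gr, of "Dual x c"]
  define G' where "G' = {z. \<exists>y\<in>?A. dfst y \<noteq> 0 \<and> z * y \<in> ?A}"
  have 1: "derivation_graph G'" unfolding G'_def by (rule derivation_graph_fractions[OF A(1) fn0])
  have AG': "?A \<subseteq> G'" unfolding G'_def using subring_setD(1)[OF A(1)] by (force intro!: bexI[of _ 1])
  have 4: "dfst ` G' \<subseteq> L" if L: "subfield_set L" "dfst ` G \<subseteq> L" "x \<in> L" for L
  proof
    have Lr: "subring_set L" using L by (simp add: subfield_set_def)
    have a: "dfst z \<in> L" if "z \<in> ?A" for z
    proof -
      from that obtain P where P: "z = poly P (Dual x c)" "\<forall>i. coeff P i \<in> G" by (auto simp: adjoin_def)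
      show ?thesis unfolding P(1) dfst_poly
        by (intro subring_set_poly[OF Lr]) (use P(2) L in \<open>auto simp: coeff_map_poly\<close>)
    qed
    fix l assume "l \<in> dfst ` G'"
    then obtain z y where z: "l = dfst z" "y \<in> ?A" "dfst y \<noteq> 0" "z * y \<in> ?A" by (auto simp: G'_def)
    have "l = dfst (z * y) * inverse (dfst y)" using z by simp
    also have "\<dots> \<in> L" using a[OF z(2)] a[OF z(4)] L(1) subring_setD(6)[OF Lr] by (auto simp: subfield_set_def)
    finally show "l \<in> L" .
  qed
  show ?thesis by (rule that[OF 1]) (use A AG' 4 in auto)
qed

lemma derivation_graph_Union:
  assumes "C \<noteq> {}" "\<And>G H. G \<in> C \<Longrightarrow> H \<in> C \<Longrightarrow> G \<subseteq> H \<or> H \<subseteq> G" "\<And>G. G \<in> C \<Longrightarrow> derivation_graph G"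
  shows "derivation_graph (\<Union>C)"
proof -
  have two: "\<exists>G\<in>C. x \<in> G \<and> y \<in> G" if "x \<in> \<Union>C" "y \<in> \<Union>C" for x y
  proof -
    from that obtain G H where GH: "G \<in> C" "x \<in> G" "H \<in> C" "y \<in> H" by auto
    from assms(2)[OF GH(1,3)] show ?thesis
    proof
      assume "G \<subseteq> H" then show ?thesis using GH by (intro bexI[of _ H]) auto
    next
      assume "H \<subseteq> G" then show ?thesis using GH by (intro bexI[of _ G]) auto
    qed
  qed
  have r: "subring_set (\<Union>C)"
    unfolding subring_set_def
  proof (intro conjI ballI)
    from assms(1) obtain G where "G \<in> C" by auto
    then show "1 \<in> \<Union>C" using assms(3) by (auto simp: derivation_graph_def subring_set_def)
    fix x y assume "x \<in> \<Union>C" "y \<in> \<Union>C"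
    from two[OF this] obtain G where G: "G \<in> C" "x \<in> G" "y \<in> G" by auto
    then have "subring_set G" using assms(3) by (auto simp: derivation_graph_def)
    from subring_setD(4,6)[OF this G(2,3)] G(1) show "x - y \<in> \<Union>C" "x * y \<in> \<Union>C" by auto
  qed
  show ?thesis
    unfolding derivation_graph_def
    using r assms(3) unfolding functional_set_def derivation_graph_def by (meson UnionE UnionI)
qed

section \<open>Extending derivations to the whole field\<close>

definition derivation :: "('a::field \<Rightarrow> 'a) \<Rightarrow> bool" where
  "derivation D \<longleftrightarrow> (\<forall>x y. D (x + y) = D x + D y) \<and> (\<forall>x y. D (x * y) = x * D y + D x * y)"

text \<open>A maximal graph, given by Zorn's lemma, has full domain: every element is transcendental
  or algebraic over the domain, and in either case it can be adjoined.\<close>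

lemma derivation_of_graph:
  fixes G :: "'a::field_char_0 dual set"
  assumes "derivation_graph G"
  obtains D where "derivation D" "\<And>z. z \<in> G \<Longrightarrow> D (dfst z) = dsnd z"
proof -
  define A where "A = {H. derivation_graph H \<and> G \<subseteq> H}"
  have "\<exists>M\<in>A. \<forall>Y\<in>A. M \<subseteq> Y \<longrightarrow> Y = M"
  proof (rule subset_Zorn_nonempty)
    show "A \<noteq> {}" using assms by (auto simp: A_def)
    fix C assume C: "C \<noteq> {}" "subset.chain A C"
    then have CA: "C \<subseteq> A" and comp: "\<And>G H. G \<in> C \<Longrightarrow> H \<in> C \<Longrightarrow> G \<subseteq> H \<or> H \<subseteq> G"
      unfolding subset_chain_def by blast+
    have "derivation_graph (\<Union>C)"
      by (rule derivation_graph_Union[OF C(1) comp]) (use CA in \<open>auto simp: A_def\<close>)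
    moreover have "G \<subseteq> \<Union>C" using C(1) CA by (auto simp: A_def)
    ultimately show "\<Union>C \<in> A" by (simp add: A_def)
  qed
  then obtain M where M: "derivation_graph M" "G \<subseteq> M"
    and max: "\<And>Y. derivation_graph Y \<Longrightarrow> M \<subseteq> Y \<Longrightarrow> Y = M" by (auto simp: A_def)
  have r: "subring_set M" "functional_set M" using M by (auto simp: derivation_graph_def)
  have full: "x \<in> dfst ` M" for x
  proof -
    obtain c where "functional_set (adjoin M (Dual x c))"
    proof (cases "transcendental_over (dfst ` M) x")
      case True
      from functional_adjoin_transcendental[OF r(2) this] show ?thesis by (rule that)
    next
      case False
      from functional_adjoin_algebraic[OF r this] show ?thesis using that by blast
    qed
    then obtain G' where "derivation_graph G'" "M \<subseteq> G'" "Dual x c \<in> G'"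
      by (rule derivation_graph_extend[OF M(1)])
    then have "Dual x c \<in> M" using max[of G'] by simp
    then show ?thesis by (intro image_eqI[of _ _ "Dual x c"]) simp_all
  qed
  have uniq: "z = w" if "z \<in> M" "w \<in> M" "dfst z = dfst w" for z w
  proof -
    have "z - w \<in> M" "dfst (z - w) = 0" using subring_setD(4)[OF r(1) that(1,2)] that(3) by simp_all
    then have "z - w = 0" by (rule r(2)[unfolded functional_set_def, rule_format])
    then show ?thesis by simp
  qed
  define D where "D = (\<lambda>x. dsnd (SOME z. z \<in> M \<and> dfst z = x))"
  have D: "D (dfst z) = dsnd z" if "z \<in> M" for z
  proof -
    have "(SOME w. w \<in> M \<and> dfst w = dfst z) = z"
      by (rule some_equality) (use that uniq in auto)
    then show ?thesis by (simp add: D_def)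
  qed
  have "derivation D"
    unfolding derivation_def
  proof (intro conjI allI)
    fix x y :: 'a
    obtain z w where zw: "z \<in> M" "w \<in> M" "x = dfst z" "y = dfst w" using full[of x] full[of y] by auto
    show "D (x + y) = D x + D y"
      using D[OF subring_setD(5)[OF r(1) zw(1,2)]] by (simp add: zw D)
    show "D (x * y) = x * D y + D x * y"
      using D[OF subring_setD(6)[OF r(1) zw(1,2)]] by (simp add: zw D)
  qed
  then show ?thesis by (rule that) (use D M(2) in auto)
qed

lemma derivation_graph_zero:
  assumes "subfield_set L"
  shows "derivation_graph ((\<lambda>x. Dual x 0) ` L)"
proof -
  have L: "subring_set L" using assms by (simp add: subfield_set_def)
  have r: "subring_set ((\<lambda>x. Dual x 0) ` L)"
    unfolding subring_set_def using subring_setD[OF L]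
    by (auto simp: one_dual_def minus_dual_def times_dual_def)
  have "\<exists>w\<in>(\<lambda>x. Dual x 0) ` L. z * w = 1" if z: "z \<in> (\<lambda>x. Dual x 0) ` L" "dfst z \<noteq> 0" for z
  proof (rule bexI[of _ "Dual (inverse (dfst z)) 0"])
    show "z * Dual (inverse (dfst z)) 0 = 1" using z by (auto simp: dual_eq_iff)
    show "Dual (inverse (dfst z)) 0 \<in> (\<lambda>x. Dual x 0) ` L"
      using z assms by (auto simp: subfield_set_def)
  qed
  then show ?thesis unfolding derivation_graph_def
    using r by (auto simp: functional_set_def dual_eq_iff)
qed

text \<open>Zorn's lemma on graphs that realize the prescribed values on an initial segment I and
  whose domain lies in the field generated by \<open>b\<close> on I. The least index outside I is
  transcendental over that domain, so its value is free.\<close>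

lemma derivation_extension:
  fixes b :: "'i \<Rightarrow> 'a::field_char_0" and lt :: "'i \<Rightarrow> 'i \<Rightarrow> bool"
  assumes wf: "wf {(i, j). lt i j}" and tot: "\<And>i j. i = j \<or> lt i j \<or> lt j i"
    and tr: "\<And>i. transcendental_over (field_gen (b ` {j. lt j i})) (b i)"
  obtains D where "derivation D" "\<And>i. D (b i) = f i"
proof -
  define ok where "ok = (\<lambda>G I. derivation_graph G \<and> (\<forall>i\<in>I. \<forall>j. lt j i \<longrightarrow> j \<in> I) \<and>
    (\<forall>i\<in>I. Dual (b i) (f i) \<in> G) \<and> dfst ` G \<subseteq> field_gen (b ` I))"
  define A where "A = {G. \<exists>I. ok G I}"
  have "\<exists>M\<in>A. \<forall>Y\<in>A. M \<subseteq> Y \<longrightarrow> Y = M"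
  proof (rule subset_Zorn_nonempty)
    have "ok ((\<lambda>x. Dual x 0) ` field_gen {}) {}"
      unfolding ok_def using derivation_graph_zero[OF subfield_set_gen] by auto
    then show "A \<noteq> {}" by (auto simp: A_def)
    fix C assume C: "C \<noteq> {}" "subset.chain A C"
    then have CA: "C \<subseteq> A" and comp: "\<And>G H. G \<in> C \<Longrightarrow> H \<in> C \<Longrightarrow> G \<subseteq> H \<or> H \<subseteq> G"
      unfolding subset_chain_def by blast+
    have 1: "derivation_graph (\<Union>C)"
      by (rule derivation_graph_Union[OF C(1) comp]) (use CA in \<open>auto simp: A_def ok_def\<close>)
    have "\<forall>G\<in>C. \<exists>I. ok G I" using CA by (auto simp: A_def)
    from bchoice[OF this] obtain J where "\<forall>G\<in>C. ok G (J G)" by (rule exE)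
    then have J: "\<And>G. G \<in> C \<Longrightarrow> ok G (J G)" by (rule bspec)
    have "ok (\<Union>C) (\<Union>(J ` C))"
      unfolding ok_def
    proof (intro conjI 1)
      show "\<forall>i\<in>\<Union> (J ` C). \<forall>j. lt j i \<longrightarrow> j \<in> \<Union> (J ` C)"
      proof (intro ballI allI impI)
        fix i j assume "i \<in> \<Union> (J ` C)" "lt j i"
        then obtain G where G: "G \<in> C" "i \<in> J G" by auto
        then have "j \<in> J G" using J[OF G(1)] \<open>lt j i\<close> by (auto simp: ok_def)
        then show "j \<in> \<Union> (J ` C)" using G by auto
      qed
      show "\<forall>i\<in>\<Union> (J ` C). Dual (b i) (f i) \<in> \<Union> C"
      proof
        fix i assume "i \<in> \<Union> (J ` C)"
        then obtain G where G: "G \<in> C" "i \<in> J G" by auto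
        then have "Dual (b i) (f i) \<in> G" using J[OF G(1)] by (auto simp: ok_def)
        then show "Dual (b i) (f i) \<in> \<Union> C" using G by auto
      qed
      show "dfst ` \<Union> C \<subseteq> field_gen (b ` \<Union> (J ` C))"
      proof
        fix x assume "x \<in> dfst ` \<Union> C"
        then obtain G where G: "G \<in> C" "x \<in> dfst ` G" by auto
        then have "x \<in> field_gen (b ` J G)" using J[OF G(1)] by (auto simp: ok_def)
        moreover have "b ` J G \<subseteq> b ` \<Union> (J ` C)" using G(1) by auto
        ultimately show "x \<in> field_gen (b ` \<Union> (J ` C))" using field_gen_mono by blast
      qed
    qed
    then show "\<Union>C \<in> A" by (auto simp: A_def)
  qed
  then obtain M I where M: "ok M I" and max: "\<And>Y. Y \<in> A \<Longrightarrow> M \<subseteq> Y \<Longrightarrow> Y = M" by (auto simp: A_def)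
  have "I = UNIV"
  proof (rule ccontr)
    assume "I \<noteq> UNIV"
    then obtain i0 where "i0 \<in> - I" by auto
    then obtain i where i: "i \<in> - I" "\<And>j. lt j i \<Longrightarrow> j \<notin> - I"
      using wfE_min[OF wf, of i0 "- I"] by auto
    have I: "I = {j. lt j i}"
    proof (intro Set.set_eqI iffI)
      fix j assume "j \<in> I"
      then show "j \<in> {j. lt j i}" using tot[of i j] M i(1) by (auto simp: ok_def)
    qed (use i in auto)
    have sub: "dfst ` M \<subseteq> field_gen (b ` I)" using M by (simp add: ok_def)
    have "transcendental_over (dfst ` M) (b i)"
      using transcendental_over_mono[OF sub] tr[of i] I by simp
    moreover have dgM: "derivation_graph M" using M by (simp add: ok_def)
    ultimately have "functional_set (adjoin M (Dual (b i) (f i)))"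
      using functional_adjoin_transcendental by (auto simp: derivation_graph_def)
    then obtain G' where G': "derivation_graph G'" "M \<subseteq> G'" "Dual (b i) (f i) \<in> G'"
      "\<forall>L. subfield_set L \<longrightarrow> dfst ` M \<subseteq> L \<longrightarrow> b i \<in> L \<longrightarrow> dfst ` G' \<subseteq> L"
      by (rule derivation_graph_extend[OF dgM])
    have "ok G' (insert i I)"
      unfolding ok_def
    proof (intro conjI G'(1))
      show "\<forall>ia\<in>insert i I. \<forall>j. lt j ia \<longrightarrow> j \<in> insert i I" using M i(2) by (auto simp: ok_def)
      show "\<forall>i\<in>insert i I. Dual (b i) (f i) \<in> G'" using M G'(2,3) by (auto simp: ok_def)
      show "dfst ` G' \<subseteq> field_gen (b ` insert i I)"
      proof (rule G'(4)[rule_format, OF subfield_set_gen])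
        show "dfst ` M \<subseteq> field_gen (b ` insert i I)"
          using sub field_gen_mono[of "b ` I" "b ` insert i I"] by auto
        show "b i \<in> field_gen (b ` insert i I)" using field_gen_superset[of "b ` insert i I"] by auto
      qed
    qed
    then have "G' \<in> A" unfolding A_def by (intro CollectI exI)
    then have "G' = M" using G'(2) by (rule max)
    then have "b i \<in> dfst ` M" using G'(3) by (intro image_eqI[of _ _ "Dual (b i) (f i)"]) simp_all
    then have "b i \<in> field_gen (b ` I)" using sub by auto
    \<comment> \<open>Were the extended graph no larger, \<open>b i\<close> would lie in the field
      over which it is transcendental.\<close>
    moreover have "b i \<notin> field_gen (b ` I)"
      using transcendental_over_notin[OF _ tr[of i]] subfield_set_gen[of "b ` I"] I by (simp add: subfield_set_def)
    ultimately show False by simp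
  qed
  then have dM: "derivation_graph M" and fM: "\<And>i. Dual (b i) (f i) \<in> M" using M by (auto simp: ok_def)
  from derivation_of_graph[OF dM] obtain D where D: "derivation D" "\<And>z. z \<in> M \<Longrightarrow> D (dfst z) = dsnd z" by blast
  have "D (b i) = f i" for i using D(2)[OF fM[of i]] by simp
  then show ?thesis using that D(1) by blast
qed

lemma derivation_simps:
  assumes "derivation D"
  shows "D 0 = 0" "D 1 = 0" "D (x + y) = D x + D y" "D (- x) = - D x" "D (x - y) = D x - D y"
    "D (x * y) = x * D y + D x * y" "x \<noteq> 0 \<Longrightarrow> D (inverse x) = - D x * inverse x * inverse x"
proof -
  show add: "D (x + y) = D x + D y" and mult: "D (x * y) = x * D y + D x * y" for x y
    using assms by (auto simp: derivation_def)
  show 0: "D 0 = 0" using add[of 0 0] by (simp only: add_0_left add_cancel_right_right)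
  show 1: "D 1 = 0" using mult[of 1 1] by (simp only: mult_1_left mult_1_right add_cancel_right_right)
  show neg: "D (- x) = - D x" for x using add[of x "-x"] 0 by (simp add: eq_neg_iff_add_eq_0 add.commute)
  show "D (x - y) = D x - D y" using add[of x "-y"] neg by simp
  assume x: "x \<noteq> 0"
  have "x * D (inverse x) + D x * inverse x = 0" using mult[of x "inverse x"] x 1 by simp
  then have *: "x * D (inverse x) = - D x * inverse x" by (simp add: eq_neg_iff_add_eq_0)
  have "D (inverse x) = inverse x * (x * D (inverse x))"
    unfolding mult.assoc[symmetric] left_inverse[OF x] by simp
  also have "\<dots> = - D x * inverse x * inverse x" unfolding * by (simp only: ac_simps)
  finally show "D (inverse x) = - D x * inverse x * inverse x" .
qed

lemma subfield_constants:
  assumes "derivation D"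
  shows "subfield_set {x. D x = 0}"
proof -
  note d = derivation_simps[OF assms]
  have "D (inverse x) = 0" if "D x = 0" for x
    using that d(1) d(7)[of x] by (cases "x = 0") auto
  then show ?thesis unfolding subfield_set_def subring_set_def using d by simp
qed

text \<open>D vanishes on the field generated by S, so applying it to m(x) = 0 gives m'(x) D(x) = 0,
  and m'(x) is nonzero.\<close>

lemma derivation_algebraic_zero:
  fixes x :: "'a::field_char_0"
  assumes D: "derivation D" "\<And>s. s \<in> S \<Longrightarrow> D s = 0" and x: "\<not> transcendental_over (field_gen S) x"
  shows "D x = 0"
proof -
  note d = derivation_simps[OF D(1)]
  have g: "D s = 0" if "s \<in> field_gen S" for s
    using field_gen_least[OF subfield_constants[OF D(1)], of S] D(2) that by auto
  have L: "subring_set (field_gen S)" using subfield_set_gen by (auto simp: subfield_set_def)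
  obtain m where mL: "\<forall>i. coeff m i \<in> field_gen S" and mx: "poly m x = 0" and "m \<noteq> 0" and nz: "poly (pderiv m) x \<noteq> 0"
    and "\<forall>p. (\<forall>i. coeff p i \<in> field_gen S) \<longrightarrow> poly p x = 0 \<longrightarrow> p \<noteq> 0 \<longrightarrow> degree m \<le> degree p"
    by (rule minimal_annihilator[OF L x])
  have "D (poly p x) = poly (pderiv p) x * D x" if "\<forall>i. coeff p i \<in> field_gen S" for p
    using that
  proof (induction p)
    case (pCons a p)
    have a: "a \<in> field_gen S" using spec[OF pCons.prems, of 0] by simp
    have "coeff p i \<in> field_gen S" for i using spec[OF pCons.prems, of "Suc i"] by simp
    then have "D (poly p x) = poly (pderiv p) x * D x" using pCons.IH by simp
    then show ?case using g[OF a] by (simp add: pderiv_pCons d(3,6) algebra_simps)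
  qed (simp add: d)
  from this[of m] mL mx have "poly (pderiv m) x * D x = 0" by (simp add: d)
  then show ?thesis using nz by simp
qed

section \<open>Homomorphisms and evaluation of polynomials in several variables\<close>

definition is_hom :: "('a::comm_ring_1 \<Rightarrow> 'b::comm_ring_1) \<Rightarrow> bool" where
  "is_hom h \<longleftrightarrow> h 1 = 1 \<and> (\<forall>x y. h (x + y) = h x + h y) \<and> (\<forall>x y. h (x * y) = h x * h y)"

lemma is_homI:
  "h 1 = 1 \<Longrightarrow> (\<And>x y. h (x + y) = h x + h y) \<Longrightarrow> (\<And>x y. h (x * y) = h x * h y) \<Longrightarrow> is_hom h"
  by (simp add: is_hom_def)

lemma is_homD:
  assumes "is_hom h"
  shows "h 0 = 0" "h 1 = 1" "h (x + y) = h x + h y" "h (x * y) = h x * h y" "h (- x) = - h x"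
    "h (x - y) = h x - h y" "h (x ^ n) = h x ^ n" "h (of_nat n) = of_nat n"
proof -
  show 1: "h 1 = 1" and add: "h (x + y) = h x + h y" and mult: "h (x * y) = h x * h y" for x y
    using assms by (auto simp: is_hom_def)
  show 0: "h 0 = 0" using add[of 0 0] by (simp only: add_0_left add_cancel_right_right)
  show neg: "h (- x) = - h x" for x using add[of x "-x"] 0 by (simp add: eq_neg_iff_add_eq_0 add.commute)
  show "h (x - y) = h x - h y" using add[of x "-y"] neg by simp
  show "h (x ^ n) = h x ^ n" by (induction n) (simp_all add: 1 mult)
  show "h (of_nat n) = of_nat n" by (induction n) (simp_all add: 0 1 add)
qed

lemma is_hom_sum: "is_hom h \<Longrightarrow> h (\<Sum>i\<in>I. f i) = (\<Sum>i\<in>I. h (f i))"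
  by (induction I rule: infinite_finite_induct) (simp_all add: is_homD(1,2,3,4))

lemma is_hom_prod: "is_hom h \<Longrightarrow> h (\<Prod>i\<in>I. f i) = (\<Prod>i\<in>I. h (f i))"
  by (induction I rule: infinite_finite_induct) (simp_all add: is_homD(1,2,3,4))

lemma is_hom_comp: "is_hom g \<Longrightarrow> is_hom h \<Longrightarrow> is_hom (\<lambda>x. g (h x))"
  by (simp add: is_hom_def)

definition monomial_eval :: "('v \<Rightarrow> 'c::comm_ring_1) \<Rightarrow> ('v \<Rightarrow>\<^sub>0 nat) \<Rightarrow> 'c" where
  "monomial_eval x m = (\<Prod>i\<in>Poly_Mapping.keys m. x i ^ Poly_Mapping.lookup m i)"

lemma mp_eval_monomial_eval:
  "mp_eval h x p = (\<Sum>m\<in>Poly_Mapping.keys p. h (Poly_Mapping.lookup p m) * monomial_eval x m)"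
  by (simp add: mp_eval_def monomial_eval_def)

lemma monomial_eval_superset:
  assumes "finite I" "Poly_Mapping.keys m \<subseteq> I"
  shows "monomial_eval x m = (\<Prod>i\<in>I. x i ^ Poly_Mapping.lookup m i)"
  unfolding monomial_eval_def
  by (rule prod.mono_neutral_left) (use assms in \<open>auto simp: in_keys_iff\<close>)

lemma monomial_eval_0 [simp]: "monomial_eval x 0 = 1"
  by (simp add: monomial_eval_def)

lemma monomial_eval_single [simp]: "monomial_eval x (Poly_Mapping.single i n) = x i ^ n"
  by (simp add: monomial_eval_def)

lemma keys_add_subset_nat:
  fixes m m' :: "'v \<Rightarrow>\<^sub>0 nat"
  shows "Poly_Mapping.keys (m + m') \<subseteq> Poly_Mapping.keys m \<union> Poly_Mapping.keys m'"
  by (rule Poly_Mapping.keys_add)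

lemma monomial_eval_add: "monomial_eval x (m + m') = monomial_eval x m * monomial_eval x m'"
proof -
  let ?I = "Poly_Mapping.keys m \<union> Poly_Mapping.keys m'"
  have "monomial_eval x (m + m') = (\<Prod>i\<in>?I. x i ^ Poly_Mapping.lookup (m + m') i)"
    by (rule monomial_eval_superset) (use keys_add_subset_nat[of m m'] in auto)
  also have "\<dots> = (\<Prod>i\<in>?I. x i ^ Poly_Mapping.lookup m i) * (\<Prod>i\<in>?I. x i ^ Poly_Mapping.lookup m' i)"
    by (simp add: lookup_add power_add prod.distrib)
  also have "\<dots> = monomial_eval x m * monomial_eval x m'"
    using monomial_eval_superset[of ?I m x] monomial_eval_superset[of ?I m' x] by simp
  finally show ?thesis .
qed

lemma monomial_eval_hom: "is_hom g \<Longrightarrow> g (monomial_eval x m) = monomial_eval (\<lambda>i. g (x i)) m"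
  by (simp add: monomial_eval_def is_hom_prod is_homD(7))

lemma mp_eval_superset:
  assumes "finite M" "Poly_Mapping.keys p \<subseteq> M" "h 0 = 0"
  shows "mp_eval h x p = (\<Sum>m\<in>M. h (Poly_Mapping.lookup p m) * monomial_eval x m)"
  unfolding mp_eval_monomial_eval
  by (rule sum.mono_neutral_left) (use assms in \<open>auto simp: in_keys_iff\<close>)

lemma mp_eval_0 [simp]: "mp_eval h x 0 = 0"
  by (simp add: mp_eval_def)

lemma mp_eval_single: "h 0 = 0 \<Longrightarrow> mp_eval h x (Poly_Mapping.single m c) = h c * monomial_eval x m"
  by (cases "c = 0") (simp_all add: mp_eval_monomial_eval)

lemma mp_eval_add:
  assumes h: "is_hom h"
  shows "mp_eval h x (p + q) = mp_eval h x p + mp_eval h x q"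
proof -
  let ?M = "Poly_Mapping.keys p \<union> Poly_Mapping.keys q"
  have "mp_eval h x (p + q) = (\<Sum>m\<in>?M. h (Poly_Mapping.lookup (p + q) m) * monomial_eval x m)"
    by (rule mp_eval_superset) (use Poly_Mapping.keys_add[of p q] is_homD(1)[OF h] in auto)
  also have "\<dots> = mp_eval h x p + mp_eval h x q"
    using mp_eval_superset[of ?M p h x] mp_eval_superset[of ?M q h x] is_homD(1,3)[OF h]
    by (simp add: lookup_add distrib_right sum.distrib)
  finally show ?thesis .
qed

lemma mp_eval_sum:
  "is_hom h \<Longrightarrow> mp_eval h x (\<Sum>i\<in>I. p i) = (\<Sum>i\<in>I. mp_eval h x (p i))"
  by (induction I rule: infinite_finite_induct) (simp_all add: mp_eval_add)

lemma sum_singles: "(\<Sum>m\<in>Poly_Mapping.keys p. Poly_Mapping.single m (Poly_Mapping.lookup p m)) = p"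
  by (rule poly_mapping_eqI)
    (auto simp: lookup_sum lookup_single when_def in_keys_iff sum.delta[where S = "Poly_Mapping.keys p", simplified] cong: if_cong)

text \<open>Both factors are expanded into single monomials, where multiplicativity is
  \<open>monomial_eval_add\<close>.\<close>

lemma mp_eval_mult:
  assumes h: "is_hom h"
  shows "mp_eval h x (p * q) = mp_eval h x p * mp_eval h x q"
proof -
  let ?s = "\<lambda>p m. Poly_Mapping.single m (Poly_Mapping.lookup p m)"
  have "p * q = (\<Sum>m\<in>Poly_Mapping.keys p. ?s p m) * (\<Sum>n\<in>Poly_Mapping.keys q. ?s q n)"
    by (simp only: sum_singles)
  also have "\<dots> = (\<Sum>m\<in>Poly_Mapping.keys p. \<Sum>n\<in>Poly_Mapping.keys q. Poly_Mapping.single (m + n)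
      (Poly_Mapping.lookup p m * Poly_Mapping.lookup q n))"
    by (simp add: sum_product mult_single)
  finally have "mp_eval h x (p * q) = (\<Sum>m\<in>Poly_Mapping.keys p. \<Sum>n\<in>Poly_Mapping.keys q.
      h (Poly_Mapping.lookup p m * Poly_Mapping.lookup q n) * monomial_eval x (m + n))"
    by (simp add: mp_eval_sum[OF h] mp_eval_single is_homD(1)[OF h])
  also have "\<dots> = mp_eval h x p * mp_eval h x q"
    unfolding mp_eval_monomial_eval sum_product
    by (intro sum.cong) (simp_all add: is_homD(4)[OF h] monomial_eval_add mult_ac)
  finally show ?thesis .
qed

lemma mp_eval_hom:
  assumes "is_hom g"
  shows "g (mp_eval h x p) = mp_eval (\<lambda>c. g (h c)) (\<lambda>i. g (x i)) p"
  unfolding mp_eval_monomial_eval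
  by (simp add: is_hom_sum[OF assms] is_homD(4)[OF assms] monomial_eval_hom[OF assms])

lemma mp_eval_cong:
  assumes "\<And>i. i \<in> mp_vars p \<Longrightarrow> x i = y i"
  shows "mp_eval h x p = mp_eval h y p"
  unfolding mp_eval_def
  by (intro sum.cong refl arg_cong2[where f = "(*)"] prod.cong arg_cong2[where f = "(^)"] assms)
    (auto simp: mp_vars_def)

lemma mp_vars_add: "mp_vars (p + q) \<subseteq> mp_vars p \<union> mp_vars q"
  unfolding mp_vars_def using Poly_Mapping.keys_add[of p q] by auto

lemma mp_vars_sum: "(\<And>i. i \<in> I \<Longrightarrow> mp_vars (p i) \<subseteq> A) \<Longrightarrow> mp_vars (\<Sum>i\<in>I. p i) \<subseteq> A"
proof (induction I rule: infinite_finite_induct)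
  case (insert i I)
  have "mp_vars (sum p (insert i I)) \<subseteq> mp_vars (p i) \<union> mp_vars (sum p I)"
    using insert.hyps by (simp add: mp_vars_add)
  then show ?case using insert by fastforce
qed (auto simp: mp_vars_def)

lemma mp_vars_mult: "mp_vars (p * q) \<subseteq> mp_vars p \<union> mp_vars q"
proof
  fix i assume "i \<in> mp_vars (p * q)"
  then obtain m where m: "m \<in> Poly_Mapping.keys (p * q)" "i \<in> Poly_Mapping.keys m" by (auto simp: mp_vars_def)
  from m(1) have "m \<in> {a + b | a b. a \<in> Poly_Mapping.keys p \<and> b \<in> Poly_Mapping.keys q}"
    using Poly_Mapping.keys_mult[of p q] by (rule subsetD[rotated])
  then obtain a b where ab: "m = a + b" "a \<in> Poly_Mapping.keys p" "b \<in> Poly_Mapping.keys q"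
    by (elim CollectE exE conjE)
  then have "i \<in> Poly_Mapping.keys a \<union> Poly_Mapping.keys b" using m(2) keys_add_subset_nat[of a b] by auto
  then show "i \<in> mp_vars p \<union> mp_vars q" using ab by (auto simp: mp_vars_def)
qed

lemma mp_vars_single: "mp_vars (Poly_Mapping.single m c) \<subseteq> Poly_Mapping.keys m"
  by (auto simp: mp_vars_def split: if_splits)

lemma is_hom_of_rat: "is_hom (of_rat :: rat \<Rightarrow> 'a::field_char_0)"
  by (rule is_homI) (simp_all add: of_rat_add of_rat_mult)

lemma is_hom_const: "is_hom (\<lambda>c::'a::comm_ring_1. [:c:])"
  by (rule is_homI) (simp_all add: one_pCons)

lemma dual_power: "Dual a b ^ n = Dual (a ^ n) (of_nat n * a ^ (n - 1) * b)"
proof (induction n)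
  case (Suc n)
  then show ?case by (cases n) (simp_all add: dual_eq_iff algebra_simps)
qed (simp add: dual_eq_iff)

lemma dual_prod:
  assumes "finite I"
  shows "(\<Prod>i\<in>I. Dual (u i) (v i)) = Dual (\<Prod>i\<in>I. u i) (\<Sum>j\<in>I. v j * (\<Prod>i\<in>I - {j}. u i))"
  using assms
proof (induction I)
  case (insert k I)
  have "(\<Sum>j\<in>I. v j * (\<Prod>i\<in>insert k I - {j}. u i)) = (\<Sum>j\<in>I. u k * (v j * (\<Prod>i\<in>I - {j}. u i)))"
  proof (rule sum.cong[OF refl])
    fix j assume "j \<in> I"
    then have "insert k I - {j} = insert k (I - {j})" using insert.hyps by auto
    then show "v j * (\<Prod>i\<in>insert k I - {j}. u i) = u k * (v j * (\<Prod>i\<in>I - {j}. u i))"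
      using insert.hyps by (simp add: mult_ac)
  qed
  moreover have "insert k I - {k} = I" using insert.hyps by auto
  ultimately show ?case using insert by (simp add: dual_eq_iff sum_distrib_left mult_ac)
qed (simp add: dual_eq_iff)

lemma is_hom_Dual: "is_hom (\<lambda>c::'a::comm_ring_1. Dual c 0)"
  by (rule is_homI) (simp_all add: dual_eq_iff)

lemma is_hom_dfst: "is_hom (dfst :: 'a::comm_ring_1 dual \<Rightarrow> 'a)"
  by (rule is_homI) simp_all

lemma dsnd_sum: "dsnd (\<Sum>i\<in>I. f i) = (\<Sum>i\<in>I. dsnd (f i))"
  by (induction I rule: infinite_finite_induct) simp_all

text \<open>The chain rule: evaluating at \<open>x + d \<epsilon>\<close> produces the directional derivative along \<open>d\<close>.\<close>

lemma mp_eval_dual: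
  assumes J: "finite J" "mp_vars f \<subseteq> J"
  shows "mp_eval (\<lambda>c. Dual (h c) 0) (\<lambda>i. Dual (x i) (d i)) f =
    Dual (mp_eval h x f) (\<Sum>j\<in>J. d j * mp_partial_eval h j x f)"
proof -
  let ?e = "Poly_Mapping.lookup"
  have mon: "dsnd (monomial_eval (\<lambda>i. Dual (x i) (d i)) m) =
      (\<Sum>j\<in>J. d j * ((of_nat (?e m j) * x j ^ (?e m j - 1)) * (\<Prod>i\<in>Poly_Mapping.keys m - {j}. x i ^ ?e m i)))"
    if m: "m \<in> Poly_Mapping.keys f" for m
  proof -
    have mJ: "Poly_Mapping.keys m \<subseteq> J" using J(2) m by (auto simp: mp_vars_def)
    have "dsnd (monomial_eval (\<lambda>i. Dual (x i) (d i)) m) = (\<Sum>j\<in>Poly_Mapping.keys m.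
        of_nat (?e m j) * x j ^ (?e m j - 1) * d j * (\<Prod>i\<in>Poly_Mapping.keys m - {j}. x i ^ ?e m i))"
      by (simp add: monomial_eval_def dual_power dual_prod)
    also have "\<dots> = (\<Sum>j\<in>J.
        of_nat (?e m j) * x j ^ (?e m j - 1) * d j * (\<Prod>i\<in>Poly_Mapping.keys m - {j}. x i ^ ?e m i))"
      by (rule sum.mono_neutral_left[OF J(1) mJ]) (auto simp: in_keys_iff)
    finally show ?thesis by (simp only: mult_ac)
  qed
  have fst: "dfst (mp_eval (\<lambda>c. Dual (h c) 0) (\<lambda>i. Dual (x i) (d i)) f) = mp_eval h x f"
    by (simp add: mp_eval_hom[OF is_hom_dfst])
  have "dsnd (mp_eval (\<lambda>c. Dual (h c) 0) (\<lambda>i. Dual (x i) (d i)) f) =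
      (\<Sum>m\<in>Poly_Mapping.keys f. h (?e f m) * dsnd (monomial_eval (\<lambda>i. Dual (x i) (d i)) m))"
    by (simp add: mp_eval_monomial_eval dsnd_sum)
  also have "\<dots> = (\<Sum>m\<in>Poly_Mapping.keys f. h (?e f m) * (\<Sum>j\<in>J. d j *
      ((of_nat (?e m j) * x j ^ (?e m j - 1)) * (\<Prod>i\<in>Poly_Mapping.keys m - {j}. x i ^ ?e m i))))"
    by (intro sum.cong refl arg_cong2[where f = "(*)"] mon)
  also have "\<dots> = (\<Sum>m\<in>Poly_Mapping.keys f. \<Sum>j\<in>J. d j * (h (?e f m) *
      (of_nat (?e m j) * x j ^ (?e m j - 1)) * (\<Prod>i\<in>Poly_Mapping.keys m - {j}. x i ^ ?e m i)))"
    by (intro sum.cong refl) (simp add: sum_distrib_left mult_ac)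
  also have "\<dots> = (\<Sum>j\<in>J. d j * mp_partial_eval h j x f)"
    by (subst sum.swap) (simp add: mp_partial_eval_def sum_distrib_left)
  finally show ?thesis using fst by (simp add: dual_eq_iff)
qed

section \<open>Linear systems and cardinal bounds\<close>

text \<open>Gaussian elimination without division, so that it works over a domain: a pivot z for the
  equation s is removed by cross-multiplication.\<close>

lemma homogeneous_system:
  fixes M :: "'x \<Rightarrow> 's \<Rightarrow> 'r::idom"
  assumes "finite S" "finite A" "card S < card A"
  shows "\<exists>c. (\<exists>x\<in>A. c x \<noteq> 0) \<and> (\<forall>s\<in>S. (\<Sum>x\<in>A. c x * M x s) = 0)"
  using assms
proof (induction S arbitrary: A M rule: finite_induct)
  case empty
  then obtain x where "x \<in> A" by fastforce
  then show ?case by (intro exI[of _ "\<lambda>_. 1"]) auto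
next
  case (insert s S)
  show ?case
  proof (cases "\<forall>x\<in>A. M x s = 0")
    case True
    have "card S < card A" using insert.prems insert.hyps by simp
    from insert.IH[OF insert.prems(1) this, of M] obtain c where
      c: "\<exists>x\<in>A. c x \<noteq> 0" "\<forall>s\<in>S. (\<Sum>x\<in>A. c x * M x s) = 0" by auto
    then show ?thesis using True by (intro exI[of _ c]) simp
  next
    case False
    then obtain z where z: "z \<in> A" "M z s \<noteq> 0" by auto
    let ?A = "A - {z}"
    define N where "N = (\<lambda>x t. M z s * M x t - M x s * M z t)"
    have "finite ?A" "card S < card ?A" using insert.prems insert.hyps z by auto
    from insert.IH[OF this, of N] obtain c where
      c: "\<exists>x\<in>?A. c x \<noteq> 0" "\<forall>s\<in>S. (\<Sum>x\<in>?A. c x * N x s) = 0" by auto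
    \<comment> \<open>The coefficient at the pivot is whatever the equation s demands once the
      others are multiplied by the pivot entry.\<close>
    define d where "d = (\<lambda>x. if x = z then - (\<Sum>x\<in>?A. c x * M x s) else M z s * c x)"
    have sum: "(\<Sum>x\<in>A. d x * M x t) = (\<Sum>x\<in>?A. c x * N x t)" for t
    proof -
      have "(\<Sum>x\<in>A. d x * M x t) = d z * M z t + (\<Sum>x\<in>?A. d x * M x t)"
        using insert.prems z(1) by (simp add: sum.remove)
      also have "(\<Sum>x\<in>?A. d x * M x t) = (\<Sum>x\<in>?A. M z s * c x * M x t)"
        by (intro sum.cong) (auto simp: d_def)
      moreover have "(\<Sum>x\<in>?A. c x * N x t) = (\<Sum>x\<in>?A. M z s * c x * M x t) - (\<Sum>x\<in>?A. c x * M x s) * M z t"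
        unfolding N_def sum_distrib_right sum_subtractf[symmetric]
        by (intro sum.cong refl) (simp add: algebra_simps)
      moreover have "d z = - (\<Sum>x\<in>?A. c x * M x s)" by (simp add: d_def)
      ultimately show ?thesis by simp
    qed
    have "(\<Sum>x\<in>?A. c x * N x s) = 0" by (simp add: N_def mult_ac)
    then have "\<forall>t\<in>insert s S. (\<Sum>x\<in>A. d x * M x t) = 0" using c(2) sum by simp
    moreover have "\<exists>x\<in>A. d x \<noteq> 0" using c(1) z(2) by (auto simp: d_def)
    ultimately show ?thesis by blast
  qed
qed

text \<open>The closure is a countable union of stages, each of size at most |A|. The parameter p
  ranges over a set of that size, which admits families such as all scalar multiplications or all
  chosen witnesses.\<close>

lemma closure_card:
  fixes f :: "'p \<Rightarrow> 'x \<Rightarrow> 'x \<Rightarrow> 'x" and A :: "'b set"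
  assumes A: "infinite A" and P: "|P| \<le>o |A|" and S: "|S| \<le>o |A|"
  obtains Y where "S \<subseteq> Y" "\<forall>p\<in>P. \<forall>x\<in>Y. \<forall>y\<in>Y. f p x y \<in> Y" "|Y| \<le>o |A|"
proof -
  have fA: "\<not> finite (Field |A| )" using A by (simp add: Field_card_of)
  define st where "st = (\<lambda>Z. Z \<union> (\<lambda>(p, x, y). f p x y) ` (P \<times> Z \<times> Z))"
  define Y where "Y = (\<Union>n. (st ^^ n) S)"
  have card: "|(st ^^ n) S| \<le>o |A|" for n
  proof (induction n)
    case (Suc n)
    let ?Z = "(st ^^ n) S"
    have "|P \<times> ?Z \<times> ?Z| \<le>o |A|"
      by (intro card_of_Times_ordLeq_infinite_Field fA P Suc card_of_Card_order)
    then have "|(\<lambda>(p, x, y). f p x y) ` (P \<times> ?Z \<times> ?Z)| \<le>o |A|"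
      by (rule ordLeq_transitive[OF card_of_image])
    then show ?case using Suc card_of_Un_ordLeq_infinite_Field[OF fA Suc _ card_of_Card_order]
      by (simp add: st_def)
  qed (use S in simp)
  have "|UNIV :: nat set| \<le>o |A|" using A by (simp add: infinite_iff_card_of_nat)
  then have "|Y| \<le>o |A|"
    unfolding Y_def using card
    by (intro card_of_UNION_ordLeq_infinite_Field[OF fA card_of_Card_order]) auto
  moreover have "S \<subseteq> Y" unfolding Y_def using UN_upper[of 0 UNIV "\<lambda>n. (st ^^ n) S"] by simp
  moreover have "f p x y \<in> Y" if "p \<in> P" "x \<in> Y" "y \<in> Y" for p x y
  proof -
    have mono: "(st ^^ m) S \<subseteq> (st ^^ n) S" if "m \<le> n" for m n
      using that by (induction n rule: dec_induct) (auto simp: st_def)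
    obtain m n where "x \<in> (st ^^ m) S" "y \<in> (st ^^ n) S" using \<open>x \<in> Y\<close> \<open>y \<in> Y\<close> by (auto simp: Y_def)
    then have "x \<in> (st ^^ (max m n)) S" "y \<in> (st ^^ (max m n)) S"
      using mono[of m "max m n"] mono[of n "max m n"] by auto
    then have "f p x y \<in> (st ^^ Suc (max m n)) S"
      using that(1) by (auto simp: st_def intro!: image_eqI[of _ _ "(p, x, y)"])
    then show ?thesis unfolding Y_def by blast
  qed
  ultimately show ?thesis by (intro that) auto
qed

lemma finite_ordLeq_infinite: "finite B \<Longrightarrow> infinite A \<Longrightarrow> |B| \<le>o |A|"
  by (rule ordLess_imp_ordLeq, rule finite_ordLess_infinite) (simp_all add: Field_card_of card_of_well_order_on)

lemma card_field_gen:
  fixes S :: "'a::field set" and A :: "'b set"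
  assumes A: "infinite A" and S: "|S| \<le>o |A|"
  shows "|field_gen S| \<le>o |A|"
proof -
  define f :: "nat \<Rightarrow> 'a \<Rightarrow> 'a \<Rightarrow> 'a" where
    "f = (\<lambda>p x y. if p = 0 then x - y else if p = 1 then x * y else inverse x)"
  have fA: "\<not> finite (Field |A| )" using A by (simp add: Field_card_of)
  have "|{1} \<union> S| \<le>o |A|"
    by (rule card_of_Un_ordLeq_infinite_Field[OF fA _ S card_of_Card_order]) (simp add: finite_ordLeq_infinite A)
  moreover have "|UNIV :: nat set| \<le>o |A|" using A by (simp add: infinite_iff_card_of_nat)
  ultimately obtain Y where Y: "{1} \<union> S \<subseteq> Y" "\<forall>p\<in>UNIV. \<forall>x\<in>Y. \<forall>y\<in>Y. f p x y \<in> Y" "|Y| \<le>o |A|"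
    by (elim closure_card[OF A, of "UNIV :: nat set" "{1} \<union> S" f])
  have cl: "f p x y \<in> Y" if "x \<in> Y" "y \<in> Y" for p x y using Y(2) that by simp
  have "subfield_set Y"
    unfolding subfield_set_def subring_set_def
  proof (intro conjI ballI)
    show "1 \<in> Y" using Y(1) by simp
    fix x y assume xy: "x \<in> Y" "y \<in> Y"
    show "x - y \<in> Y" using cl[OF xy, of 0] by (simp add: f_def)
    show "x * y \<in> Y" using cl[OF xy, of 1] by (simp add: f_def)
  next
    fix x assume x: "x \<in> Y"
    show "inverse x \<in> Y" using cl[OF x x, of 2] by (simp add: f_def)
  qed
  then have "field_gen S \<subseteq> Y" using Y(1) by (intro field_gen_least) auto
  then show ?thesis by (rule ordLeq_transitive[OF card_of_mono1 Y(3)])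
qed

text \<open>There are at most |A| polynomials over L, all obtained from 0 by \<open>pCons\<close>,
  and each nonzero one has finitely many roots.\<close>

lemma card_algebraic:
  fixes L :: "'a::field set" and A :: "'b set"
  assumes A: "infinite A" and L: "|L| \<le>o |A|" "0 \<in> L"
  shows "|{x. \<not> transcendental_over L x}| \<le>o |A|"
proof -
  have "|{0 :: 'a poly}| \<le>o |A|" using A by (simp add: finite_ordLeq_infinite)
  then obtain Y where Y: "{0} \<subseteq> Y" "\<forall>a\<in>L. \<forall>p\<in>Y. \<forall>q\<in>Y. pCons a p \<in> Y" "|Y| \<le>o |A|"
    by (elim closure_card[OF A L(1), of "{0}" "\<lambda>a p q. pCons a p"])
  have inY: "p \<in> Y" if "\<forall>i. coeff p i \<in> L" for p
    using that
  proof (induction p)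
    case 0
    then show ?case using Y(1) by simp
  next
    case (pCons a p)
    have "a \<in> L" using spec[OF pCons.prems, of 0] by simp
    moreover have "coeff p i \<in> L" for i using spec[OF pCons.prems, of "Suc i"] by simp
    ultimately show ?case using Y(2)[rule_format, of a p p] pCons.IH by simp
  qed
  have fA: "\<not> finite (Field |A| )" using A by (simp add: Field_card_of)
  have "|\<Union>p\<in>Y - {0}. {x. poly p x = 0}| \<le>o |A|"
  proof (rule card_of_UNION_ordLeq_infinite_Field[OF fA card_of_Card_order])
    show "|Y - {0}| \<le>o |A|" by (rule ordLeq_transitive[OF card_of_mono1 Y(3)]) auto
    show "\<forall>p\<in>Y - {0}. |{x. poly p x = 0}| \<le>o |A|"
      using A by (auto intro: finite_ordLeq_infinite poly_roots_finite)
  qed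
  moreover have "{x. \<not> transcendental_over L x} \<subseteq> (\<Union>p\<in>Y - {0}. {x. poly p x = 0})"
    using inY by (auto simp: transcendental_over_def)
  ultimately show ?thesis by (rule ordLeq_transitive[OF card_of_mono1, rotated])
qed

lemma card_lists:
  fixes A :: "'a set"
  assumes "infinite (UNIV :: 'a set)"
  shows "|UNIV :: 'a list set| \<le>o |UNIV :: 'a set|"
proof -
  have "|{[] :: 'a list}| \<le>o |UNIV :: 'a set|" using assms by (simp add: finite_ordLeq_infinite)
  then obtain Y :: "'a list set" where Y: "{[]} \<subseteq> Y" "\<forall>a\<in>UNIV. \<forall>p\<in>Y. \<forall>q\<in>Y. a # p \<in> Y" "|Y| \<le>o |UNIV :: 'a set|"
    by (elim closure_card[OF assms card_of_mono1[OF subset_refl], of "{[]}" "\<lambda>a p q. a # p"])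
  have "xs \<in> Y" for xs
  proof (induction xs)
    case (Cons a xs)
    then show ?case using Y(2)[rule_format, of a xs xs] by simp
  qed (use Y(1) in simp)
  then have "UNIV = Y" by (rule UNIV_eq_I)
  then show ?thesis using Y(3) by simp
qed

section \<open>Derivation closure\<close>

text \<open>In characteristic zero this is the set of elements algebraic over
  \<open>field_gen S\<close>, as the two implications below show. Described through derivations it
  is visibly an intersection of subfields of constants.\<close>

definition derivation_closure :: "'a::field set \<Rightarrow> 'a set" where
  "derivation_closure S = {x. \<forall>D. derivation D \<longrightarrow> (\<forall>s\<in>S. D s = 0) \<longrightarrow> D x = 0}"

lemma subfield_derivation_closure: "subfield_set (derivation_closure S)"
proof -
  have inter: "subfield_set (\<Inter>F)" if "\<And>L. L \<in> F \<Longrightarrow> subfield_set L" for F :: "'a set set"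
    unfolding subfield_set_def subring_set_def
    using that by (auto simp: subfield_set_def subring_set_def)
  have eq: "derivation_closure S = \<Inter>{{x. D x = 0} | D. derivation D \<and> (\<forall>s\<in>S. D s = 0)}"
    unfolding derivation_closure_def by auto
  show ?thesis unfolding eq
  proof (rule inter)
    fix L :: "'a set" assume "L \<in> {{x. D x = 0} | D. derivation D \<and> (\<forall>s\<in>S. D s = 0)}"
    then show "subfield_set L" using subfield_constants by auto
  qed
qed

lemma transcendental_outside_closure:
  fixes x :: "'a::field_char_0"
  assumes "x \<notin> derivation_closure S"
  shows "transcendental_over (field_gen S) x"
proof (rule ccontr)
  assume "\<not> transcendental_over (field_gen S) x"
  then have "x \<in> derivation_closure S"
    unfolding derivation_closure_def using derivation_algebraic_zero[of _ S x] by auto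
  then show False using assms by simp
qed

text \<open>The zero derivation on \<open>field_gen S\<close> extends with value 1 at x.\<close>

lemma outside_closure_transcendental:
  fixes x :: "'a::field_char_0"
  assumes x: "transcendental_over (field_gen S) x"
  shows "x \<notin> derivation_closure S"
proof -
  let ?G = "(\<lambda>x. Dual x 0) ` field_gen S"
  have G: "derivation_graph ?G" by (rule derivation_graph_zero[OF subfield_set_gen])
  have "dfst ` ?G = field_gen S" by (auto simp: image_image)
  then have "functional_set (adjoin ?G (Dual x 1))"
    using functional_adjoin_transcendental[of ?G x] G x by (simp add: derivation_graph_def)
  then obtain G' where G': "derivation_graph G'" "?G \<subseteq> G'" "Dual x 1 \<in> G'"
    "\<forall>L. subfield_set L \<longrightarrow> dfst ` ?G \<subseteq> L \<longrightarrow> x \<in> L \<longrightarrow> dfst ` G' \<subseteq> L"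
    by (rule derivation_graph_extend[OF G])
  from derivation_of_graph[OF G'(1)] obtain D where D: "derivation D" "\<And>z. z \<in> G' \<Longrightarrow> D (dfst z) = dsnd z"
    by auto
  have "D x = 1" using D(2)[OF G'(3)] by simp
  have zero: "D s = 0" if "s \<in> S" for s
  proof -
    have "Dual s 0 \<in> G'" using that G'(2) field_gen_superset[of S] by auto
    from D(2)[OF this] show ?thesis by simp
  qed
  show ?thesis
  proof
    assume "x \<in> derivation_closure S"
    then have "derivation D \<longrightarrow> (\<forall>s\<in>S. D s = 0) \<longrightarrow> D x = 0"
      unfolding derivation_closure_def by simp
    then show False using D(1) zero \<open>D x = 1\<close> by simp
  qed
qed

section \<open>Simple roots and refinement by derivations\<close>

lemma simple_root_iff:
  fixes p :: "'a::field_char_0 poly"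
  assumes "p \<noteq> 0"
  shows "order x p = 1 \<longleftrightarrow> poly p x = 0 \<and> poly (pderiv p) x \<noteq> 0"
proof (cases "poly p x = 0")
  case True
  have "pderiv p \<noteq> 0"
  proof
    assume "pderiv p = 0"
    then have "degree p = 0" by (simp add: pderiv_eq_0_iff)
    then obtain c where "p = [:c:]" by (rule degree_eq_zeroE)
    then show False using True assms by simp
  qed
  have "order x p = Suc (order x (pderiv p))" by (rule order_pderiv[OF assms True])
  then show ?thesis using True \<open>pderiv p \<noteq> 0\<close> by (simp add: order_root)
next
  case False
  then have "order x p = 0" by (rule order_0I)
  then show ?thesis using False by simp
qed

lemma gt_poly_nonzero: "gt_poly d a \<noteq> (0 :: 'a::field poly)"
proof -
  have "coeff (gt_poly d a) (d + 2) = 1" by (simp add: gt_poly_def coeff_sum)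
  then show ?thesis by auto
qed

lemma poly_gt_poly: "poly (gt_poly d a) x = x ^ (d + 2) + x ^ (d + 1) + (\<Sum>i\<le>d. a i * x ^ i)"
  by (simp add: gt_poly_def poly_monom poly_sum)

lemma pderiv_sum: "pderiv (\<Sum>i\<in>I. f i) = (\<Sum>i\<in>I. pderiv (f i))"
  by (induction I rule: infinite_finite_induct) (simp_all add: pderiv_add)

lemma poly_pderiv_gt_poly:
  "poly (pderiv (gt_poly d a)) x =
    of_nat (d + 2) * x ^ (d + 1) + of_nat (d + 1) * x ^ d + (\<Sum>i\<le>d. of_nat i * a i * x ^ (i - 1))"
  by (simp add: gt_poly_def poly_monom poly_sum pderiv_add pderiv_sum pderiv_monom)

text \<open>All entries of a sequence tend to 0 together. An expression in several small quantities
  then yields a single neighbourhood for all of them.\<close>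

definition tuple_filter :: "'a::field set set \<Rightarrow> (nat \<Rightarrow> 'a) filter" where
  "tuple_filter B = (INF U\<in>B. principal {f. \<forall>i. f i \<in> U})"

lemma eventually_tuple:
  assumes "field_base B"
  shows "eventually P (tuple_filter B) \<longleftrightarrow> (\<exists>V\<in>B. \<forall>f. (\<forall>i. f i \<in> V) \<longrightarrow> P f)"
  unfolding tuple_filter_def by (subst eventually_directed[OF assms]) auto

lemma base_conv_tuple: "field_base B \<Longrightarrow> base_conv B (\<lambda>f. f i) 0 (tuple_filter B)"
  unfolding base_conv_def by (auto simp: eventually_tuple)

lemma derivation_sum:
  assumes "derivation D"
  shows "D (\<Sum>i\<in>I. f i) = (\<Sum>i\<in>I. D (f i))"
  by (induction I rule: infinite_finite_induct) (simp_all add: derivation_simps(1,3)[OF assms])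

lemma derivation_power:
  assumes "derivation D"
  shows "D (x ^ n) = of_nat n * x ^ (n - 1) * D x"
proof (induction n)
  case (Suc n)
  then show ?case by (cases n) (simp_all add: derivation_simps[OF assms] algebra_simps)
qed (simp add: derivation_simps(2)[OF assms])

text \<open>Implicit differentiation of the equation, where the coefficients contribute through
  their derivatives \<open>D (a i)\<close>.\<close>

lemma derivation_simple_root:
  assumes D: "derivation D" and x: "poly (gt_poly d a) x = 0" "poly (pderiv (gt_poly d a)) x \<noteq> 0"
  shows "D x = - (\<Sum>i\<le>d. D (a i) * x ^ i) * inverse (poly (pderiv (gt_poly d a)) x)"
proof -
  note d = derivation_simps[OF D] derivation_sum[OF D] derivation_power[OF D]
  have "0 = D (poly (gt_poly d a) x)" using x by (simp add: d)
  also have "\<dots> = of_nat (d + 2) * x ^ (d + 1) * D x + of_nat (d + 1) * x ^ d * D x +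
      (\<Sum>i\<le>d. a i * (of_nat i * x ^ (i - 1) * D x) + D (a i) * x ^ i)"
    unfolding poly_gt_poly d(3) d(8) d(6) d(9) by simp
  also have "\<dots> = poly (pderiv (gt_poly d a)) x * D x + (\<Sum>i\<le>d. D (a i) * x ^ i)"
    unfolding poly_pderiv_gt_poly sum.distrib distrib_right sum_distrib_right by (simp add: mult_ac)
  finally have *: "D x * poly (pderiv (gt_poly d a)) x = - (\<Sum>i\<le>d. D (a i) * x ^ i)"
    by (simp add: eq_neg_iff_add_eq_0 mult.commute)
  have "D x = D x * poly (pderiv (gt_poly d a)) x * inverse (poly (pderiv (gt_poly d a)) x)"
    unfolding mult.assoc right_inverse[OF x(2)] by simp
  then show ?thesis unfolding * .
qed

text \<open>Basic neighbourhoods of 0 for the coarsest common refinement that makes the maps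
  \<open>D i\<close> with i in F continuous at 0.\<close>

definition deriv_set :: "('i \<Rightarrow> 'a::field \<Rightarrow> 'a) \<Rightarrow> 'a set \<Rightarrow> 'i set \<Rightarrow> 'a set" where
  "deriv_set D V F = {x \<in> V. \<forall>i\<in>F. D i x \<in> V}"

definition deriv_base :: "'a::field set set \<Rightarrow> ('i \<Rightarrow> 'a \<Rightarrow> 'a) \<Rightarrow> 'i set \<Rightarrow> 'a set set" where
  "deriv_base B D J = {deriv_set D V F | V F. V \<in> B \<and> finite F \<and> F \<subseteq> J}"

lemma deriv_base_memI: "V \<in> B \<Longrightarrow> finite F \<Longrightarrow> F \<subseteq> J \<Longrightarrow> deriv_set D V F \<in> deriv_base B D J"
  unfolding deriv_base_def by blast

lemma deriv_base_memE:
  assumes "U \<in> deriv_base B D J"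
  obtains V F where "U = deriv_set D V F" "V \<in> B" "finite F" "F \<subseteq> J"
  using assms unfolding deriv_base_def by blast

text \<open>Each \<open>D i\<close> of a sum, product or inverse is a rational expression in the
  arguments and their derivatives under the same \<open>D i\<close>; it tends to 0 with them. The
  finite set F never has to grow in the one-neighbourhood axioms.\<close>

lemma field_base_deriv_base:
  fixes D :: "'i \<Rightarrow> 'a::field \<Rightarrow> 'a"
  assumes B: "field_base B" and D: "\<And>i. derivation (D i)"
  shows "field_base (deriv_base B D J)"
proof -
  note b = field_baseD[OF B] and t = base_conv_tuple[OF B] and
    c = base_conv_add[OF B] base_conv_mult[OF B] base_conv_const[OF B] base_conv_diff[OF B] base_conv_inverse[OF B]
  note d = derivation_simps[OF D]
  let ?Z = "tuple_filter B"
  \<comment> \<open>Template for the unary operations: \<open>E0\<close> gives the value and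
    \<open>E\<close> its derivative. The alternative \<open>D i (g x) = 0\<close> absorbs the point
    where \<open>inverse\<close> takes its default value.\<close>
  have single: "\<exists>V\<in>B. \<forall>x\<in>deriv_set D V F. g x \<in> deriv_set D U F"
    if U: "U \<in> B" "finite F" and E0: "base_conv B (\<lambda>f. E0 (f 0)) 0 ?Z" and g0: "\<And>x. g x = E0 x"
      and E: "\<And>i. base_conv B (\<lambda>f. E i (f 0) (f 1)) 0 ?Z" and gi: "\<And>i x. D i (g x) = E i x (D i x) \<or> D i (g x) = 0"
    for g E0 E U F
  proof -
    have "eventually (\<lambda>f. E0 (f 0) \<in> U \<and> (\<forall>i\<in>F. E i (f 0) (f 1) \<in> U)) ?Z"
      using E0 E U by (intro eventually_conj eventually_ball_finite) (auto simp: base_conv_def)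
    then obtain V where V: "V \<in> B" and V': "\<And>f :: nat \<Rightarrow> 'a. (\<forall>i. f i \<in> V) \<Longrightarrow> E0 (f 0) \<in> U \<and> (\<forall>i\<in>F. E i (f 0) (f 1) \<in> U)"
      unfolding eventually_tuple[OF B] by (auto simp del: One_nat_def)
    have "g x \<in> deriv_set D U F" if x: "x \<in> deriv_set D V F" for x
    proof -
      have xV: "x \<in> V" "\<And>i. i \<in> F \<Longrightarrow> D i x \<in> V" using x by (auto simp: deriv_set_def)
      have "g x \<in> U" using V'[of "\<lambda>_. x"] xV(1) g0 by simp
      moreover have "D i (g x) \<in> U" if "i \<in> F" for i
      proof -
        have "E i x (D i x) \<in> U" using V'[of "\<lambda>n. if n = 0 then x else D i x"] xV that by simp
        then show ?thesis using gi[of i x] b(2)[OF U(1)] by auto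
      qed
      ultimately show ?thesis by (simp add: deriv_set_def)
    qed
    then show ?thesis using V by auto
  qed
  show ?thesis
    unfolding field_base_def
  proof (intro conjI ballI allI impI)
    obtain V where "V \<in> B" using b(1) by auto
    then have "deriv_set D V {} \<in> deriv_base B D J" by (intro deriv_base_memI) auto
    then show "deriv_base B D J \<noteq> {}" by auto
  next
    fix U assume "U \<in> deriv_base B D J"
    then show "0 \<in> U" by (elim deriv_base_memE) (simp add: deriv_set_def b(2) d(1))
  next
    fix U1 U2 assume "U1 \<in> deriv_base B D J" "U2 \<in> deriv_base B D J"
    then obtain V1 F1 V2 F2 where *: "U1 = deriv_set D V1 F1" "V1 \<in> B" "finite F1" "F1 \<subseteq> J"
      "U2 = deriv_set D V2 F2" "V2 \<in> B" "finite F2" "F2 \<subseteq> J" by (elim deriv_base_memE)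
    obtain W where "W \<in> B" "W \<subseteq> V1" "W \<subseteq> V2" using b(3)[OF *(2,6)] by auto
    then show "\<exists>W\<in>deriv_base B D J. W \<subseteq> U1 \<and> W \<subseteq> U2"
      using * by (intro bexI[of _ "deriv_set D W (F1 \<union> F2)"] deriv_base_memI) (auto simp: deriv_set_def)
  next
    fix U' assume "U' \<in> deriv_base B D J"
    then obtain U F where *: "U' = deriv_set D U F" "U \<in> B" "finite F" "F \<subseteq> J" by (elim deriv_base_memE)
    show "\<exists>V\<in>deriv_base B D J. \<forall>x\<in>V. \<forall>y\<in>V. x - y \<in> U'"
    proof -
      obtain V where "V \<in> B" "\<forall>x\<in>V. \<forall>y\<in>V. x - y \<in> U" using b(4)[OF *(2)] by auto
      then show ?thesis using *
        by (intro bexI[of _ "deriv_set D V F"] deriv_base_memI) (auto simp: deriv_set_def d(5))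
    qed
    show "\<exists>V\<in>deriv_base B D J. \<forall>x\<in>V. \<forall>y\<in>V. x * y \<in> U'"
    proof -
      have "base_conv B (\<lambda>f. f 0 * f 1 + f 2 * f 3) (0 * 0 + 0 * 0) ?Z" by (intro c t)
      then have "eventually (\<lambda>f. f 0 * f 1 + f 2 * f 3 \<in> U) ?Z" using *(2) by (auto simp: base_conv_def)
      then obtain V where V: "V \<in> B" "\<And>f :: nat \<Rightarrow> 'a. (\<forall>i. f i \<in> V) \<Longrightarrow> f 0 * f 1 + f 2 * f 3 \<in> U"
        unfolding eventually_tuple[OF B] by auto
      have V2: "x * y + z * w \<in> U" if "x \<in> V" "y \<in> V" "z \<in> V" "w \<in> V" for x y z w
        using V(2)[of "\<lambda>n. if n = 0 then x else if n = 1 then y else if n = 2 then z else w"] that by simp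
      have V1: "x * y \<in> U" if "x \<in> V" "y \<in> V" for x y
        using V2[OF that b(2)[OF V(1)] b(2)[OF V(1)]] by simp
      show ?thesis using * V(1)
        by (intro bexI[of _ "deriv_set D V F"] deriv_base_memI) (auto simp: deriv_set_def d(6) V1 V2)
    qed
    show "\<exists>V\<in>deriv_base B D J. \<forall>x\<in>V. a * x \<in> U'" for a
    proof -
      have "base_conv B (\<lambda>f. a * f 0) (a * 0) ?Z" "base_conv B (\<lambda>f. a * f 1 + D i a * f 0) (a * 0 + D i a * 0) ?Z" for i
        by (intro c t)+
      then obtain V where "V \<in> B" "\<forall>x\<in>deriv_set D V F. a * x \<in> deriv_set D U F"
        using single[OF *(2,3), of "\<lambda>x. a * x" "\<lambda>x. a * x" "\<lambda>i x y. a * y + D i a * x"] by (auto simp: d(6))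
      then show ?thesis using * by (intro bexI[of _ "deriv_set D V F"] deriv_base_memI) auto
    qed
    show "\<exists>V\<in>deriv_base B D J. \<forall>x\<in>V. inverse (1 + x) - 1 \<in> U'"
    proof -
      have i: "base_conv B (\<lambda>f. inverse (1 + f 0)) (inverse (1 + 0)) ?Z" by (intro c t) simp
      have e0: "base_conv B (\<lambda>f. inverse (1 + f 0) - 1) (inverse (1 + 0) - 1) ?Z"
        by (rule c(4)[OF i c(3)])
      have e1: "base_conv B (\<lambda>f. (0 - f 1) * inverse (1 + f 0) * inverse (1 + f 0)) ((0 - 0) * inverse (1 + 0) * inverse (1 + 0)) ?Z"
        by (rule c(2)[OF c(2)[OF c(4)[OF c(3) t] i] i])
      \<comment> \<open>At x = -1 the expression is the constant -1, whose derivative is 0.\<close>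
      have g: "D k (inverse (1 + x) - 1) = (0 - D k x) * inverse (1 + x) * inverse (1 + x) \<or> D k (inverse (1 + x) - 1) = 0" for k x
      proof (cases "1 + x = 0")
        case False
        show ?thesis using d(7)[OF False, of k] by (simp add: d(2,3,5))
      qed (simp add: d)
      obtain V where "V \<in> B" "\<forall>x\<in>deriv_set D V F. inverse (1 + x) - 1 \<in> deriv_set D U F"
        using single[OF *(2,3), of "\<lambda>x. inverse (1 + x) - 1" "\<lambda>x. inverse (1 + x) - 1" "\<lambda>i x y. (0 - y) * inverse (1 + x) * inverse (1 + x)", OF _ _ _ g] e0 e1
        by auto
      then show ?thesis using * by (intro bexI[of _ "deriv_set D V F"] deriv_base_memI) auto
    qed
  next
    fix x :: 'a assume "x \<noteq> 0"
    then obtain V where "V \<in> B" "x \<notin> V" using b(8) by auto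
    then show "\<exists>U\<in>deriv_base B D J. x \<notin> U"
      by (intro bexI[of _ "deriv_set D V {}"] deriv_base_memI) (auto simp: deriv_set_def)
  qed
qed

text \<open>The root from the old base already lies near -1; the formula of
  \<open>derivation_simple_root\<close> makes its derivatives small when the coefficients and their
  derivatives are. Nondiscreteness is a genuine hypothesis, since a set
  \<open>deriv_set D V F\<close> might be {0}.\<close>

lemma gt_base_deriv_base:
  fixes D :: "'i \<Rightarrow> 'a::field_char_0 \<Rightarrow> 'a"
  assumes gB: "gt_base B" and D: "\<And>i. derivation (D i)"
    and nontriv: "\<And>V F. V \<in> B \<Longrightarrow> finite F \<Longrightarrow> F \<subseteq> J \<Longrightarrow> \<exists>x\<in>deriv_set D V F. x \<noteq> 0"
  shows "gt_base (deriv_base B D J)"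
proof -
  have B: "field_base B" using gB by (simp add: gt_base_def)
  note b = field_baseD[OF B] and t = base_conv_tuple[OF B] and
    c = base_conv_add[OF B] base_conv_mult[OF B] base_conv_const[OF B] base_conv_diff[OF B] base_conv_inverse[OF B]
      base_conv_sum[OF B] base_conv_power[OF B]
  note d = derivation_simps[OF D]
  let ?Z = "tuple_filter B"
  have hensel: "\<exists>V\<in>deriv_base B D J. \<forall>a. (\<forall>i\<le>n. a i \<in> V) \<longrightarrow> (\<exists>x. x + 1 \<in> U' \<and> order x (gt_poly n a) = 1)"
    if "U' \<in> deriv_base B D J" for U' n
  proof -
    from that obtain U F where *: "U' = deriv_set D U F" "U \<in> B" "finite F" "F \<subseteq> J" by (elim deriv_base_memE)
    define A where "A = (\<lambda>(f :: nat \<Rightarrow> 'a) i. f (2 * i + 1))"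
    \<comment> \<open>Encoding of the parameters: entry 0 is x + 1, odd entries are the
      coefficients, and the positive even entries are their derivatives. With these, E is the
      formula for D(x).\<close>
    define E where "E = (\<lambda>f :: nat \<Rightarrow> 'a. (0 - (\<Sum>i\<le>n. f (2 * i + 2) * (f 0 - 1) ^ i)) *
      inverse (of_nat (n + 2) * (f 0 - 1) ^ (n + 1) + of_nat (n + 1) * (f 0 - 1) ^ n + (\<Sum>i\<le>n. of_nat i * f (2 * i + 1) * (f 0 - 1) ^ (i - 1))))"
    have x: "base_conv B (\<lambda>f. f 0 - 1) (0 - 1) ?Z" by (intro c t)
    \<comment> \<open>The limit of the denominator is the derivative of X^(n+2) + X^(n+1) at -1,
      which is a sign.\<close>
    have nz: "of_nat (n + 2) * (0 - 1) ^ (n + 1) + of_nat (n + 1) * (0 - 1) ^ n + (\<Sum>i\<le>n. of_nat i * 0 * (0 - 1) ^ (i - 1)) \<noteq> (0::'a)"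
    proof -
      have "of_nat (n + 2) * (0 - 1) ^ (n + 1) + of_nat (n + 1) * (0 - 1) ^ n + (\<Sum>i\<le>n. of_nat i * 0 * (0 - 1) ^ (i - 1)) = - ((- 1 :: 'a) ^ n)"
        by (simp add: algebra_simps)
      then show ?thesis by simp
    qed
    have "base_conv B E ((0 - (\<Sum>i\<le>n. 0 * (0 - 1) ^ i)) *
      inverse (of_nat (n + 2) * (0 - 1) ^ (n + 1) + of_nat (n + 1) * (0 - 1) ^ n + (\<Sum>i\<le>n. of_nat i * 0 * (0 - 1) ^ (i - 1)))) ?Z"
      unfolding E_def by (intro c(1-4,6,7) c(5)[OF _ nz] t x)
    then have "eventually (\<lambda>f. E f \<in> U) ?Z" using *(2) by (auto simp: base_conv_def)
    then obtain V0 where V0: "V0 \<in> B" "\<And>f :: nat \<Rightarrow> 'a. (\<forall>i. f i \<in> V0) \<Longrightarrow> E f \<in> U"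
      unfolding eventually_tuple[OF B] by auto
    obtain V1 where V1: "V1 \<in> B" "V1 \<subseteq> V0" "V1 \<subseteq> U" using b(3)[OF V0(1) *(2)] by auto
    have "\<exists>V\<in>B. \<forall>a. (\<forall>i\<le>n. a i \<in> V) \<longrightarrow> (\<exists>x. x + 1 \<in> V1 \<and> order x (gt_poly n a) = 1)"
      using gB V1(1) by (simp add: gt_base_def)
    then obtain V2 where V2: "V2 \<in> B" "\<And>a. (\<forall>i\<le>n. a i \<in> V2) \<Longrightarrow> \<exists>x. x + 1 \<in> V1 \<and> order x (gt_poly n a) = 1"
      by auto
    obtain V3 where V3: "V3 \<in> B" "V3 \<subseteq> V1" "V3 \<subseteq> V2" using b(3)[OF V1(1) V2(1)] by auto
    have "\<exists>x. x + 1 \<in> U' \<and> order x (gt_poly n a) = 1" if a: "\<forall>i\<le>n. a i \<in> deriv_set D V3 F" for a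
    proof -
      have aV: "a i \<in> V3" if "i \<le> n" for i using a that by (simp add: deriv_set_def)
      have DaV: "D k (a i) \<in> V3" if "i \<le> n" "k \<in> F" for i k using a that by (simp add: deriv_set_def)
      have "\<forall>i\<le>n. a i \<in> V2" using aV V3(3) by auto
      from V2(2)[OF this] obtain x where x: "x + 1 \<in> V1" "order x (gt_poly n a) = 1" by auto
      then have r: "poly (gt_poly n a) x = 0" "poly (pderiv (gt_poly n a)) x \<noteq> 0"
        using simple_root_iff[OF gt_poly_nonzero] by auto
      have "D k (x + 1) \<in> U" if k: "k \<in> F" for k
      proof -
        define f where "f = (\<lambda>m. if m = 0 then x + 1 else if (m - 1) div 2 \<le> n then
          (if odd m then a ((m - 1) div 2) else D k (a ((m - 1) div 2))) else 0)"
        have f0: "f 0 = x + 1" by (simp add: f_def)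
        have f1: "f (2 * i + 1) = a i" if "i \<le> n" for i using that by (simp add: f_def)
        have f2: "f (2 * i + 2) = D k (a i)" if "i \<le> n" for i
        proof -
          have "(2 * i + 2 - 1) div 2 = i" by presburger
          then show ?thesis using that by (simp add: f_def)
        qed
        have "f m \<in> V0" for m
          using x(1) V1(2) V3(2) aV DaV[OF _ k] b(2)[OF V0(1)] unfolding f_def by auto
        then have "E f \<in> U" using V0(2) by simp
        also have "E f = - (\<Sum>i\<le>n. D k (a i) * x ^ i) * inverse (poly (pderiv (gt_poly n a)) x)"
          unfolding E_def poly_pderiv_gt_poly f0 by (simp add: f1[simplified] f2[simplified])
        also have "\<dots> = D k (x + 1)" using derivation_simple_root[OF D r, of k] by (simp add: d(2,3))
        finally show ?thesis .
      qed
      then have "x + 1 \<in> U'" using x(1) V1(3) *(1) by (auto simp: deriv_set_def)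
      then show ?thesis using x(2) by auto
    qed
    then show ?thesis using * V3(1) by (intro bexI[of _ "deriv_set D V3 F"] deriv_base_memI) auto
  qed
  have "\<exists>x\<in>U. x \<noteq> 0" if "U \<in> deriv_base B D J" for U
    using that nontriv by (elim deriv_base_memE) simp
  then show ?thesis
    using field_base_deriv_base[OF B D] hensel by (simp add: gt_base_def)
qed

hide_const (open) Polynomials.lead_coeff

section \<open>Algebraic elements over a domain and primitive elements\<close>

lemma is_hom_map_poly:
  assumes h: "is_hom h"
  shows "is_hom (map_poly h)"
proof (rule is_homI)
  note d = is_homD[OF h]
  show "map_poly h 1 = 1" by (simp add: d(2))
  show "map_poly h (p + q) = map_poly h p + map_poly h q" for p q
    by (rule poly_eqI) (simp add: coeff_map_poly d(1,3))
  show "map_poly h (p * q) = map_poly h p * map_poly h q" for p q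
    by (rule poly_eqI) (simp add: coeff_map_poly coeff_mult d(1,4) is_hom_sum[OF h])
qed

lemma is_hom_poly: "is_hom (\<lambda>p. poly p x)"
  by (rule is_homI) simp_all

definition hev :: "('a::comm_ring_1 \<Rightarrow> 'b::comm_ring_1) \<Rightarrow> 'a poly \<Rightarrow> 'b \<Rightarrow> 'b" where
  "hev h P x = poly (map_poly h P) x"

lemma is_hom_hev: "is_hom h \<Longrightarrow> is_hom (\<lambda>P. hev h P x)"
  unfolding hev_def by (rule is_hom_comp[OF is_hom_poly is_hom_map_poly])

lemma hev_pCons: "is_hom h \<Longrightarrow> hev h (pCons a P) x = h a + x * hev h P x"
  by (simp add: hev_def map_poly_pCons is_homD(1))

lemma hev_0 [simp]: "hev h 0 x = 0"
  by (simp add: hev_def)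

lemma hev_monom: "is_hom h \<Longrightarrow> hev h (monom a n) x = h a * x ^ n"
  by (simp add: hev_def map_poly_monom is_homD(1) poly_monom)

lemma hev_smult: "is_hom h \<Longrightarrow> hev h (smult a P) x = h a * hev h P x"
  by (simp add: hev_def map_poly_smult is_homD(1,4))

lemma hev_altdef:
  assumes "is_hom h" "degree P \<le> n"
  shows "hev h P x = (\<Sum>i\<le>n. h (coeff P i) * x ^ i)"
proof -
  have "hev h P x = (\<Sum>i\<le>n. hev h (monom (coeff P i) i) x)"
    using poly_as_sum_of_monoms'[OF assms(2)] is_hom_sum[OF is_hom_hev[OF assms(1)]] by metis
  then show ?thesis by (simp add: hev_monom[OF assms(1)])
qed

lemma hev_hom: "is_hom g \<Longrightarrow> is_hom h \<Longrightarrow> g (hev h P x) = hev (\<lambda>a. g (h a)) P (g x)"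
  by (induction P) (simp_all add: hev_pCons is_hom_comp is_homD(1,3,4))

lemma hev_map_poly: "is_hom g \<Longrightarrow> is_hom h \<Longrightarrow> hev h (map_poly g P) x = hev (\<lambda>a. h (g a)) P x"
  unfolding hev_def by (subst map_poly_map_poly) (simp_all add: is_homD(1) comp_def)

text \<open>Domains instead of fields: the locale is used for K[t] in K[[t]] and, in the primitive
  element argument, again for the polynomial rings over both sides. Fractions are replaced by
  multiplying with nonzero elements of the base.\<close>

locale idom_extension =
  fixes h :: "'r::idom \<Rightarrow> 'e::idom"
  assumes hom: "is_hom h" and inj: "h r = 0 \<Longrightarrow> r = 0"
    and char0: "of_nat n = (0 :: 'e) \<Longrightarrow> n = 0"
begin

lemmas homD = is_homD[OF hom]

definition alg :: "'e \<Rightarrow> bool" where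
  "alg x \<longleftrightarrow> (\<exists>P. P \<noteq> 0 \<and> hev h P x = 0)"

text \<open>Membership in the span of B over the fraction field of the base, with denominators
  cleared.\<close>

definition spanned :: "'e set \<Rightarrow> 'e \<Rightarrow> bool" where
  "spanned B y \<longleftrightarrow> (\<exists>q m. q \<noteq> 0 \<and> h q * y = (\<Sum>b\<in>B. h (m b) * b))"

definition fin_ring :: "'e set \<Rightarrow> 'e set \<Rightarrow> bool" where
  "fin_ring R B \<longleftrightarrow> finite B \<and> subring_set R \<and> range h \<subseteq> R \<and> (\<forall>y\<in>R. spanned B y)"

text \<open>The elements of the extension that lie in F[x], where F is the fraction field of the
  base.\<close>

definition adj :: "'e \<Rightarrow> 'e set" where
  "adj x = {y. \<exists>q P. q \<noteq> 0 \<and> h q * y = hev h P x}"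

lemma spanned_0: "spanned B 0"
  unfolding spanned_def by (intro exI[of _ 1] exI[of _ "\<lambda>_. 0"]) (simp add: homD(1))

lemma spanned_add:
  assumes "spanned B x" "spanned B y"
  shows "spanned B (x + y)"
proof -
  from assms obtain q m r n where *: "q \<noteq> 0" "h q * x = (\<Sum>b\<in>B. h (m b) * b)"
    "r \<noteq> 0" "h r * y = (\<Sum>b\<in>B. h (n b) * b)" unfolding spanned_def by auto
  have "h (q * r) * (x + y) = h r * (h q * x) + h q * (h r * y)" by (simp add: homD(4) algebra_simps)
  also have "\<dots> = (\<Sum>b\<in>B. h (r * m b + q * n b) * b)"
    unfolding * by (simp add: sum_distrib_left sum.distrib homD(3,4) algebra_simps)
  finally show ?thesis unfolding spanned_def using * by (intro exI[of _ "q * r"]) auto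
qed

lemma spanned_scale:
  assumes "spanned B x"
  shows "spanned B (h r * x)"
proof -
  from assms obtain q m where *: "q \<noteq> 0" "h q * x = (\<Sum>b\<in>B. h (m b) * b)" unfolding spanned_def by auto
  have "h q * (h r * x) = h r * (h q * x)" by (simp add: mult_ac)
  also have "\<dots> = (\<Sum>b\<in>B. h (r * m b) * b)"
    unfolding * by (simp add: sum_distrib_left homD(4) mult_ac)
  finally show ?thesis unfolding spanned_def using * by (intro exI[of _ q]) auto
qed

lemma spanned_unscale:
  assumes "spanned B (h r * x)" "r \<noteq> 0"
  shows "spanned B x"
proof -
  from assms obtain q m where *: "q \<noteq> 0" "h q * (h r * x) = (\<Sum>b\<in>B. h (m b) * b)" unfolding spanned_def by auto
  then have "h (q * r) * x = (\<Sum>b\<in>B. h (m b) * b)" by (simp add: homD(4) mult_ac)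
  then show ?thesis unfolding spanned_def using * assms(2) by (intro exI[of _ "q * r"]) auto
qed

lemma spanned_mem:
  assumes "b \<in> B" "finite B"
  shows "spanned B b"
  unfolding spanned_def
proof (intro exI conjI)
  have "(\<Sum>c\<in>B. h (if c = b then 1 else 0) * c) = (\<Sum>c\<in>B. if c = b then c else 0)"
    by (intro sum.cong) (auto simp: homD(1,2))
  then show "h 1 * b = (\<Sum>c\<in>B. h (if c = b then 1 else 0) * c)" using assms by (simp add: homD(2))
qed simp

lemma spanned_sum: "(\<And>i. i \<in> I \<Longrightarrow> spanned B (f i)) \<Longrightarrow> spanned B (\<Sum>i\<in>I. f i)"
  by (induction I rule: infinite_finite_induct) (auto intro: spanned_0 spanned_add)

text \<open>Among the first |B| + 1 powers of x there is a linear relation over the base, by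
  \<open>homogeneous_system\<close>.\<close>

lemma alg_of_spanned:
  assumes B: "finite B" and x: "\<And>n. spanned B (x ^ n)"
  shows "alg x"
proof -
  have "\<exists>q m. q \<noteq> 0 \<and> h q * x ^ n = (\<Sum>b\<in>B. h (m b) * b)" for n using x[of n] by (simp add: spanned_def)
  from choice[OF allI[OF this]] obtain q where
    "\<forall>n. \<exists>m. q n \<noteq> 0 \<and> h (q n) * x ^ n = (\<Sum>b\<in>B. h (m b) * b)" by (rule exE)
  from choice[OF this] obtain m where
    "\<forall>n. q n \<noteq> 0 \<and> h (q n) * x ^ n = (\<Sum>b\<in>B. h (m n b) * b)" by (rule exE)
  then have q: "q n \<noteq> 0" and qm: "h (q n) * x ^ n = (\<Sum>b\<in>B. h (m n b) * b)" for n by auto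
  obtain c where c: "\<exists>i\<in>{..card B}. c i \<noteq> 0" "\<forall>b\<in>B. (\<Sum>i\<in>{..card B}. c i * m i b) = 0"
    using homogeneous_system[OF B, of "{..card B}" m] by auto
  define P where "P = (\<Sum>i\<in>{..card B}. monom (c i * q i) i)"
  have "hev h P x = (\<Sum>i\<in>{..card B}. h (c i) * (h (q i) * x ^ i))"
    unfolding P_def by (simp add: is_hom_sum[OF is_hom_hev[OF hom]] hev_monom[OF hom] homD(4) mult.assoc)
  also have "\<dots> = (\<Sum>i\<in>{..card B}. \<Sum>b\<in>B. h (c i * m i b) * b)"
    unfolding qm by (simp add: sum_distrib_left homD(4) mult.assoc)
  also have "\<dots> = (\<Sum>b\<in>B. h (\<Sum>i\<in>{..card B}. c i * m i b) * b)"
    by (subst sum.swap) (simp add: is_hom_sum[OF hom] sum_distrib_right)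
  also have "\<dots> = 0" using c(2) by (simp add: homD(1))
  finally have "hev h P x = 0" .
  moreover obtain k where "k \<le> card B" "c k \<noteq> 0" using c(1) by auto
  then have "coeff P k \<noteq> 0" unfolding P_def using q[of k] by (simp add: coeff_sum)
  then have "P \<noteq> 0" by auto
  ultimately show ?thesis unfolding alg_def by auto
qed

lemma fin_ring_base: "fin_ring (range h) {1}"
  unfolding fin_ring_def
proof (intro conjI ballI)
  show "subring_set (range h)" unfolding subring_set_def
  proof (intro conjI ballI)
    show "1 \<in> range h" using homD(2) by (intro range_eqI[of _ _ 1]) simp
    fix x y assume "x \<in> range h" "y \<in> range h"
    then obtain a b where "x = h a" "y = h b" by auto
    then have "x - y = h (a - b)" "x * y = h (a * b)" by (simp_all add: homD(4,6))
    then show "x - y \<in> range h" "x * y \<in> range h" by auto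
  qed
  fix y assume "y \<in> range h"
  then obtain a where "y = h a * 1" by auto
  then show "spanned {1} y" using spanned_scale[OF spanned_mem[of 1 "{1}"], of a] by simp
qed auto

text \<open>The leading coefficient of p comes from the base, so a power of x beyond the degree
  becomes a combination of lower ones after multiplication by l. Products of B with the low powers
  therefore span.\<close>

lemma fin_ring_adjoin:
  assumes R: "fin_ring R B" and p: "\<And>i. coeff p i \<in> R" "poly p x = 0" "coeff p (degree p) = h l" "l \<noteq> 0"
  shows "\<exists>B'. fin_ring (adjoin R x) B'"
proof -
  have fB: "finite B" and sR: "subring_set R" and hR: "range h \<subseteq> R" and sp: "\<And>y. y \<in> R \<Longrightarrow> spanned B y"
    using R by (auto simp: fin_ring_def)
  note r = subring_setD[OF sR]
  define d where "d = degree p"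
  define B' where "B' = (\<lambda>(b, j). b * x ^ j) ` (B \<times> {..<d})"
  have fB': "finite B'" using fB by (simp add: B'_def)
  have s: "spanned B' (a * x ^ n)" if "a \<in> R" for a n
    using that
  proof (induction n arbitrary: a rule: less_induct)
    case (less n)
    show ?case
    proof (cases "n < d")
      case True
      from sp[OF less.prems] obtain q m where qm: "q \<noteq> 0" "h q * a = (\<Sum>b\<in>B. h (m b) * b)"
        unfolding spanned_def by auto
      have "h q * (a * x ^ n) = (\<Sum>b\<in>B. h (m b) * (b * x ^ n))"
        using qm(2) by (simp add: mult.assoc[symmetric] sum_distrib_right)
      moreover have "spanned B' (\<Sum>b\<in>B. h (m b) * (b * x ^ n))"
        by (intro spanned_sum spanned_scale spanned_mem fB') (use True in \<open>auto simp: B'_def\<close>)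
      ultimately have "spanned B' (h q * (a * x ^ n))" by simp
      then show ?thesis using qm(1) by (rule spanned_unscale)
    next
      case False
      have "0 = (\<Sum>i\<le>d. coeff p i * x ^ i)" using p(2) by (simp add: poly_altdef d_def)
      also have "\<dots> = (\<Sum>i<d. coeff p i * x ^ i) + h l * x ^ d"
        using p(3) by (simp add: lessThan_Suc_atMost[symmetric] d_def)
      finally have e: "h l * x ^ d = - (\<Sum>i<d. coeff p i * x ^ i)" by (simp add: eq_neg_iff_add_eq_0 add.commute)
      have "h l * (a * x ^ n) = (a * x ^ (n - d)) * (h l * x ^ d)"
        using False by (simp add: power_add[symmetric] mult_ac)
      also have "\<dots> = (\<Sum>i<d. (- (a * coeff p i)) * x ^ (n - d + i))"
        unfolding e by (simp add: sum_distrib_left sum_negf power_add mult_ac)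
      finally have e2: "h l * (a * x ^ n) = (\<Sum>i<d. (- (a * coeff p i)) * x ^ (n - d + i))" .
      have "spanned B' (\<Sum>i<d. (- (a * coeff p i)) * x ^ (n - d + i))"
        by (rule spanned_sum, rule less.IH) (use False less.prems p(1) r(3,6) in auto)
      then have "spanned B' (h l * (a * x ^ n))" unfolding e2 .
      then show ?thesis using p(4) by (rule spanned_unscale)
    qed
  qed
  have "spanned B' y" if "y \<in> adjoin R x" for y
  proof -
    from that obtain P where P: "y = poly P x" "\<forall>i. coeff P i \<in> R" by (auto simp: adjoin_def)
    show ?thesis unfolding P(1) poly_altdef by (rule spanned_sum, rule s) (use P in simp)
  qed
  moreover have "range h \<subseteq> adjoin R x" using hR subring_set_adjoin(2)[OF sR] by (rule order.trans)
  ultimately have "fin_ring (adjoin R x) B'"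
    unfolding fin_ring_def using fB' subring_set_adjoin(1)[OF sR] by simp
  then show ?thesis by (rule exI)
qed

lemma degree_map_h: "degree (map_poly h P) = degree P"
proof (rule degree_map_poly)
  fix x :: 'r assume "x \<noteq> 0" then show "h x \<noteq> 0" using inj by auto
qed

lemma map_h_eq_0: "map_poly h P = 0 \<Longrightarrow> P = 0"
proof (rule poly_eqI)
  fix n assume "map_poly h P = 0"
  then have "coeff (map_poly h P) n = 0" by simp
  then have "h (coeff P n) = 0" by (simp add: coeff_map_poly homD(1))
  then show "coeff P n = coeff 0 n" using inj by simp
qed

lemma fin_ring_alg_extend:
  assumes R: "fin_ring R B" and x: "alg x"
  shows "\<exists>R' B'. fin_ring R' B' \<and> R \<subseteq> R' \<and> x \<in> R'"
proof -
  from x obtain P where P: "P \<noteq> 0" "hev h P x = 0" by (auto simp: alg_def)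
  have sR: "subring_set R" and hR: "range h \<subseteq> R" using R by (auto simp: fin_ring_def)
  have "\<exists>B'. fin_ring (adjoin R x) B'"
  proof (rule fin_ring_adjoin[OF R])
    show "coeff (map_poly h P) i \<in> R" for i using hR by (simp add: coeff_map_poly homD(1) range_subsetD)
    show "poly (map_poly h P) x = 0" using P(2) by (simp add: hev_def)
    show "coeff (map_poly h P) (degree (map_poly h P)) = h (lead_coeff P)"
      by (simp add: degree_map_h coeff_map_poly homD(1))
    show "lead_coeff P \<noteq> 0" using P by simp
  qed
  then obtain B' where "fin_ring (adjoin R x) B'" by (rule exE)
  then show ?thesis using subring_set_adjoin(2,3)[OF sR, of x] by (intro exI[of _ "adjoin R x"] exI[of _ B']) auto
qed

lemma fin_ring_finite_set:
  assumes "finite F" "\<And>x. x \<in> F \<Longrightarrow> alg x"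
  shows "\<exists>R B. fin_ring R B \<and> F \<subseteq> R"
  using assms
proof (induction F)
  case empty
  then show ?case using fin_ring_base by (intro exI[of _ "range h"] exI[of _ "{1}"]) simp
next
  case (insert x F)
  then obtain R B where R: "fin_ring R B" "F \<subseteq> R" by auto
  have "alg x" using insert.prems by simp
  from fin_ring_alg_extend[OF R(1) this] obtain R' B' where "fin_ring R' B'" "R \<subseteq> R'" "x \<in> R'" by auto
  then show ?case using R(2) by (intro exI[of _ R'] exI[of _ B']) auto
qed

lemma alg_of_fin_ring:
  assumes R: "fin_ring R B" and x: "x \<in> R"
  shows "alg x"
proof (rule alg_of_spanned[of B])
  show "finite B" using R by (simp add: fin_ring_def)
  have "subring_set R" using R by (simp add: fin_ring_def)
  then show "spanned B (x ^ n)" for n using R x subring_setD(7)[of R x n] by (simp add: fin_ring_def)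
qed

lemma alg_h: "alg (h r)"
  using alg_of_fin_ring[OF fin_ring_base, of "h r"] by simp

lemma alg_ring:
  assumes "alg x" "alg y"
  shows "alg (x + y)" "alg (x - y)" "alg (x * y)"
proof -
  have "\<exists>R B. fin_ring R B \<and> {x, y} \<subseteq> R" by (rule fin_ring_finite_set) (use assms in auto)
  then obtain R B where R: "fin_ring R B" "x \<in> R" "y \<in> R" by auto
  then have "subring_set R" by (simp add: fin_ring_def)
  from subring_setD(4-6)[OF this R(2,3)] show "alg (x + y)" "alg (x - y)" "alg (x * y)"
    using alg_of_fin_ring[OF R(1)] by auto
qed

lemma alg_hev:
  assumes "alg x"
  shows "alg (hev h P x)"
  by (induction P) (use alg_ring alg_h assms homD(1) alg_h[of 0] in \<open>simp_all add: hev_pCons[OF hom]\<close>)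

text \<open>The coefficients lie in one ring of finite rank, and adjoining a root of a monic
  polynomial keeps the rank finite.\<close>

lemma alg_monic_root:
  assumes "\<And>i. alg (coeff p i)" "poly p x = 0" "lead_coeff p = 1"
  shows "alg x"
proof -
  have "finite (range (coeff p))"
  proof (rule finite_subset)
    show "range (coeff p) \<subseteq> insert 0 (coeff p ` {..degree p})"
    proof
      fix y assume "y \<in> range (coeff p)"
      then obtain n where "y = coeff p n" by auto
      then show "y \<in> insert 0 (coeff p ` {..degree p})"
        by (cases "n \<le> degree p") (auto simp: coeff_eq_0)
    qed
  qed simp
  then have "\<exists>R B. fin_ring R B \<and> range (coeff p) \<subseteq> R" by (rule fin_ring_finite_set) (use assms in auto)
  then obtain R B where R: "fin_ring R B" "range (coeff p) \<subseteq> R" by auto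
  have "\<exists>B'. fin_ring (adjoin R x) B'"
    by (rule fin_ring_adjoin[OF R(1) _ assms(2), of 1]) (use R(2) assms(3) homD(2) in auto)
  then obtain B' where "fin_ring (adjoin R x) B'" by (rule exE)
  moreover have "x \<in> adjoin R x" using R(1) by (intro subring_set_adjoin) (simp add: fin_ring_def)
  ultimately show ?thesis by (rule alg_of_fin_ring)
qed

text \<open>An annihilator of minimal degree has a nonzero constant term, and solving for that term
  shows that x divides a nonzero element of the base. This replaces inversion and later certifies
  that x does not vanish under a specialization.\<close>

lemma alg_multiple:
  assumes "alg x" "x \<noteq> 0"
  shows "\<exists>U c. c \<noteq> 0 \<and> x * hev h U x = h c"
proof -
  define A where "A = (\<lambda>P. P \<noteq> 0 \<and> hev h P x = 0)"
  obtain P where "A P" using assms(1) by (auto simp: alg_def A_def)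
  define m where "m = arg_min degree A"
  have m: "A m" and min: "\<And>p. A p \<Longrightarrow> degree m \<le> degree p"
    using arg_min_nat_lemma[of A P degree] \<open>A P\<close> by (auto simp: m_def)
  obtain c Q where cQ: "m = pCons c Q" by (cases m)
  have e: "h c + x * hev h Q x = 0" using m by (simp add: A_def cQ hev_pCons[OF hom])
  have "c \<noteq> 0"
  proof
    assume "c = 0"
    then have "Q \<noteq> 0" "hev h Q x = 0" using m e assms(2) by (auto simp: A_def cQ homD(1))
    then have "degree m \<le> degree Q" by (intro min) (simp add: A_def)
    then show False using \<open>Q \<noteq> 0\<close> by (simp add: cQ)
  qed
  moreover have "x * hev h (- Q) x = h c"
  proof -
    have "h c = - (x * hev h Q x)" using e by (simp add: eq_neg_iff_add_eq_0)
    then show ?thesis using is_homD(5)[OF is_hom_hev[OF hom, of x], of Q] by simp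
  qed
  ultimately show ?thesis by (intro exI[of _ "- Q"] exI[of _ c]) simp
qed

lemma hev_scale: "hev h (pcompose P [:0, c:]) y = hev h P (h c * y)"
  by (induction P)
    (simp_all add: pcompose_pCons hev_pCons[OF hom] is_homD(3,4)[OF is_hom_hev[OF hom]] hev_smult[OF hom] homD(1) mult_ac)

text \<open>By \<open>alg_multiple\<close> a nonzero base multiple of y is a polynomial in x, hence
  algebraic; the multiple is then absorbed by rescaling the variable.\<close>

lemma alg_inverse:
  assumes "alg x" "x * y = 1"
  shows "alg y"
proof -
  have "x \<noteq> 0" using assms(2) by auto
  from alg_multiple[OF assms(1) this] obtain U c where U: "c \<noteq> 0" "x * hev h U x = h c" by auto
  have "h c * y = (x * y) * hev h U x" unfolding U(2)[symmetric] by (simp add: mult_ac)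
  then have hc: "h c * y = hev h U x" using assms(2) by simp
  then have a: "alg (h c * y)" using alg_hev[OF assms(1)] by simp
  then obtain P where P: "P \<noteq> 0" "hev h P (h c * y) = 0" by (auto simp: alg_def)
  have "hev h (pcompose P [:0, c:]) y = hev h P (h c * y)" by (rule hev_scale)
  moreover have "pcompose P [:0, c:] \<noteq> 0" using P(1) U(1) by (simp add: pcompose_eq_0_iff)
  ultimately show ?thesis using P(2) unfolding alg_def by auto
qed

lemma adjI: "q \<noteq> 0 \<Longrightarrow> h q * y = hev h P x \<Longrightarrow> y \<in> adj x"
  unfolding adj_def by auto

lemma adj_h: "h r \<in> adj x"
  by (rule adjI[of 1 _ "[:r:]"]) (simp_all add: homD(2) hev_pCons[OF hom])

lemma adj_hev: "hev h P x \<in> adj x"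
  by (rule adjI[of 1 _ P]) (simp_all add: homD(2))

lemma adj_self: "x \<in> adj x"
  by (rule adjI[of 1 _ "[:0, 1:]"]) (simp_all add: homD(1,2) hev_pCons[OF hom])

lemma adj_ring:
  assumes "y \<in> adj x" "z \<in> adj x"
  shows "y + z \<in> adj x" "y * z \<in> adj x"
proof -
  note e = is_homD[OF is_hom_hev[OF hom]]
  from assms obtain q P r Q where *: "q \<noteq> 0" "h q * y = hev h P x" "r \<noteq> 0" "h r * z = hev h Q x"
    unfolding adj_def by auto
  have "h (q * r) * (y + z) = h r * (h q * y) + h q * (h r * z)" by (simp add: homD(4) algebra_simps)
  also have "\<dots> = hev h (smult r P + smult q Q) x" unfolding * by (simp add: e(3) hev_smult[OF hom])
  finally show "y + z \<in> adj x" using * by (intro adjI[of "q * r"]) auto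
  have "h (q * r) * (y * z) = (h q * y) * (h r * z)" by (simp add: homD(4) algebra_simps)
  also have "\<dots> = hev h (P * Q) x" unfolding * by (simp add: e(4))
  finally show "y * z \<in> adj x" using * by (intro adjI[of "q * r"]) auto
qed

lemma adj_divide: "h q * y \<in> adj x \<Longrightarrow> q \<noteq> 0 \<Longrightarrow> y \<in> adj x"
proof -
  assume a: "h q * y \<in> adj x" "q \<noteq> 0"
  then obtain r P where *: "r \<noteq> 0" "h r * (h q * y) = hev h P x" unfolding adj_def by auto
  then have "h (r * q) * y = hev h P x" by (simp add: homD(4) mult.assoc)
  then show ?thesis using a * by (intro adjI[of "r * q"]) auto
qed

lemma adj_trans:
  assumes "y \<in> adj x" "x \<in> adj z"
  shows "y \<in> adj z"
proof -
  from assms(1) obtain q P where *: "q \<noteq> 0" "h q * y = hev h P x" unfolding adj_def by auto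
  have "hev h P x \<in> adj z"
    by (induction P) (use adj_ring adj_h assms(2) adj_h[of 0] homD(1) in \<open>simp_all add: hev_pCons[OF hom]\<close>)
  then have "h q * y \<in> adj z" using *(2) by simp
  then show ?thesis using *(1) by (rule adj_divide)
qed

lemma adj_alg:
  assumes "alg x" "y \<in> adj x"
  shows "alg y"
proof -
  from assms(2) obtain q P where *: "q \<noteq> 0" "h q * y = hev h P x" unfolding adj_def by auto
  obtain U where U: "U \<noteq> 0" "hev h U (h q * y) = 0" using alg_hev[OF assms(1), of P] * by (auto simp: alg_def)
  have "hev h (pcompose U [:0, q:]) y = hev h U (h q * y)" by (rule hev_scale)
  moreover have "pcompose U [:0, q:] \<noteq> 0" using U(1) *(1) by (simp add: pcompose_eq_0_iff)
  ultimately show ?thesis using U(2) unfolding alg_def by auto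
qed

lemma of_nat_inj: "of_nat m = (of_nat n :: 'e) \<Longrightarrow> m = n"
proof (induction m n rule: linorder_wlog)
  case (le m n)
  then have "of_nat (n - m) = (0 :: 'e)" by (simp add: of_nat_diff)
  then have "n - m = 0" by (rule char0)
  then show ?case using le by simp
qed auto

text \<open>A generic combination \<open>z + \<lambda> w\<close> satisfies a relation of minimal degree with coefficients that are
  polynomials in \<open>\<lambda>\<close>; its derivative in \<open>\<lambda>\<close> expresses \<open>w\<close> rationally in \<open>z + \<lambda> w\<close>.\<close>

lemma primitive_element_two:
  assumes z: "alg z" and w: "alg w"
  shows "\<exists>v. alg v \<and> z \<in> adj v \<and> w \<in> adj v"
proof -
  \<comment> \<open>The parameter \<lambda> is the variable of both polynomial rings, so
    \<open>[:z, w:]\<close> stands for z + \<lambda> w.\<close>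
  interpret L: idom_extension "map_poly h"
  proof
    show "is_hom (map_poly h)" by (rule is_hom_map_poly[OF hom])
    show "map_poly h r = 0 \<Longrightarrow> r = 0" for r by (rule map_h_eq_0)
    show "of_nat n = (0 :: 'e poly) \<Longrightarrow> n = 0" for n
    proof (rule char0)
      assume "of_nat n = (0 :: 'e poly)"
      then have "poly (of_nat n) 0 = (0 :: 'e)" by simp
      then show "of_nat n = (0 :: 'e)" by (simp add: of_nat_poly)
    qed
  qed
  have const: "L.alg [:y:]" if "alg y" for y
  proof -
    from that obtain P where P: "P \<noteq> 0" "hev h P y = 0" by (auto simp: alg_def)
    have "hev (map_poly h) (map_poly (\<lambda>c. [:c:]) P) [:y:] = hev (\<lambda>c. map_poly h [:c:]) P [:y:]"
      by (rule hev_map_poly[OF is_hom_const L.hom])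
    also have "\<dots> = [:hev h P y:]"
      using hev_hom[OF is_hom_const hom, of P y] by (simp add: map_poly_pCons homD(1))
    finally have "hev (map_poly h) (map_poly (\<lambda>c. [:c:]) P) [:y:] = 0" using P by simp
    moreover have "map_poly (\<lambda>c. [:c:]) P \<noteq> 0" using P(1) by (simp add: map_poly_eq_0_iff)
    ultimately show ?thesis unfolding L.alg_def by auto
  qed
  have "map_poly h [:0, 1:] = [:0, 1:]" by (simp add: map_poly_pCons homD(1,2))
  then have "L.alg [:0, 1:]" using L.alg_h[of "[:0, 1:]"] by simp
  from L.alg_ring(1)[OF const[OF z] L.alg_ring(3)[OF this const[OF w]]] have "L.alg [:z, w:]" by simp
  then obtain P0 where P0: "P0 \<noteq> 0" "hev (map_poly h) P0 [:z, w:] = 0" by (auto simp: L.alg_def)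
  define A where "A = (\<lambda>P. P \<noteq> 0 \<and> hev (map_poly h) P [:z, w:] = 0)"
  define m where "m = arg_min degree A"
  have m: "A m" and min: "\<And>p. A p \<Longrightarrow> degree m \<le> degree p"
    using arg_min_nat_lemma[of A P0 degree] P0 by (auto simp: m_def A_def)
  have dm: "degree m \<noteq> 0"
  proof
    assume "degree m = 0"
    then obtain c where c: "m = [:c:]" by (rule degree_eq_zeroE)
    then have "map_poly h c = 0" using m by (simp add: A_def hev_pCons[OF L.hom])
    then show False using map_h_eq_0 m c by (simp add: A_def)
  qed
  have nat0: "of_nat n \<noteq> (0 :: 'r poly)" if "n \<noteq> 0" for n
  proof
    assume "of_nat n = (0 :: 'r poly)"
    then have "map_poly h (of_nat n) = 0" by simp
    then show False using L.homD(8)[of n] L.char0[of n] that by simp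
  qed
  have pm: "pderiv m \<noteq> 0"
  proof
    assume "pderiv m = 0"
    then have "coeff (pderiv m) (degree m - 1) = 0" by simp
    then have "of_nat (degree m) * coeff m (degree m) = 0" using dm by (simp add: coeff_pderiv)
    then show False using nat0[OF dm] m by (simp add: A_def)
  qed
  have "degree (pderiv m) < degree m"
  proof -
    have "degree (pderiv m) \<le> degree m - 1"
      by (rule degree_le) (auto simp: coeff_pderiv coeff_eq_0)
    then show ?thesis using dm by simp
  qed
  then have nz: "hev (map_poly h) (pderiv m) [:z, w:] \<noteq> 0" using min[of "pderiv m"] pm by (auto simp: A_def)
  have deriv_h: "pderiv (map_poly h a) = map_poly h (pderiv a)" for a
    by (rule poly_eqI) (simp add: coeff_pderiv coeff_map_poly homD(1,4,8) del: of_nat_Suc)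
  have der: "pderiv (hev (map_poly h) P [:z, w:]) =
      hev (map_poly h) (map_poly pderiv P) [:z, w:] + [:w:] * hev (map_poly h) (pderiv P) [:z, w:]" for P
  proof (induction P)
    case (pCons a P)
    have "pderiv (hev (map_poly h) (pCons a P) [:z, w:]) = map_poly h (pderiv a) +
        ([:z, w:] * pderiv (hev (map_poly h) P [:z, w:]) + hev (map_poly h) P [:z, w:] * [:w:])"
      unfolding hev_pCons[OF L.hom] pderiv_add pderiv_mult deriv_h by (simp add: pderiv_pCons)
    also have "\<dots> = hev (map_poly h) (map_poly pderiv (pCons a P)) [:z, w:] +
        [:w:] * hev (map_poly h) (pderiv (pCons a P)) [:z, w:]"
      unfolding pCons.IH pderiv_pCons
      by (simp only: map_poly_pCons[where f = pderiv, OF pderiv_0] hev_pCons[OF L.hom] L.homD(1) is_homD(3)[OF is_hom_hev[OF L.hom]])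
        (simp only: algebra_simps add_0_left)
    finally show ?case .
  qed simp
  have rel: "hev (map_poly h) (map_poly pderiv m) [:z, w:] + [:w:] * hev (map_poly h) (pderiv m) [:z, w:] = 0"
    using der[of m] m by (simp add: A_def)
  \<comment> \<open>A natural number is substituted for \<lambda>. Characteristic zero offers
    infinitely many, and only finitely many of them kill the derivative.\<close>
  have "infinite (range (of_nat :: nat \<Rightarrow> 'e))"
    by (rule range_inj_infinite) (auto intro!: injI of_nat_inj)
  then have "\<not> range (of_nat :: nat \<Rightarrow> 'e) \<subseteq> {x. poly (hev (map_poly h) (pderiv m) [:z, w:]) x = 0}"
    using poly_roots_finite[OF nz] finite_subset by auto
  then obtain c :: nat where c: "poly (hev (map_poly h) (pderiv m) [:z, w:]) (of_nat c) \<noteq> 0" by auto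
  define v where "v = z + of_nat c * w"
  define e where "e = (\<lambda>P. map_poly (\<lambda>q. poly q (of_nat c :: 'r)) P)"
  have ev: "poly (hev (map_poly h) P [:z, w:]) (of_nat c) = hev h (e P) v" for P
  proof -
    have "poly (hev (map_poly h) P [:z, w:]) (of_nat c) = hev (\<lambda>q. poly (map_poly h q) (of_nat c)) P (poly [:z, w:] (of_nat c))"
      by (rule hev_hom[OF is_hom_poly L.hom])
    also have "(\<lambda>q. poly (map_poly h q) (of_nat c)) = (\<lambda>q. h (poly q (of_nat c)))"
    proof
      fix q
      have "h (poly q (of_nat c)) = poly (map_poly h q) (h (of_nat c))"
        by (induction q) (simp_all add: map_poly_pCons homD(1,3,4))
      then show "poly (map_poly h q) (of_nat c) = h (poly q (of_nat c))" by (simp add: homD(8))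
    qed
    also have "hev (\<lambda>q. h (poly q (of_nat c))) P (poly [:z, w:] (of_nat c)) = hev h (e P) v"
      unfolding e_def by (subst hev_map_poly[OF is_hom_poly hom]) (simp add: v_def mult.commute)
    finally show ?thesis .
  qed
  have av: "alg v" unfolding v_def using alg_ring(1)[OF z alg_ring(3)[OF alg_h[of "of_nat c"] w]] by (simp add: homD(8))
  let ?x = "hev h (e (pderiv m)) v"
  have x0: "?x \<noteq> 0" using c ev by simp
  have rel2: "hev h (e (map_poly pderiv m)) v + w * ?x = 0"
    using arg_cong[OF rel, of "\<lambda>p. poly p (of_nat c)"] by (simp add: ev)
  \<comment> \<open>Division inside \<open>adj v\<close> is available only by base elements, so
    \<open>?x\<close> is first completed to one of them.\<close>
  from alg_multiple[OF alg_hev[OF av] x0] obtain U k where U: "k \<noteq> 0" "?x * hev h U ?x = h k" by auto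
  have "h k * w = (w * ?x) * hev h U ?x" unfolding U(2)[symmetric] by (simp add: mult_ac)
  also have "w * ?x = h (-1) * hev h (e (map_poly pderiv m)) v"
    using rel2 by (simp add: homD(5,2) eq_neg_iff_add_eq_0 add.commute)
  also have "h (-1) * hev h (e (map_poly pderiv m)) v * hev h U ?x \<in> adj v"
    by (intro adj_ring(2) adj_h adj_hev adj_trans[OF adj_hev[of U ?x] adj_hev])
  finally have "h k * w \<in> adj v" .
  then have wv: "w \<in> adj v" using U(1) by (rule adj_divide)
  have "z = v + h (- of_nat c) * w" by (simp add: v_def homD(5,8))
  then have "z \<in> adj v" using adj_ring(1)[OF adj_self adj_ring(2)[OF adj_h wv]] by simp
  then show ?thesis using av wv by auto
qed

lemma primitive_element:
  assumes "finite F" "\<And>x. x \<in> F \<Longrightarrow> alg x"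
  shows "\<exists>v. alg v \<and> F \<subseteq> adj v"
  using assms
proof (induction F)
  case empty
  then show ?case using alg_h by auto
next
  case (insert x F)
  then obtain v where v: "alg v" "F \<subseteq> adj v" by auto
  have "alg x" using insert.prems by simp
  from primitive_element_two[OF v(1) this] obtain u where "alg u" "v \<in> adj u" "x \<in> adj u" by auto
  then show ?case using v(2) adj_trans by (intro exI[of _ u]) auto
qed

end

section \<open>Transcendental elements and independent derivations\<close>

text \<open>The field generated by C consists of fractions of values of polynomials in C. Clearing
  denominators turns an equation for b into a polynomial relation within B, which is trivial by
  independence.\<close>

lemma alg_independent_transcendental:
  fixes b :: "'a::field_char_0"
  assumes ind: "alg_independent B" and b: "b \<in> B" "C \<subseteq> B - {b}"
  shows "transcendental_over (field_gen C) b"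
proof -
  define ev where "ev = (mp_eval of_rat (\<lambda>s. s) :: ('a, rat) mpolynomial \<Rightarrow> 'a)"
  define R where "R = {ev p | p. mp_vars p \<subseteq> C}"
  have ev_add: "ev (p + q) = ev p + ev q" and ev_mult: "ev (p * q) = ev p * ev q"
    and ev_single: "ev (Poly_Mapping.single m r) = of_rat r * monomial_eval (\<lambda>s. s) m" for p q m r
    unfolding ev_def by (simp_all add: mp_eval_add mp_eval_mult mp_eval_single is_hom_of_rat)
  have R: "subring_set R"
    unfolding subring_set_def
  proof (intro conjI ballI)
    have "ev (Poly_Mapping.single 0 1) = 1" by (simp add: ev_single del: single_one)
    moreover have "mp_vars (Poly_Mapping.single 0 (1::rat)) \<subseteq> C"
      using mp_vars_single[of 0 "1::rat"] by fastforce
    ultimately show "1 \<in> R" unfolding R_def by (intro CollectI exI[of _ "Poly_Mapping.single 0 1"]) simp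
    fix x y assume "x \<in> R" "y \<in> R"
    then obtain p q where pq: "x = ev p" "y = ev q" "mp_vars p \<subseteq> C" "mp_vars q \<subseteq> C"
      unfolding R_def by auto
    have pqC: "mp_vars (p * q) \<subseteq> C" using pq mp_vars_mult[of p q] by auto
    show "x * y \<in> R" unfolding R_def using pq(1,2) pqC
      by (intro CollectI exI[of _ "p * q"]) (simp add: ev_mult)
    let ?n = "Poly_Mapping.single 0 (-1) :: ('a, rat) mpolynomial"
    have "mp_vars ?n \<subseteq> Poly_Mapping.keys (0 :: 'a \<Rightarrow>\<^sub>0 nat)" by (rule mp_vars_single)
    then have n0: "mp_vars ?n \<subseteq> C" by simp
    have "mp_vars (p + ?n * q) \<subseteq> C"
      by (rule order.trans[OF mp_vars_add Un_least[OF pq(3) order.trans[OF mp_vars_mult Un_least[OF n0 pq(4)]]]])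
    moreover have "x - y = ev (p + ?n * q)" using pq by (simp add: ev_add ev_mult ev_single)
    ultimately show "x - y \<in> R" unfolding R_def by (intro CollectI exI[of _ "p + ?n * q"] conjI)
  qed
  note r = subring_setD[OF R]
  have CR: "C \<subseteq> R"
  proof
    fix s assume "s \<in> C"
    then have "mp_vars (Poly_Mapping.single (Poly_Mapping.single s 1) (1::rat)) \<subseteq> C"
      using mp_vars_single[of "Poly_Mapping.single s (1::nat)" "1::rat"] by auto
    moreover have "s = ev (Poly_Mapping.single (Poly_Mapping.single s 1) 1)" by (simp add: ev_single)
    ultimately show "s \<in> R" unfolding R_def
      by (intro CollectI exI[of _ "Poly_Mapping.single (Poly_Mapping.single s 1) 1"] conjI)
  qed
  define F where "F = {z. \<exists>y\<in>R. y \<noteq> 0 \<and> z * y \<in> R}"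
  have FI: "z \<in> F" if "y \<in> R" "y \<noteq> 0" "z * y \<in> R" for y z using that unfolding F_def by auto
  have F: "subfield_set F"
    unfolding subfield_set_def subring_set_def
  proof (intro conjI ballI)
    show "1 \<in> F" using r(1) by (intro FI[of 1]) auto
    fix z1 z2 assume "z1 \<in> F" "z2 \<in> F"
    then obtain y1 y2 where y: "y1 \<in> R" "y2 \<in> R" "y1 \<noteq> 0" "y2 \<noteq> 0" "z1 * y1 \<in> R" "z2 * y2 \<in> R"
      by (auto simp: F_def)
    have "(z1 - z2) * (y1 * y2) = (z1 * y1) * y2 - (z2 * y2) * y1" by (simp add: algebra_simps)
    also have "\<dots> \<in> R" using y r by auto
    finally show "z1 - z2 \<in> F" using y r(6) by (intro FI[of "y1 * y2"]) auto
    have "(z1 * z2) * (y1 * y2) = (z1 * y1) * (z2 * y2)" by (simp add: algebra_simps)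
    also have "\<dots> \<in> R" using y r by auto
    finally show "z1 * z2 \<in> F" using y r(6) by (intro FI[of "y1 * y2"]) auto
  next
    fix z assume "z \<in> F"
    then obtain y where y: "y \<in> R" "y \<noteq> 0" "z * y \<in> R" by (auto simp: F_def)
    show "inverse z \<in> F"
    proof (cases "z = 0")
      case True
      then show ?thesis using r(1,2) by (intro FI[of 1]) auto
    next
      case False
      have "inverse z * (z * y) \<in> R"
        unfolding mult.assoc[symmetric] left_inverse[OF False] using y(1) by simp
      then show ?thesis using False y by (intro FI[OF y(3)]) simp_all
    qed
  qed
  have "C \<subseteq> F" using CR r(1) by (auto intro!: FI[of 1])
  then have genF: "field_gen C \<subseteq> F" by (rule field_gen_least[OF F])
  have clear: "\<exists>y\<in>R. y \<noteq> 0 \<and> (\<forall>i. y * coeff P i \<in> R)" if "\<forall>i. coeff P i \<in> F" for P :: "'a poly"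
    using that
  proof (induction P)
    case 0
    then show ?case using r(1,2) by (intro bexI[of _ 1]) auto
  next
    case (pCons a P)
    have "coeff P i \<in> F" for i using spec[OF pCons.prems, of "Suc i"] by simp
    then obtain y where y: "y \<in> R" "y \<noteq> 0" "\<And>i. y * coeff P i \<in> R" using pCons.IH by auto
    have "a \<in> F" using spec[OF pCons.prems, of 0] by simp
    then obtain w where w: "w \<in> R" "w \<noteq> 0" "a * w \<in> R" by (auto simp: F_def)
    have "w * y * coeff (pCons a P) i \<in> R" for i
    proof (cases i)
      case 0
      have "w * y * coeff (pCons a P) i = y * (a * w)" using 0 by (simp add: mult_ac)
      then show ?thesis using r(6)[OF y(1) w(3)] by (simp only:)
    next
      case (Suc j)
      then show ?thesis using r(6)[OF w(1) y(3)[of j]] by (simp add: mult.assoc)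
    qed
    then show ?case using w y r(6) by (intro bexI[of _ "w * y"]) auto
  qed
  show ?thesis
    unfolding transcendental_over_def
  proof (intro allI impI)
    fix P assume P: "\<forall>i. coeff P i \<in> field_gen C" "poly P b = 0"
    then have "\<forall>i. coeff P i \<in> F" using genF by auto
    from clear[OF this] obtain y where y: "y \<in> R" "y \<noteq> 0" "\<And>i. y * coeff P i \<in> R" by auto
    have "\<exists>q. y * coeff P i = ev q \<and> mp_vars q \<subseteq> C" for i using y(3)[of i] unfolding R_def by auto
    from choice[OF allI[OF this]] obtain q where
      "\<forall>i. y * coeff P i = ev (q i) \<and> mp_vars (q i) \<subseteq> C" by (rule exE)
    then have q: "\<And>i. y * coeff P i = ev (q i)" "\<And>i. mp_vars (q i) \<subseteq> C" by auto
    let ?b = "\<lambda>i. Poly_Mapping.single (Poly_Mapping.single b i) (1::rat)"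
    define p where "p = (\<Sum>i\<le>degree P. q i * ?b i)"
    have "mp_vars (q i * ?b i) \<subseteq> B" for i
    proof -
      have "mp_vars (?b i) \<subseteq> {b}" using mp_vars_single[of "Poly_Mapping.single b i" "1::rat"] by (auto split: if_splits)
      then show ?thesis using mp_vars_mult[of "q i" "?b i"] q(2)[of i] b by auto
    qed
    then have "mp_vars p \<subseteq> B" unfolding p_def by (intro mp_vars_sum)
    moreover have "mp_eval of_rat (\<lambda>s. s) p = 0"
    proof -
      have "mp_eval of_rat (\<lambda>s. s) p = (\<Sum>i\<le>degree P. ev (q i * ?b i))"
        unfolding p_def ev_def by (rule mp_eval_sum[OF is_hom_of_rat])
      also have "\<dots> = (\<Sum>i\<le>degree P. y * (coeff P i * b ^ i))"
        by (simp add: ev_mult ev_single q(1)[symmetric] mult.assoc)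
      also have "\<dots> = y * poly P b" by (simp add: poly_altdef sum_distrib_left)
      finally show ?thesis using P(2) by simp
    qed
    ultimately have p0: "p = 0" using ind unfolding alg_independent_def by blast
    \<comment> \<open>Evaluating the trivial relation with b sent to the variable and all other
      elements to constants recovers a nonzero multiple of P, which shows that P is zero.\<close>
    define v where "v = (\<lambda>s. if s = b then [:0, 1:] else [:s:])"
    have hom: "is_hom (\<lambda>r. [:of_rat r :: 'a:])" by (rule is_hom_comp[OF is_hom_const is_hom_of_rat])
    have evq: "mp_eval (\<lambda>r. [:of_rat r:]) v (q i) = [:ev (q i):]" for i
    proof -
      have "mp_eval (\<lambda>r. [:of_rat r:]) v (q i) = mp_eval (\<lambda>r. [:of_rat r:]) (\<lambda>s. [:s:]) (q i)"
        by (rule mp_eval_cong) (use q(2)[of i] b(2) in \<open>auto simp: v_def\<close>)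
      also have "\<dots> = [:ev (q i):]" unfolding ev_def by (rule mp_eval_hom[OF is_hom_const, symmetric])
      finally show ?thesis .
    qed
    have "0 = mp_eval (\<lambda>r. [:of_rat r:]) v p" by (simp add: p0)
    also have "\<dots> = (\<Sum>i\<le>degree P. [:ev (q i):] * [:0, 1:] ^ i)"
      unfolding p_def by (simp add: mp_eval_sum[OF hom] mp_eval_mult[OF hom] mp_eval_single evq one_pCons[symmetric])
        (simp add: v_def one_pCons)
    also have "\<dots> = (\<Sum>i\<le>degree P. monom (coeff (smult y P) i) i)"
      by (intro sum.cong refl) (simp add: q(1)[symmetric] monom_altdef)
    also have "\<dots> = smult y P" by (rule poly_as_sum_of_monoms') simp
    finally show "P = 0" using y(2) by simp
  qed
qed

text \<open>If K is uncountable, the elements algebraic over \<open>field_gen S\<close> are too few.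
  If K is countable, S is finite, and infinitely many independent elements carry dual derivations,
  more than S can detect.\<close>

lemma derivation_closure_proper:
  fixes S :: "'a::field_char_0 set"
  assumes td: "infinite_transcendence_degree TYPE('a)" and S: "|S| <o |UNIV :: 'a set|"
  shows "derivation_closure S \<noteq> UNIV"
proof -
  have inf: "infinite (UNIV :: 'a set)" by (rule infinite_UNIV_char_0)
  have "\<exists>x. transcendental_over (field_gen S) x"
  proof (cases "countable (UNIV :: 'a set)")
    case False
    \<comment> \<open>The naturals make the bounding set infinite while it stays smaller than
      K.\<close>
    let ?A = "S \<union> range (of_nat :: nat \<Rightarrow> 'a)"
    have infA: "infinite ?A" using infinite_UNIV_nat inj_of_nat by (simp add: range_inj_infinite)
    have "\<not> |UNIV :: 'a set| \<le>o |range (of_nat :: nat \<Rightarrow> 'a)|"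
    proof
      assume "|UNIV :: 'a set| \<le>o |range (of_nat :: nat \<Rightarrow> 'a)|"
      then obtain f where "inj_on f (UNIV :: 'a set)" "f ` UNIV \<subseteq> range (of_nat :: nat \<Rightarrow> 'a)"
        by (auto simp: card_of_ordLeq[symmetric])
      then have "countable (UNIV :: 'a set)"
        using countable_image_inj_on[of f UNIV] countable_subset[of "f ` UNIV" "range of_nat"] by simp
      then show False using False by simp
    qed
    then have "|range (of_nat :: nat \<Rightarrow> 'a)| <o |UNIV :: 'a set|"
      by (simp only: not_ordLeq_iff_ordLess[OF card_of_Well_order card_of_Well_order])
    then have A: "|?A| <o |UNIV :: 'a set|" by (rule card_of_Un_ordLess_infinite[OF inf S])
    have "|field_gen S| \<le>o |?A|" by (rule card_field_gen[OF infA card_of_mono1]) auto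
    then have "|{x. \<not> transcendental_over (field_gen S) x}| \<le>o |?A|"
      using subfield_set_gen[of S] subring_setD(2) by (intro card_algebraic infA) (auto simp: subfield_set_def)
    then have "|{x. \<not> transcendental_over (field_gen S) x}| <o |UNIV :: 'a set|"
      using A by (rule ordLeq_ordLess_trans)
    then have "{x. \<not> transcendental_over (field_gen S) x} \<noteq> UNIV"
      by (intro notI) (simp add: ordLess_irreflexive)
    then show ?thesis by auto
  next
    case True
    have "|UNIV :: 'a set| \<le>o |UNIV :: nat set|" using True unfolding countable_def card_of_ordLeq[symmetric] by auto
    then have "|UNIV :: 'a set| \<le>o natLeq" by (rule ordLeq_ordIso_trans[OF _ card_of_nat])
    from ordLess_ordLeq_trans[OF S this] have fin: "finite S" by (simp add: finite_iff_ordLess_natLeq)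
    obtain B :: "'a set" where B: "alg_independent B" "infinite B"
      using td by (auto simp: infinite_transcendence_degree_def transcendence_basis_def)
    obtain b :: "nat \<Rightarrow> 'a" where b: "inj b" "range b \<subseteq> B"
      using infinite_countable_subset[OF B(2)] by auto
    have tr: "transcendental_over (field_gen (b ` {j. j < i})) (b i)" for i
      by (rule alg_independent_transcendental[OF B(1)]) (use b in \<open>auto simp: inj_def\<close>)
    have wf: "wf {(i, j). i < (j::nat)}" by (rule wf)
    have "\<exists>D. derivation D \<and> (\<forall>j. D (b j) = (if i = j then 1 else 0))" for i
    proof -
      obtain D where "derivation D" "\<And>j. D (b j) = (if i = j then 1 else 0)"
        by (rule derivation_extension[where f = "\<lambda>j. if i = j then 1 else 0", OF wf _ tr]) auto
      then show ?thesis by auto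
    qed
    from choice[OF allI[OF this]] obtain D where
      "\<forall>i. derivation (D i) \<and> (\<forall>j. D i (b j) = (if i = j then 1 else 0))" by (rule exE)
    then have D: "\<And>i. derivation (D i)" "\<And>i j. D i (b j) = (if i = j then 1 else 0)" by auto
    \<comment> \<open>One derivation more than S has elements: a nontrivial combination vanishes on
      S, yet it takes the value \<open>c k\<close> at \<open>b k\<close>.\<close>
    obtain c where c: "\<exists>i\<in>{..card S}. c i \<noteq> 0" "\<forall>s\<in>S. (\<Sum>i\<in>{..card S}. c i * D i s) = 0"
      using homogeneous_system[OF fin, of "{..card S}" D] by auto
    define E where "E = (\<lambda>x. \<Sum>i\<in>{..card S}. c i * D i x)"
    have E: "derivation E"
      unfolding derivation_def E_def
      by (simp add: derivation_simps(3,6)[OF D(1)] distrib_left sum.distrib sum_distrib_left sum_distrib_right mult_ac)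
    obtain k where k: "k \<le> card S" "c k \<noteq> 0" using c(1) by auto
    have "E (b k) = c k" unfolding E_def D(2) using k(1) by (simp add: if_distrib cong: if_cong)
    then have "E (b k) \<noteq> 0" using k by simp
    then have "b k \<notin> derivation_closure S" using E c(2) unfolding derivation_closure_def E_def by auto
    from transcendental_outside_closure[OF this] show ?thesis by (rule exI)
  qed
  then obtain x where "transcendental_over (field_gen S) x" by (rule exE)
  from outside_closure_transcendental[OF this] show ?thesis by auto
qed

text \<open>Elements \<open>b i\<close> are chosen along a well-order of K of minimal length, each
  in its neighbourhood and outside the derivation closure of its predecessors. The values of all
  derivations on them may then be prescribed by an independent family of sets.\<close>

lemma independent_derivations:
  fixes N :: "'a::field_char_0 \<Rightarrow> 'a set"
  assumes td: "infinite_transcendence_degree TYPE('a)"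
    and N: "\<And>\<alpha> L. subfield_set L \<Longrightarrow> L \<noteq> UNIV \<Longrightarrow> \<not> N \<alpha> \<subseteq> L"
  obtains D :: "'a set \<times> bool \<Rightarrow> 'a \<Rightarrow> 'a" where "\<And>i. derivation (D i)"
    "\<And>\<alpha> i F. finite F \<Longrightarrow> i \<notin> F \<Longrightarrow> \<exists>b\<in>N \<alpha>. D i b = 1 \<and> (\<forall>j\<in>F. D j b = 0)"
proof -
  have inf: "infinite (UNIV :: 'a set)" by (rule infinite_UNIV_char_0)
  let ?r = "|UNIV :: 'a set|"
  have fr: "\<not> finite (Field ?r)" using inf by (simp add: Field_card_of)
  have co: "Card_order ?r" by (rule card_of_Card_order)
  have bl: "|UNIV :: bool set| \<le>o ?r" by (rule finite_ordLeq_infinite) (simp_all add: inf)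
  have "|(UNIV :: 'a set) \<times> (UNIV :: 'a list set) \<times> (UNIV :: 'a list set) \<times> (UNIV :: bool set)| \<le>o ?r"
    by (intro card_of_Times_ordLeq_infinite_Field fr co card_lists[OF inf] card_of_mono1[OF subset_refl]
        bl)
  then have "|UNIV :: ('a \<times> 'a list \<times> 'a list \<times> bool) set| \<le>o ?r" by simp
  \<comment> \<open>Each stage of the recursion carries a code: the neighbourhood to choose from, a
    finite pattern (xs, ys) and a Boolean. There are only |K| codes.\<close>
  then obtain e :: "'a \<Rightarrow> 'a \<times> 'a list \<times> 'a list \<times> bool" where e: "range e = UNIV"
    using card_of_ordLeq2[of "UNIV :: ('a \<times> 'a list \<times> 'a list \<times> bool) set" "UNIV :: 'a set"] by auto
  have wo: "Well_order ?r" by (rule card_of_Well_order)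
  have F: "Field ?r = UNIV" by (simp add: Field_card_of)
  define lt where "lt = (\<lambda>i j. (i, j) \<in> ?r - Id)"
  have wf: "wf {(i, j). lt i j}"
  proof -
    have "{(i, j). lt i j} = ?r - Id" by (auto simp: lt_def)
    then show ?thesis using wo by (simp add: well_order_on_def)
  qed
  have tot: "i = j \<or> lt i j \<or> lt j i" for i j
    using wo F by (auto simp: lt_def well_order_on_def linear_order_on_def total_on_def)
  \<comment> \<open>Proper initial segments of the cardinal |K| have smaller cardinality, as
    \<open>derivation_closure_proper\<close> requires.\<close>
  have small: "|f ` {j. lt j i}| <o ?r" for i and f :: "'a \<Rightarrow> 'a"
  proof -
    have "{j. lt j i} = underS ?r i" by (auto simp: lt_def underS_def)
    then have "|{j. lt j i}| <o ?r" using card_of_underS[OF co, of i] F by simp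
    then show ?thesis by (rule ordLeq_ordLess_trans[OF card_of_image])
  qed
  have "\<exists>b. \<forall>i. b i \<in> N (fst (e i)) - derivation_closure (b ` {j. lt j i})"
  proof (rule dependent_wf_choice[OF wf, of "\<lambda>f i r. r \<in> N (fst (e i)) - derivation_closure (f ` {j. lt j i})"])
    fix f g :: "'a \<Rightarrow> 'a" and x r assume "\<And>z. (z, x) \<in> {(i, j). lt i j} \<Longrightarrow> f z = g z"
    then have "f ` {j. lt j x} = g ` {j. lt j x}" by (intro image_cong) auto
    then show "(r \<in> N (fst (e x)) - derivation_closure (f ` {j. lt j x})) = (r \<in> N (fst (e x)) - derivation_closure (g ` {j. lt j x}))"
      by simp
  next
    fix x f
    show "\<exists>r. r \<in> N (fst (e x)) - derivation_closure (f ` {j. lt j x})"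
      using N[OF subfield_derivation_closure derivation_closure_proper[OF td small[of f x]], of "fst (e x)"] by auto
  qed
  then obtain b where b: "\<And>i. b i \<in> N (fst (e i))" "\<And>i. b i \<notin> derivation_closure (b ` {j. lt j i})" by auto
  have tr: "transcendental_over (field_gen (b ` {j. lt j i})) (b i)" for i
    by (rule transcendental_outside_closure[OF b(2)])
  define val where "val = (\<lambda>(Y :: 'a set, c :: bool) (\<alpha> :: 'a, xs :: 'a list, ys :: 'a list, d :: bool). if Y \<inter> set xs = set ys \<and> c = d then 1 else 0 :: 'a)"
  have "\<exists>D. derivation D \<and> (\<forall>j. D (b j) = val i (e j))" for i
  proof -
    obtain D where "derivation D" "\<And>j. D (b j) = val i (e j)"
      by (rule derivation_extension[where f = "\<lambda>j. val i (e j)", OF wf tot tr]) auto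
    then show ?thesis by auto
  qed
  from choice[OF allI[OF this]] obtain D where
    "\<forall>i. derivation (D i) \<and> (\<forall>j. D i (b j) = val i (e j))" by (rule exE)
  then have D: "\<And>i. derivation (D i)" "\<And>i j. D i (b j) = val i (e j)" by auto
  have "\<exists>z\<in>N \<alpha>. D i z = 1 \<and> (\<forall>j\<in>F. D j z = 0)" if F: "finite F" "i \<notin> F" for \<alpha> i F
  proof -
    obtain Y c where i: "i = (Y, c)" by (cases i)
    \<comment> \<open>\<open>w Z\<close> is a point where Z and Y differ. Collecting these points
      for F in xs separates Y from every other set occurring in F; an index with the same set Y is
      separated by its Boolean.\<close>
    have "\<exists>x. Z \<noteq> Y \<longrightarrow> (x \<in> Z) \<noteq> (x \<in> Y)" for Z by auto
    from choice[OF allI[OF this]] obtain w where "\<forall>Z. Z \<noteq> Y \<longrightarrow> (w Z \<in> Z) \<noteq> (w Z \<in> Y)" by (rule exE)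
    then have w: "\<And>Z. Z \<noteq> Y \<Longrightarrow> (w Z \<in> Z) \<noteq> (w Z \<in> Y)" by simp
    obtain xs where xs: "set xs = (w \<circ> fst) ` F" using finite_list[of "(w \<circ> fst) ` F"] F(1) by auto
    define ys where "ys = filter (\<lambda>x. x \<in> Y) xs"
    have "(\<alpha>, xs, ys, c) \<in> range e" using e by simp
    then obtain k where k: "e k = (\<alpha>, xs, ys, c)" by auto
    have 1: "D i (b k) = 1" using D(2) by (auto simp: k i val_def ys_def)
    have "D j (b k) = 0" if j: "j \<in> F" for j
    proof -
      obtain Z d where jj: "j = (Z, d)" by (cases j)
      have "\<not> (Z \<inter> set xs = set ys \<and> d = c)"
      proof
        assume *: "Z \<inter> set xs = set ys \<and> d = c"
        then have "Z \<noteq> Y" using F(2) j jj i by auto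
        moreover have "w Z \<in> set xs" using xs j jj by force
        ultimately show False using w[of Z] * by (auto simp: ys_def)
      qed
      then show ?thesis unfolding D(2) by (simp add: k jj val_def)
    qed
    then show ?thesis using 1 b(1)[of k] k by (intro bexI[of _ "b k"]) auto
  qed
  then show ?thesis by (rule that[OF D(1)])
qed

section \<open>Passing from topologies to neighbourhood bases\<close>

lemma nbhd_add:
  assumes T: "field_topology T" and U: "openin T U" "a + b \<in> U"
  obtains V W where "openin T V" "openin T W" "a \<in> V" "b \<in> W" "\<And>x y. x \<in> V \<Longrightarrow> y \<in> W \<Longrightarrow> x + y \<in> U"
proof -
  have ts: "topspace T = UNIV" using T by (simp add: field_topology_def)
  have "continuous_map (prod_topology T T) T (\<lambda>(x, y). x + y)" using T by (simp add: field_topology_def)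
  then have "openin (prod_topology T T) {z \<in> topspace (prod_topology T T). (\<lambda>(x, y). x + y) z \<in> U}"
    using U(1) by (rule openin_continuous_map_preimage)
  then have "\<exists>V W. openin T V \<and> openin T W \<and> a \<in> V \<and> b \<in> W \<and>
      V \<times> W \<subseteq> {z \<in> topspace (prod_topology T T). (\<lambda>(x, y). x + y) z \<in> U}"
    unfolding openin_prod_topology_alt using U(2) ts by simp
  then obtain V W where *: "openin T V" "openin T W" "a \<in> V" "b \<in> W"
      "V \<times> W \<subseteq> {z \<in> topspace (prod_topology T T). (\<lambda>(x, y). x + y) z \<in> U}" by (elim exE conjE)
  have "x + y \<in> U" if "x \<in> V" "y \<in> W" for x y
    using subsetD[OF *(5), of "(x, y)"] that by simp
  then show ?thesis using * that by simp
qed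

lemma nbhd_mult:
  assumes T: "field_topology T" and U: "openin T U" "a * b \<in> U"
  obtains V W where "openin T V" "openin T W" "a \<in> V" "b \<in> W" "\<And>x y. x \<in> V \<Longrightarrow> y \<in> W \<Longrightarrow> x * y \<in> U"
proof -
  have ts: "topspace T = UNIV" using T by (simp add: field_topology_def)
  have "continuous_map (prod_topology T T) T (\<lambda>(x, y). x * y)" using T by (simp add: field_topology_def)
  then have "openin (prod_topology T T) {z \<in> topspace (prod_topology T T). (\<lambda>(x, y). x * y) z \<in> U}"
    using U(1) by (rule openin_continuous_map_preimage)
  then have "\<exists>V W. openin T V \<and> openin T W \<and> a \<in> V \<and> b \<in> W \<and>
      V \<times> W \<subseteq> {z \<in> topspace (prod_topology T T). (\<lambda>(x, y). x * y) z \<in> U}"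
    unfolding openin_prod_topology_alt using U(2) ts by simp
  then obtain V W where *: "openin T V" "openin T W" "a \<in> V" "b \<in> W"
      "V \<times> W \<subseteq> {z \<in> topspace (prod_topology T T). (\<lambda>(x, y). x * y) z \<in> U}" by (elim exE conjE)
  have "x * y \<in> U" if "x \<in> V" "y \<in> W" for x y
    using subsetD[OF *(5), of "(x, y)"] that by simp
  then show ?thesis using * that by simp
qed

definition nbhd_base :: "'a::field topology \<Rightarrow> 'a set set \<Rightarrow> bool" where
  "nbhd_base T B \<longleftrightarrow> (\<forall>U\<in>B. nbhd T 0 U) \<and> (\<forall>U. nbhd T 0 U \<longrightarrow> (\<exists>V\<in>B. V \<subseteq> U))"

text \<open>Converse of the construction of \<open>base_topology\<close>. It makes the generated
  topologies comparable with a given one.\<close>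

lemma gt_base_of_nbhd_base:
  assumes T: "gt_henselian T" and B: "nbhd_base T B"
  shows "gt_base B" "base_topology B = T"
proof -
  have ft: "field_topology T" using T by (simp add: gt_henselian_def)
  have ts: "topspace T = UNIV" using ft by (simp add: field_topology_def)
  have sh: thesis
    if o: "openin T U" "a + b \<in> U" and t: "\<And>W. openin T W \<Longrightarrow> b \<in> W \<Longrightarrow> \<forall>y\<in>W. a + y \<in> U \<Longrightarrow> thesis" for U a b thesis
  proof -
    obtain V W where "openin T V" "openin T W" "a \<in> V" "b \<in> W" "\<And>x y. x \<in> V \<Longrightarrow> y \<in> W \<Longrightarrow> x + y \<in> U"
      using nbhd_add[OF ft o] by auto
    then show thesis by (intro t[of W]) simp_all
  qed
  have get: "\<exists>V\<in>B. V \<subseteq> U" if "openin T U" "0 \<in> U" for U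
  proof -
    have "nbhd T 0 U" unfolding nbhd_def using that ts by (intro conjI exI[of _ U]) simp_all
    then show ?thesis using B by (simp add: nbhd_base_def)
  qed
  have int: "\<exists>W. openin T W \<and> 0 \<in> W \<and> W \<subseteq> U" if "U \<in> B" for U
    using B that by (simp add: nbhd_base_def nbhd_def)
  have haus: "\<exists>U\<in>B. x \<notin> U" if x: "x \<noteq> 0" for x
  proof -
    have "Hausdorff_space T" using ft by (simp add: field_topology_def)
    from this[unfolded Hausdorff_space_def, rule_format, of 0 x]
    obtain U V where UV: "openin T U" "openin T V" "0 \<in> U" "x \<in> V" "disjnt U V"
      using x ts by auto
    obtain W where "W \<in> B" "W \<subseteq> U" using get[OF UV(1,3)] by auto
    then show ?thesis using UV(4,5) by (intro bexI[of _ W]) (auto simp: disjnt_def)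
  qed
  have fb: "field_base B"
    unfolding field_base_def
  proof (intro conjI ballI allI impI haus)
    have "openin T UNIV" using openin_topspace[of T] ts by simp
    from get[OF this] show "B \<noteq> {}" by auto
    fix U assume U: "U \<in> B"
    obtain U' where U': "openin T U'" "0 \<in> U'" "U' \<subseteq> U" using int[OF U] by auto
    show "0 \<in> U" using U' by auto
    show "\<exists>W\<in>B. W \<subseteq> U \<and> W \<subseteq> V" if V: "V \<in> B" for V
    proof -
      obtain V' where "openin T V'" "0 \<in> V'" "V' \<subseteq> V" using int[OF V] by auto
      then obtain W where "W \<in> B" "W \<subseteq> U' \<inter> V'" using get[of "U' \<inter> V'"] U' by auto
      then show ?thesis using U' \<open>V' \<subseteq> V\<close> by (intro bexI[of _ W]) auto
    qed
    show "\<exists>V\<in>B. \<forall>x\<in>V. \<forall>y\<in>V. x - y \<in> U"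
    proof -
      obtain V1 V2 where V: "openin T V1" "openin T V2" "0 \<in> V1" "0 \<in> V2" "\<And>x y. x \<in> V1 \<Longrightarrow> y \<in> V2 \<Longrightarrow> x + y \<in> U'"
        using nbhd_add[OF ft U'(1), of 0 0] U'(2) by auto
      have "(-1) * 0 \<in> V2" using V(4) by simp
      from nbhd_mult[OF ft V(2) this] obtain V3 V4 where W: "openin T V3" "openin T V4" "-1 \<in> V3" "0 \<in> V4"
        "\<And>x y. x \<in> V3 \<Longrightarrow> y \<in> V4 \<Longrightarrow> x * y \<in> V2" by auto
      obtain Z where Z: "Z \<in> B" "Z \<subseteq> V1 \<inter> V4" using get[of "V1 \<inter> V4"] V W by auto
      have "x - y \<in> U" if "x \<in> Z" "y \<in> Z" for x y
      proof -
        have "- y \<in> V2" using W(5)[OF W(3), of y] that Z by auto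
        then have "x + - y \<in> U'" using V(5) that Z by blast
        then show ?thesis using U' by auto
      qed
      then show ?thesis using Z(1) by auto
    qed
    show "\<exists>V\<in>B. \<forall>x\<in>V. \<forall>y\<in>V. x * y \<in> U"
    proof -
      obtain V1 V2 where V: "openin T V1" "openin T V2" "0 \<in> V1" "0 \<in> V2" "\<And>x y. x \<in> V1 \<Longrightarrow> y \<in> V2 \<Longrightarrow> x * y \<in> U'"
        using nbhd_mult[OF ft U'(1), of 0 0] U'(2) by auto
      obtain Z where Z: "Z \<in> B" "Z \<subseteq> V1 \<inter> V2" using get[of "V1 \<inter> V2"] V by auto
      have "x * y \<in> U" if "x \<in> Z" "y \<in> Z" for x y
        using V(5)[of x y] that Z(2) U'(3) by auto
      then show ?thesis using Z(1) by auto
    qed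
    show "\<exists>V\<in>B. \<forall>x\<in>V. a * x \<in> U" for a
    proof -
      have "a * 0 \<in> U'" using U' by simp
      from nbhd_mult[OF ft U'(1) this] obtain V1 V2 where V: "openin T V1" "openin T V2" "a \<in> V1" "0 \<in> V2"
        "\<And>x y. x \<in> V1 \<Longrightarrow> y \<in> V2 \<Longrightarrow> x * y \<in> U'" by auto
      obtain Z where Z: "Z \<in> B" "Z \<subseteq> V2" using get[of "V2"] V by auto
      have "a * x \<in> U" if "x \<in> Z" for x
        using V(5)[OF V(3), of x] that Z(2) U'(3) by auto
      then show ?thesis using Z(1) by auto
    qed
    show "\<exists>V\<in>B. \<forall>x\<in>V. inverse (1 + x) - 1 \<in> U"
    proof -
      obtain V1 where V1: "openin T V1" "1 \<in> V1" "\<forall>y\<in>V1. -1 + y \<in> U'" by (rule sh[OF U'(1), of "-1" 1]) (use U'(2) in simp)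
      have "continuous_map (subtopology T (- {0})) T inverse" using ft by (simp add: field_topology_def)
      then have "openin (subtopology T (- {0})) {x \<in> topspace (subtopology T (- {0})). inverse x \<in> V1}"
        using V1(1) by (rule openin_continuous_map_preimage)
      then obtain W where W: "openin T W" "{x \<in> topspace (subtopology T (- {0})). inverse x \<in> V1} = W \<inter> - {0}"
        unfolding openin_subtopology by auto
      have W': "inverse x \<in> V1" if "x \<in> W" "x \<noteq> 0" for x
      proof -
        have "x \<in> W \<inter> - {0}" using that by simp
        then show ?thesis unfolding W(2)[symmetric] by simp
      qed
      have "1 \<in> {x \<in> topspace (subtopology T (- {0})). inverse x \<in> V1}" using V1(2) ts by simp
      then have "1 + 0 \<in> W" unfolding W(2) by simp
      from W(1) this obtain V2 where V2: "openin T V2" "0 \<in> V2" "\<forall>y\<in>V2. 1 + y \<in> W" by (rule sh)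
      \<comment> \<open>Inversion is continuous only away from 0, so 1 + x = 0 has to be excluded by
        shrinking to a set without -1.\<close>
      obtain Y where Y: "Y \<in> B" "-1 \<notin> Y" using haus[of "-1"] by auto
      obtain Y' where Y': "openin T Y'" "0 \<in> Y'" "Y' \<subseteq> Y" using int[OF Y(1)] by auto
      obtain Z where Z: "Z \<in> B" "Z \<subseteq> V2 \<inter> Y'" using get[of "V2 \<inter> Y'"] V2 Y' by auto
      have "inverse (1 + x) - 1 \<in> U" if x: "x \<in> Z" for x
      proof -
        have "1 + x \<noteq> 0"
        proof
          assume "1 + x = 0"
          then have "x = -1" by (simp add: add_eq_0_iff)
          then show False using x Z Y Y' by auto
        qed
        moreover have "1 + x \<in> W" using x Z V2 by auto
        ultimately have "inverse (1 + x) \<in> V1" by (intro W')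
        then have "-1 + inverse (1 + x) \<in> U'" using V1(3) by simp
        then show ?thesis using U'(3) by auto
      qed
      then show ?thesis using Z(1) by auto
    qed
  qed
  have nontriv: "\<exists>x\<in>U. x \<noteq> 0" if U: "U \<in> B" for U
  \<comment> \<open>If {0} were a neighbourhood of 0, translations would make all singletons open
    and the topology discrete.\<close>
  proof (rule ccontr)
    assume "\<not> (\<exists>x\<in>U. x \<noteq> 0)"
    moreover obtain U' where U': "openin T U'" "0 \<in> U'" "U' \<subseteq> U" using int[OF U] by auto
    ultimately have U0: "U' = {0}" by auto
    have "openin T {x}" for x
    proof -
      obtain W where W: "openin T W" "x \<in> W" "\<forall>y\<in>W. - x + y \<in> U'" by (rule sh[OF U'(1), of "-x" x]) (use U'(2) in simp)
      have "W \<subseteq> {x}"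
      proof
        fix y assume "y \<in> W"
        then have "- x + y = 0" using W(3) U0 by simp
        then have "y = x" by (simp add: add.commute[of "- x"])
        then show "y \<in> {x}" by simp
      qed
      then have "W = {x}" using W(2) by (intro subset_antisym) simp_all
      then show ?thesis using W(1) by simp
    qed
    note single = this
    have "openin T S" for S
    proof (subst openin_subopen, intro ballI)
      fix x assume "x \<in> S"
      then show "\<exists>U. openin T U \<and> x \<in> U \<and> U \<subseteq> S" using single[of x] by (intro exI[of _ "{x}"]) simp
    qed
    then have "T = discrete_topology UNIV" by (simp add: topology_eq)
    then show False using T by (simp add: gt_henselian_def)
  qed
  have hensel: "\<exists>V\<in>B. \<forall>a. (\<forall>i\<le>d. a i \<in> V) \<longrightarrow> (\<exists>x. x + 1 \<in> U \<and> order x (gt_poly d a) = 1)" if U: "U \<in> B" for U d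
  proof -
    obtain U' where U': "openin T U'" "0 \<in> U'" "U' \<subseteq> U" using int[OF U] by auto
    obtain W where W: "openin T W" "-1 \<in> W" "\<forall>y\<in>W. 1 + y \<in> U'" by (rule sh[OF U'(1), of 1 "-1"]) (use U'(2) in simp)
    have "nbhd T (-1) W" unfolding nbhd_def using W(1,2) ts by (intro conjI exI[of _ W]) simp_all
    then have "\<exists>V. nbhd T 0 V \<and> (\<forall>a. (\<forall>i\<le>d. a i \<in> V) \<longrightarrow> (\<exists>x\<in>W. order x (gt_poly d a) = 1))"
      using T by (simp add: gt_henselian_def)
    then obtain V where V: "nbhd T 0 V" "\<And>a. (\<forall>i\<le>d. a i \<in> V) \<Longrightarrow> \<exists>x\<in>W. order x (gt_poly d a) = 1" by auto
    obtain Z where Z: "Z \<in> B" "Z \<subseteq> V" using B V(1) by (auto simp: nbhd_base_def)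
    have "\<exists>x. x + 1 \<in> U \<and> order x (gt_poly d a) = 1" if "\<forall>i\<le>d. a i \<in> Z" for a
    proof -
      have "\<forall>i\<le>d. a i \<in> V" using that Z by auto
      from V(2)[OF this] obtain x where "x \<in> W" "order x (gt_poly d a) = 1" by auto
      moreover from this have "x + 1 \<in> U" using W(3) U'(3) by (auto simp: add.commute)
      ultimately show ?thesis by auto
    qed
    then show ?thesis using Z(1) by auto
  qed
  show "gt_base B" unfolding gt_base_def using fb nontriv hensel by simp
  have "openin T U \<longleftrightarrow> (\<forall>x\<in>U. \<exists>V\<in>B. \<forall>y. y - x \<in> V \<longrightarrow> y \<in> U)" for U
  proof
    assume U: "openin T U"
    show "\<forall>x\<in>U. \<exists>V\<in>B. \<forall>y. y - x \<in> V \<longrightarrow> y \<in> U"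
    proof
      fix x assume "x \<in> U"
      then have "x + 0 \<in> U" by simp
      with U obtain W where W: "openin T W" "0 \<in> W" "\<forall>y\<in>W. x + y \<in> U" by (rule sh)
      obtain V where V: "V \<in> B" "V \<subseteq> W" using get[OF W(1,2)] by auto
      have "y \<in> U" if "y - x \<in> V" for y
      proof -
        have "y - x \<in> W" using that V(2) by auto
        from bspec[OF W(3) this] show ?thesis by simp
      qed
      then show "\<exists>V\<in>B. \<forall>y. y - x \<in> V \<longrightarrow> y \<in> U" using V(1) by auto
    qed
  next
    assume *: "\<forall>x\<in>U. \<exists>V\<in>B. \<forall>y. y - x \<in> V \<longrightarrow> y \<in> U"
    show "openin T U"
    proof (subst openin_subopen, intro ballI)
      fix x assume "x \<in> U"
      then obtain V where V: "V \<in> B" "\<And>y. y - x \<in> V \<Longrightarrow> y \<in> U" using * by auto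
      obtain V' where V': "openin T V'" "0 \<in> V'" "V' \<subseteq> V" using int[OF V(1)] by auto
      obtain W where W: "openin T W" "x \<in> W" "\<forall>y\<in>W. - x + y \<in> V'" by (rule sh[OF V'(1), of "-x" x]) (use V'(2) in simp)
      have "W \<subseteq> U"
      proof
        fix y assume "y \<in> W"
        then have "- x + y \<in> V" using W(3) V'(3) by auto
        then show "y \<in> U" by (intro V(2)) simp
      qed
      then show "\<exists>W. openin T W \<and> x \<in> W \<and> W \<subseteq> U" using W by auto
    qed
  qed
  then show "base_topology B = T"
    unfolding topology_eq openin_base_topology[OF fb] eventually_near[OF fb] by simp
qed

lemma nbhd_base_all: "nbhd_base T {U. nbhd T 0 U}"
  by (auto simp: nbhd_base_def)

text \<open>A Loewenheim-Skolem argument: witnesses for all axioms are chosen by |K| many functions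
  of two sets, and one set is closed under them. The resulting topology may be coarser than the
  original one.\<close>

lemma gt_base_small:
  fixes B :: "'a::field_char_0 set set"
  assumes B: "gt_base B"
  obtains N :: "'a \<Rightarrow> 'a set" where "gt_base (range N)"
proof -
  have fb: "field_base B" using B by (simp add: gt_base_def)
  note b = field_baseD[OF fb]
  have inf: "infinite (UNIV :: 'a set)" by (rule infinite_UNIV_char_0)
  \<comment> \<open>The single parameter p serves as scalar, as point to be excluded, and, when it
    is a natural number, as the degree in the henselian axiom. In characteristic zero that number is
    determined by p.\<close>
  define good where "good = (\<lambda>p U V W. W \<in> B \<and> W \<subseteq> U \<and> W \<subseteq> V \<and> (\<forall>x\<in>W. \<forall>y\<in>W. x - y \<in> U) \<and> (\<forall>x\<in>W. \<forall>y\<in>W. x * y \<in> U)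
    \<and> (\<forall>x\<in>W. p * x \<in> U) \<and> (\<forall>x\<in>W. inverse (1 + x) - 1 \<in> U) \<and> (p \<noteq> 0 \<longrightarrow> p \<notin> W) \<and>
    (\<forall>d. p = of_nat d \<longrightarrow> (\<forall>a. (\<forall>i\<le>d. a i \<in> W) \<longrightarrow> (\<exists>x. x + 1 \<in> U \<and> order x (gt_poly d a) = 1))))"
  have ex: "\<exists>W. good p U V W" if U: "U \<in> B" and V: "V \<in> B" for p U V
  proof -
    obtain W1 where W1: "W1 \<in> B" "\<forall>x\<in>W1. \<forall>y\<in>W1. x - y \<in> U" using b(4)[OF U] by auto
    obtain W2 where W2: "W2 \<in> B" "\<forall>x\<in>W2. \<forall>y\<in>W2. x * y \<in> U" using b(5)[OF U] by auto
    obtain W3 where W3: "W3 \<in> B" "\<forall>x\<in>W3. p * x \<in> U" using b(6)[OF U] by auto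
    obtain W4 where W4: "W4 \<in> B" "\<forall>x\<in>W4. inverse (1 + x) - 1 \<in> U" using b(7)[OF U] by auto
    obtain W5 where W5: "W5 \<in> B" "p \<noteq> 0 \<longrightarrow> p \<notin> W5" using b(8)[of p] U by auto
    have "\<exists>W6\<in>B. \<forall>d. p = of_nat d \<longrightarrow> (\<forall>a. (\<forall>i\<le>d. a i \<in> W6) \<longrightarrow> (\<exists>x. x + 1 \<in> U \<and> order x (gt_poly d a) = 1))"
    proof (cases "p \<in> range of_nat")
      case True
      then obtain e where e: "p = of_nat e" by auto
      have "\<exists>W\<in>B. \<forall>a. (\<forall>i\<le>e. a i \<in> W) \<longrightarrow> (\<exists>x. x + 1 \<in> U \<and> order x (gt_poly e a) = 1)"
        using B U by (simp add: gt_base_def)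
      then show ?thesis using e by auto
    next
      case False
      then show ?thesis using U by auto
    qed
    then obtain W6 where W6: "W6 \<in> B"
      "\<forall>d. p = of_nat d \<longrightarrow> (\<forall>a. (\<forall>i\<le>d. a i \<in> W6) \<longrightarrow> (\<exists>x. x + 1 \<in> U \<and> order x (gt_poly d a) = 1))" by auto
    obtain Y1 where Y1: "Y1 \<in> B" "Y1 \<subseteq> U" "Y1 \<subseteq> V" using b(3)[OF U V] by auto
    obtain Y2 where Y2: "Y2 \<in> B" "Y2 \<subseteq> Y1" "Y2 \<subseteq> W1" using b(3)[OF Y1(1) W1(1)] by auto
    obtain Y3 where Y3: "Y3 \<in> B" "Y3 \<subseteq> Y2" "Y3 \<subseteq> W2" using b(3)[OF Y2(1) W2(1)] by auto
    obtain Y4 where Y4: "Y4 \<in> B" "Y4 \<subseteq> Y3" "Y4 \<subseteq> W3" using b(3)[OF Y3(1) W3(1)] by auto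
    obtain Y5 where Y5: "Y5 \<in> B" "Y5 \<subseteq> Y4" "Y5 \<subseteq> W4" using b(3)[OF Y4(1) W4(1)] by auto
    obtain Y6 where Y6: "Y6 \<in> B" "Y6 \<subseteq> Y5" "Y6 \<subseteq> W5" using b(3)[OF Y5(1) W5(1)] by auto
    obtain Y7 where Y7: "Y7 \<in> B" "Y7 \<subseteq> Y6" "Y7 \<subseteq> W6" using b(3)[OF Y6(1) W6(1)] by auto
    have sub: "Y7 \<subseteq> U" "Y7 \<subseteq> V" "Y7 \<subseteq> W1" "Y7 \<subseteq> W2" "Y7 \<subseteq> W3" "Y7 \<subseteq> W4" "Y7 \<subseteq> W5" "Y7 \<subseteq> W6"
      using Y1 Y2 Y3 Y4 Y5 Y6 Y7 by auto
    have "good p U V Y7"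
      unfolding good_def
    proof (intro conjI)
      show "\<forall>d. p = of_nat d \<longrightarrow> (\<forall>a. (\<forall>i\<le>d. a i \<in> Y7) \<longrightarrow> (\<exists>x. x + 1 \<in> U \<and> order x (gt_poly d a) = 1))"
      proof (intro allI impI)
        fix d a assume "p = of_nat d" "\<forall>i\<le>d. a i \<in> Y7"
        then show "\<exists>x. x + 1 \<in> U \<and> order x (gt_poly d a) = 1"
          using W6(2)[rule_format, of d a] subsetD[OF sub(8)] by simp
      qed
      show "p \<noteq> 0 \<longrightarrow> p \<notin> Y7" using W5(2) sub(7) by auto
      show "\<forall>x\<in>Y7. \<forall>y\<in>Y7. x - y \<in> U" using W1(2) sub(3) by auto
      show "\<forall>x\<in>Y7. \<forall>y\<in>Y7. x * y \<in> U" using W2(2) sub(4) by auto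
      show "\<forall>x\<in>Y7. p * x \<in> U" using W3(2) sub(5) by auto
      show "\<forall>x\<in>Y7. inverse (1 + x) - 1 \<in> U" using W4(2) sub(6) by auto
    qed (use Y7(1) sub in auto)
    then show ?thesis by (rule exI)
  qed
  define w where "w = (\<lambda>p U V. SOME W. good p U V W)"
  have w: "good p U V (w p U V)" if "U \<in> B" "V \<in> B" for p U V
    unfolding w_def using someI_ex[of "good p U V"] ex[OF that, of p] by simp
  obtain U0 where U0: "U0 \<in> B" using b(1) by auto
  have "|{U0}| \<le>o |UNIV :: 'a set|" using inf by (simp add: finite_ordLeq_infinite)
  then obtain Y where Y: "{U0} \<subseteq> Y" "\<forall>p\<in>UNIV. \<forall>x\<in>Y. \<forall>y\<in>Y. w p x y \<in> Y" "|Y| \<le>o |UNIV :: 'a set|"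
    by (rule closure_card[OF inf card_of_mono1[OF subset_refl], of "{U0}" w])
  define C where "C = Y \<inter> B"
  have U0C: "U0 \<in> C" using U0 Y(1) by (auto simp: C_def)
  have CB: "U \<in> B" if "U \<in> C" for U using that by (simp add: C_def)
  have wC: "w p U V \<in> C" if "U \<in> C" "V \<in> C" for p U V
    using that Y(2) w[of U V p] by (auto simp: C_def good_def)
  have gC: "good p U V (w p U V)" if "U \<in> C" "V \<in> C" for p U V using w that CB by simp
  have gt: "gt_base C"
    unfolding gt_base_def field_base_def
  proof (intro conjI ballI allI impI)
    show "C \<noteq> {}" using U0C by auto
    fix U assume U: "U \<in> C"
    show "0 \<in> U" using b(2)[OF CB[OF U]] .
    show "\<exists>x\<in>U. x \<noteq> 0" using B CB[OF U] by (simp add: gt_base_def)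
    note g = gC[OF U U, unfolded good_def]
    show "\<exists>V\<in>C. \<forall>x\<in>V. \<forall>y\<in>V. x - y \<in> U" using g[of 0] by (intro bexI[of _ "w 0 U U"] wC U) (elim conjE)
    show "\<exists>V\<in>C. \<forall>x\<in>V. \<forall>y\<in>V. x * y \<in> U" using g[of 0] by (intro bexI[of _ "w 0 U U"] wC U) (elim conjE)
    show "\<exists>V\<in>C. \<forall>x\<in>V. a * x \<in> U" for a using g[of a] by (intro bexI[of _ "w a U U"] wC U) (elim conjE)
    show "\<exists>V\<in>C. \<forall>x\<in>V. inverse (1 + x) - 1 \<in> U" using g[of 0] by (intro bexI[of _ "w 0 U U"] wC U) (elim conjE)
    show "\<exists>V\<in>C. \<forall>a. (\<forall>i\<le>d. a i \<in> V) \<longrightarrow> (\<exists>x. x + 1 \<in> U \<and> order x (gt_poly d a) = 1)" for d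
      using g[of "of_nat d"] by (intro bexI[of _ "w (of_nat d) U U"] wC U) (elim conjE, drule spec[of _ d], erule mp, rule refl)
    show "\<exists>W\<in>C. W \<subseteq> U \<and> W \<subseteq> V" if V: "V \<in> C" for V
      using gC[OF U V, of 0, unfolded good_def] by (intro bexI[of _ "w 0 U V"] wC U V conjI) (elim conjE, assumption)+
  next
    fix x :: 'a assume x: "x \<noteq> 0"
    show "\<exists>U\<in>C. x \<notin> U"
      using gC[OF U0C U0C, of x, unfolded good_def] x by (intro bexI[of _ "w x U0 U0"] wC U0C) (elim conjE, simp)
  qed
  have "|C| \<le>o |UNIV :: 'a set|" using card_of_mono1[of C Y] ordLeq_transitive[OF _ Y(3)] by (simp add: C_def)
  then obtain N :: "'a \<Rightarrow> 'a set" where "range N = C"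
    using card_of_ordLeq2[of C "UNIV :: 'a set"] U0C by auto
  then show ?thesis using gt that[of N] by simp
qed

section \<open>Families of topologies and their weights\<close>

lemma exist_family:
  fixes T :: "'b \<Rightarrow> 'a topology" and \<kappa> :: "'c rel"
  assumes inc: "\<And>x y. x \<noteq> y \<Longrightarrow> incomparable (T x) (T y)" and P: "\<And>x. P (T x)"
    and card: "|UNIV :: 'b set| =o \<kappa>"
  shows "exist_pairwise_incomparable \<kappa> P"
  unfolding exist_pairwise_incomparable_def
proof (intro exI[of _ "range T"] conjI)
  have irr: "\<not> incomparable (T x) (T x)" for x by (simp add: incomparable_def refines_topology_def)
  have "inj T"
  proof (rule injI, rule ccontr)
    fix x y assume "T x = T y" "x \<noteq> y"
    then show False using inc[of x y] irr[of y] by simp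
  qed
  then have "|UNIV :: 'b set| =o |range T|" by (rule card_of_ordIsoI[OF inj_on_imp_bij_betw])
  from ordIso_transitive[OF ordIso_symmetric[OF this] card] show "|range T| =o \<kappa>" .
  show "\<forall>T\<in>range T. P T" using P by auto
  show "pairwise incomparable (range T)"
    unfolding pairwise_def
  proof (intro ballI impI)
    fix S S' assume "S \<in> range T" "S' \<in> range T" "S \<noteq> S'"
    then obtain x y where "S = T x" "S' = T y" "x \<noteq> y" by auto
    then show "incomparable S S'" using inc by simp
  qed
qed

lemma card_UNIV_set: "|UNIV :: 'b set set| =o ctwo ^c |UNIV :: 'b set|"
  using card_of_Pow_Func[of "UNIV :: 'b set"] by (simp add: cexp_def ctwo_def Field_card_of)

lemma card_UNIV_set_set: "|UNIV :: 'b set set set| =o ctwo ^c (ctwo ^c |UNIV :: 'b set| )"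
  by (rule ordIso_transitive[OF card_UNIV_set cexp_cong2[OF card_UNIV_set Card_order_ctwo card_of_Card_order]])

text \<open>The choice in \<open>weight\<close> is meaningful because cardinals are well-ordered:
  some basis has least cardinality.\<close>

lemma minimal_basis:
  obtains C where "topology_basis T C" "weight T = |C|" "\<forall>C'. topology_basis T C' \<longrightarrow> |C| \<le>o |C'|"
proof -
  define R where "R = {|C| | C. topology_basis T C}"
  have "topology_basis T {U. openin T U}" unfolding topology_basis_def
  proof (intro conjI allI impI ballI)
    fix U assume "openin T U"
    then show "\<exists>C\<subseteq>{U. openin T U}. U = \<Union>C" by (intro exI[of _ "{U}"]) auto
  qed simp
  then have "R \<noteq> {}" unfolding R_def by auto
  moreover have "\<forall>r\<in>R. Card_order r" unfolding R_def using card_of_Card_order by auto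
  ultimately have "\<exists>r\<in>R. \<forall>r'\<in>R. r \<le>o r'" by (rule exists_minim_Card_order)
  then obtain r where r: "r \<in> R" "\<forall>r'\<in>R. r \<le>o r'" by auto
  then obtain C where C: "topology_basis T C" "r = |C|" unfolding R_def by auto
  have "\<exists>C. topology_basis T C \<and> (\<forall>C'. topology_basis T C' \<longrightarrow> |C| \<le>o |C'| )"
    using r(2) C unfolding R_def by (intro exI[of _ C]) auto
  from someI_ex[OF this] show ?thesis by (intro that) (auto simp: weight_def)
qed

text \<open>The interiors of the translates of the sets in B form a basis of size at most |K| times
  |B|.\<close>

lemma weight_base_topology:
  fixes B :: "'a::field_char_0 set set"
  assumes B: "field_base B" and card: "|B| \<le>o |UNIV :: 'a set|"
  shows "weight (base_topology B) \<le>o |UNIV :: 'a set|"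
proof -
  define O' where "O' = (\<lambda>(a, V). {y. eventually (\<lambda>z. z - a \<in> V) (near B y)})"
  let ?C = "O' ` (UNIV \<times> B)"
  have "topology_basis (base_topology B) ?C"
    unfolding topology_basis_def
  proof (intro conjI ballI allI impI)
    fix V assume "V \<in> ?C"
    then show "openin (base_topology B) V" using openin_near[OF B] by (auto simp: O'_def)
  next
    fix U assume U: "openin (base_topology B) U"
    let ?D = "{W \<in> ?C. W \<subseteq> U}"
    have "U \<subseteq> \<Union>?D"
    proof
      fix x assume "x \<in> U"
      then obtain V where V: "V \<in> B" "\<And>y. y - x \<in> V \<Longrightarrow> y \<in> U"
        using U by (auto simp: openin_base_topology[OF B] eventually_near[OF B])
      have "O' (x, V) \<subseteq> U"
      proof
        fix y assume "y \<in> O' (x, V)"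
        then have "eventually (\<lambda>z. z - x \<in> V) (near B y)" by (simp add: O'_def)
        then have "y - x \<in> V" by (rule near_self[OF B])
        then show "y \<in> U" by (rule V(2))
      qed
      moreover have "x \<in> O' (x, V)" using V(1) by (auto simp: O'_def eventually_near[OF B])
      moreover have "O' (x, V) \<in> ?C" using V(1) by auto
      ultimately show "x \<in> \<Union>?D" by auto
    qed
    then show "\<exists>C\<subseteq>?C. U = \<Union>C" by (intro exI[of _ ?D]) auto
  qed
  moreover have "|?C| \<le>o |UNIV :: 'a set|"
  proof (rule ordLeq_transitive[OF card_of_image])
    have "\<not> finite (Field |UNIV :: 'a set| )" by (simp add: Field_card_of infinite_UNIV_char_0)
    then show "|(UNIV :: 'a set) \<times> B| \<le>o |UNIV :: 'a set|"
      by (rule card_of_Times_ordLeq_infinite_Field[OF _ ordLeq_refl[OF card_of_Card_order] card card_of_Card_order])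
  qed
  moreover obtain C where "weight (base_topology B) = |C|"
      "\<forall>C'. topology_basis (base_topology B) C' \<longrightarrow> |C| \<le>o |C'|"
    by (rule minimal_basis[of "base_topology B"])
  ultimately show ?thesis using ordLeq_transitive[of "|C|" "|?C|" "|UNIV :: 'a set|"] by simp
qed

lemma small_weight_base:
  fixes T :: "'a::field_char_0 topology"
  assumes T: "gt_henselian T" and w: "weight T \<le>o |UNIV :: 'a set|"
  obtains N :: "'a \<Rightarrow> 'a set" where "gt_base (range N)" "base_topology (range N) = T"
proof -
  obtain C where C: "topology_basis T C" "weight T = |C|" "\<forall>C'. topology_basis T C' \<longrightarrow> |C| \<le>o |C'|"
    by (rule minimal_basis)
  have ts: "topspace T = UNIV" using T by (simp add: gt_henselian_def field_topology_def)
  define B where "B = {V \<in> C. 0 \<in> V}"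
  have cof: "\<exists>V\<in>B. V \<subseteq> U" if U: "openin T U" "0 \<in> U" for U
  proof -
    from C(1) U(1) obtain C' where C': "C' \<subseteq> C" "U = \<Union>C'" unfolding topology_basis_def by auto
    then obtain V where "V \<in> C'" "0 \<in> V" using U(2) by auto
    then show ?thesis using C' by (intro bexI[of _ V]) (auto simp: B_def)
  qed
  have nb: "nbhd_base T B"
    unfolding nbhd_base_def
  proof (intro conjI ballI allI impI)
    fix U assume "U \<in> B"
    then show "nbhd T 0 U" using C(1) ts unfolding nbhd_def topology_basis_def B_def by auto
  next
    fix U assume "nbhd T 0 U"
    then obtain W where W: "openin T W" "0 \<in> W" "W \<subseteq> U" by (auto simp: nbhd_def)
    from cof[OF W(1,2)] W(3) show "\<exists>V\<in>B. V \<subseteq> U" by auto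
  qed
  have "|B| \<le>o |C|" by (rule card_of_mono1) (auto simp: B_def)
  then have "|B| \<le>o |UNIV :: 'a set|" using w unfolding C(2) by (rule ordLeq_transitive)
  moreover have "B \<noteq> {}" using cof[of UNIV] openin_topspace[of T] ts by auto
  ultimately obtain N :: "'a \<Rightarrow> 'a set" where "range N = B"
    using card_of_ordLeq2[of B "UNIV :: 'a set"] by auto
  then show ?thesis using gt_base_of_nbhd_base[OF T nb] that[of N] by simp
qed

text \<open>Every x is a quotient (x w) / w with w nonzero and so small that both w and x w lie in
  V.\<close>

lemma base_set_not_in_subfield:
  assumes B: "gt_base B" and V: "V \<in> B" and L: "subfield_set L" "L \<noteq> UNIV"
  shows "\<not> V \<subseteq> L"
proof
  assume VL: "V \<subseteq> L"
  have fb: "field_base B" using B by (simp add: gt_base_def)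
  have "x \<in> L" for x
  proof -
    obtain W where W: "W \<in> B" "\<forall>w\<in>W. x * w \<in> V" using field_baseD(6)[OF fb V, of x] by auto
    obtain Z where Z: "Z \<in> B" "Z \<subseteq> W" "Z \<subseteq> V" using field_baseD(3)[OF fb W(1) V] by auto
    have "\<exists>w\<in>Z. w \<noteq> 0" using B Z(1) by (simp add: gt_base_def)
    then obtain w where w: "w \<in> Z" "w \<noteq> 0" by (elim bexE)
    have "x * w \<in> L" "inverse w \<in> L" using w W Z VL L(1) by (auto simp: subfield_set_def)
    then have "x * w * inverse w \<in> L" using L(1) subring_setD(6) by (auto simp: subfield_set_def)
    then show ?thesis using w(2) by (simp add: mult.assoc)
  qed
  then show False using L(2) by auto
qed

section \<open>Families of refinements given by derivations\<close>

text \<open>For i outside the finite set F, every \<open>deriv_set D V F\<close> contains an element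
  with \<open>D i\<close> equal to 1. This gives nondiscreteness, and it shows that no neighbourhood
  for J can force \<open>D i\<close> to be small when i is not in J.\<close>

lemma derivation_topologies:
  fixes N :: "'a::field_char_0 \<Rightarrow> 'a set"
  assumes td: "infinite_transcendence_degree TYPE('a)" and N: "gt_base (range N)"
  shows "\<exists>D :: 'a set \<times> bool \<Rightarrow> 'a \<Rightarrow> 'a. (\<forall>i. derivation (D i)) \<and>
    (\<forall>J. gt_base (deriv_base (range N) D J)) \<and>
    (\<forall>J J'. \<not> J' \<subseteq> J \<longrightarrow> \<not> refines_topology (base_topology (deriv_base (range N) D J)) (base_topology (deriv_base (range N) D J'))) \<and>
    (\<forall>J. refines_topology (base_topology (deriv_base (range N) D J)) (base_topology (range N)))"
proof -
  have fb: "field_base (range N)" using N by (simp add: gt_base_def)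
  have nN: "\<not> N \<alpha> \<subseteq> L" if "subfield_set L" "L \<noteq> UNIV" for \<alpha> L
    by (rule base_set_not_in_subfield[OF N _ that]) simp
  have "\<exists>D :: 'a set \<times> bool \<Rightarrow> 'a \<Rightarrow> 'a. (\<forall>i. derivation (D i)) \<and>
    (\<forall>\<alpha> i F. finite F \<longrightarrow> i \<notin> F \<longrightarrow> (\<exists>b\<in>N \<alpha>. D i b = 1 \<and> (\<forall>j\<in>F. D j b = 0)))"
  proof (rule independent_derivations[of N, OF td nN])
    fix D :: "'a set \<times> bool \<Rightarrow> 'a \<Rightarrow> 'a"
    assume a: "\<And>i. derivation (D i)"
      "\<And>\<alpha> i F. finite F \<Longrightarrow> i \<notin> F \<Longrightarrow> \<exists>b\<in>N \<alpha>. D i b = 1 \<and> (\<forall>j\<in>F. D j b = 0)"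
    show ?thesis by (intro exI[of _ D] conjI allI impI a)
  qed
  then obtain D :: "'a set \<times> bool \<Rightarrow> 'a \<Rightarrow> 'a" where D': "\<forall>i. derivation (D i)"
    and ind': "\<forall>\<alpha> i F. finite F \<longrightarrow> i \<notin> F \<longrightarrow> (\<exists>b\<in>N \<alpha>. D i b = 1 \<and> (\<forall>j\<in>F. D j b = 0))"
    by (elim exE conjE)
  note D = D'[rule_format] and ind = ind'[rule_format]
  have elt: "\<exists>b\<in>deriv_set D V F. D i b = 1" if V: "V \<in> range N" "finite F" "i \<notin> F" for V F i
  proof -
    obtain \<alpha> where "V = N \<alpha>" using V(1) by auto
    then obtain b where b: "b \<in> V" "D i b = 1" "\<forall>j\<in>F. D j b = 0" using ind[OF V(2,3), of \<alpha>] by auto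
    have "0 \<in> V" using field_baseD(2)[OF fb V(1)] .
    then show ?thesis using b by (intro bexI[of _ b]) (simp_all add: deriv_set_def)
  qed
  have infI: "infinite (UNIV :: ('a set \<times> bool) set)"
  proof
    assume "finite (UNIV :: ('a set \<times> bool) set)"
    then have "finite (range (\<lambda>x :: 'a. ({x}, True)))" by (rule finite_subset[rotated]) simp
    moreover have "inj (\<lambda>x :: 'a. ({x}, True))" by (auto intro: injI)
    ultimately show False using infinite_UNIV_char_0[where 'a = 'a] by (simp add: finite_image_iff)
  qed
  have gt: "gt_base (deriv_base (range N) D J)" for J
  proof (rule gt_base_deriv_base[OF N D])
    fix V and F :: "('a set \<times> bool) set" assume V: "V \<in> range N" "finite F"
    obtain i where "i \<notin> F" using ex_new_if_finite[OF infI V(2)] by auto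
    from elt[OF V this] obtain b where "b \<in> deriv_set D V F" "D i b = 1" by auto
    then show "\<exists>x\<in>deriv_set D V F. x \<noteq> 0" using derivation_simps(1)[OF D, of i] by (intro bexI[of _ b]) auto
  qed
  then have fbD: "field_base (deriv_base (range N) D J)" for J by (simp add: gt_base_def)
  have nref: "\<not> refines_topology (base_topology (deriv_base (range N) D J)) (base_topology (deriv_base (range N) D J'))"
    if "\<not> J' \<subseteq> J" for J J'
  proof
    assume r: "refines_topology (base_topology (deriv_base (range N) D J)) (base_topology (deriv_base (range N) D J'))"
    obtain i where i: "i \<in> J'" "i \<notin> J" using \<open>\<not> J' \<subseteq> J\<close> by auto
    \<comment> \<open>A neighbourhood without 1 is contradicted by an element whose derivative is
      exactly 1.\<close>
    obtain W where W: "W \<in> range N" "1 \<notin> W" using field_baseD(8)[OF fb, of 1] by auto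
    have "deriv_set D W {i} \<in> deriv_base (range N) D J'" using W(1) i(1) by (intro deriv_base_memI) auto
    then have "\<exists>V\<in>deriv_base (range N) D J. V \<subseteq> deriv_set D W {i}"
      using r unfolding refines_base[OF fbD fbD] by simp
    then obtain V' where V': "V' \<in> deriv_base (range N) D J" "V' \<subseteq> deriv_set D W {i}" by auto
    then obtain V F where V: "V' = deriv_set D V F" "V \<in> range N" "finite F" "F \<subseteq> J" by (elim deriv_base_memE)
    have "i \<notin> F" using i(2) V(4) by auto
    from elt[OF V(2,3) this] obtain b where "b \<in> V'" "D i b = 1" using V(1) by auto
    then have "1 \<in> W" using V'(2) by (auto simp: deriv_set_def)
    then show False using W(2) by simp
  qed
  have ref: "refines_topology (base_topology (deriv_base (range N) D J)) (base_topology (range N))" for J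
    unfolding refines_base[OF fb fbD]
  proof
    fix U assume "U \<in> range N"
    then show "\<exists>V\<in>deriv_base (range N) D J. V \<subseteq> U"
      by (intro bexI[of _ "deriv_set D U {}"] deriv_base_memI) (auto simp: deriv_set_def)
  qed
  show ?thesis by (intro exI[of _ D] conjI allI impI D gt nref ref)
qed

lemma many_refinements:
  fixes N :: "'a::field_char_0 \<Rightarrow> 'a set"
  assumes td: "infinite_transcendence_degree TYPE('a)" and N: "gt_base (range N)"
  shows "exist_pairwise_incomparable (ctwo ^c (ctwo ^c |UNIV :: 'a set| ))
      (\<lambda>\<sigma>. gt_henselian \<sigma> \<and> refines_topology \<sigma> (base_topology (range N)))"
proof -
  obtain D :: "'a set \<times> bool \<Rightarrow> 'a \<Rightarrow> 'a" where D': "\<forall>i. derivation (D i)"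
    "\<forall>J. gt_base (deriv_base (range N) D J)"
    "\<forall>J J'. \<not> J' \<subseteq> J \<longrightarrow> \<not> refines_topology (base_topology (deriv_base (range N) D J)) (base_topology (deriv_base (range N) D J'))"
    "\<forall>J. refines_topology (base_topology (deriv_base (range N) D J)) (base_topology (range N))"
    using derivation_topologies[OF td N] by (elim exE conjE)
  note D = D'(1)[rule_format] D'(2)[rule_format] D'(3)[rule_format] D'(4)[rule_format]
  \<comment> \<open>For every Y exactly one of the two indices (Y, True) and (Y, False) is in
    \<open>J S\<close>, so different S give index sets of which neither contains the other.\<close>
  define J where "J = (\<lambda>S :: 'a set set. {(Y, c). (Y \<in> S) = c})"
  have J: "\<not> J S \<subseteq> J S'" if S: "S \<noteq> S'" for S S'
  proof -
    obtain Y where "(Y \<in> S) \<noteq> (Y \<in> S')" using S by auto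
    then have "(Y, Y \<in> S) \<in> J S" "(Y, Y \<in> S) \<notin> J S'" by (auto simp: J_def)
    then show ?thesis by auto
  qed
  show ?thesis
  proof (rule exist_family[where T = "\<lambda>S. base_topology (deriv_base (range N) D (J S))"])
    show "|UNIV :: 'a set set set| =o ctwo ^c (ctwo ^c |UNIV :: 'a set| )" by (rule card_UNIV_set_set)
    show "incomparable (base_topology (deriv_base (range N) D (J S))) (base_topology (deriv_base (range N) D (J S')))"
      if "S \<noteq> S'" for S S'
      unfolding incomparable_def using D(3)[OF J[OF that]] D(3)[OF J[OF that[symmetric]]] by simp
    show "gt_henselian (base_topology (deriv_base (range N) D (J S))) \<and>
        refines_topology (base_topology (deriv_base (range N) D (J S))) (base_topology (range N))" for S
      using gt_henselian_base[OF D(2)] D(4) by simp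
  qed
qed

lemma field_base_mult_add:
  assumes B: "field_base B" and U: "U \<in> B"
  shows "\<exists>V\<in>B. \<forall>a\<in>V. \<forall>b\<in>V. \<forall>c\<in>V. \<forall>d\<in>V. a * b + c * d \<in> U"
proof -
  have "base_conv B (\<lambda>f :: nat \<Rightarrow> 'a. f 0 * f 1 + f 2 * f 3) (0 * 0 + 0 * 0) (tuple_filter B)"
    by (intro base_conv_add[OF B] base_conv_mult[OF B] base_conv_tuple[OF B])
  then have "eventually (\<lambda>f :: nat \<Rightarrow> 'a. f 0 * f 1 + f 2 * f 3 \<in> U) (tuple_filter B)" using U by (auto simp: base_conv_def)
  then obtain V where V: "V \<in> B" "\<And>f :: nat \<Rightarrow> 'a. (\<forall>i. f i \<in> V) \<Longrightarrow> f 0 * f 1 + f 2 * f 3 \<in> U"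
    unfolding eventually_tuple[OF B] by auto
  have "x * y + z * w \<in> U" if "x \<in> V" "y \<in> V" "z \<in> V" "w \<in> V" for x y z w
    using V(2)[of "\<lambda>n. if n = 0 then x else if n = 1 then y else if n = 2 then z else w"] that by simp
  then show ?thesis by (intro bexI[OF _ V(1)] ballI)
qed

lemma locally_bounded_base:
  assumes B: "field_base B" and U: "U \<in> B" "\<And>W. W \<in> B \<Longrightarrow> \<exists>c. c \<noteq> 0 \<and> (\<forall>x\<in>U. c * x \<in> W)"
  shows "locally_bounded (base_topology B)"
  unfolding locally_bounded_def
proof (intro exI conjI)
  let ?O = "{y. eventually (\<lambda>z. z \<in> U) (near B y)}"
  show "openin (base_topology B) ?O" by (rule openin_near[OF B])
  have "0 \<in> ?O" using U(1) by (auto simp: eventually_near[OF B])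
  then show "?O \<noteq> {}" by auto
  have OU: "?O \<subseteq> U" using near_self[OF B, of "\<lambda>z. z \<in> U"] by auto
  show "field_bounded (base_topology B) ?O"
    unfolding field_bounded_def
  proof (intro allI impI)
    fix W' assume "nbhd (base_topology B) 0 W'"
    then obtain W where W: "W \<in> B" "W \<subseteq> W'" unfolding nbhd_base_topology_0[OF B] by auto
    obtain c where c: "c \<noteq> 0" "\<forall>x\<in>U. c * x \<in> W" using U(2)[OF W(1)] by auto
    then show "\<exists>c. c \<noteq> 0 \<and> (\<lambda>x. c * x) ` ?O \<subseteq> W'" using OU W(2) by (intro exI[of _ c]) auto
  qed
qed

text \<open>A bounded open set is moved to 0: if u + V lies in it, then c x = c (u + x) - c u is
  small for x in V.\<close>

lemma bounded_nbhd:
  assumes T: "gt_henselian T" and lb: "locally_bounded T"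
  shows "\<exists>U. nbhd T 0 U \<and> (\<forall>W. nbhd T 0 W \<longrightarrow> (\<exists>c. c \<noteq> 0 \<and> (\<forall>x\<in>U. c * x \<in> W)))"
proof -
  have ft: "field_topology T" using T by (simp add: gt_henselian_def)
  have ts: "topspace T = UNIV" using ft by (simp add: field_topology_def)
  obtain O' u where O': "openin T O'" "u \<in> O'" "field_bounded T O'" using lb by (auto simp: locally_bounded_def)
  have "u + 0 \<in> O'" using O' by simp
  from nbhd_add[OF ft O'(1) this] obtain V1 V where V: "openin T V1" "openin T V" "u \<in> V1" "0 \<in> V"
    "\<And>x y. x \<in> V1 \<Longrightarrow> y \<in> V \<Longrightarrow> x + y \<in> O'" by auto
  have nV: "nbhd T 0 V" unfolding nbhd_def using V(2,4) ts by (intro conjI exI[of _ V]) simp_all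
  have bd: "\<exists>c. c \<noteq> 0 \<and> (\<forall>x\<in>V. c * x \<in> W)" if W: "nbhd T 0 W" for W
  proof -
    have nb: "gt_base {U. nbhd T 0 U}" by (rule gt_base_of_nbhd_base(1)[OF T nbhd_base_all])
    then have fb: "field_base {U. nbhd T 0 U}" by (simp add: gt_base_def)
    obtain Z where Z: "nbhd T 0 Z" "\<forall>x\<in>Z. \<forall>y\<in>Z. x - y \<in> W" using field_baseD(4)[OF fb, of W] W by auto
    obtain c where c: "c \<noteq> 0" "(\<lambda>x. c * x) ` O' \<subseteq> Z" using O'(3) Z(1) unfolding field_bounded_def by auto
    have "c * x \<in> W" if "x \<in> V" for x
    proof -
      have "c * (u + x) \<in> Z" "c * u \<in> Z" using c(2) V(5)[OF V(3) that] O'(2) by auto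
      then have "c * (u + x) - c * u \<in> W" using Z(2) by simp
      then show ?thesis by (simp add: algebra_simps)
    qed
    then show ?thesis using c(1) by auto
  qed
  show ?thesis by (intro exI[of _ V] conjI allI impI nV bd)
qed

text \<open>A multiplier c must control both c x and D(c x) = c D(x) + D(c) x. Taking c small
  together with D(c), relative to a scalar e that shrinks U, achieves both.\<close>

lemma locally_bounded_deriv:
  assumes B: "field_base B" and D: "\<And>i. derivation (D i)" and E: "gt_base (deriv_base B D {i})"
    and U: "U \<in> B" "\<And>W. W \<in> B \<Longrightarrow> \<exists>c. c \<noteq> 0 \<and> (\<forall>x\<in>U. c * x \<in> W)"
  shows "locally_bounded (base_topology (deriv_base B D {i}))"
proof (rule locally_bounded_base)
  show "field_base (deriv_base B D {i})" using E by (simp add: gt_base_def)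
  show "deriv_set D U {i} \<in> deriv_base B D {i}" using U(1) by (intro deriv_base_memI) auto
  fix W' assume "W' \<in> deriv_base B D {i}"
  then obtain W F where W: "W' = deriv_set D W F" "W \<in> B" "finite F" "F \<subseteq> {i}" by (elim deriv_base_memE)
  obtain V where V: "V \<in> B" "\<forall>a\<in>V. \<forall>b\<in>V. \<forall>c\<in>V. \<forall>d\<in>V. a * b + c * d \<in> W"
    using field_base_mult_add[OF B W(2)] by auto
  \<comment> \<open>The scalar e brings x and D(x) into V; afterwards c and D(c) are taken so small
    that they stay in V after division by e.\<close>
  obtain e where e: "e \<noteq> 0" "\<forall>x\<in>U. e * x \<in> V" using U(2)[OF V(1)] by auto
  obtain V2 where V2: "V2 \<in> B" "\<forall>x\<in>V2. inverse e * x \<in> V" using field_baseD(6)[OF B V(1)] by auto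
  have V2': "deriv_set D V2 {i} \<in> deriv_base B D {i}" using V2(1) by (intro deriv_base_memI) auto
  have "\<exists>c\<in>deriv_set D V2 {i}. c \<noteq> 0" using E V2' by (simp add: gt_base_def)
  then obtain c where c: "c \<in> deriv_set D V2 {i}" "c \<noteq> 0" by (elim bexE)
  then have cV: "inverse e * c \<in> V" "inverse e * D i c \<in> V" using V2(2) by (auto simp: deriv_set_def)
  have can: "(inverse e * a) * (e * b) = a * b" for a b
  proof -
    have "(inverse e * a) * (e * b) = (inverse e * e) * (a * b)" by (simp only: ac_simps)
    then show ?thesis using e(1) by simp
  qed
  have z: "0 \<in> V" using field_baseD(2)[OF B V(1)] .
  have "c * x \<in> W'" if x: "x \<in> deriv_set D U {i}" for x
  proof -
    have xU: "e * x \<in> V" "e * D i x \<in> V" using x e(2) by (auto simp: deriv_set_def)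
    have "(inverse e * c) * (e * x) + 0 * 0 \<in> W" by (rule V(2)[rule_format, OF cV(1) xU(1) z z])
    then have 1: "c * x \<in> W" unfolding can by simp
    have "(inverse e * c) * (e * D i x) + (inverse e * D i c) * (e * x) \<in> W" using V(2) cV xU by simp
    then have "D i (c * x) \<in> W" unfolding can by (simp add: derivation_simps(6)[OF D])
    then show ?thesis using 1 W(1,4) by (auto simp: deriv_set_def)
  qed
  then show "\<exists>c. c \<noteq> 0 \<and> (\<forall>x\<in>deriv_set D U {i}. c * x \<in> W')" using c(2) by auto
qed

text \<open>One derivation at a time: the index sets are singletons, so the base keeps size |K|, and
  boundedness of the original base set is inherited.\<close>

lemma many_small:
  fixes N :: "'a::field_char_0 \<Rightarrow> 'a set"
  assumes td: "infinite_transcendence_degree TYPE('a)" and N: "gt_base (range N)"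
  shows "exist_pairwise_incomparable (ctwo ^c |UNIV :: 'a set| )
      (\<lambda>\<sigma>. gt_henselian \<sigma> \<and> weight \<sigma> \<le>o |UNIV :: 'a set| \<and> refines_topology \<sigma> (base_topology (range N)) \<and>
        ((\<exists>U\<in>range N. \<forall>W\<in>range N. \<exists>c. c \<noteq> 0 \<and> (\<forall>x\<in>U. c * x \<in> W)) \<longrightarrow> locally_bounded \<sigma>))"
proof -
  obtain D :: "'a set \<times> bool \<Rightarrow> 'a \<Rightarrow> 'a" where D': "\<forall>i. derivation (D i)"
    "\<forall>J. gt_base (deriv_base (range N) D J)"
    "\<forall>J J'. \<not> J' \<subseteq> J \<longrightarrow> \<not> refines_topology (base_topology (deriv_base (range N) D J)) (base_topology (deriv_base (range N) D J'))"
    "\<forall>J. refines_topology (base_topology (deriv_base (range N) D J)) (base_topology (range N))"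
    using derivation_topologies[OF td N] by (elim exE conjE)
  note D = D'(1)[rule_format] D'(2)[rule_format] D'(3)[rule_format] D'(4)[rule_format]
  have fb: "field_base (range N)" using N by (simp add: gt_base_def)
  define J where "J = (\<lambda>Y :: 'a set. {(Y, True)})"
  have J: "\<not> J S \<subseteq> J S'" if "S \<noteq> S'" for S S' using that by (auto simp: J_def)
  show ?thesis
  proof (rule exist_family[where T = "\<lambda>S. base_topology (deriv_base (range N) D (J S))"])
    show "|UNIV :: 'a set set| =o ctwo ^c |UNIV :: 'a set|" by (rule card_UNIV_set)
    show "incomparable (base_topology (deriv_base (range N) D (J S))) (base_topology (deriv_base (range N) D (J S')))"
      if "S \<noteq> S'" for S S'
      unfolding incomparable_def using D(3)[OF J[OF that]] D(3)[OF J[OF that[symmetric]]] by simp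
    fix S
    have "deriv_base (range N) D (J S) \<subseteq> (\<lambda>(\<alpha>, c). deriv_set D (N \<alpha>) (if c then J S else {})) ` (UNIV \<times> UNIV)"
    proof
      fix U assume "U \<in> deriv_base (range N) D (J S)"
      then obtain V F where V: "U = deriv_set D V F" "V \<in> range N" "F \<subseteq> J S" by (elim deriv_base_memE)
      then obtain \<alpha> where a: "V = N \<alpha>" by auto
      have "F = (if F = J S then J S else {})" using V(3) by (auto simp: J_def)
      then show "U \<in> (\<lambda>(\<alpha>, c). deriv_set D (N \<alpha>) (if c then J S else {})) ` (UNIV \<times> UNIV)"
        using V(1) a by (intro image_eqI[of _ _ "(\<alpha>, F = J S)"]) auto
    qed
    then have "|deriv_base (range N) D (J S)| \<le>o |(UNIV :: 'a set) \<times> (UNIV :: bool set)|"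
      by (rule ordLeq_transitive[OF card_of_mono1 card_of_image])
    also have "|(UNIV :: 'a set) \<times> (UNIV :: bool set)| \<le>o |UNIV :: 'a set|"
    proof (rule card_of_Times_ordLeq_infinite_Field)
      show "\<not> finite (Field |UNIV :: 'a set| )" by (simp add: Field_card_of infinite_UNIV_char_0)
      show "|UNIV :: bool set| \<le>o |UNIV :: 'a set|" by (rule finite_ordLeq_infinite) (simp_all add: infinite_UNIV_char_0)
    qed (simp_all add: card_of_Card_order card_of_mono1)
    finally have "weight (base_topology (deriv_base (range N) D (J S))) \<le>o |UNIV :: 'a set|"
      using D(2)[of "J S"] by (intro weight_base_topology) (simp_all add: gt_base_def)
    moreover have "locally_bounded (base_topology (deriv_base (range N) D (J S)))"
      if lb: "\<exists>U\<in>range N. \<forall>W\<in>range N. \<exists>c. c \<noteq> 0 \<and> (\<forall>x\<in>U. c * x \<in> W)"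
    proof -
      from lb obtain U where U: "U \<in> range N" "\<And>W. W \<in> range N \<Longrightarrow> \<exists>c. c \<noteq> 0 \<and> (\<forall>x\<in>U. c * x \<in> W)" by auto
      show ?thesis unfolding J_def
        by (rule locally_bounded_deriv[OF fb D(1,2) U])
    qed
    ultimately show "gt_henselian (base_topology (deriv_base (range N) D (J S))) \<and>
        weight (base_topology (deriv_base (range N) D (J S))) \<le>o |UNIV :: 'a set| \<and>
        refines_topology (base_topology (deriv_base (range N) D (J S))) (base_topology (range N)) \<and>
        ((\<exists>U\<in>range N. \<forall>W\<in>range N. \<exists>c. c \<noteq> 0 \<and> (\<forall>x\<in>U. c * x \<in> W)) \<longrightarrow>
          locally_bounded (base_topology (deriv_base (range N) D (J S))))"
      using gt_henselian_base[OF D(2)] D(4) by simp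
  qed
qed

lemma exist_pairwise_incomparable_mono:
  "exist_pairwise_incomparable \<kappa> P \<Longrightarrow> (\<And>T. P T \<Longrightarrow> Q T) \<Longrightarrow> exist_pairwise_incomparable \<kappa> Q"
  unfolding exist_pairwise_incomparable_def by auto

text \<open>The multiples c U of one bounded neighbourhood form a base, and they are indexed by
  K.\<close>

lemma locally_bounded_small_base:
  fixes T :: "'a::field_char_0 topology"
  assumes T: "gt_henselian T" and lb: "locally_bounded T"
  obtains N :: "'a \<Rightarrow> 'a set" where "gt_base (range N)" "base_topology (range N) = T"
    "\<exists>U\<in>range N. \<forall>W\<in>range N. \<exists>c. c \<noteq> 0 \<and> (\<forall>x\<in>U. c * x \<in> W)"
proof -
  obtain U where U: "nbhd T 0 U" "\<And>W. nbhd T 0 W \<Longrightarrow> \<exists>c. c \<noteq> 0 \<and> (\<forall>x\<in>U. c * x \<in> W)"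
    using bounded_nbhd[OF T lb] by (elim exE conjE) simp
  have ts: "topspace T = UNIV" using T by (simp add: gt_henselian_def field_topology_def)
  have fb: "field_base {U. nbhd T 0 U}"
    using gt_base_of_nbhd_base(1)[OF T nbhd_base_all] by (simp add: gt_base_def)
  have up: "nbhd T 0 W" if "nbhd T 0 V" "V \<subseteq> W" for V W
  proof -
    from that(1) obtain Z where "openin T Z" "0 \<in> Z" "Z \<subseteq> V" unfolding nbhd_def by (elim conjE exE)
    then show ?thesis using that(2) ts unfolding nbhd_def by (intro conjI exI[of _ Z]) simp_all
  qed
  \<comment> \<open>The value at 0 is set to U, because 0 U would not be a neighbourhood.\<close>
  define N where "N = (\<lambda>c :: 'a. if c = 0 then U else (\<lambda>x. c * x) ` U)"
  have Nn: "nbhd T 0 (N c)" for c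
  proof (cases "c = 0")
    case False
    obtain V where V: "nbhd T 0 V" "\<forall>x\<in>V. inverse c * x \<in> U" using field_baseD(6)[OF fb, of U "inverse c"] U(1) by auto
    have "V \<subseteq> (\<lambda>x. c * x) ` U"
    proof
      fix x assume "x \<in> V"
      then have "inverse c * x \<in> U" using V(2) by simp
      moreover have "x = c * (inverse c * x)" using False by (simp add: mult.assoc[symmetric])
      ultimately show "x \<in> (\<lambda>x. c * x) ` U" by (rule rev_image_eqI)
    qed
    then show ?thesis using up[OF V(1)] False by (simp add: N_def)
  qed (simp add: N_def U(1))
  have nb: "nbhd_base T (range N)"
    unfolding nbhd_base_def
  proof (intro conjI allI impI)
    show "\<forall>U\<in>range N. nbhd T 0 U" using Nn by auto
    fix W assume "nbhd T 0 W"
    from U(2)[OF this] obtain c where "c \<noteq> 0" "\<forall>x\<in>U. c * x \<in> W" by auto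
    then show "\<exists>V\<in>range N. V \<subseteq> W" by (intro bexI[of _ "N c"]) (auto simp: N_def)
  qed
  have "U \<in> range N" by (intro range_eqI[of _ _ 0]) (simp add: N_def)
  then have "\<exists>U\<in>range N. \<forall>W\<in>range N. \<exists>c. c \<noteq> 0 \<and> (\<forall>x\<in>U. c * x \<in> W)"
    using U(2) Nn by (intro bexI[of _ U]) auto
  then show ?thesis using that[of N] gt_base_of_nbhd_base[OF T nb] by simp
qed

unbundle no vec_syntax

section \<open>Algebraic power series\<close>

lemma is_hom_fps_of_poly: "is_hom (fps_of_poly :: 'a::field poly \<Rightarrow> 'a fps)"
  by (rule is_homI) (simp_all add: fps_of_poly_add fps_of_poly_mult)

lemma of_nat_fps_nth: "(of_nat n :: 'a::comm_ring_1 fps) $ 0 = of_nat n"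
  by (induction n) simp_all

interpretation ps: idom_extension "fps_of_poly :: 'a::field_char_0 poly \<Rightarrow> 'a fps"
proof
  show "is_hom (fps_of_poly :: 'a poly \<Rightarrow> 'a fps)" by (rule is_hom_fps_of_poly)
  show "fps_of_poly r = 0 \<Longrightarrow> r = 0" for r :: "'a poly"
    using fps_of_poly_eq_iff[of r 0] by simp
  show "of_nat n = (0 :: 'a fps) \<Longrightarrow> n = 0" for n
    using of_nat_fps_nth[of n, where 'a = 'a] by simp
qed

lemma poly_fps_nth_cong:
  assumes "\<And>k. k \<le> n \<Longrightarrow> y $ k = z $ k"
  shows "k \<le> n \<Longrightarrow> poly p y $ k = poly p (z :: 'a::comm_ring_1 fps) $ k"
proof (induction p arbitrary: k)
  case (pCons a p)
  have "(\<Sum>i=0..k. y $ i * poly p y $ (k - i)) = (\<Sum>i=0..k. z $ i * poly p z $ (k - i))"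
    by (intro sum.cong refl) (use pCons.prems assms pCons.IH in auto)
  then show ?case by (simp add: fps_mult_nth)
qed simp

lemma poly_taylor2:
  fixes p :: "'a::idom poly"
  shows "\<exists>q. poly p (y + u) = poly p y + u * poly (pderiv p) y + u * u * q"
proof (induction p)
  case 0
  then show ?case by (intro exI[of _ 0]) simp
next
  case (pCons a p)
  then obtain q where q: "poly p (y + u) = poly p y + u * poly (pderiv p) y + u * u * q" by auto
  have "poly (pCons a p) (y + u) = a + (y + u) * (poly p y + u * poly (pderiv p) y + u * u * q)"
    by (simp only: poly_pCons q)
  also have "\<dots> = poly (pCons a p) y + u * poly (pderiv (pCons a p)) y + u * u * (y * q + poly (pderiv p) y + u * q)"
    by (simp add: pderiv_pCons algebra_simps)
  finally show ?case by (rule exI)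
qed

lemma poly_fps_nth_0:
  "poly p y $ 0 = poly (map_poly (\<lambda>f. f $ 0) p) (y $ 0 :: 'a::comm_ring_1)"
  by (induction p) (simp_all add: map_poly_pCons)

lemma pderiv_map_nth_0: "pderiv (map_poly (\<lambda>f. f $ 0) p) = map_poly (\<lambda>f. f $ 0) (pderiv (p :: 'a::idom fps poly))"
  by (rule poly_eqI) (simp add: coeff_pderiv coeff_map_poly of_nat_fps_nth del: of_nat_Suc)

text \<open>Newton's method, one coefficient at a time. The correction c X^(n+1) changes the
  coefficient n+1 of p(y) by c p'(y)(0) and none below it, since the quadratic Taylor term has
  higher order.\<close>

lemma fps_hensel:
  fixes p :: "'a::field fps poly"
  assumes root: "poly (map_poly (\<lambda>f. f $ 0) p) x = 0"
    and simple: "poly (pderiv (map_poly (\<lambda>f. f $ 0) p)) x \<noteq> 0"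
  shows "\<exists>y. y $ 0 = x \<and> poly p y = 0"
proof -
  define ok where "ok = (\<lambda>n y. y $ 0 = x \<and> (\<forall>k\<le>n. poly p y $ k = 0))"
  have "\<exists>s. \<forall>n. ok n (s n) \<and> (\<forall>k\<le>n. s (Suc n) $ k = s n $ k)"
  proof (rule dependent_nat_choice)
    show "\<exists>y. ok 0 y" using root by (intro exI[of _ "fps_const x"]) (simp add: ok_def poly_fps_nth_0)
  next
    fix y n assume y: "ok n y"
    let ?d = "poly (pderiv p) y $ 0"
    have d: "?d \<noteq> 0" using simple y by (simp add: poly_fps_nth_0 pderiv_map_nth_0 ok_def)
    define c where "c = - (poly p y $ Suc n) / ?d"
    define u where "u = fps_const c * fps_X ^ Suc n"
    have u: "(u * f) $ k = (if k < Suc n then 0 else c * f $ (k - Suc n))" for f k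
      by (simp add: u_def mult.assoc fps_X_power_mult_nth del: power_Suc)
    have u1: "u $ k = (if k = Suc n then c else 0)" for k
      by (simp add: u_def fps_X_power_nth del: power_Suc)
    obtain q where q: "poly p (y + u) = poly p y + u * poly (pderiv p) y + u * u * q"
      using poly_taylor2[of p y u] by auto
    have "ok (Suc n) (y + u)"
      unfolding ok_def
    proof (intro conjI allI impI)
      show "(y + u) $ 0 = x" using y by (simp add: ok_def u1)
      fix k assume "k \<le> Suc n"
      then show "poly p (y + u) $ k = 0"
      proof (cases "k = Suc n")
        case True
        have "(u * q) $ 0 = 0" by (simp add: u1)
        then show ?thesis using True d unfolding q mult.assoc[of u u q]
          by (simp add: u c_def del: fps_mult_nth_0)
      next
        case False
        then have "k \<le> n" using \<open>k \<le> Suc n\<close> by simp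
        then show ?thesis using y unfolding q mult.assoc[of u u q]
          by (simp add: u ok_def del: fps_mult_nth_0)
      qed
    qed
    then show "\<exists>y'. ok (Suc n) y' \<and> (\<forall>k\<le>n. y' $ k = y $ k)"
      by (intro exI[of _ "y + u"]) (simp add: u1)
  qed
  then obtain s where s: "\<And>n. ok n (s n)" and st: "\<And>n k. k \<le> n \<Longrightarrow> s (Suc n) $ k = s n $ k" by auto
  have st': "s m $ k = s n $ k" if "k \<le> n" "n \<le> m" for k n m
    using that(2,1) by (induction m rule: dec_induct) (use st in auto)
  define y where "y = Abs_fps (\<lambda>n. s n $ n)"
  have y: "y $ k = s n $ k" if "k \<le> n" for k n using st'[of k k n] that by (simp add: y_def)
  have "poly p y = 0"
  proof (rule fps_ext)
    fix n
    have "poly p y $ n = poly p (s n) $ n" by (rule poly_fps_nth_cong[OF y]) auto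
    then show "poly p y $ n = 0 $ n" using s[of n] by (simp add: ok_def)
  qed
  moreover have "y $ 0 = x" using y[of 0 0] s[of 0] by (simp add: ok_def)
  ultimately show ?thesis by auto
qed

lemma hev_pcompose:
  assumes "is_hom h"
  shows "hev h (pcompose P Q) x = hev h P (hev h Q x)"
  by (induction P)
    (simp_all add: pcompose_pCons hev_pCons[OF assms] is_homD(1,3,4)[OF is_hom_hev[OF assms]] is_homD(1)[OF assms])

lemma fps_of_poly_poly: "fps_of_poly (poly P a) = hev fps_of_poly P (fps_of_poly (a :: 'a::field poly))"
  by (induction P) (simp_all add: hev_pCons is_hom_fps_of_poly fps_of_poly_add fps_of_poly_mult)

lemma coeff_1_shift: "coeff (pcompose f [:a, 1:]) 1 = poly (pderiv f) (a :: 'a::idom)"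
proof -
  have "coeff (pderiv (pcompose f [:a, 1:])) 0 = poly (pderiv f) a"
    by (simp add: pderiv_pcompose pderiv_pCons coeff_mult_0)
  then show ?thesis by (simp add: coeff_pderiv)
qed

lemma coeff_scale: "coeff (pcompose f [:0, a :: 'a::comm_ring_1:]) i = a ^ i * coeff f i"
proof (induction f arbitrary: i)
  case (pCons c f)
  then show ?case by (cases i) (simp_all add: pcompose_pCons coeff_pCons mult_ac)
qed simp

text \<open>Replacing \<open>z\<close> by a tail \<open>(z - z_0) / t^N\<close> turns its equation into one that is linear with
  nonzero slope at \<open>t = 0\<close>.\<close>

lemma smooth_model:
  fixes z :: "'a::field_char_0 fps"
  assumes z: "ps.alg z"
  shows "\<exists>w g. ps.alg w \<and> z \<in> ps.adj w \<and> hev fps_of_poly g w = 0 \<and>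
    poly (coeff g 1) 0 \<noteq> 0 \<and> (\<forall>i\<ge>2. poly (coeff g i) 0 = 0)"
proof -
  define A where "A = (\<lambda>P. P \<noteq> 0 \<and> hev fps_of_poly P z = 0)"
  obtain P where "A P" using z by (auto simp: ps.alg_def A_def)
  define f where "f = arg_min degree A"
  have f: "A f" and min: "\<And>p. A p \<Longrightarrow> degree f \<le> degree p"
    using arg_min_nat_lemma[of A P degree] \<open>A P\<close> by (auto simp: f_def)
  have df: "degree f \<noteq> 0"
  proof
    assume "degree f = 0"
    then obtain c where c: "f = [:c:]" by (rule degree_eq_zeroE)
    then have "fps_of_poly c = 0" using f by (simp add: A_def hev_pCons[OF ps.hom])
    then show False using ps.inj f c by (simp add: A_def)
  qed
  have "degree (pderiv f) < degree f" using df by (simp add: degree_pderiv)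
  moreover have "pderiv f \<noteq> 0" using df by (simp add: pderiv_eq_0_iff)
  ultimately have nz: "hev fps_of_poly (pderiv f) z \<noteq> 0" using min[of "pderiv f"] by (auto simp: A_def)
  \<comment> \<open>N = e + 1 ensures that f'(z_0) still has order exactly e, and that the terms of
    degree at least 2 have order at least 2N, which exceeds N + e.\<close>
  define e where "e = subdegree (hev fps_of_poly (pderiv f) z)"
  define N where "N = Suc e"
  define z0 where "z0 = truncate_fps N z"
  define w where "w = fps_shift N z"
  define L :: "'a poly poly" where "L = [:z0, monom 1 N:]"
  have z0: "fps_of_poly z0 = fps_cutoff N z" by (simp add: z0_def)
  have Lw: "hev fps_of_poly L w = z"
  proof -
    have "hev fps_of_poly L w = fps_cutoff N z + fps_shift N z * fps_X ^ N"
      by (simp add: L_def hev_pCons[OF ps.hom] z0 fps_of_poly_monom' w_def)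
    then show ?thesis using fps_shift_cutoff'[of N z] by (simp add: ac_simps)
  qed
  have zadj: "z \<in> ps.adj w" using ps.adj_hev[of L w] Lw by simp
  have wadj: "ps.alg w"
  proof -
    have "fps_of_poly (monom 1 N) * w = z - fps_of_poly z0"
      using Lw by (simp add: L_def hev_pCons[OF ps.hom] mult.commute eq_diff_eq add.commute)
    also have "z - fps_of_poly z0 \<in> ps.adj z"
      using ps.adj_ring(1)[OF ps.adj_self ps.adj_h[of "- z0"]] by (simp add: fps_of_poly_uminus)
    finally have "w \<in> ps.adj z" by (rule ps.adj_divide) simp
    then show ?thesis by (rule ps.adj_alg[OF z])
  qed
  define F where "F = pcompose f L"
  have Fw: "hev fps_of_poly F w = 0" using f by (simp add: F_def hev_pcompose[OF ps.hom] Lw A_def)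
  have "L = pcompose [:z0, 1:] [:0, monom 1 N:]" by (simp add: L_def pcompose_pCons)
  then have "F = pcompose (pcompose f [:z0, 1:]) [:0, monom 1 N:]" by (simp add: F_def pcompose_assoc)
  then have cF: "coeff F i = monom 1 N ^ i * coeff (pcompose f [:z0, 1:]) i" for i by (simp add: coeff_scale)
  let ?d = "poly (pderiv f) z0"
  have dn: "coeff ?d k = hev fps_of_poly (pderiv f) z $ k" if "k < N" for k
  proof -
    have "fps_of_poly ?d = hev fps_of_poly (pderiv f) (fps_of_poly z0)"
      by (rule fps_of_poly_poly)
    then have "coeff ?d k = poly (map_poly fps_of_poly (pderiv f)) (fps_of_poly z0) $ k"
      by (metis fps_of_poly_nth hev_def)
    also have "\<dots> = poly (map_poly fps_of_poly (pderiv f)) z $ k"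
      by (rule poly_fps_nth_cong[of e]) (use that in \<open>auto simp: z0 N_def\<close>)
    finally show ?thesis by (simp add: hev_def)
  qed
  have d0: "coeff ?d k = 0" if "k < e" for k
    using dn[of k] that nth_less_subdegree_zero[of k "hev fps_of_poly (pderiv f) z"] by (simp add: e_def N_def)
  have de: "coeff ?d e \<noteq> 0" using dn[of e] nz by (simp add: N_def e_def)
  \<comment> \<open>M is the order in t of the linear coefficient of F, the power of t that is
    divided out of F.\<close>
  define M where "M = N + e"
  have mp: "monom 1 N ^ i = (monom 1 (N * i) :: 'a poly)" for i
    by (simp add: monom_power)
  have cm: "coeff (coeff F i) k = (if k < N * i then 0 else coeff (coeff (pcompose f [:z0, 1:]) i) (k - N * i))" for i k
    by (simp add: cF mp coeff_monom_mult)
  have low1: "coeff (coeff F 1) k = 0" if "k < M" for k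
    using that d0[of "k - N"] unfolding cm coeff_1_shift by (auto simp: M_def)
  have lowi: "coeff (coeff F i) k = 0" if "2 \<le> i" "k \<le> M" for i k
  proof -
    have "N * 2 \<le> N * i" using that(1) by (intro mult_le_mono2)
    then have "k < N * i" using that(2) by (simp add: M_def N_def)
    then show ?thesis by (simp add: cm)
  qed
  have lowi1: "coeff (coeff F i) k = 0" if "1 \<le> i" "k < M" for i k
  proof (cases "i = 1")
    case False
    then show ?thesis using lowi[of i k] that by simp
  qed (use low1 that in simp)
  \<comment> \<open>Divisibility of the constant coefficient is not visible from F; it follows from
    F(w) = 0, because all other terms are divisible.\<close>
  have low0: "coeff (coeff F 0) k = 0" if "k < M" for k
  proof -
    have "0 = (\<Sum>i\<le>degree F. fps_of_poly (coeff F i) * w ^ i)"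
      using Fw hev_altdef[OF ps.hom order_refl, of F w] by simp
    also have "\<dots> = fps_of_poly (coeff F 0) + (\<Sum>i=1..degree F. fps_of_poly (coeff F i) * w ^ i)"
      by (simp add: atMost_atLeast0 sum.atLeast_Suc_atMost)
    finally have "(fps_of_poly (coeff F 0) + (\<Sum>i=1..degree F. fps_of_poly (coeff F i) * w ^ i)) $ k = 0 $ k"
      by (rule arg_cong[OF sym])
    moreover have "(fps_of_poly (coeff F i) * w ^ i) $ k = 0" if "i \<in> {1..degree F}" for i
      unfolding fps_mult_nth by (intro sum.neutral) (use lowi1[of i] that \<open>k < M\<close> in auto)
    ultimately show ?thesis by (simp add: fps_sum_nth)
  qed
  have low: "coeff (coeff F i) k = 0" if "k < M" for i k
    using low0 lowi1[of i] that by (cases i) auto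
  define g where "g = map_poly (poly_shift M) F"
  have cg: "coeff g i = poly_shift M (coeff F i)" for i by (simp add: g_def coeff_map_poly)
  have Fg: "F = smult (monom 1 M) g"
    by (rule poly_eqI, rule poly_eqI) (use low in \<open>auto simp: cg coeff_monom_mult coeff_poly_shift\<close>)
  have "fps_X ^ M * hev fps_of_poly g w = 0" using Fw unfolding Fg hev_smult[OF ps.hom] by (simp add: fps_of_poly_monom')
  then have gw: "hev fps_of_poly g w = 0" by simp
  have "poly (coeff g 1) 0 = coeff ?d e"
    unfolding poly_0_coeff_0 cg coeff_poly_shift cm coeff_1_shift by (simp add: M_def)
  moreover have "poly (coeff g i) 0 = 0" if "2 \<le> i" for i
    unfolding poly_0_coeff_0 cg coeff_poly_shift using lowi[OF that, of M] by simp
  ultimately show ?thesis using wadj zadj gw de by (intro exI[of _ w] exI[of _ g]) auto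
qed

text \<open>Sending (t, z) to a point (\<tau>, \<eta>) satisfying all relations of z defines a
  homomorphism on K[t, z], and on its localization at q when q(\<tau>) is nonzero. F lies in that
  localization for a suitable q.\<close>

lemma specialization:
  fixes z :: "'a::field_char_0 fps"
  assumes z: "ps.alg z" and F: "finite F" "F \<subseteq> ps.adj z"
    and pts: "\<And>q. q \<noteq> 0 \<Longrightarrow> \<exists>\<tau> \<eta>. poly q \<tau> \<noteq> 0 \<and>
      (\<forall>P. hev fps_of_poly P z = 0 \<longrightarrow> hev (\<lambda>p. poly p \<tau>) P \<eta> = 0)"
  shows "\<exists>R \<phi>. subring_set R \<and> F \<subseteq> R \<and> range fps_const \<subseteq> R \<and>
    (\<forall>x\<in>R. \<forall>y\<in>R. \<phi> (x + y) = \<phi> x + \<phi> y \<and> \<phi> (x * y) = \<phi> x * \<phi> y) \<and>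
    (\<forall>c. \<phi> (fps_const c) = c) \<and> (\<forall>y\<in>F. y \<noteq> 0 \<longrightarrow> \<phi> y \<noteq> 0)"
proof -
  have "\<forall>y\<in>F. \<exists>q. q \<noteq> 0 \<and> (\<exists>P. fps_of_poly q * y = hev fps_of_poly P z)"
    using F(2) by (auto simp: ps.adj_def)
  from bchoice[OF this] obtain qq where qq: "\<forall>y\<in>F. qq y \<noteq> 0 \<and> (\<exists>P. fps_of_poly (qq y) * y = hev fps_of_poly P z)"
    by (rule exE)
  have "\<forall>y\<in>F - {0}. \<exists>c. c \<noteq> 0 \<and> (\<exists>U. y * hev fps_of_poly U y = fps_of_poly c)"
  proof
    fix y assume y: "y \<in> F - {0}"
    then have "ps.alg y" using ps.adj_alg[OF z] F(2) by auto
    from ps.alg_multiple[OF this] y show "\<exists>c. c \<noteq> 0 \<and> (\<exists>U. y * hev fps_of_poly U y = fps_of_poly c)" by auto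
  qed
  from bchoice[OF this] obtain cc where
    cc: "\<forall>y\<in>F - {0}. cc y \<noteq> 0 \<and> (\<exists>U. y * hev fps_of_poly U y = fps_of_poly (cc y))" by (rule exE)
  \<comment> \<open>The first product collects the denominators of F. The second collects base
    multiples of its nonzero elements, so that q(\<tau>) \<noteq> 0 keeps their images
    nonzero.\<close>
  define q where "q = (\<Prod>y\<in>F. qq y) * (\<Prod>y\<in>F - {0}. cc y)"
  have q0: "q \<noteq> 0" using qq cc F(1) by (simp add: q_def)
  from pts[OF q0] obtain \<tau> \<eta> where t: "poly q \<tau> \<noteq> 0"
    and I: "\<And>P. hev fps_of_poly P z = 0 \<Longrightarrow> hev (\<lambda>p. poly p \<tau>) P \<eta> = 0" by auto
  define sp where "sp = (\<lambda>P. hev (\<lambda>p. poly p \<tau>) P \<eta>)"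
  define ev where "ev = (\<lambda>P. hev fps_of_poly P z)"
  have sph: "is_hom sp" unfolding sp_def by (rule is_hom_hev[OF is_hom_poly])
  have evh: "is_hom ev" unfolding ev_def by (rule is_hom_hev[OF ps.hom])
  have sps: "sp (smult a P) = poly a \<tau> * sp P" for a P unfolding sp_def by (rule hev_smult[OF is_hom_poly])
  have evs: "ev (smult a P) = fps_of_poly a * ev P" for a P unfolding ev_def by (rule hev_smult[OF ps.hom])
  have I': "sp P = sp Q" if "ev P = ev Q" for P Q
  proof -
    have "ev (P - Q) = 0" using that is_homD(6)[OF evh] by simp
    then have "sp (P - Q) = 0" using I by (simp add: ev_def sp_def)
    then show ?thesis using is_homD(6)[OF sph] by simp
  qed
  define rep where "rep = (\<lambda>y (n, P). fps_of_poly (q ^ n) * y = ev P)"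
  define R where "R = {y. \<exists>r. rep y r}"
  define \<phi> where "\<phi> = (\<lambda>y. case (SOME r. rep y r) of (n, P) \<Rightarrow> sp P / poly q \<tau> ^ n)"
  have RI: "y \<in> R" if "fps_of_poly (q ^ n) * y = ev P" for y n P
    using that by (auto simp: R_def rep_def)
  \<comment> \<open>Independence of the chosen representation: two of them are compared after
    multiplying each by the power of q belonging to the other.\<close>
  have phi: "\<phi> y * poly q \<tau> ^ n = sp P" if "fps_of_poly (q ^ n) * y = ev P" for y n P
  proof -
    have "rep y (n, P)" using that by (simp add: rep_def)
    then have "rep y (SOME r. rep y r)" by (rule someI)
    moreover obtain m Q where mQ: "(SOME r. rep y r) = (m, Q)" by (cases "SOME r. rep y r")
    ultimately have Q: "fps_of_poly (q ^ m) * y = ev Q" by (simp add: rep_def)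
    have "ev (smult (q ^ m) P) = ev (smult (q ^ n) Q)"
      unfolding evs that[symmetric] Q[symmetric] by (simp add: mult_ac)
    then have "poly q \<tau> ^ m * sp P = poly q \<tau> ^ n * sp Q" using I' by (metis sps poly_power)
    then show ?thesis using t by (simp add: \<phi>_def mQ field_simps)
  qed
  have Rrep: "\<exists>n P. fps_of_poly (q ^ n) * y = ev P" if "y \<in> R" for y
    using that by (auto simp: R_def rep_def)
  have add: "x + y \<in> R \<and> \<phi> (x + y) = \<phi> x + \<phi> y" and mult: "x * y \<in> R \<and> \<phi> (x * y) = \<phi> x * \<phi> y"
    if xy: "x \<in> R" "y \<in> R" for x y
  proof -
    obtain n P m Q where x: "fps_of_poly (q ^ n) * x = ev P" and y: "fps_of_poly (q ^ m) * y = ev Q"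
      using Rrep xy by blast
    have "fps_of_poly (q ^ (n + m)) * (x + y) =
        fps_of_poly (q ^ m) * (fps_of_poly (q ^ n) * x) + fps_of_poly (q ^ n) * (fps_of_poly (q ^ m) * y)"
      by (simp add: power_add fps_of_poly_mult algebra_simps)
    also have "\<dots> = ev (smult (q ^ m) P + smult (q ^ n) Q)" unfolding x y by (simp add: evs is_homD(3)[OF evh])
    finally have s: "fps_of_poly (q ^ (n + m)) * (x + y) = ev (smult (q ^ m) P + smult (q ^ n) Q)" .
    have "\<phi> (x + y) * poly q \<tau> ^ (n + m) = poly q \<tau> ^ m * sp P + poly q \<tau> ^ n * sp Q"
      using phi[OF s] by (simp add: sps is_homD(3)[OF sph])
    also have "\<dots> = (\<phi> x + \<phi> y) * poly q \<tau> ^ (n + m)"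
      unfolding phi[OF x, symmetric] phi[OF y, symmetric] by (simp add: power_add algebra_simps)
    finally show "x + y \<in> R \<and> \<phi> (x + y) = \<phi> x + \<phi> y" using RI[OF s] t by simp
    have "fps_of_poly (q ^ (n + m)) * (x * y) = (fps_of_poly (q ^ n) * x) * (fps_of_poly (q ^ m) * y)"
      by (simp add: power_add fps_of_poly_mult algebra_simps)
    also have "\<dots> = ev (P * Q)" unfolding x y by (simp add: is_homD(4)[OF evh])
    finally have s: "fps_of_poly (q ^ (n + m)) * (x * y) = ev (P * Q)" .
    have "\<phi> (x * y) * poly q \<tau> ^ (n + m) = sp P * sp Q"
      using phi[OF s] by (simp add: is_homD(4)[OF sph])
    also have "\<dots> = (\<phi> x * \<phi> y) * poly q \<tau> ^ (n + m)"
      unfolding phi[OF x, symmetric] phi[OF y, symmetric] by (simp add: power_add algebra_simps)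
    finally show "x * y \<in> R \<and> \<phi> (x * y) = \<phi> x * \<phi> y" using RI[OF s] t by simp
  qed
  have poly: "fps_of_poly a \<in> R \<and> \<phi> (fps_of_poly a) = poly a \<tau>" for a
  proof -
    have s: "fps_of_poly (q ^ 0) * fps_of_poly a = ev [:a:]" by (simp add: ev_def hev_pCons[OF ps.hom])
    show ?thesis using RI[OF s] phi[OF s] by (simp add: sp_def hev_pCons[OF is_hom_poly])
  qed
  have const: "fps_const c \<in> R \<and> \<phi> (fps_const c) = c" for c
    using poly[of "[:c:]"] by (simp add: fps_of_poly_const)
  have neg: "- x \<in> R" if "x \<in> R" for x
    using mult[OF conjunct1[OF poly[of "[:-1:]"]] that] by (simp add: fps_of_poly_const fps_const_neg[symmetric] del: fps_const_neg)
  have R: "subring_set R"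
    unfolding subring_set_def
  proof (intro conjI ballI)
    show "1 \<in> R" using const[of 1] by simp
    fix x y assume "x \<in> R" "y \<in> R"
    then show "x * y \<in> R" "x - y \<in> R" using mult[of x y] add[of x "- y"] neg[of y] by auto
  qed
  have FR: "F \<subseteq> R"
  proof
    fix y assume y: "y \<in> F"
    then obtain P where P: "fps_of_poly (qq y) * y = ev P" using qq by (auto simp: ev_def)
    have "qq y dvd q" using y F(1) unfolding q_def by (intro dvd_mult2 dvd_prodI) auto
    then obtain r where r: "q = qq y * r" ..
    have "fps_of_poly (q ^ 1) * y = fps_of_poly r * (fps_of_poly (qq y) * y)" by (simp add: r fps_of_poly_mult mult_ac)
    then have "fps_of_poly (q ^ 1) * y = ev (smult r P)" unfolding P evs .
    then show "y \<in> R" by (rule RI)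
  qed
  have nonzero: "\<phi> y \<noteq> 0" if y: "y \<in> F" "y \<noteq> 0" for y
  proof -
    obtain U where U: "y * hev fps_of_poly U y = fps_of_poly (cc y)" using cc y by auto
    have yR: "y \<in> R" using FR y by auto
    have uR: "hev fps_of_poly U y \<in> R"
      unfolding hev_def by (rule subring_set_poly[OF R _ yR]) (simp add: coeff_map_poly poly)
    have "\<phi> y * \<phi> (hev fps_of_poly U y) = poly (cc y) \<tau>" using mult[OF yR uR] poly[of "cc y"] U by simp
    moreover have "cc y dvd q" using y F(1) unfolding q_def by (intro dvd_mult dvd_prodI) auto
    then have "poly (cc y) \<tau> \<noteq> 0" using t by auto
    ultimately show ?thesis by auto
  qed
  show ?thesis
    using R FR const add mult nonzero by (intro exI[of _ R] exI[of _ \<phi>]) auto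
qed

section \<open>Homogeneous polynomials and an affine chart of the projective plane\<close>

lemma is_hom_to_ac: "is_hom (to_ac :: 'a::field \<Rightarrow> 'a alg_closure)"
  by (rule is_homI) simp_all

lemma mp_partial_eval_hom:
  assumes "is_hom g"
  shows "g (mp_partial_eval h j x p) = mp_partial_eval (\<lambda>c. g (h c)) j (\<lambda>i. g (x i)) p"
  unfolding mp_partial_eval_def
  by (simp add: is_hom_sum[OF assms] is_hom_prod[OF assms] is_homD(4,7,8)[OF assms])

definition mp_homog_degree :: "('v, 'b::zero) mpolynomial \<Rightarrow> nat \<Rightarrow> bool" where
  "mp_homog_degree p d \<longleftrightarrow> (\<forall>m\<in>Poly_Mapping.keys p. (\<Sum>i\<in>Poly_Mapping.keys m. Poly_Mapping.lookup m i) = d)"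

lemma mp_eval_scale:
  fixes c :: "'c::comm_ring_1"
  assumes "mp_homog_degree p d"
  shows "mp_eval h (\<lambda>i. c * x i) p = c ^ d * mp_eval h x p"
proof -
  have "monomial_eval (\<lambda>i. c * x i) m = c ^ d * monomial_eval x m" if "m \<in> Poly_Mapping.keys p" for m
    using assms that by (simp add: monomial_eval_def power_mult_distrib prod.distrib power_sum[symmetric] mp_homog_degree_def)
  then show ?thesis unfolding mp_eval_monomial_eval by (simp add: sum_distrib_left mult_ac)
qed

text \<open>The scaling law of p applied to x + \<epsilon> e_j over the dual numbers; the
  \<epsilon>-part is the assertion. The factor c on the left avoids the exponent d - 1.\<close>

lemma mp_partial_eval_scale:
  fixes c :: "'c::comm_ring_1"
  assumes p: "mp_homog_degree p d" and J: "finite J" "mp_vars p \<subseteq> J" "j \<in> J"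
  shows "c * mp_partial_eval h j (\<lambda>i. c * x i) p = c ^ d * mp_partial_eval h j x p"
proof -
  let ?d = "\<lambda>i. if i = j then 1 else 0 :: 'c"
  have delta: "(\<Sum>k\<in>J. (if k = j then a else 0) * f k) = a * f j" for a :: 'c and f
    using J by (simp add: if_distrib[of "\<lambda>x. x * _"] cong: if_cong)
  have "mp_eval (\<lambda>c. Dual (h c) 0) (\<lambda>i. Dual c 0 * Dual (x i) (?d i)) p =
      Dual c 0 ^ d * mp_eval (\<lambda>c. Dual (h c) 0) (\<lambda>i. Dual (x i) (?d i)) p"
    by (rule mp_eval_scale[OF p])
  moreover have "(\<lambda>i. Dual c 0 * Dual (x i) (?d i)) = (\<lambda>i. Dual (c * x i) (if i = j then c else 0))"
    by (auto simp: dual_eq_iff)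
  ultimately have "Dual (mp_eval h (\<lambda>i. c * x i) p) (\<Sum>k\<in>J. (if k = j then c else 0) * mp_partial_eval h k (\<lambda>i. c * x i) p) =
      Dual c 0 ^ d * Dual (mp_eval h x p) (\<Sum>k\<in>J. ?d k * mp_partial_eval h k x p)"
    by (simp only: mp_eval_dual[OF J(1,2)])
  then have "dsnd (Dual (mp_eval h (\<lambda>i. c * x i) p) (\<Sum>k\<in>J. (if k = j then c else 0) * mp_partial_eval h k (\<lambda>i. c * x i) p)) =
      dsnd (Dual c 0 ^ d * Dual (mp_eval h x p) (\<Sum>k\<in>J. ?d k * mp_partial_eval h k x p))" by (rule arg_cong)
  then show ?thesis unfolding delta by (simp add: dual_power)
qed

text \<open>Euler's identity: scaling by 1 + \<epsilon> multiplies p by (1 + \<epsilon>)^d.\<close>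

lemma mp_euler:
  fixes x :: "'v \<Rightarrow> 'c::comm_ring_1"
  assumes p: "mp_homog_degree p d" and J: "finite J" "mp_vars p \<subseteq> J"
  shows "(\<Sum>k\<in>J. x k * mp_partial_eval h k x p) = of_nat d * mp_eval h x p"
proof -
  have "mp_eval (\<lambda>c. Dual (h c) 0) (\<lambda>i. Dual 1 1 * Dual (x i) 0) p = Dual 1 1 ^ d * mp_eval (\<lambda>c. Dual (h c) 0) (\<lambda>i. Dual (x i) 0) p"
    by (rule mp_eval_scale[OF p])
  moreover have "(\<lambda>i. Dual 1 1 * Dual (x i) 0) = (\<lambda>i. Dual (x i) (x i))" by (auto simp: dual_eq_iff)
  ultimately have "Dual (mp_eval h x p) (\<Sum>k\<in>J. x k * mp_partial_eval h k x p) =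
      Dual 1 1 ^ d * Dual (mp_eval h x p) (\<Sum>k\<in>J. 0 * mp_partial_eval h k x p)"
    by (simp only: mp_eval_dual[OF J])
  then have "dsnd (Dual (mp_eval h x p) (\<Sum>k\<in>J. x k * mp_partial_eval h k x p)) =
      dsnd (Dual 1 1 ^ d * Dual (mp_eval h x p) (\<Sum>k\<in>J. 0 * mp_partial_eval h k x p))" by (rule arg_cong)
  then show ?thesis by (simp add: dual_power)
qed

definition affine_vec :: "'c::comm_ring_1 \<Rightarrow> 'c \<Rightarrow> nat \<Rightarrow> 'c" where
  "affine_vec s u = (\<lambda>i. if i = 0 then 1 else if i = 1 then s else if i = 2 then u else 0)"

lemma affine_vec_simps [simp]:
  "affine_vec s u 0 = 1" "affine_vec s u (Suc 0) = s" "affine_vec s u 2 = u" "i > 2 \<Longrightarrow> affine_vec s u i = 0"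
  by (simp_all add: affine_vec_def)

lemma affine_vec_hom: "is_hom g \<Longrightarrow> (\<lambda>i. g (affine_vec s u i)) = affine_vec (g s) (g u)"
  by (auto simp: affine_vec_def is_homD(1,2))

text \<open>A crude upper bound of the total degree. It is used as the degree of the homogenization,
  so the exponents of the homogenizing variable do not truncate.\<close>

definition hz_degree :: "'a::field poly poly \<Rightarrow> nat" where
  "hz_degree P = degree P + (\<Sum>j\<le>degree P. degree (coeff P j))"

definition homogenize :: "'a::field poly poly \<Rightarrow> (nat, 'a) mpolynomial" where
  "homogenize P = (\<Sum>j\<le>degree P. \<Sum>i\<le>degree (coeff P j).
     Poly_Mapping.single (Poly_Mapping.single 0 (hz_degree P - i - j) + Poly_Mapping.single 1 i + Poly_Mapping.single 2 j)
       (coeff (coeff P j) i))"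

lemma mp_eval_homogenize:
  assumes h: "is_hom h"
  shows "mp_eval h (affine_vec s u) (homogenize P) = hev (\<lambda>p. hev h p s) P u"
proof -
  have hh: "is_hom (\<lambda>p. hev h p s)" by (rule is_hom_hev[OF h])
  have "mp_eval h (affine_vec s u) (homogenize P) =
      (\<Sum>j\<le>degree P. \<Sum>i\<le>degree (coeff P j). h (coeff (coeff P j) i) * (s ^ i * u ^ j))"
    unfolding homogenize_def
    by (simp add: mp_eval_sum[OF h] mp_eval_single is_homD(1)[OF h] monomial_eval_add)
  also have "\<dots> = (\<Sum>j\<le>degree P. hev h (coeff P j) s * u ^ j)"
    by (intro sum.cong refl) (simp add: hev_altdef[OF h order_refl] sum_distrib_right mult.assoc)
  finally show ?thesis by (simp add: hev_altdef[OF hh order_refl])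
qed

lemma keys_sum_subset: "Poly_Mapping.keys (\<Sum>i\<in>I. f i) \<subseteq> (\<Union>i\<in>I. Poly_Mapping.keys (f i))"
proof (induction I rule: infinite_finite_induct)
  case (insert i I)
  then show ?case using Poly_Mapping.keys_add[of "f i" "sum f I"] by auto
qed auto

lemma homogenize_homog: "mp_homog_degree (homogenize P) (hz_degree P)" "mp_vars (homogenize P) \<subseteq> {..2}"
proof -
  let ?m = "\<lambda>i j. Poly_Mapping.single 0 (hz_degree P - i - j) + Poly_Mapping.single 1 i + Poly_Mapping.single (2::nat) j"
  have k: "\<exists>i j. j \<le> degree P \<and> i \<le> degree (coeff P j) \<and> m = ?m i j" if m: "m \<in> Poly_Mapping.keys (homogenize P)" for m
  proof -
    from m have "m \<in> (\<Union>j\<in>{..degree P}. Poly_Mapping.keys (\<Sum>i\<le>degree (coeff P j). Poly_Mapping.single (?m i j) (coeff (coeff P j) i)))"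
      unfolding homogenize_def using keys_sum_subset by (rule subsetD[rotated])
    then obtain j where j: "j \<le> degree P" "m \<in> Poly_Mapping.keys (\<Sum>i\<le>degree (coeff P j). Poly_Mapping.single (?m i j) (coeff (coeff P j) i))"
      by auto
    from j(2) have "m \<in> (\<Union>i\<in>{..degree (coeff P j)}. Poly_Mapping.keys (Poly_Mapping.single (?m i j) (coeff (coeff P j) i)))"
      using keys_sum_subset by (rule subsetD[rotated])
    then show ?thesis using j(1) by (auto split: if_splits)
  qed
  have kk: "Poly_Mapping.keys (?m i j) \<subseteq> {..2}" for i j
    using keys_add_subset_nat[of "Poly_Mapping.single 0 (hz_degree P - i - j) + Poly_Mapping.single 1 i" "Poly_Mapping.single (2::nat) j"]
      keys_add_subset_nat[of "Poly_Mapping.single 0 (hz_degree P - i - j)" "Poly_Mapping.single (1::nat) i"]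
    by (auto split: if_splits)
  show "mp_vars (homogenize P) \<subseteq> {..2}"
  proof
    fix v assume "v \<in> mp_vars (homogenize P)"
    then obtain m where m: "m \<in> Poly_Mapping.keys (homogenize P)" "v \<in> Poly_Mapping.keys m" by (auto simp: mp_vars_def)
    obtain i j where "m = ?m i j" using k[OF m(1)] by auto
    then show "v \<in> {..2}" using m(2) kk[of i j] by auto
  qed
  show "mp_homog_degree (homogenize P) (hz_degree P)"
    unfolding mp_homog_degree_def
  proof
    fix m assume "m \<in> Poly_Mapping.keys (homogenize P)"
    from k[OF this] obtain i j where ij: "j \<le> degree P" "i \<le> degree (coeff P j)" "m = ?m i j" by auto
    have "i \<le> (\<Sum>j\<le>degree P. degree (coeff P j))"
      using ij(2) member_le_sum[of j "{..degree P}" "\<lambda>j. degree (coeff P j)"] ij(1) by simp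
    then have le: "i + j \<le> hz_degree P" using ij(1) by (simp add: hz_degree_def)
    have "(\<Sum>v\<in>Poly_Mapping.keys m. Poly_Mapping.lookup m v) = (\<Sum>v\<in>{..2}. Poly_Mapping.lookup m v)"
      by (rule sum.mono_neutral_left) (use ij(3) kk in \<open>auto simp: in_keys_iff\<close>)
    also have "{..2} = {0, 1, 2 :: nat}" by auto
    also have "(\<Sum>v\<in>{0, 1, 2 :: nat}. Poly_Mapping.lookup m v) = hz_degree P"
      using le by (simp add: ij(3) lookup_add lookup_single)
    finally show "(\<Sum>v\<in>Poly_Mapping.keys m. Poly_Mapping.lookup m v) = hz_degree P" .
  qed
qed

lemma homog_polys_iff: "f \<in> homog_polys n \<longleftrightarrow> (\<exists>d. mp_homog_degree f d) \<and> mp_vars f \<subseteq> {..n}"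
  by (auto simp: homog_polys_def mp_homogeneous_def mp_homog_degree_def)

lemma homogenize_in: "homogenize P \<in> homog_polys 2"
  using homogenize_homog[of P] by (auto simp: homog_polys_iff)

definition ev2 :: "'a::field alg_closure \<Rightarrow> 'a alg_closure \<Rightarrow> 'a poly poly \<Rightarrow> 'a alg_closure" where
  "ev2 s u P = hev (\<lambda>p. hev to_ac p s) P u"

lemma is_hom_ev2: "is_hom (ev2 s u)"
  unfolding ev2_def by (intro is_hom_hev is_hom_to_ac)

lemma ev2_const: "ev2 s u [:p:] = hev to_ac p s"
  unfolding ev2_def by (simp add: hev_pCons is_hom_hev is_hom_to_ac)

lemma ev2_homogenize: "mp_eval to_ac (affine_vec s u) (homogenize P) = ev2 s u P"
  unfolding ev2_def by (rule mp_eval_homogenize[OF is_hom_to_ac])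

definition cc :: "'a::field \<Rightarrow> 'a poly poly" where "cc c = [:[:c:]:]"

lemma is_hom_cc: "is_hom cc"
  unfolding cc_def by (rule is_homI) (simp_all add: one_pCons)

text \<open>Evaluation at (1, X, Y), where X is the variable of the coefficients and Y the outer
  one.\<close>

definition dehomogenize :: "(nat, 'a::field) mpolynomial \<Rightarrow> 'a poly poly" where
  "dehomogenize f = mp_eval cc (affine_vec [:[:0, 1:]:] [:0, 1:]) f"

lemma ev2_coords: "ev2 s u (cc c) = to_ac c" "ev2 s u [:[:0, 1:]:] = s" "ev2 s u [:0, 1:] = u"
  by (simp_all add: cc_def ev2_def hev_pCons is_hom_hev is_hom_to_ac is_homD(1,2)[OF is_hom_hev[OF is_hom_to_ac]])

lemma hev_coords:
  fixes w :: "'a::field fps"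
  shows "hev fps_of_poly (cc c) w = fps_const c" "hev fps_of_poly [:[:0, 1:]:] w = fps_X" "hev fps_of_poly [:0, 1:] w = w"
  by (simp_all add: cc_def hev_pCons is_hom_fps_of_poly fps_of_poly_const)

lemma ev2_dehomogenize: "ev2 s u (dehomogenize f) = mp_eval to_ac (affine_vec s u) f"
  unfolding dehomogenize_def
  by (simp add: mp_eval_hom[OF is_hom_ev2] affine_vec_hom[OF is_hom_ev2] ev2_coords)

lemma hev_dehomogenize:
  "hev fps_of_poly (dehomogenize f) w = mp_eval fps_const (affine_vec fps_X w) f" for w :: "'a::field fps"
  unfolding dehomogenize_def
  by (simp add: mp_eval_hom[OF is_hom_hev[OF is_hom_fps_of_poly]]
      affine_vec_hom[OF is_hom_hev[OF is_hom_fps_of_poly]] hev_coords)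

lemma dehomogenize_homogenize: "dehomogenize (homogenize P) = (P :: 'a::field poly poly)"
proof -
  have "hev cc p [:[:0, 1:]:] = [:p:]" for p :: "'a poly"
    by (induction p) (simp_all add: hev_pCons is_hom_cc, simp add: cc_def)
  then have "dehomogenize (homogenize P) = hev (\<lambda>p. [:p:]) P [:0, 1:]"
    unfolding dehomogenize_def by (simp add: mp_eval_homogenize[OF is_hom_cc])
  also have "\<dots> = P" unfolding hev_def pcompose_altdef[symmetric] by simp
  finally show ?thesis .
qed

lemma proj_point_iff:
  fixes v :: "nat \<Rightarrow> 'c::field"
  shows "v \<in> proj_point x \<longleftrightarrow> (\<exists>c. c \<noteq> 0 \<and> v = (\<lambda>i. c * x i))"
  by (auto simp: proj_point_def)

lemma homog_nonzero_proj:
  assumes "f \<in> homog_polys n"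
  shows "(\<forall>v\<in>proj_point x. mp_eval to_ac v f \<noteq> 0) \<longleftrightarrow> mp_eval to_ac x f \<noteq> 0"
    "(\<forall>v\<in>proj_point x. mp_eval to_ac v f = 0) \<longleftrightarrow> mp_eval to_ac x f = 0"
proof -
  obtain d where d: "mp_homog_degree f d" using assms by (auto simp: homog_polys_iff)
  have x: "x \<in> proj_point x" unfolding proj_point_iff by (intro exI[of _ 1]) auto
  have s: "mp_eval to_ac v f = 0 \<longleftrightarrow> mp_eval to_ac x f = 0" if v: "v \<in> proj_point x" for v
  proof -
    obtain c where c: "c \<noteq> 0" "v = (\<lambda>i. c * x i)" using v by (auto simp: proj_point_iff)
    then have "mp_eval to_ac v f = c ^ d * mp_eval to_ac x f" using mp_eval_scale[OF d, of to_ac c x] by simp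
    then show ?thesis using c(1) by simp
  qed
  show "(\<forall>v\<in>proj_point x. mp_eval to_ac v f \<noteq> 0) \<longleftrightarrow> mp_eval to_ac x f \<noteq> 0"
  proof
    assume "\<forall>v\<in>proj_point x. mp_eval to_ac v f \<noteq> 0"
    from bspec[OF this x] show "mp_eval to_ac x f \<noteq> 0" .
  next
    assume a: "mp_eval to_ac x f \<noteq> 0"
    show "\<forall>v\<in>proj_point x. mp_eval to_ac v f \<noteq> 0"
    proof
      fix v assume "v \<in> proj_point x"
      from s[OF this] a show "mp_eval to_ac v f \<noteq> 0" by simp
    qed
  qed
  show "(\<forall>v\<in>proj_point x. mp_eval to_ac v f = 0) \<longleftrightarrow> mp_eval to_ac x f = 0"
  proof
    assume "\<forall>v\<in>proj_point x. mp_eval to_ac v f = 0"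
    from bspec[OF this x] show "mp_eval to_ac x f = 0" .
  next
    assume a: "mp_eval to_ac x f = 0"
    show "\<forall>v\<in>proj_point x. mp_eval to_ac v f = 0"
    proof
      fix v assume "v \<in> proj_point x"
      from s[OF this] a show "mp_eval to_ac v f = 0" by simp
    qed
  qed
qed

definition apoint :: "'a::field alg_closure \<times> 'a alg_closure \<Rightarrow> (nat \<Rightarrow> 'a alg_closure) set" where
  "apoint = (\<lambda>(s, u). proj_point (affine_vec s u))"

lemma apoint_in: "apoint x \<in> proj_space 2"
proof (cases x)
  case (Pair s u)
  have "affine_vec s u 0 \<noteq> 0" by simp
  then have "(\<exists>i. affine_vec s u i \<noteq> 0) \<and> (\<forall>i>2. affine_vec s u i = 0)" by (intro conjI exI[of _ 0] allI impI) simp_all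
  then show ?thesis unfolding proj_space_def Pair apoint_def
    by (intro CollectI exI[of _ "affine_vec s u"] conjI) simp_all
qed

lemma apoint_scaled:
  assumes "(\<lambda>i. c * affine_vec s u i) = (\<lambda>i. d * affine_vec s' u' i)" "c \<noteq> (0 :: 'c::field)"
  shows "c = d" "s = s'" "u = u'"
proof -
  show "c = d" using fun_cong[OF assms(1), of 0] by simp
  then show "s = s'" "u = u'" using fun_cong[OF assms(1), of 1] fun_cong[OF assms(1), of 2] assms(2) by simp_all
qed

lemma inj_apoint: "inj apoint"
proof (rule injI)
  fix x y :: "'a alg_closure \<times> 'a alg_closure" assume e: "apoint x = apoint y"
  have "affine_vec (fst x) (snd x) \<in> apoint x"
    unfolding apoint_def by (cases x) (auto simp: proj_point_iff intro!: exI[of _ 1])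
  then have "affine_vec (fst x) (snd x) \<in> proj_point (affine_vec (fst y) (snd y))"
    unfolding e by (cases y) (simp add: apoint_def)
  then obtain c where "affine_vec (fst x) (snd x) = (\<lambda>i. c * affine_vec (fst y) (snd y) i)" by (auto simp: proj_point_iff)
  then have "(\<lambda>i. 1 * affine_vec (fst x) (snd x) i) = (\<lambda>i. c * affine_vec (fst y) (snd y) i)" by simp
  from apoint_scaled[OF this] show "x = y" by (simp add: prod_eq_iff)
qed

definition basic_open :: "nat \<Rightarrow> (nat, 'a::field) mpolynomial \<Rightarrow> (nat \<Rightarrow> 'a alg_closure) set set" where
  "basic_open n f = {P \<in> proj_space n. \<forall>v\<in>P. mp_eval to_ac v f \<noteq> 0}"

lemma zariski_alt: "zariski n = topology_generated_by {basic_open n f | f. f \<in> homog_polys n}"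
  by (simp add: zariski_def basic_open_def)

lemma openin_basic_open: "f \<in> homog_polys n \<Longrightarrow> openin (zariski n) (basic_open n f)"
  unfolding zariski_alt by (rule topology_generated_by_Basis) auto

lemma topspace_zariski: "topspace (zariski n :: (nat \<Rightarrow> 'a::field alg_closure) set topology) = proj_space n"
proof -
  let ?one = "Poly_Mapping.single 0 1 :: (nat, 'a) mpolynomial"
  have "?one \<in> homog_polys n" by (auto simp: homog_polys_iff mp_homog_degree_def mp_vars_def)
  moreover have "mp_eval to_ac v ?one = 1" for v by (subst mp_eval_single) simp_all
  then have "basic_open n ?one = (proj_space n :: (nat \<Rightarrow> 'a alg_closure) set set)" by (auto simp: basic_open_def)
  ultimately have "proj_space n \<in> {basic_open n f | f :: (nat, 'a) mpolynomial. f \<in> homog_polys n}" by force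
  moreover have "P \<in> proj_space n" if "P \<in> \<Union>{basic_open n f | f :: (nat, 'a) mpolynomial. f \<in> homog_polys n}" for P
    using that by (auto simp: basic_open_def)
  ultimately show ?thesis unfolding zariski_alt topology_generated_by_topspace by blast
qed

lemma apoint_basic_open: "apoint (s, u) \<in> basic_open 2 f \<longleftrightarrow> mp_eval to_ac (affine_vec s u) f \<noteq> 0" if "f \<in> homog_polys 2"
  using homog_nonzero_proj(1)[OF that, of "affine_vec s u"] apoint_in[of "(s, u)"] by (simp add: basic_open_def apoint_def)

lemma apoint_basic_open_hz: "apoint (s, u) \<in> basic_open 2 (homogenize P) \<longleftrightarrow> ev2 s u P \<noteq> 0"
  by (simp add: apoint_basic_open[OF homogenize_in] ev2_homogenize)

text \<open>The topology is given by a generating family, so the claim is proved by induction on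
  generation; a product of polynomials handles an intersection.\<close>

lemma zariski_open_affine:
  assumes "openin (zariski 2) U" "apoint (s, u) \<in> U"
  shows "\<exists>P. ev2 s u P \<noteq> 0 \<and> (\<forall>s' u'. ev2 s' u' P \<noteq> 0 \<longrightarrow> apoint (s', u') \<in> U)"
proof -
  have "generate_topology_on {basic_open 2 f | f. f \<in> homog_polys 2} U"
    using assms(1) unfolding zariski_alt by (rule openin_topology_generated_by)
  then show ?thesis using assms(2)
  proof (induction arbitrary: s u)
    case Empty
    then show ?case by simp
  next
    case (Int a b)
    obtain P where P: "ev2 s u P \<noteq> 0" "\<And>s' u'. ev2 s' u' P \<noteq> 0 \<Longrightarrow> apoint (s', u') \<in> a" using Int.IH(1)[of s u] Int.prems by auto
    obtain Q where Q: "ev2 s u Q \<noteq> 0" "\<And>s' u'. ev2 s' u' Q \<noteq> 0 \<Longrightarrow> apoint (s', u') \<in> b" using Int.IH(2)[of s u] Int.prems by auto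
    show ?case
      by (intro exI[of _ "P * Q"]) (simp add: is_homD(4)[OF is_hom_ev2] P Q)
  next
    case (UN K)
    then obtain k where k: "k \<in> K" "apoint (s, u) \<in> k" by auto
    from UN.IH[OF this] obtain P where "ev2 s u P \<noteq> 0" "\<forall>s' u'. ev2 s' u' P \<noteq> 0 \<longrightarrow> apoint (s', u') \<in> k" by auto
    then show ?case using k(1) by (intro exI[of _ P]) auto
  next
    case (Basis b)
    then obtain f where f: "b = basic_open 2 f" "f \<in> homog_polys 2" by auto
    show ?case
      using Basis.prems unfolding f(1)
      by (intro exI[of _ "dehomogenize f"]) (simp add: apoint_basic_open[OF f(2)] ev2_dehomogenize)
  qed
qed

definition x0_poly :: "(nat, 'a::field) mpolynomial" where
  "x0_poly = Poly_Mapping.single (Poly_Mapping.single 0 1) 1"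

lemma x0_poly: "x0_poly \<in> homog_polys n" "mp_eval to_ac v (x0_poly :: (nat, 'a::field) mpolynomial) = v 0"
  unfolding x0_poly_def
  by (auto simp: homog_polys_iff mp_homog_degree_def mp_vars_def mp_eval_single)

lemma proj_point_scale:
  fixes x :: "nat \<Rightarrow> 'c::field"
  assumes "c \<noteq> 0"
  shows "proj_point (\<lambda>i. c * x i) = proj_point x"
proof (rule Set.set_eqI)
  fix v
  show "v \<in> proj_point (\<lambda>i. c * x i) \<longleftrightarrow> v \<in> proj_point x"
    unfolding proj_point_iff
  proof
    assume "\<exists>d. d \<noteq> 0 \<and> v = (\<lambda>i. d * (c * x i))"
    then obtain d where "d \<noteq> 0" "v = (\<lambda>i. d * (c * x i))" by auto
    then show "\<exists>d. d \<noteq> 0 \<and> v = (\<lambda>i. d * x i)" using assms by (intro exI[of _ "d * c"]) (simp add: mult.assoc)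
  next
    assume "\<exists>d. d \<noteq> 0 \<and> v = (\<lambda>i. d * x i)"
    then obtain d where "d \<noteq> 0" "v = (\<lambda>i. d * x i)" by auto
    then show "\<exists>d. d \<noteq> 0 \<and> v = (\<lambda>i. d * (c * x i))" using assms by (intro exI[of _ "d / c"]) auto
  qed
qed

lemma apoint_chart:
  assumes "Q \<in> basic_open 2 x0_poly"
  shows "\<exists>x. Q = apoint x"
proof -
  have "Q \<in> proj_space 2" using assms by (simp add: basic_open_def)
  then obtain v where v: "Q = proj_point v" "\<forall>i>2. v i = 0" by (auto simp: proj_space_def)
  have "v 0 \<noteq> 0"
    using assms homog_nonzero_proj(1)[OF x0_poly(1), of v] by (simp add: basic_open_def v(1) x0_poly(2))
  have "v = (\<lambda>i. v 0 * affine_vec (v 1 / v 0) (v 2 / v 0) i)"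
  proof
    fix i
    show "v i = v 0 * affine_vec (v 1 / v 0) (v 2 / v 0) i"
      using \<open>v 0 \<noteq> 0\<close> v(2) by (auto simp: affine_vec_def)
  qed
  then have "Q = proj_point (affine_vec (v 1 / v 0) (v 2 / v 0))"
    using v(1) proj_point_scale[OF \<open>v 0 \<noteq> 0\<close>, of "affine_vec (v 1 / v 0) (v 2 / v 0)"] by simp
  then show ?thesis by (intro exI[of _ "(v 1 / v 0, v 2 / v 0)"]) (simp add: apoint_def)
qed

section \<open>The plane curve of an algebraic power series\<close>

text \<open>The series w is a formal branch (t, w) of the curve. The hypotheses on g are those
  supplied by \<open>smooth_model\<close>: over t = 0 the equation is linear with nonzero slope, so
  that this fibre can hold only one point.\<close>

locale plane_curve =
  fixes w :: "'a::field_char_0 fps" and g :: "'a poly poly"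
  assumes w: "ps.alg w" and gw: "hev fps_of_poly g w = 0"
    and g1: "poly (coeff g 1) 0 \<noteq> 0" and gi: "\<And>i. i \<ge> 2 \<Longrightarrow> poly (coeff g i) 0 = 0"
begin

text \<open>The prime ideal of polynomials in two variables vanishing at (t, w); the coordinate ring
  of the curve is a localization of the quotient.\<close>

definition ann :: "'a poly poly set" where "ann = {P. hev fps_of_poly P w = 0}"

definition minp :: "'a poly poly" where "minp = arg_min degree (\<lambda>P. P \<noteq> 0 \<and> P \<in> ann)"

abbreviation lc :: "'a poly" where "lc \<equiv> coeff minp (degree minp)"

lemmas evh = is_homD[OF is_hom_hev[OF is_hom_fps_of_poly, of w]]
lemmas acv = is_homD[OF is_hom_ev2]

lemma ann_hom: "P \<in> ann \<Longrightarrow> Q \<in> ann \<Longrightarrow> P - Q \<in> ann" "P \<in> ann \<Longrightarrow> Q * P \<in> ann"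
  by (simp_all add: ann_def evh)

lemma minp: "minp \<noteq> 0" "minp \<in> ann" "\<And>P. P \<noteq> 0 \<Longrightarrow> P \<in> ann \<Longrightarrow> degree minp \<le> degree P" "degree minp \<noteq> 0"
proof -
  obtain P where P: "P \<noteq> 0 \<and> P \<in> ann" using w by (auto simp: ps.alg_def ann_def)
  show 1: "minp \<noteq> 0" and 2: "minp \<in> ann" and 3: "\<And>P. P \<noteq> 0 \<Longrightarrow> P \<in> ann \<Longrightarrow> degree minp \<le> degree P"
    using arg_min_nat_lemma[of "\<lambda>P. P \<noteq> 0 \<and> P \<in> ann" P degree, OF P] unfolding minp_def by auto
  show "degree minp \<noteq> 0"
  proof
    assume "degree minp = 0"
    then obtain c where c: "minp = [:c:]" by (rule degree_eq_zeroE)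
    then have "fps_of_poly c = 0" using 2 by (simp add: ann_def hev_pCons is_hom_fps_of_poly)
    then show False using ps.inj 1 c by simp
  qed
qed

text \<open>The ideal is principal after inverting the leading coefficient of \<open>minp\<close>:
  away from the zeros of \<open>lc\<close> the curve is cut out by \<open>minp\<close>
  alone.\<close>

lemma pseudo_division:
  assumes "Q \<in> ann"
  shows "\<exists>n u. smult (lc ^ n) Q = u * minp"
  using assms
proof (induction "length (coeffs Q)" arbitrary: Q rule: less_induct)
  case less
  show ?case
  proof (cases "Q = 0")
    case True
    then show ?thesis by (intro exI[of _ 0] exI[of _ 0]) simp
  next
    case False
    then have deg: "degree minp \<le> degree Q" using less.prems minp(3) by simp
    define m where "m = monom (coeff Q (degree Q)) (degree Q - degree minp)"
    define R where "R = smult lc Q - m * minp"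
    have "smult lc Q \<in> ann" using ann_hom(2)[OF less.prems, of "[:lc:]"] by simp
    then have R: "R \<in> ann" unfolding R_def using ann_hom minp(2) by simp
    have dle: "degree R \<le> degree Q"
      unfolding R_def m_def using deg
      by (intro degree_diff_le order.trans[OF degree_smult_le] order.trans[OF degree_mult_le])
        (auto intro: order.trans[OF add_right_mono[OF degree_monom_le]])
    have "coeff R (degree Q) = 0" unfolding R_def m_def using deg by (simp add: coeff_monom_mult)
    then have "length (coeffs R) < length (coeffs Q)"
      using False dle leading_coeff_0_iff[of R]
      by (cases "R = 0"; cases "degree R = degree Q") (simp_all add: length_coeffs_degree)
    from less.hyps[OF this R] obtain n u where nu: "smult (lc ^ n) R = u * minp" by auto
    have "smult (lc ^ Suc n) Q = smult (lc ^ n) R + smult (lc ^ n) (m * minp)"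
      unfolding R_def by (simp add: smult_diff_right mult.commute)
    also have "\<dots> = (u + smult (lc ^ n) m) * minp" unfolding nu by (simp add: distrib_right)
    finally show ?thesis by blast
  qed
qed

lemma ev2_smult: "ev2 s u (smult p P) = hev to_ac p s * ev2 s u P"
  unfolding ev2_def by (rule hev_smult[OF is_hom_hev[OF is_hom_to_ac]])

text \<open>A function that is not zero on the curve divides a nonzero polynomial in t modulo the
  ideal. Hence it vanishes only over finitely many values of t.\<close>

lemma not_ann_multiple:
  assumes "P \<notin> ann"
  shows "\<exists>B c. c \<noteq> 0 \<and> P * B - [:c:] \<in> ann"
proof -
  let ?x = "hev fps_of_poly P w"
  have "?x \<noteq> 0" using assms by (simp add: ann_def)
  from ps.alg_multiple[OF ps.alg_hev[OF w] this] obtain U c where U: "c \<noteq> 0" "?x * hev fps_of_poly U ?x = fps_of_poly c"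
    by auto
  have "hev fps_of_poly (P * pcompose U P - [:c:]) w = 0"
    using U(2) by (simp add: evh hev_pcompose[OF is_hom_fps_of_poly] hev_pCons[OF is_hom_fps_of_poly])
  then show ?thesis using U(1) by (auto simp: ann_def)
qed

lemma ann_const: "[:c:] \<in> ann \<Longrightarrow> c = 0"
  using ps.inj by (simp add: ann_def hev_pCons is_hom_fps_of_poly)

text \<open>At t = 0 the derivative reduces to the nonzero slope of g.\<close>

lemma pderiv_g_not_ann: "pderiv g \<notin> ann"
proof
  assume "pderiv g \<in> ann"
  then have "hev fps_of_poly (pderiv g) w $ 0 = 0" by (simp add: ann_def)
  moreover have "hev fps_of_poly P w $ 0 = (\<Sum>i\<le>degree P. poly (coeff P i) 0 * (w $ 0) ^ i)" for P
    unfolding hev_altdef[OF is_hom_fps_of_poly order_refl]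
    by (simp add: fps_sum_nth fps_power_zeroth poly_0_coeff_0)
  moreover have "(\<Sum>i\<le>degree (pderiv g). poly (coeff (pderiv g) i) 0 * (w $ 0) ^ i) = (\<Sum>i\<le>degree (pderiv g). if i = 0 then poly (coeff g 1) 0 else 0)"
    by (intro sum.cong refl) (use gi in \<open>auto simp: coeff_pderiv\<close>)
  ultimately show False using g1 by simp
qed

text \<open>The factor \<open>den\<close> removes the fibres, other than the one over \<open>0\<close>, where the minimal polynomial
  drops its degree or the curve could be singular.\<close>

lemma ex_den: "\<exists>q B c e. poly q 0 \<noteq> 0 \<and> pderiv g * B - [:c:] \<in> ann \<and> lc * c = [:0, 1:] ^ e * q \<and> c \<noteq> 0"
proof -
  obtain B c where B: "c \<noteq> 0" "pderiv g * B - [:c:] \<in> ann" using not_ann_multiple[OF pderiv_g_not_ann] by auto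
  have nz: "lc * c \<noteq> 0" using B(1) minp(1) by simp
  obtain q where q: "lc * c = [:- 0, 1:] ^ order 0 (lc * c) * q" "\<not> [:- 0, 1:] dvd q"
    using order_decomp[OF nz, of 0] by auto
  then have "poly q 0 \<noteq> 0" by (simp add: poly_eq_0_iff_dvd)
  then show ?thesis using B q(1) by (intro exI[of _ q] exI[of _ B] exI[of _ c] exI[of _ "order 0 (lc * c)"]) simp
qed

definition den :: "'a poly" where
  "den = (SOME q. \<exists>B c e. poly q 0 \<noteq> 0 \<and> pderiv g * B - [:c:] \<in> ann \<and> lc * c = [:0, 1:] ^ e * q \<and> c \<noteq> 0)"

lemma den: "\<exists>B c e. poly den 0 \<noteq> 0 \<and> pderiv g * B - [:c:] \<in> ann \<and> lc * c = [:0, 1:] ^ e * den \<and> c \<noteq> 0"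
  unfolding den_def by (rule someI_ex[OF ex_den])

text \<open>The points over the algebraic closure, in affine coordinates; the ideal is cut down by
  inverting \<open>den\<close>.\<close>

definition apts :: "('a alg_closure \<times> 'a alg_closure) set" where
  "apts = {(s, u). hev to_ac den s \<noteq> 0 \<and> (\<forall>P\<in>ann. ev2 s u P = 0)}"

lemma apts_ann: "(s, u) \<in> apts \<Longrightarrow> P \<in> ann \<Longrightarrow> ev2 s u P = 0"
  by (simp add: apts_def)

lemma hev_ac_0: "hev to_ac p 0 = to_ac (poly p 0)"
  by (induction p) (simp_all add: hev_pCons is_hom_to_ac)

lemma hev_ac_mult: "hev to_ac (p * q) s = hev to_ac p s * hev to_ac q s"
  by (rule is_homD(4)[OF is_hom_hev[OF is_hom_to_ac]])

lemma apts_nonzero: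
  assumes "(s, u) \<in> apts" "s \<noteq> 0"
  shows "hev to_ac lc s \<noteq> 0" "ev2 s u (pderiv g) \<noteq> 0"
proof -
  obtain B c e where B: "pderiv g * B - [:c:] \<in> ann" "lc * c = [:0, 1:] ^ e * den" using den by auto
  have "hev to_ac [:0, 1:] s = s" by (simp add: hev_pCons is_hom_to_ac)
  then have "hev to_ac (lc * c) s \<noteq> 0"
    unfolding B(2) hev_ac_mult using assms by (simp add: is_homD(7)[OF is_hom_hev[OF is_hom_to_ac]] apts_def)
  then have l: "hev to_ac lc s \<noteq> 0" and c: "hev to_ac c s \<noteq> 0" by (auto simp: hev_ac_mult)
  show "hev to_ac lc s \<noteq> 0" by (rule l)
  have "ev2 s u (pderiv g) * ev2 s u B = hev to_ac c s"
    using apts_ann[OF assms(1) B(1)] by (simp add: acv ev2_const)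
  then show "ev2 s u (pderiv g) \<noteq> 0" using c by auto
qed

lemma ev2_0: "ev2 0 u P = (\<Sum>i\<le>degree P. to_ac (poly (coeff P i) 0) * u ^ i)"
  unfolding ev2_def using hev_altdef[OF is_hom_hev[OF is_hom_to_ac], of P "degree P" 0 u] by (simp only: hev_ac_0 order_refl simp_thms)

lemma g_at_0: "ev2 0 u g = to_ac (poly (coeff g 0) 0) + to_ac (poly (coeff g 1) 0) * u"
  "ev2 0 u (pderiv g) = to_ac (poly (coeff g 1) 0)"
proof -
  have "degree g \<noteq> 0" using g1 coeff_eq_0[of g 1] by (cases "degree g") auto
  then have "ev2 0 u g = (\<Sum>i\<in>{0, 1}. to_ac (poly (coeff g i) 0) * u ^ i)"
    unfolding ev2_0 by (intro sum.mono_neutral_right) (use gi in \<open>auto simp: Suc_le_eq numeral_2_eq_2\<close>)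
  then show "ev2 0 u g = to_ac (poly (coeff g 0) 0) + to_ac (poly (coeff g 1) 0) * u" by simp
  have "ev2 0 u (pderiv g) = (\<Sum>i\<le>degree (pderiv g). if i = 0 then to_ac (poly (coeff g 1) 0) else 0)"
    unfolding ev2_0 by (intro sum.cong refl) (use gi in \<open>auto simp: coeff_pderiv\<close>)
  then show "ev2 0 u (pderiv g) = to_ac (poly (coeff g 1) 0)" by simp
qed

lemma apts_smooth: "(s, u) \<in> apts \<Longrightarrow> ev2 s u (pderiv g) \<noteq> 0"
  using apts_nonzero(2)[of s u] g_at_0(2)[of u] g1 by (cases "s = 0") auto

definition base :: "'a alg_closure \<times> 'a alg_closure" where "base = (0, to_ac (w $ 0))"

lemma base_in: "base \<in> apts"
proof -
  have "ev2 0 (to_ac (w $ 0)) P = 0" if "P \<in> ann" for P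
  proof -
    have "to_ac (hev fps_of_poly P w $ 0) = (\<Sum>i\<le>degree P. to_ac (poly (coeff P i) 0) * to_ac (w $ 0) ^ i)"
      unfolding hev_altdef[OF is_hom_fps_of_poly order_refl]
      by (simp add: fps_sum_nth fps_power_zeroth poly_0_coeff_0 to_ac_sum)
    then show ?thesis using that by (simp add: ev2_0 ann_def)
  qed
  then show ?thesis using den by (auto simp: base_def apts_def hev_ac_0)
qed

lemma fibre_0: "(0, u) \<in> apts \<Longrightarrow> (0, u) = base"
proof -
  assume a: "(0, u) \<in> apts"
  have "g \<in> ann" using gw by (simp add: ann_def)
  then have "ev2 0 u g = ev2 0 (to_ac (w $ 0)) g" using apts_ann[OF a] apts_ann[OF base_in[unfolded base_def]] by simp
  then show ?thesis using g1 by (simp add: g_at_0 base_def)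
qed

text \<open>An explicit Nullstellensatz: for a value t in K avoiding finitely many roots, the
  specialized \<open>minp\<close> keeps its degree and has a root in the algebraic closure. By
  pseudo-division the whole ideal vanishes there.\<close>

lemma ex_apt:
  assumes "P \<notin> ann"
  shows "\<exists>s u. (s, u) \<in> apts \<and> ev2 s u P \<noteq> 0"
proof -
  obtain B c where B: "c \<noteq> 0" "P * B - [:c:] \<in> ann" using not_ann_multiple[OF assms] by auto
  have "den \<noteq> 0" using den by auto
  then have nz: "c * lc * den \<noteq> 0" using B(1) minp(1) by simp
  have "{t. poly (c * lc * den) t = 0} \<noteq> UNIV"
  proof
    assume "{t. poly (c * lc * den) t = 0} = UNIV"
    then have "finite (UNIV :: 'a set)" using poly_roots_finite[OF nz] by (simp only:)
    then show False using infinite_UNIV_char_0[where 'a = 'a] by (rule notE[rotated])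
  qed
  then obtain t :: 'a where t: "poly (c * lc * den) t \<noteq> 0" by auto
  define s where "s = to_ac t"
  have hs: "hev to_ac p s = to_ac (poly p t)" for p
    unfolding s_def by (induction p) (simp_all add: hev_pCons is_hom_to_ac)
  have nzs: "hev to_ac c s \<noteq> 0" "hev to_ac lc s \<noteq> 0" "hev to_ac den s \<noteq> 0" using t by (auto simp: hs)
  define f where "f = map_poly (\<lambda>p. hev to_ac p s) minp"
  have "coeff f (degree minp) \<noteq> 0" unfolding f_def using nzs(2)
    by (simp add: coeff_map_poly is_homD(1)[OF is_hom_hev[OF is_hom_to_ac]])
  then have "degree minp \<le> degree f" by (rule le_degree)
  then have "degree f > 0" using minp(4) by simp
  then obtain u where u: "poly f u = 0" using alg_closed_imp_poly_has_root by blast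
  have m0: "ev2 s u minp = 0" using u by (simp add: ev2_def hev_def f_def)
  have "ev2 s u Q = 0" if Q: "Q \<in> ann" for Q
  proof -
    obtain n v where "smult (lc ^ n) Q = v * minp" using pseudo_division[OF Q] by (elim exE)
    then have "ev2 s u (smult (lc ^ n) Q) = 0" using m0 by (simp add: acv)
    then show ?thesis using nzs(2) by (simp add: ev2_smult is_homD(7)[OF is_hom_hev[OF is_hom_to_ac]])
  qed
  then have a: "(s, u) \<in> apts" using nzs(3) by (simp add: apts_def)
  have "ev2 s u P * ev2 s u B = hev to_ac c s" using apts_ann[OF a B(2)] by (simp add: acv ev2_const)
  then have "ev2 s u P \<noteq> 0" using nzs(1) by auto
  then show ?thesis using a by auto
qed

text \<open>The zeros lie over finitely many s by \<open>not_ann_multiple\<close>. Each fibre is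
  finite: over 0 it is the base point, elsewhere \<open>minp\<close> does not specialize to
  0.\<close>

lemma finite_apts:
  assumes "P \<notin> ann"
  shows "finite {x \<in> apts. case x of (s, u) \<Rightarrow> ev2 s u P = 0}"
proof -
  obtain B c where B: "c \<noteq> 0" "P * B - [:c:] \<in> ann" using not_ann_multiple[OF assms] by auto
  have "map_poly to_ac c \<noteq> 0" using B(1) by (simp add: map_poly_eq_0_iff)
  then have fs: "finite {s. hev to_ac c s = 0}" unfolding hev_def by (rule poly_roots_finite)
  have fu: "finite {u. (s, u) \<in> apts}" for s
  proof (cases "s = 0")
    case True
    have "{u. (s, u) \<in> apts} \<subseteq> {snd base}" using fibre_0 True by force
    then show ?thesis by (rule finite_subset) simp
  next
    case False
    show ?thesis
    proof (cases "\<exists>u. (s, u) \<in> apts")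
      case True
      then have "hev to_ac lc s \<noteq> 0" using apts_nonzero(1)[OF _ False] by auto
      then have "coeff (map_poly (\<lambda>p. hev to_ac p s) minp) (degree minp) \<noteq> 0"
        by (simp add: coeff_map_poly is_homD(1)[OF is_hom_hev[OF is_hom_to_ac]])
      then have "map_poly (\<lambda>p. hev to_ac p s) minp \<noteq> 0" by auto
      then have "finite {u. poly (map_poly (\<lambda>p. hev to_ac p s) minp) u = 0}" by (rule poly_roots_finite)
      moreover have "{u. (s, u) \<in> apts} \<subseteq> {u. poly (map_poly (\<lambda>p. hev to_ac p s) minp) u = 0}"
        using apts_ann[OF _ minp(2)] by (auto simp: ev2_def hev_def)
      ultimately show ?thesis by (rule finite_subset[rotated])
    qed simp
  qed
  have "{x \<in> apts. case x of (s, u) \<Rightarrow> ev2 s u P = 0} \<subseteq> (SIGMA s:{s. hev to_ac c s = 0}. {u. (s, u) \<in> apts})"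
  proof
    fix x assume "x \<in> {x \<in> apts. case x of (s, u) \<Rightarrow> ev2 s u P = 0}"
    then obtain s u where x: "x = (s, u)" "(s, u) \<in> apts" "ev2 s u P = 0" by auto
    have "hev to_ac c s = 0" using apts_ann[OF x(2) B(2)] x(3) by (simp add: acv ev2_const)
    then show "x \<in> (SIGMA s:{s. hev to_ac c s = 0}. {u. (s, u) \<in> apts})" using x by simp
  qed
  then show ?thesis by (rule finite_subset) (intro finite_SigmaI fs fu)
qed

definition curve :: "(nat \<Rightarrow> 'a alg_closure) set set" where "curve = apoint ` apts"

lemma curve_mem: "apoint x \<in> curve \<longleftrightarrow> x \<in> apts"
  unfolding curve_def using inj_apoint by (auto dest: injD)

text \<open>The open part is the chart where the coordinate 0 and \<open>den\<close> do not vanish;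
  the closed part is cut out by the homogenized ideal.\<close>

lemma locally_closed: "\<exists>U C. openin (zariski 2) U \<and> closedin (zariski 2) C \<and> curve = U \<inter> C"
proof (intro exI conjI)
  let ?U = "basic_open 2 x0_poly \<inter> basic_open 2 (homogenize [:den:])"
  let ?O = "\<Union>((\<lambda>P. basic_open 2 (homogenize P)) ` ann)"
  show "openin (zariski 2) ?U" by (intro openin_Int openin_basic_open x0_poly(1) homogenize_in)
  have "openin (zariski 2) ?O" by (intro openin_Union) (auto intro: openin_basic_open homogenize_in)
  from closedin_diff[OF closedin_topspace this] show "closedin (zariski 2) (proj_space 2 - ?O)"
    by (simp only: topspace_zariski)
  have iff: "apoint x \<in> ?U \<inter> (proj_space 2 - ?O) \<longleftrightarrow> x \<in> apts" for x
  proof (cases x)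
    case (Pair s u)
    have "apoint (s, u) \<in> basic_open 2 x0_poly" by (simp add: apoint_basic_open x0_poly)
    moreover have "apoint (s, u) \<in> proj_space 2" by (rule apoint_in)
    ultimately show ?thesis unfolding Pair by (simp add: apoint_basic_open_hz apts_def ev2_const)
  qed
  show "curve = ?U \<inter> (proj_space 2 - ?O)"
  proof (rule Set.set_eqI, rule iffI)
    fix Q assume "Q \<in> curve"
    then obtain x where "x \<in> apts" "Q = apoint x" unfolding curve_def by (elim imageE)
    then show "Q \<in> ?U \<inter> (proj_space 2 - ?O)" using iff[of x] by (simp only:)
  next
    fix Q assume Q: "Q \<in> ?U \<inter> (proj_space 2 - ?O)"
    then have "Q \<in> basic_open 2 x0_poly" by simp
    then have "\<exists>x. Q = apoint x" by (rule apoint_chart)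
    then obtain x where x: "Q = apoint x" by (elim exE)
    have "x \<in> apts" using Q iff[of x] unfolding x by (simp only:)
    then show "Q \<in> curve" unfolding curve_def x by (rule imageI)
  qed
qed

abbreviation TC where "TC \<equiv> subtopology (zariski 2) curve"

lemma curve_sub: "curve \<subseteq> topspace (zariski 2)"
  unfolding topspace_zariski curve_def using apoint_in by auto

lemma topspace_TC: "topspace TC = curve"
  using curve_sub by (simp add: topspace_subtopology inf_absorb2)

lemma openin_TC:
  assumes "openin TC W" "apoint (s, u) \<in> W"
  shows "\<exists>P. ev2 s u P \<noteq> 0 \<and> (\<forall>s' u'. (s', u') \<in> apts \<longrightarrow> ev2 s' u' P \<noteq> 0 \<longrightarrow> apoint (s', u') \<in> W)"
proof -
  obtain U where U: "openin (zariski 2) U" "W = U \<inter> curve" using assms(1) unfolding openin_subtopology by auto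
  then have "apoint (s, u) \<in> U" using assms(2) by simp
  from zariski_open_affine[OF U(1) this] obtain P where
    "ev2 s u P \<noteq> 0" "\<forall>s' u'. ev2 s' u' P \<noteq> 0 \<longrightarrow> apoint (s', u') \<in> U" by auto
  then show ?thesis unfolding U(2) using curve_mem by (intro exI[of _ P]) auto
qed

definition zset :: "'a poly poly \<Rightarrow> (nat \<Rightarrow> 'a alg_closure) set set" where
  "zset P = {Q \<in> curve. \<exists>s u. Q = apoint (s, u) \<and> ev2 s u P = 0}"

lemma zset_mem: "apoint (s, u) \<in> zset P \<longleftrightarrow> (s, u) \<in> apts \<and> ev2 s u P = 0"
  unfolding zset_def using inj_apoint curve_mem by (auto dest: injD)

lemma closedin_zset: "closedin TC (zset P)"
proof -
  have "zset P = curve - (basic_open 2 (homogenize P) \<inter> curve)"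
  proof (rule Set.set_eqI)
    fix Q
    show "Q \<in> zset P \<longleftrightarrow> Q \<in> curve - (basic_open 2 (homogenize P) \<inter> curve)"
    proof (cases "Q \<in> curve")
      case True
      then obtain s u where "Q = apoint (s, u)" unfolding curve_def by auto
      then show ?thesis using True by (simp add: zset_mem curve_mem apoint_basic_open_hz)
    qed (simp add: zset_def)
  qed
  moreover have "openin TC (basic_open 2 (homogenize P) \<inter> curve)"
    unfolding openin_subtopology using openin_basic_open[OF homogenize_in] by blast
  ultimately show ?thesis using closedin_diff[OF closedin_topspace, of TC] topspace_TC by simp
qed

text \<open>Closed subsets are handled through a single polynomial that vanishes on them but not at
  a given point outside.\<close>

lemma closed_avoid:
  assumes C: "closedin TC C" and x: "(s, u) \<in> apts" "apoint (s, u) \<notin> C"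
  shows "\<exists>P. ev2 s u P \<noteq> 0 \<and> C \<subseteq> zset P"
proof -
  have "openin TC (curve - C)" using openin_diff[OF openin_topspace C] topspace_TC by simp
  moreover have "apoint (s, u) \<in> curve - C" using x curve_mem by simp
  ultimately obtain P where P: "ev2 s u P \<noteq> 0"
    "\<And>s' u'. (s', u') \<in> apts \<Longrightarrow> ev2 s' u' P \<noteq> 0 \<Longrightarrow> apoint (s', u') \<in> curve - C" using openin_TC by blast
  have "C \<subseteq> zset P"
  proof
    fix Q assume Q: "Q \<in> C"
    have "C \<subseteq> curve" using closedin_subset[OF C] topspace_TC by simp
    then obtain s' u' where su: "Q = apoint (s', u')" "(s', u') \<in> apts" using Q unfolding curve_def by auto
    then have "ev2 s' u' P = 0" using P(2)[OF su(2)] Q by auto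
    then show "Q \<in> zset P" using su by (simp add: zset_mem)
  qed
  then show ?thesis using P(1) by auto
qed

text \<open>Primality of the ideal: two proper closed sets lie in the zero sets of P and Q outside
  \<open>ann\<close>, and by \<open>ex_apt\<close> some point of the curve is a zero of
  neither.\<close>

lemma irreducible_curve: "irreducible_space TC"
  unfolding irreducible_space_def topspace_TC
proof (intro conjI allI impI)
  show "curve \<noteq> {}" using base_in by (auto simp: curve_def)
  fix A B assume AB: "closedin TC A" "closedin TC B" "A \<union> B = curve"
  show "A = curve \<or> B = curve"
  proof (rule ccontr)
    assume n: "\<not> (A = curve \<or> B = curve)"
    have "A \<subseteq> curve" "B \<subseteq> curve" using AB(3) by auto
    then obtain x y where x: "x \<in> apts" "apoint x \<notin> A" and y: "y \<in> apts" "apoint y \<notin> B"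
      using n unfolding curve_def by auto
    obtain P where P: "ev2 (fst x) (snd x) P \<noteq> 0" "A \<subseteq> zset P" using closed_avoid[OF AB(1), of "fst x" "snd x"] x by auto
    obtain Q where Q: "ev2 (fst y) (snd y) Q \<noteq> 0" "B \<subseteq> zset Q" using closed_avoid[OF AB(2), of "fst y" "snd y"] y by auto
    have "P \<notin> ann" "Q \<notin> ann" using P(1) Q(1) apts_ann[of "fst x" "snd x" P] apts_ann[of "fst y" "snd y" Q] x y by auto
    then have "P * Q \<notin> ann" by (simp add: ann_def evh)
    from ex_apt[OF this] obtain s u where su: "(s, u) \<in> apts" "ev2 s u (P * Q) \<noteq> 0" by auto
    have "apoint (s, u) \<in> A \<union> B" using su(1) AB(3) curve_mem by simp
    then have "ev2 s u P = 0 \<or> ev2 s u Q = 0" using P(2) Q(2) zset_mem by auto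
    then show False using su(2) by (auto simp: acv)
  qed
qed

end

section \<open>Dimension, smoothness and rational points of the curve\<close>

text \<open>Closed sets are defined over K, so conjugate points cannot be separated and values in
  the algebraic closure must be annihilated by polynomials over K. Removing powers of the variable
  makes the constant term nonzero.\<close>

lemma alg_closure_annihilator:
  assumes "finite V" "0 \<notin> V"
  shows "\<exists>m :: 'a::field poly. poly m 0 \<noteq> 0 \<and> (\<forall>v\<in>V. hev to_ac m v = 0)"
  using assms
proof (induction V)
  case empty
  show ?case by (rule exI[of _ 1]) simp
next
  case (insert v V)
  then obtain m :: "'a poly" where m: "poly m 0 \<noteq> 0" "\<forall>v\<in>V. hev to_ac m v = 0" by auto
  obtain p :: "'a poly" where p: "p \<noteq> 0" "poly (map_poly to_ac p) v = 0" by (rule alg_closure_algebraic)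
  obtain q where q: "p = [:- 0, 1:] ^ order 0 p * q" "\<not> [:- 0, 1:] dvd q" using order_decomp[OF p(1), of 0] by auto
  note h = is_homD[OF is_hom_hev[OF is_hom_to_ac, of v]]
  have "hev to_ac p v = v ^ order 0 p * hev to_ac q v"
    using h(4)[of "[:- 0, 1:] ^ order 0 p" q] q(1) by (simp add: h(7) hev_pCons[OF is_hom_to_ac])
  then have "hev to_ac q v = 0" using p(2) insert.prems by (auto simp: hev_def)
  moreover have "poly q 0 \<noteq> 0" using q(2) by (simp add: poly_eq_0_iff_dvd)
  ultimately show ?case using m
    by (intro exI[of _ "m * q"]) (simp add: is_homD(4)[OF is_hom_hev[OF is_hom_to_ac]])
qed

lemma mp_partial_eval_not_var: "j \<notin> mp_vars p \<Longrightarrow> mp_partial_eval h j x p = 0"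
  unfolding mp_partial_eval_def by (intro sum.neutral) (auto simp: mp_vars_def in_keys_iff)

lemma dim_line:
  fixes b :: "nat \<Rightarrow> 'c::field"
  assumes "b \<in> S" "b \<noteq> 0" "\<And>w. w \<in> S \<Longrightarrow> \<exists>k. w = (\<lambda>i. k * b i)"
  shows "vector_space.dim (\<lambda>(c :: 'c) w (i :: nat). c * w i) S = 1"
proof -
  interpret vs: vector_space "\<lambda>(c :: 'c) w (i :: nat). c * w i"
    by unfold_locales (auto simp: fun_eq_iff algebra_simps)
  have "S \<subseteq> vs.span {b}"
  proof
    fix w assume "w \<in> S"
    then obtain k where w: "w = (\<lambda>i. k * b i)" using assms(3) by auto
    show "w \<in> vs.span {b}" unfolding w by (rule vs.span_scale[OF vs.span_base]) simp
  qed
  moreover have "\<not> vs.dependent {b}" using assms(2) by simp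
  ultimately show ?thesis using assms(1) by (intro vs.dim_unique[of "{b}"]) simp_all
qed

context plane_curve begin

lemma affine_vec_in_apoint: "affine_vec s u \<in> apoint (s, u)"
  unfolding apoint_def by (auto simp: proj_point_iff intro!: exI[of _ 1])

lemma x_not_ann: "[:[:0, 1:]:] \<notin> ann"
  by (simp add: ann_def hev_coords)

lemma zset_base: "zset [:[:0, 1:]:] = {apoint base}"
proof (rule Set.set_eqI, rule iffI)
  fix Q assume "Q \<in> zset [:[:0, 1:]:]"
  then obtain s u where Q: "Q \<in> curve" "Q = apoint (s, u)" "s = 0" unfolding zset_def ev2_coords by auto
  then have "(0, u) \<in> apts" using curve_mem by simp
  then show "Q \<in> {apoint base}" using fibre_0 Q by simp
next
  fix Q assume "Q \<in> {apoint base}"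
  then show "Q \<in> zset [:[:0, 1:]:]" using base_in unfolding base_def by (simp add: zset_mem ev2_coords)
qed

lemma irreducible_singleton: "Q \<in> curve \<Longrightarrow> irreducible_space (subtopology TC {Q})"
  using curve_sub unfolding irreducible_space_def by auto

lemma finite_zset:
  assumes "P \<notin> ann"
  shows "finite (zset P)"
proof (rule finite_subset)
  show "zset P \<subseteq> apoint ` {x \<in> apts. case x of (s, u) \<Rightarrow> ev2 s u P = 0}"
    unfolding zset_def curve_def using inj_apoint by (auto dest: injD)
qed (intro finite_imageI finite_apts assms)

text \<open>A proper closed subset Z1 is finite. If P0 vanishes on Z0 but not on all of Z1, then
  composing P0 with an annihilator of its nonzero values on Z1 gives a second function; their zero
  sets cover Z1 and neither contains it.\<close>

lemma no_chain:
  assumes Z0: "closedin TC Z0" "Z0 \<noteq> {}" and Z1: "closedin TC Z1" "irreducible_space (subtopology TC Z1)"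
    and sub: "Z0 \<subset> Z1" "Z1 \<subset> curve"
  shows False
proof -
  obtain x where x: "x \<in> apts" "apoint x \<notin> Z1" using sub(2) unfolding curve_def by auto
  obtain P where P: "ev2 (fst x) (snd x) P \<noteq> 0" "Z1 \<subseteq> zset P" using closed_avoid[OF Z1(1), of "fst x" "snd x"] x by auto
  have "P \<notin> ann" using P(1) apts_ann[of "fst x" "snd x" P] x by auto
  then have "finite (zset P)" by (rule finite_zset)
  then have fin: "finite Z1" using P(2) by (rule finite_subset[rotated])
  obtain Y where Y: "Y \<in> Z1" "Y \<notin> Z0" using sub(1) by auto
  then have "Y \<in> apoint ` apts" using sub(2) unfolding curve_def by auto
  then obtain y where "Y = apoint y" "y \<in> apts" by (elim imageE)
  then have y: "y \<in> apts" "apoint y \<in> Z1" "apoint y \<notin> Z0" using Y by simp_all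
  obtain P0 where P0: "ev2 (fst y) (snd y) P0 \<noteq> 0" "Z0 \<subseteq> zset P0" using closed_avoid[OF Z0(1), of "fst y" "snd y"] y by auto
  let ?V = "(\<lambda>x. ev2 (fst x) (snd x) P0) ` (apoint -` Z1)"
  have "finite ?V" using fin inj_apoint by (intro finite_imageI finite_vimageI)
  from alg_closure_annihilator[of "?V - {0}"] this
  obtain m :: "'a poly" where m: "poly m 0 \<noteq> 0" "\<forall>v\<in>?V - {0}. hev to_ac m v = 0" by auto
  \<comment> \<open>M is m(P0): it vanishes wherever P0 takes a nonzero value on Z1, and equals m(0)
    \<noteq> 0 on Z0.\<close>
  define M where "M = hev cc m P0"
  have M: "ev2 s u M = hev to_ac m (ev2 s u P0)" for s u
    unfolding M_def hev_hom[OF is_hom_ev2 is_hom_cc] ev2_coords ..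
  let ?T = "subtopology TC Z1"
  have tsp: "topspace ?T = Z1" using sub(2) topspace_TC by (auto simp: topspace_subtopology)
  have cl: "closedin ?T (zset Q \<inter> Z1)" for Q by (rule iffD2[OF closedin_subtopology]) (intro exI[of _ "zset Q"] conjI refl closedin_zset)
  have "(zset P0 \<inter> Z1) \<union> (zset M \<inter> Z1) = Z1"
  proof -
    have "Q \<in> zset P0 \<or> Q \<in> zset M" if Q: "Q \<in> Z1" for Q
    proof -
      have "Q \<in> apoint ` apts" using Q sub(2) unfolding curve_def by auto
      then obtain y where "y \<in> apts" "Q = apoint y" by (elim imageE)
      then obtain s u where su: "Q = apoint (s, u)" "(s, u) \<in> apts" by (cases y) simp
      have "ev2 s u P0 \<in> ?V" using Q su(1) by (intro image_eqI[of _ _ "(s, u)"]) auto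
      then have "ev2 s u M = 0" if "ev2 s u P0 \<noteq> 0"
        unfolding M by (intro bspec[OF m(2)]) (simp only: Diff_iff singleton_iff that not_False_eq_True simp_thms)
      then show ?thesis using su by (auto simp: zset_mem)
    qed
    then show ?thesis by auto
  qed
  then have "zset P0 \<inter> Z1 = Z1 \<or> zset M \<inter> Z1 = Z1"
    using Z1(2) cl[of P0] cl[of M] unfolding irreducible_space_def tsp by simp
  then show False
  proof
    assume "zset P0 \<inter> Z1 = Z1"
    then have "apoint (fst y, snd y) \<in> zset P0" using y(2) by auto
    then show False using P0(1) unfolding zset_mem by simp
  next
    assume a: "zset M \<inter> Z1 = Z1"
    obtain z where z: "z \<in> Z0" using Z0(2) by auto
    then have "z \<in> apoint ` apts" using sub unfolding curve_def by auto
    then obtain y where "z = apoint y" by (elim imageE)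
    then obtain s u where su: "z = apoint (s, u)" by (cases y) simp
    have "ev2 s u P0 = 0" "ev2 s u M = 0" using z a sub(1) P0(2) zset_mem[of s u] unfolding su by auto
    then show False using m(1) by (simp add: M hev_ac_0)
  qed
qed

lemma krull_curve: "krull_dimension TC = 1"
  unfolding krull_dimension_def
proof (rule antisym)
  show "Sup {enat d | d. \<exists>Z :: nat \<Rightarrow> (nat \<Rightarrow> 'a alg_closure) set set.
      (\<forall>i\<le>d. closedin TC (Z i) \<and> irreducible_space (subtopology TC (Z i))) \<and> (\<forall>i<d. Z i \<subset> Z (Suc i))} \<le> 1"
  proof (rule Sup_least)
    fix x :: enat
    assume "x \<in> {enat d | d. \<exists>Z :: nat \<Rightarrow> (nat \<Rightarrow> 'a alg_closure) set set.
      (\<forall>i\<le>d. closedin TC (Z i) \<and> irreducible_space (subtopology TC (Z i))) \<and> (\<forall>i<d. Z i \<subset> Z (Suc i))}"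
    then obtain d Z where x: "x = enat d"
      and Z: "\<forall>i\<le>d. closedin TC (Z i) \<and> irreducible_space (subtopology TC (Z i))" "\<forall>i<d. Z i \<subset> Z (Suc i)" by auto
    have "d \<le> 1"
    proof (rule ccontr)
      assume d: "\<not> d \<le> 1"
      have c: "closedin TC (Z 0)" "closedin TC (Z 1)" "closedin TC (Z 2)" "irreducible_space (subtopology TC (Z 0))"
        "irreducible_space (subtopology TC (Z 1))" using Z(1) d by auto
      have "Z 0 \<noteq> {}" using c(4) unfolding irreducible_space_def by auto
      moreover have "Z 0 \<subset> Z 1" using Z(2)[rule_format, of 0] d by simp
      moreover have "Z 1 \<subset> Z 2" using Z(2)[rule_format, of 1] d by (simp add: numeral_2_eq_2)
      then have "Z 1 \<subset> curve" using closedin_subset[OF c(3)] topspace_TC by auto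
      ultimately show False by (rule no_chain[OF c(1) _ c(2) c(5)])
    qed
    then show "x \<le> 1" unfolding x by (simp add: one_enat_def)
  qed
  \<comment> \<open>The base point is closed, because the fibre over t = 0 has no other point; this
    gives a chain of length 1.\<close>
  define Z where "Z = (\<lambda>i :: nat. if i = 0 then {apoint base} else curve)"
  have bc: "apoint base \<in> curve" using base_in curve_mem by simp
  obtain s u where "(s, u) \<in> apts" "ev2 s u [:[:0, 1:]:] \<noteq> 0" using ex_apt[OF x_not_ann] by (elim exE conjE)
  then have ne: "apoint (s, u) \<in> curve" "apoint (s, u) \<notin> {apoint base}"
    unfolding curve_mem zset_base[symmetric] zset_mem by simp_all
  have 1: "closedin TC (Z i) \<and> irreducible_space (subtopology TC (Z i))" for i
  proof (cases "i = 0")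
    case True
    then show ?thesis unfolding Z_def using closedin_zset[of "[:[:0, 1:]:]"] irreducible_singleton[OF bc] by (simp add: zset_base)
  next
    case False
    have "closedin TC curve" using closedin_topspace[of TC] topspace_TC by simp
    then show ?thesis unfolding Z_def using False irreducible_curve by (simp add: subtopology_subtopology)
  qed
  have 2: "Z i \<subset> Z (Suc i)" if "i < 1" for i
    using that ne bc by (auto simp: Z_def)
  show "1 \<le> Sup {enat d | d. \<exists>Z :: nat \<Rightarrow> (nat \<Rightarrow> 'a alg_closure) set set.
      (\<forall>i\<le>d. closedin TC (Z i) \<and> irreducible_space (subtopology TC (Z i))) \<and> (\<forall>i<d. Z i \<subset> Z (Suc i))}"
    unfolding one_enat_def by (rule Sup_upper, rule CollectI, rule exI[of _ 1]) (use 1 2 in \<open>auto intro!: exI[of _ Z]\<close>)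
qed

lemma variety_curve: "variety 2 curve" "variety_dimension 2 curve = 1"
  unfolding variety_def variety_dimension_def using locally_closed irreducible_curve krull_curve by auto

definition pd :: "nat \<Rightarrow> (nat, 'a) mpolynomial \<Rightarrow> 'a poly poly" where
  "pd j f = mp_partial_eval cc j (affine_vec [:[:0, 1:]:] [:0, 1:]) f"

lemma ev2_pd: "ev2 s u (pd j f) = mp_partial_eval to_ac j (affine_vec s u) f"
  unfolding pd_def mp_partial_eval_hom[OF is_hom_ev2] by (simp add: ev2_coords affine_vec_hom[OF is_hom_ev2])

lemma hev_pd: "hev fps_of_poly (pd j f) w = mp_partial_eval fps_const j (affine_vec fps_X w) f"
  unfolding pd_def mp_partial_eval_hom[OF is_hom_hev[OF is_hom_fps_of_poly]]
  by (simp add: hev_coords affine_vec_hom[OF is_hom_hev[OF is_hom_fps_of_poly]])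

lemma sum_atMost_2: "(\<Sum>j\<in>{..2::nat}. F j) = F 0 + F 1 + (F 2 :: 'c::comm_ring_1)"
  by (simp add: numeral_2_eq_2)

text \<open>Differentiating f(1, t, w) = 0 in t. The derivation of K[[t]] enters as the homomorphism
  y + y' \<epsilon> into the dual numbers.\<close>

lemma tangent:
  assumes "dehomogenize f \<in> ann" "mp_vars f \<subseteq> {..2}"
  shows "hev fps_of_poly (pd 1 f) w + fps_deriv w * hev fps_of_poly (pd 2 f) w = 0"
proof -
  define \<delta> where "\<delta> = (\<lambda>y :: 'a fps. Dual y (fps_deriv y))"
  have hom: "is_hom \<delta>" unfolding \<delta>_def by (rule is_homI) (simp_all add: dual_eq_iff algebra_simps)
  have "\<delta> (mp_eval fps_const (affine_vec fps_X w) f) =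
      mp_eval (\<lambda>c. Dual (fps_const c) 0) (\<lambda>i. Dual (affine_vec fps_X w i) (fps_deriv (affine_vec fps_X w i))) f"
    unfolding mp_eval_hom[OF hom] by (simp add: \<delta>_def)
  also have "\<dots> = Dual (mp_eval fps_const (affine_vec fps_X w) f)
      (\<Sum>j\<in>{..2}. fps_deriv (affine_vec fps_X w j) * mp_partial_eval fps_const j (affine_vec fps_X w) f)"
    by (rule mp_eval_dual) (use assms(2) in simp_all)
  finally have "\<delta> 0 = Dual 0 (\<Sum>j\<in>{..2}. fps_deriv (affine_vec fps_X w j) * mp_partial_eval fps_const j (affine_vec fps_X w) f)"
    using assms(1) by (simp add: ann_def hev_dehomogenize)
  then show ?thesis unfolding sum_atMost_2 hev_pd by (simp add: \<delta>_def dual_eq_iff)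
qed

lemma pd_homogenize: "pd 2 (homogenize g) = pderiv g"
proof -
  define \<rho> where "\<rho> = (\<lambda>P :: 'a poly poly. Dual P (pderiv P))"
  let ?A = "affine_vec [:[:0, 1:]:] [:0, 1:] :: nat \<Rightarrow> 'a poly poly"
  have hom: "is_hom \<rho>" unfolding \<rho>_def by (rule is_homI) (simp_all add: dual_eq_iff pderiv_add pderiv_mult algebra_simps)
  have "\<rho> (mp_eval cc ?A (homogenize g)) = mp_eval (\<lambda>c. Dual (cc c) 0) (\<lambda>i. Dual (?A i) (pderiv (?A i))) (homogenize g)"
    unfolding mp_eval_hom[OF hom] by (simp add: \<rho>_def cc_def pderiv_pCons)
  also have "\<dots> = Dual (mp_eval cc ?A (homogenize g)) (\<Sum>j\<in>{..2}. pderiv (?A j) * mp_partial_eval cc j ?A (homogenize g))"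
    by (rule mp_eval_dual) (use homogenize_homog(2) in simp_all)
  finally have "\<rho> g = Dual g (\<Sum>j\<in>{..2}. pderiv (?A j) * pd j (homogenize g))"
    using dehomogenize_homogenize[of g] by (simp add: dehomogenize_def pd_def)
  then show ?thesis unfolding sum_atMost_2 by (simp add: \<rho>_def dual_eq_iff pderiv_pCons)
qed

lemma dehomogenize_ann: "f \<in> vanishing_polys 2 curve \<Longrightarrow> dehomogenize f \<in> ann"
proof (rule ccontr)
  assume f: "f \<in> vanishing_polys 2 curve" and "dehomogenize f \<notin> ann"
  from ex_apt[OF this(2)] obtain s u where su: "(s, u) \<in> apts" "ev2 s u (dehomogenize f) \<noteq> 0" by (elim exE conjE)
  have "mp_eval to_ac (affine_vec s u) f = 0"
    using f su(1) affine_vec_in_apoint[of s u] curve_mem[of "(s, u)"] unfolding vanishing_polys_def by auto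
  then show False using su(2) by (simp add: ev2_dehomogenize)
qed

lemma g_ann: "g \<in> ann" using gw by (simp add: ann_def)

lemma homogenize_vanishing: "homogenize g \<in> vanishing_polys 2 curve"
proof -
  have "\<forall>v\<in>P. mp_eval to_ac v (homogenize g) = 0" if P: "P \<in> curve" for P
  proof -
    obtain s u where su: "P = apoint (s, u)" "(s, u) \<in> apts" using P unfolding curve_def by auto
    have Ps: "P = proj_point (affine_vec s u)" using su(1) by (simp add: apoint_def)
    show ?thesis unfolding Ps homog_nonzero_proj(2)[OF homogenize_in] ev2_homogenize by (rule apts_ann[OF su(2) g_ann])
  qed
  then show ?thesis unfolding vanishing_polys_def using homogenize_in by simp
qed

text \<open>Every gradient of a vanishing form satisfies two linear relations: Euler's identity and
  orthogonality to the tangent direction (0, 1, w'). They determine it up to a factor, read off in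
  the coordinate 2, where the form of g has a nonzero entry.\<close>

lemma gradient_affine:
  assumes f: "f \<in> vanishing_polys 2 curve" and su: "(s, u) \<in> apts" and j: "j \<in> {..2}"
  shows "mp_partial_eval to_ac j (affine_vec s u) f * ev2 s u (pderiv g) =
    mp_partial_eval to_ac 2 (affine_vec s u) f * mp_partial_eval to_ac j (affine_vec s u) (homogenize g)"
proof -
  let ?G = "homogenize g" let ?D = "\<lambda>j f. mp_partial_eval to_ac j (affine_vec s u) f"
  have G2: "?D 2 ?G = ev2 s u (pderiv g)" using ev2_pd[of s u 2 ?G] by (simp add: pd_homogenize)
  have vars: "mp_vars f \<subseteq> {..2}" using f by (simp add: vanishing_polys_def homog_polys_def)
  have tf: "hev fps_of_poly (pd 1 f) w = - (fps_deriv w * hev fps_of_poly (pd 2 f) w)"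
    using tangent[OF dehomogenize_ann[OF f] vars] by (simp add: eq_neg_iff_add_eq_0)
  have tg: "hev fps_of_poly (pd 1 ?G) w = - (fps_deriv w * hev fps_of_poly (pd 2 ?G) w)"
    using tangent[OF dehomogenize_ann[OF homogenize_vanishing] homogenize_homog(2)] by (simp add: eq_neg_iff_add_eq_0)
  have "pd 1 f * pd 2 ?G - pd 2 f * pd 1 ?G \<in> ann" unfolding ann_def mem_Collect_eq evh tf tg by (simp only: mult_minus_left mult_minus_right mult.commute mult.left_commute mult.assoc diff_self)
  from apts_ann[OF su this] have 1: "?D 1 f * ?D 2 ?G = ?D 2 f * ?D 1 ?G" by (simp add: acv ev2_pd)
  have e: "?D 0 f' + s * ?D 1 f' + u * ?D 2 f' = 0" if f': "f' \<in> vanishing_polys 2 curve" for f'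
  proof -
    obtain d where d: "mp_homog_degree f' d" "mp_vars f' \<subseteq> {..2}" using f' unfolding vanishing_polys_def homog_polys_iff by auto
    have "mp_eval to_ac (affine_vec s u) f' = 0"
      using apts_ann[OF su dehomogenize_ann[OF f']] by (simp add: ev2_dehomogenize)
    then show ?thesis using mp_euler[OF d(1) _ d(2), of "affine_vec s u" to_ac] unfolding sum_atMost_2 by simp
  qed
  have f0: "?D 0 f = - (s * ?D 1 f) - u * ?D 2 f" using e[OF f] by (simp add: eq_neg_iff_add_eq_0 algebra_simps)
  have g0: "?D 0 ?G = - (s * ?D 1 ?G) - u * ?D 2 ?G" using e[OF homogenize_vanishing] by (simp add: eq_neg_iff_add_eq_0 algebra_simps)
  have "?D 0 f * ?D 2 ?G = - s * (?D 1 f * ?D 2 ?G) - u * ?D 2 f * ?D 2 ?G" unfolding f0 by (simp add: algebra_simps)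
  also have "\<dots> = ?D 2 f * ?D 0 ?G" unfolding 1 g0 by (simp add: algebra_simps)
  finally have 0: "?D 0 f * ?D 2 ?G = ?D 2 f * ?D 0 ?G" .
  have "j = 0 \<or> j = 1 \<or> j = 2" using j by auto
  then show ?thesis unfolding G2[symmetric] using 0 1 by auto
qed

text \<open>All gradients are multiples of that of the homogenized g, which is nonzero; changing the
  coordinate vector of the point rescales each gradient as a whole.\<close>

lemma jacobian_rank_curve:
  assumes P: "P \<in> curve" "v \<in> P"
  shows "jacobian_rank 2 curve v = 1"
proof -
  obtain s u where su: "P = apoint (s, u)" "(s, u) \<in> apts" using P(1) unfolding curve_def by auto
  have "v \<in> proj_point (affine_vec s u)" using P(2) unfolding su(1) apoint_def by simp
  then obtain c where c: "c \<noteq> 0" "v = (\<lambda>i. c * affine_vec s u i)" unfolding proj_point_iff by (elim exE conjE)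
  let ?G = "homogenize g" let ?D = "\<lambda>j f. mp_partial_eval to_ac j (affine_vec s u) f" and ?V = "\<lambda>f j. mp_partial_eval to_ac j v f"
  have G2: "?D 2 ?G = ev2 s u (pderiv g)" using ev2_pd[of s u 2 ?G] by (simp add: pd_homogenize)
  have nz: "ev2 s u (pderiv g) \<noteq> 0" by (rule apts_smooth[OF su(2)])
  have sc: "\<exists>k. k \<noteq> 0 \<and> (\<forall>j\<in>{..2}. ?V f j = k * ?D j f) \<and> (\<forall>j. j \<notin> {..2} \<longrightarrow> ?V f j = 0)" if f: "f \<in> vanishing_polys 2 curve" for f
  proof -
    obtain d where d: "mp_homog_degree f d" "mp_vars f \<subseteq> {..2}" using f unfolding vanishing_polys_def homog_polys_iff by auto
    have "?V f j = c ^ d / c * ?D j f" if "j \<in> {..2}" for j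
      using mp_partial_eval_scale[OF d(1) _ d(2) that, of c to_ac "affine_vec s u"] c by (simp add: field_simps)
    moreover have "?V f j = 0" if "j \<notin> {..2}" for j by (rule mp_partial_eval_not_var) (use d(2) that in blast)
    ultimately show ?thesis using c(1) by (intro exI[of _ "c ^ d / c"]) simp
  qed
  obtain kG where kG: "kG \<noteq> 0" "\<forall>j\<in>{..2}. ?V ?G j = kG * ?D j ?G" "\<forall>j. j \<notin> {..2} \<longrightarrow> ?V ?G j = 0"
    using sc[OF homogenize_vanishing] by (elim exE conjE)
  show ?thesis unfolding jacobian_rank_def
  proof (rule dim_line)
    show "?V ?G \<in> ?V ` vanishing_polys 2 curve" by (rule imageI[OF homogenize_vanishing])
    have nz2: "?V ?G 2 \<noteq> 0" using kG(1,2) nz G2 by simp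
    show "?V ?G \<noteq> 0"
    proof
      assume "?V ?G = 0"
      from fun_cong[OF this, of 2] show False using nz2 by simp
    qed
    fix w' assume "w' \<in> ?V ` vanishing_polys 2 curve"
    then obtain f where f: "f \<in> vanishing_polys 2 curve" "w' = ?V f" by (elim imageE)
    obtain k where k: "\<forall>j\<in>{..2}. ?V f j = k * ?D j f" "\<forall>j. j \<notin> {..2} \<longrightarrow> ?V f j = 0"
      using sc[OF f(1)] by (elim exE conjE)
    define q where "q = k / kG * (?D 2 f / ev2 s u (pderiv g))"
    have "?V f j = q * ?V ?G j" for j
    proof (cases "j \<in> {..2}")
      case True
      have "?D j f = ?D 2 f / ev2 s u (pderiv g) * ?D j ?G"
        using gradient_affine[OF f(1) su(2) True] nz by (simp add: field_simps)
      then have "?V f j = k * (?D 2 f / ev2 s u (pderiv g) * ?D j ?G)" using k(1) True by simp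
      also have "\<dots> = q * (kG * ?D j ?G)" using kG(1) by (simp add: q_def)
      also have "\<dots> = q * ?V ?G j" using kG(2) True by simp
      finally show ?thesis .
    next
      case False
      then show ?thesis using k(2) kG(3) by simp
    qed
    then show "\<exists>k. w' = (\<lambda>i. k * ?V ?G i)" unfolding f(2) by (intro exI[of _ q] ext)
  qed
qed

lemma smooth_curve: "smooth_variety 2 curve"
  unfolding smooth_variety_def using variety_curve jacobian_rank_curve
  by (auto simp: one_enat_def)

lemma rational_base: "apoint base \<in> rational_points curve"
proof -
  have "affine_vec 0 (to_ac (w $ 0)) i \<in> range to_ac" for i
    using to_ac_0[where 'a = 'a] to_ac_1[where 'a = 'a] rangeI[of to_ac 0] rangeI[of to_ac 1] by (auto simp: affine_vec_def simp del: range_eqI)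
  then show ?thesis unfolding rational_points_def using base_in curve_mem affine_vec_in_apoint[of 0 "to_ac (w $ 0)"]
    by (auto simp: base_def)
qed

text \<open>The base point is rational, so there are infinitely many rational points and only
  finitely many lie over zeros of q. Dividing by the coordinate 0 gives affine coordinates in
  K.\<close>

lemma large_points:
  assumes large: "large_field TYPE('a)" and q: "q \<noteq> 0"
  shows "\<exists>\<tau> \<eta>. poly q \<tau> \<noteq> 0 \<and> (\<forall>P. hev fps_of_poly P w = 0 \<longrightarrow> hev (\<lambda>p. poly p \<tau>) P \<eta> = 0)"
proof -
  have "infinite (rational_points curve)"
    using large smooth_curve variety_curve(2) rational_base unfolding large_field_def by blast
  moreover have "finite (zset [:q:])" using finite_zset[of "[:q:]"] ann_const[of q] q by auto
  ultimately obtain Q where Q: "Q \<in> rational_points curve" "Q \<notin> zset [:q:]"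
    using finite_subset by (metis subsetI)
  obtain v where v: "Q \<in> curve" "v \<in> Q" "\<forall>i. v i \<in> range to_ac" using Q(1) unfolding rational_points_def by auto
  obtain s u where su: "Q = apoint (s, u)" "(s, u) \<in> apts" using v(1) unfolding curve_def by auto
  have "v \<in> proj_point (affine_vec s u)" using v(2) unfolding su(1) apoint_def by simp
  then obtain c where c: "c \<noteq> 0" "v = (\<lambda>i. c * affine_vec s u i)" unfolding proj_point_iff by (elim exE conjE)
  obtain a0 a1 a2 where a: "v 0 = to_ac a0" "v 1 = to_ac a1" "v 2 = to_ac a2" using v(3) by (meson imageE)
  have s: "s = to_ac (a1 / a0)" and u: "u = to_ac (a2 / a0)" using a c by (auto simp: field_simps)
  have pe: "hev to_ac p (to_ac x) = to_ac (poly p x)" for p x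
    by (induction p) (simp_all add: hev_pCons is_hom_to_ac)
  have ev: "ev2 s u P = to_ac (hev (\<lambda>p. poly p (a1 / a0)) P (a2 / a0))" for P
    unfolding ev2_def s u pe by (rule hev_hom[OF is_hom_to_ac is_hom_poly, symmetric])
  have "ev2 s u [:q:] \<noteq> 0" using Q(2) su by (simp add: zset_mem)
  then have "poly q (a1 / a0) \<noteq> 0" unfolding ev2_const s pe by simp
  moreover have "hev (\<lambda>p. poly p (a1 / a0)) P (a2 / a0) = 0" if "hev fps_of_poly P w = 0" for P
    using apts_ann[OF su(2), of P] that unfolding ev by (simp add: ann_def)
  ultimately show ?thesis by (intro exI[of _ "a1 / a0"] exI[of _ "a2 / a0"]) simp
qed

end

text \<open>The form in which largeness is used: finitely many algebraic power series specialize to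
  K over K, with nonzero ones staying nonzero. In other words, K is existentially closed in its
  algebraic power series.\<close>

theorem large_specialization:
  fixes F :: "'a::field_char_0 fps set"
  assumes large: "large_field TYPE('a)" and F: "finite F" "\<And>y. y \<in> F \<Longrightarrow> ps.alg y"
  shows "\<exists>R \<phi>. subring_set R \<and> F \<subseteq> R \<and> range fps_const \<subseteq> R \<and>
    (\<forall>x\<in>R. \<forall>y\<in>R. \<phi> (x + y) = \<phi> x + \<phi> y \<and> \<phi> (x * y) = \<phi> x * \<phi> y) \<and>
    (\<forall>c. \<phi> (fps_const c) = c) \<and> (\<forall>y\<in>F. y \<noteq> 0 \<longrightarrow> \<phi> y \<noteq> 0)"
proof -
  have "\<exists>v. ps.alg v \<and> F \<subseteq> ps.adj v" by (rule ps.primitive_element[OF F(1)]) (rule F(2))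
  then obtain z where z: "ps.alg z" "F \<subseteq> ps.adj z" by (elim exE conjE)
  obtain w g where W: "ps.alg w" "z \<in> ps.adj w" "hev fps_of_poly g w = 0"
    "poly (coeff g 1) 0 \<noteq> 0" "\<forall>i\<ge>2. poly (coeff g i) 0 = 0"
    using smooth_model[OF z(1)] by (elim exE conjE)
  interpret plane_curve w g by unfold_locales (use W in auto)
  have "F \<subseteq> ps.adj w" using z(2) ps.adj_trans[OF _ W(2)] by auto
  from specialization[OF W(1) F(1) this large_points[OF large]] show ?thesis .
qed

section \<open>Finite approximations of a gt-henselian topology\<close>

text \<open>\<open>gt_poly\<close> over a commutative ring, since its coefficients will be power
  series.\<close>

definition ring_gt_poly :: "nat \<Rightarrow> (nat \<Rightarrow> 'b::comm_ring_1) \<Rightarrow> 'b poly" where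
  "ring_gt_poly d a = monom 1 (d + 2) + monom 1 (d + 1) + (\<Sum>i\<le>d. monom (a i) i)"

lemma gt_poly_ring_gt_poly: "gt_poly d a = ring_gt_poly d a"
  by (simp add: gt_poly_def ring_gt_poly_def)

lemma coeff_ring_gt_poly: "coeff (ring_gt_poly d a) i = (if i = d + 2 \<or> i = d + 1 then 1 else if i \<le> d then a i else 0)"
proof -
  have "(\<Sum>j\<le>d. coeff (monom (a j) j) i) = (\<Sum>j\<le>d. if i = j then a j else 0)"
    by (intro sum.cong refl) auto
  also have "\<dots> = (if i \<le> d then a i else 0)" by (simp add: sum.delta)
  finally show ?thesis by (auto simp: ring_gt_poly_def coeff_sum)
qed

lemma lead_coeff_ring_gt_poly: "lead_coeff (ring_gt_poly d a) = 1"
proof -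
  have "degree (ring_gt_poly d a) \<le> d + 2" by (rule degree_le) (simp add: coeff_ring_gt_poly)
  moreover have "d + 2 \<le> degree (ring_gt_poly d a)" by (rule le_degree) (simp add: coeff_ring_gt_poly)
  ultimately have "degree (ring_gt_poly d a) = d + 2" by (rule antisym)
  then show ?thesis by (simp add: coeff_ring_gt_poly)
qed

lemma ring_gt_poly_cong: "(\<And>i. i \<le> d \<Longrightarrow> a i = b i) \<Longrightarrow> ring_gt_poly d a = ring_gt_poly d b"
  unfolding ring_gt_poly_def by simp

lemma map_poly_ring_gt_poly: "h 0 = 0 \<Longrightarrow> h 1 = 1 \<Longrightarrow> map_poly h (ring_gt_poly d a) = ring_gt_poly d (\<lambda>i. h (a i))"
  by (rule poly_eqI) (simp add: coeff_map_poly coeff_ring_gt_poly)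

lemma order_gt_poly:
  "order x (gt_poly d a) = 1 \<longleftrightarrow> poly (ring_gt_poly d a) x = 0 \<and> poly (pderiv (ring_gt_poly d a)) x \<noteq> 0" for x :: "'a::field_char_0"
  unfolding simple_root_iff[OF gt_poly_nonzero] unfolding gt_poly_ring_gt_poly ..

lemma gt_poly_zero_root:
  fixes a :: "nat \<Rightarrow> 'a::field_char_0"
  assumes "\<And>i. i \<le> d \<Longrightarrow> a i = 0"
  shows "order (- 1) (gt_poly d a) = 1"
proof -
  have "poly (gt_poly d a) (- 1) = 0" unfolding poly_gt_poly using assms by simp
  moreover have "poly (pderiv (gt_poly d a)) (- 1) = - ((- 1) ^ d)"
    unfolding poly_pderiv_gt_poly using assms by (simp add: algebra_simps)
  ultimately show ?thesis unfolding simple_root_iff[OF gt_poly_nonzero] by simp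
qed

text \<open>Finite approximations of a countable neighbourhood base: the \<open>n\<close>-th entry is the part
  constructed so far of the \<open>n\<close>-th neighbourhood of \<open>0\<close>.\<close>

definition approx_base :: "(nat \<Rightarrow> 'a::field) \<Rightarrow> (nat \<Rightarrow> 'a set) \<Rightarrow> bool" where
  "approx_base e E \<longleftrightarrow>
     (\<forall>n. finite (E n)) \<and> (\<forall>n. 0 \<in> E n) \<and> (\<exists>L. \<forall>n\<ge>L. E n = {0}) \<and>
     (\<forall>n. \<forall>x\<in>E (Suc n). \<forall>y\<in>E (Suc n). x - y \<in> E n \<and> x * y \<in> E n) \<and>
     (\<forall>n. \<forall>i\<le>n. \<forall>x\<in>E (Suc n). e i * x \<in> E n) \<and>
     (\<forall>n. \<forall>x\<in>E (Suc n). inverse (1 + x) - 1 \<in> E n) \<and>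
     (\<forall>n. \<forall>d\<le>n. \<forall>a. (\<forall>i\<le>d. a i \<in> E (Suc n)) \<longrightarrow> (\<exists>x. x + 1 \<in> E n \<and> order x (gt_poly d a) = 1)) \<and>
     (\<forall>n. e n \<noteq> 0 \<longrightarrow> e n \<notin> E n) \<and> (\<forall>n. - 1 \<notin> E n)"

lemma approx_baseD:
  assumes "approx_base e E"
  shows "finite (E n)" "0 \<in> E n" "\<exists>L. \<forall>n\<ge>L. E n = {0}"
    "x \<in> E (Suc n) \<Longrightarrow> y \<in> E (Suc n) \<Longrightarrow> x - y \<in> E n" "x \<in> E (Suc n) \<Longrightarrow> y \<in> E (Suc n) \<Longrightarrow> x * y \<in> E n"
    "i \<le> n \<Longrightarrow> x \<in> E (Suc n) \<Longrightarrow> e i * x \<in> E n" "x \<in> E (Suc n) \<Longrightarrow> inverse (1 + x) - 1 \<in> E n"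
    "d \<le> n \<Longrightarrow> (\<And>i. i \<le> d \<Longrightarrow> a i \<in> E (Suc n)) \<Longrightarrow> \<exists>x. x + 1 \<in> E n \<and> order x (gt_poly d a) = 1"
    "e n \<noteq> 0 \<Longrightarrow> e n \<notin> E n" "- 1 \<notin> E n"
  using assms unfolding approx_base_def by simp_all

lemma approx_base_antimono:
  assumes E: "approx_base e E" and "m \<le> n"
  shows "E n \<subseteq> E m"
  using assms(2)
proof (induction n rule: dec_induct)
  case (step n)
  have "E (Suc n) \<subseteq> E n" using approx_baseD(4)[OF E _ approx_baseD(2)[OF E]] by force
  then show ?case using step.IH by (rule order.trans)
qed simp

lemma approx_base_zero: "approx_base e (\<lambda>_. {0 :: 'a::field_char_0})"
  unfolding approx_base_def
proof (intro conjI allI impI)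
  fix n d and a :: "nat \<Rightarrow> 'a" assume "\<forall>i\<le>d. a i \<in> {0}"
  then show "\<exists>x. x + 1 \<in> {0} \<and> order x (gt_poly d a) = 1"
    using gt_poly_zero_root[of d a] by (intro exI[of _ "- 1"]) simp
qed auto

text \<open>The set S lifts \<open>E n\<close> to algebraic power series: setting t = 0 maps it onto
  \<open>E n\<close>.\<close>

definition lift_ok :: "(nat \<Rightarrow> 'a::field_char_0 set) \<Rightarrow> nat \<Rightarrow> 'a fps set \<Rightarrow> bool" where
  "lift_ok E n S \<longleftrightarrow> finite S \<and> fps_const ` E n \<subseteq> S \<and> (\<forall>y\<in>S. ps.alg y \<and> y $ 0 \<in> E n)"

text \<open>The closure conditions from one level to the next, phrased as identities in the power
  series ring. Inverses appear through a product equal to 1, so that the conditions pass through a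
  map preserving only sums and products.\<close>

definition lift_step :: "(nat \<Rightarrow> 'a::field_char_0) \<Rightarrow> nat \<Rightarrow> 'a fps set \<Rightarrow> 'a fps set \<Rightarrow> bool" where
  "lift_step e n S S' \<longleftrightarrow>
     (\<forall>x\<in>S. \<forall>y\<in>S. x - y \<in> S') \<and> (\<forall>x\<in>S. \<forall>y\<in>S. x * y \<in> S') \<and>
     (\<forall>i\<le>n. \<forall>x\<in>S. fps_const (e i) * x \<in> S') \<and>
     (\<forall>x\<in>S. \<exists>z\<in>S'. (1 + x) * (1 + z) = 1) \<and>
     (\<forall>d\<le>n. \<forall>a. (\<forall>i\<le>d. a i \<in> S) \<longrightarrow>
       (\<exists>x. x + 1 \<in> S' \<and> poly (ring_gt_poly d a) x = 0 \<and> poly (pderiv (ring_gt_poly d a)) x \<noteq> 0))"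

lemma alg_const: "ps.alg (fps_const c)"
  using ps.alg_h[of "[:c:]"] by (simp add: fps_of_poly_const)

lemma alg_0: "ps.alg 0"
  using alg_const[of 0] by simp

lemma alg_1: "ps.alg 1"
  using alg_const[of 1] by simp

lemma alg_X: "ps.alg fps_X"
  using ps.alg_h[of "[:0, 1:]"] by (simp add: fps_of_poly_pCons)

lemma alg_coeff_ring_gt_poly: "(\<And>i. i \<le> d \<Longrightarrow> ps.alg (a i)) \<Longrightarrow> ps.alg (coeff (ring_gt_poly d a) i)"
  by (simp add: coeff_ring_gt_poly alg_0 alg_1)

lemma alg_poly: "(\<And>i. ps.alg (coeff p i)) \<Longrightarrow> ps.alg x \<Longrightarrow> ps.alg (poly p x)"
proof (induction p)
  case 0
  then show ?case using alg_const[of 0] by simp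
next
  case (pCons c p)
  have "ps.alg c" using pCons.prems(1)[of 0] by simp
  moreover have "ps.alg (coeff p i)" for i using pCons.prems(1)[of "Suc i"] by simp
  ultimately show ?case using pCons.IH pCons.prems(2) by (simp add: ps.alg_ring)
qed

lemma alg_coeff_pderiv: "(\<And>i. ps.alg (coeff p i)) \<Longrightarrow> ps.alg (coeff (pderiv p) i)"
  unfolding coeff_pderiv fps_of_nat[symmetric] by (intro ps.alg_ring(3) alg_const)

text \<open>As -1 is not in the sets of the approximation, 1 + x has a nonzero constant term and is
  a unit.\<close>

lemma lift_inverse:
  assumes E: "approx_base e E" and x: "ps.alg x" "x $ 0 \<in> E (Suc n)"
  shows "\<exists>z. ps.alg z \<and> z $ 0 \<in> E n \<and> (1 + x) * (1 + z) = 1"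
proof -
  have nz: "(1 + x) $ 0 \<noteq> 0"
  proof
    assume "(1 + x) $ 0 = 0"
    then have "x $ 0 = - 1" by (simp add: add_eq_0_iff)
    then show False using x(2) approx_baseD(10)[OF E, of "Suc n"] by simp
  qed
  have inv: "(1 + x) * inverse (1 + x) = 1" using inverse_mult_eq_1[OF nz] by (simp only: mult.commute)
  have "((1 + x) * inverse (1 + x)) $ 0 = 1" unfolding inv by simp
  then have "(1 + x $ 0) * inverse (1 + x) $ 0 = 1" by simp
  then have "inverse (1 + x) $ 0 = inverse (1 + x $ 0)" by (rule inverse_unique[symmetric])
  then have "(inverse (1 + x) - 1) $ 0 \<in> E n" using approx_baseD(7)[OF E x(2)] by simp
  moreover have "ps.alg (inverse (1 + x) - 1)"
    by (rule ps.alg_ring(2)[OF ps.alg_inverse[OF ps.alg_ring(1)[OF alg_1 x(1)] inv] alg_1])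
  ultimately show ?thesis using inv by (intro exI[of _ "inverse (1 + x) - 1"]) simp
qed

text \<open>Setting t = 0 gives a polynomial over \<open>E (Suc n)\<close> with a simple root near
  -1. Hensel's lemma lifts this root, and it is algebraic because the polynomial is monic.\<close>

lemma lift_root:
  assumes E: "approx_base e E" and d: "d \<le> n" and a: "\<And>i. i \<le> d \<Longrightarrow> ps.alg (a i) \<and> a i $ 0 \<in> E (Suc n)"
  shows "\<exists>x. ps.alg x \<and> (x + 1) $ 0 \<in> E n \<and> poly (ring_gt_poly d a) x = 0 \<and> poly (pderiv (ring_gt_poly d a)) x \<noteq> 0"
proof -
  let ?p = "ring_gt_poly d a"
  have "\<exists>x. x + 1 \<in> E n \<and> order x (gt_poly d (\<lambda>i. a i $ 0)) = 1"
    by (rule approx_baseD(8)[OF E d]) (use a in simp)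
  then obtain x where x: "x + 1 \<in> E n" "order x (gt_poly d (\<lambda>i. a i $ 0)) = 1" by (elim exE conjE)
  have mp: "map_poly (\<lambda>f. f $ 0) ?p = ring_gt_poly d (\<lambda>i. a i $ 0)" by (rule map_poly_ring_gt_poly) simp_all
  have r: "poly (map_poly (\<lambda>f. f $ 0) ?p) x = 0" "poly (pderiv (map_poly (\<lambda>f. f $ 0) ?p)) x \<noteq> 0"
    using x(2) unfolding mp order_gt_poly by simp_all
  obtain y where y: "y $ 0 = x" "poly ?p y = 0" using fps_hensel[OF r] by (elim exE conjE)
  have "poly (pderiv ?p) y $ 0 \<noteq> 0" unfolding poly_fps_nth_0 y(1) pderiv_map_nth_0[symmetric] by (rule r(2))
  then have "poly (pderiv ?p) y \<noteq> 0" by auto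
  moreover have "ps.alg y" by (rule ps.alg_monic_root[OF alg_coeff_ring_gt_poly y(2) lead_coeff_ring_gt_poly]) (use a in simp)
  ultimately show ?thesis using x(1) y by (intro exI[of _ y]) simp
qed

text \<open>Finiteness is preserved because only finitely many operations, degrees and coefficient
  tuples occur at level n.\<close>

lemma ex_lift_step:
  assumes E: "approx_base e E" and S: "lift_ok E (Suc n) S"
  shows "\<exists>S'. lift_ok E n S' \<and> lift_step e n S S'"
proof -
  have fin: "finite S" and alg: "\<And>y. y \<in> S \<Longrightarrow> ps.alg y" and c0: "\<And>y. y \<in> S \<Longrightarrow> y $ 0 \<in> E (Suc n)"
    using S by (simp_all add: lift_ok_def)
  have "\<forall>x\<in>S. \<exists>z. ps.alg z \<and> z $ 0 \<in> E n \<and> (1 + x) * (1 + z) = 1"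
    using lift_inverse[OF E alg c0] by simp
  from bchoice[OF this] obtain zi where zi: "\<forall>x\<in>S. ps.alg (zi x) \<and> zi x $ 0 \<in> E n \<and> (1 + x) * (1 + zi x) = 1"
    by (elim exE)
  let ?D = "SIGMA d:{..n}. PiE {..d} (\<lambda>_. S)"
  have "\<forall>q\<in>?D. \<exists>x. ps.alg x \<and> (x + 1) $ 0 \<in> E n \<and> poly (ring_gt_poly (fst q) (snd q)) x = 0 \<and> poly (pderiv (ring_gt_poly (fst q) (snd q))) x \<noteq> 0"
  proof
    fix q assume "q \<in> ?D"
    then have q: "fst q \<le> n" "\<And>i. i \<le> fst q \<Longrightarrow> snd q i \<in> S" by auto
    show "\<exists>x. ps.alg x \<and> (x + 1) $ 0 \<in> E n \<and> poly (ring_gt_poly (fst q) (snd q)) x = 0 \<and> poly (pderiv (ring_gt_poly (fst q) (snd q))) x \<noteq> 0"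
      by (rule lift_root[OF E q(1)]) (use q(2) alg c0 in simp)
  qed
  from bchoice[OF this] obtain rt where rt: "\<forall>q\<in>?D. ps.alg (rt q) \<and> (rt q + 1) $ 0 \<in> E n \<and>
      poly (ring_gt_poly (fst q) (snd q)) (rt q) = 0 \<and> poly (pderiv (ring_gt_poly (fst q) (snd q))) (rt q) \<noteq> 0" by (elim exE)
  define S1 where "S1 = fps_const ` E n"
  define S2 where "S2 = (\<lambda>(x, y). x - y) ` (S \<times> S)"
  define S3 where "S3 = (\<lambda>(x, y). x * y) ` (S \<times> S)"
  define S4 where "S4 = (\<lambda>(i, x). fps_const (e i) * x) ` ({..n} \<times> S)"
  define S5 where "S5 = zi ` S"
  define S6 where "S6 = (\<lambda>q. rt q + 1) ` ?D"
  define S' where "S' = S1 \<union> S2 \<union> S3 \<union> S4 \<union> S5 \<union> S6"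
  have f: "finite S1" "finite S2" "finite S3" "finite S4" "finite S5" "finite S6"
    unfolding S1_def S2_def S3_def S4_def S5_def S6_def using fin approx_baseD(1)[OF E]
    by (auto intro!: finite_imageI finite_SigmaI finite_PiE)
  have 1: "\<forall>y\<in>S1. ps.alg y \<and> y $ 0 \<in> E n" unfolding S1_def using alg_const by auto
  have 2: "\<forall>y\<in>S2. ps.alg y \<and> y $ 0 \<in> E n"
    unfolding S2_def using approx_baseD(4)[OF E c0 c0] ps.alg_ring(2)[OF alg alg] by auto
  have 3: "\<forall>y\<in>S3. ps.alg y \<and> y $ 0 \<in> E n"
    unfolding S3_def using approx_baseD(5)[OF E c0 c0] ps.alg_ring(3)[OF alg alg] by auto
  have 4: "\<forall>y\<in>S4. ps.alg y \<and> y $ 0 \<in> E n"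
    unfolding S4_def using approx_baseD(6)[OF E _ c0] ps.alg_ring(3)[OF alg_const alg] by auto
  have 5: "\<forall>y\<in>S5. ps.alg y \<and> y $ 0 \<in> E n" unfolding S5_def using zi by simp
  have 6: "\<forall>y\<in>S6. ps.alg y \<and> y $ 0 \<in> E n"
  proof
    fix y assume "y \<in> S6"
    then obtain q where q: "q \<in> ?D" "y = rt q + 1" unfolding S6_def by (elim imageE)
    note b = bspec[OF rt q(1)]
    show "ps.alg y \<and> y $ 0 \<in> E n"
      unfolding q(2) by (rule conjI[OF ps.alg_ring(1)[OF b[THEN conjunct1] alg_1] b[THEN conjunct2, THEN conjunct1]])
  qed
  have ok: "lift_ok E n S'" unfolding lift_ok_def
  proof (intro conjI)
    show "finite S'" unfolding S'_def using f by simp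
    show "fps_const ` E n \<subseteq> S'" unfolding S'_def S1_def by (intro le_supI1 order_refl)
    show "\<forall>y\<in>S'. ps.alg y \<and> y $ 0 \<in> E n"
      unfolding S'_def ball_Un by (rule conjI[OF conjI[OF conjI[OF conjI[OF conjI[OF 1 2] 3] 4] 5] 6])
  qed
  have sub: "S2 \<subseteq> S'" "S3 \<subseteq> S'" "S4 \<subseteq> S'" "S5 \<subseteq> S'" "S6 \<subseteq> S'" unfolding S'_def by auto
  have "lift_step e n S S'" unfolding lift_step_def
  proof (intro conjI ballI allI impI)
    fix x y assume xy: "x \<in> S" "y \<in> S"
    show "x - y \<in> S'" by (rule subsetD[OF sub(1)]) (unfold S2_def, rule image_eqI[of _ _ "(x, y)"], use xy in simp_all)
    show "x * y \<in> S'" by (rule subsetD[OF sub(2)]) (unfold S3_def, rule image_eqI[of _ _ "(x, y)"], use xy in simp_all)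
  next
    fix i x assume ix: "i \<le> n" "x \<in> S"
    show "fps_const (e i) * x \<in> S'" by (rule subsetD[OF sub(3)]) (unfold S4_def, rule image_eqI[of _ _ "(i, x)"], use ix in simp_all)
  next
    fix x assume x: "x \<in> S"
    have "zi x \<in> S'" by (rule subsetD[OF sub(4)]) (unfold S5_def, rule imageI[OF x])
    then show "\<exists>z\<in>S'. (1 + x) * (1 + z) = 1" using bspec[OF zi x] by (intro bexI[of _ "zi x"]) simp_all
  next
    fix d a assume d: "d \<le> n" and a: "\<forall>i\<le>d. a i \<in> S"
    \<comment> \<open>Restricting the tuple to its relevant entries makes the set of tuples finite;
      the polynomial depends on those entries only.\<close>
    define q where "q = (d, restrict a {..d})"
    have q: "q \<in> ?D" using d a by (auto simp: q_def)
    have g: "ring_gt_poly (fst q) (snd q) = ring_gt_poly d a" unfolding q_def fst_conv snd_conv by (rule ring_gt_poly_cong) simp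
    have "rt q + 1 \<in> S'" by (rule subsetD[OF sub(5)]) (unfold S6_def, rule imageI[OF q])
    then show "\<exists>x. x + 1 \<in> S' \<and> poly (ring_gt_poly d a) x = 0 \<and> poly (pderiv (ring_gt_poly d a)) x \<noteq> 0"
      using bspec[OF rt q] unfolding g by (intro exI[of _ "rt q"]) simp
  qed
  then show ?thesis using ok by (intro exI[of _ S']) simp
qed

lemma lift_ok_insert: "lift_ok E n S \<Longrightarrow> 0 \<in> E n \<Longrightarrow> lift_ok E n (insert fps_X S)"
  unfolding lift_ok_def using alg_X by auto

lemma lift_step_mono:
  assumes "lift_step e n S S'" and sub: "S' \<subseteq> S''"
  shows "lift_step e n S S''"
proof -
  have h: "\<forall>x\<in>S. \<forall>y\<in>S. x - y \<in> S'" "\<forall>x\<in>S. \<forall>y\<in>S. x * y \<in> S'" "\<forall>i\<le>n. \<forall>x\<in>S. fps_const (e i) * x \<in> S'"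
    "\<forall>x\<in>S. \<exists>z\<in>S'. (1 + x) * (1 + z) = 1"
    "\<forall>d\<le>n. \<forall>a. (\<forall>i\<le>d. a i \<in> S) \<longrightarrow>
       (\<exists>x. x + 1 \<in> S' \<and> poly (ring_gt_poly d a) x = 0 \<and> poly (pderiv (ring_gt_poly d a)) x \<noteq> 0)"
    using assms(1) unfolding lift_step_def by simp_all
  show ?thesis unfolding lift_step_def
  proof (intro conjI ballI allI impI)
    fix x y assume xy: "x \<in> S" "y \<in> S"
    show "x - y \<in> S''" using h(1) xy sub by auto
    show "x * y \<in> S''" using h(2) xy sub by auto
  next
    fix i x assume "i \<le> n" "x \<in> S"
    then show "fps_const (e i) * x \<in> S''" using h(3) sub by auto
  next
    fix x assume x: "x \<in> S"
    obtain z where "z \<in> S'" "(1 + x) * (1 + z) = 1" using bspec[OF h(4) x] by (elim bexE)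
    then show "\<exists>z\<in>S''. (1 + x) * (1 + z) = 1" using sub by (intro bexI[of _ z]) auto
  next
    fix d a assume d: "d \<le> n" "\<forall>i\<le>d. a i \<in> S"
    have "\<exists>x. x + 1 \<in> S' \<and> poly (ring_gt_poly d a) x = 0 \<and> poly (pderiv (ring_gt_poly d a)) x \<noteq> 0"
      by (rule h(5)[rule_format, OF d(1)]) (use d(2) in simp)
    then obtain x where "x + 1 \<in> S'" "poly (ring_gt_poly d a) x = 0" "poly (pderiv (ring_gt_poly d a)) x \<noteq> 0"
      by (elim exE conjE)
    then show "\<exists>x. x + 1 \<in> S'' \<and> poly (ring_gt_poly d a) x = 0 \<and> poly (pderiv (ring_gt_poly d a)) x \<noteq> 0"
      using sub by (intro exI[of _ x]) auto
  qed
qed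

text \<open>Level n is computed from level n+1, so the recursion runs downwards from a level beyond
  which the approximation is {0}. The variable t is inserted at each level on the way.\<close>

lemma ex_lift:
  fixes E :: "nat \<Rightarrow> 'a::field_char_0 set"
  assumes E: "approx_base e E"
  shows "\<exists>L H. N \<le> L \<and> (\<forall>n. lift_ok E n (H n)) \<and> (\<forall>n\<le>L. lift_step e n (H (Suc n)) (H n)) \<and>
    fps_X \<in> H N \<and> (\<forall>n>L. H n = {0} \<and> E n = {0})"
proof -
  obtain L0 where L0: "\<forall>n\<ge>L0. E n = {0}" using approx_baseD(3)[OF E] by (elim exE)
  define L where "L = max L0 N"
  have L: "N \<le> L" "\<And>n. n \<ge> L \<Longrightarrow> E n = {0}" using L0 by (auto simp: L_def)
  define T where "T = (\<lambda>n S. insert fps_X (SOME S'. lift_ok E n S' \<and> lift_step e n S S'))"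
  have T: "lift_ok E n (T n S) \<and> lift_step e n S (T n S)" if S: "lift_ok E (Suc n) S" for n S
  proof -
    have p: "lift_ok E n (SOME S'. lift_ok E n S' \<and> lift_step e n S S') \<and> lift_step e n S (SOME S'. lift_ok E n S' \<and> lift_step e n S S')"
      by (rule someI_ex[OF ex_lift_step[OF E S]])
    show ?thesis unfolding T_def
      by (rule conjI[OF lift_ok_insert[OF p[THEN conjunct1] approx_baseD(2)[OF E]]
          lift_step_mono[OF p[THEN conjunct2] subset_insertI]])
  qed
  \<comment> \<open>The stage k of the recursion is the level L + 1 - k; it starts with {0} at level
    L + 1.\<close>
  define G where "G = rec_nat {0 :: 'a fps} (\<lambda>k. T (L - k))"
  have G: "G 0 = {0}" "G (Suc k) = T (L - k) (G k)" for k by (simp_all add: G_def)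
  have zero: "lift_ok E n {0}" if "n \<ge> L" for n
    using L(2)[OF that] alg_const[of 0] by (simp add: lift_ok_def)
  have ok: "lift_ok E (Suc L - k) (G k)" if "k \<le> Suc L" for k
    using that
  proof (induction k)
    case 0
    then show ?case using zero[of "Suc L"] by (simp add: G)
  next
    case (Suc k)
    have "Suc L - k = Suc (L - k)" "Suc L - Suc k = L - k" using Suc.prems by auto
    then show ?case using Suc T[of "L - k" "G k"] by (simp add: G)
  qed
  define H where "H = (\<lambda>n. G (Suc L - n))"
  have okH: "lift_ok E n (H n)" for n
  proof (cases "n \<le> L")
    case True
    then have "Suc L - (Suc L - n) = n" by simp
    then show ?thesis using ok[of "Suc L - n"] by (simp add: H_def)
  next
    case False
    then show ?thesis using zero[of n] by (simp add: H_def G)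
  qed
  have HT: "H n = T n (H (Suc n))" if n: "n \<le> L" for n
  proof -
    have "Suc L - n = Suc (L - n)" "L - (L - n) = n" using n by auto
    then show ?thesis by (simp add: H_def G)
  qed
  have st: "lift_step e n (H (Suc n)) (H n)" if n: "n \<le> L" for n
    unfolding HT[OF n] by (rule T[OF okH, THEN conjunct2])
  have X: "fps_X \<in> H N" unfolding HT[OF L(1)] T_def by (rule insertI1)
  have tr: "H n = {0} \<and> E n = {0}" if "n > L" for n using that L(2)[of n] by (simp add: H_def G)
  show ?thesis by (intro exI[of _ L] exI[of _ H] conjI allI impI okH st X tr L(1))
qed

locale fps_specialization =
  fixes R :: "'a::field_char_0 fps set" and \<phi> :: "'a fps \<Rightarrow> 'a"
  assumes R: "subring_set R" and const_R: "range fps_const \<subseteq> R"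
    and hom: "x \<in> R \<Longrightarrow> y \<in> R \<Longrightarrow> \<phi> (x + y) = \<phi> x + \<phi> y" "x \<in> R \<Longrightarrow> y \<in> R \<Longrightarrow> \<phi> (x * y) = \<phi> x * \<phi> y"
    and const: "\<phi> (fps_const c) = c"
begin

lemma cR: "fps_const c \<in> R"
  using const_R by auto

lemma phi_01: "\<phi> 0 = 0" "\<phi> 1 = 1"
  using const[of 0] const[of 1] by simp_all

lemma one_R: "1 \<in> R" "0 \<in> R"
  using cR[of 1] cR[of 0] by simp_all

lemma diff_R: "x \<in> R \<Longrightarrow> y \<in> R \<Longrightarrow> x - y \<in> R"
  using R by (simp add: subring_set_def)

lemma phi_diff:
  assumes "x \<in> R" "y \<in> R"
  shows "\<phi> (x - y) = \<phi> x - \<phi> y"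
proof -
  have "x - y \<in> R" using R assms by (simp add: subring_set_def)
  from hom(1)[OF this assms(2)] show ?thesis by simp
qed

lemma phi_poly:
  assumes "\<And>i. coeff p i \<in> R" "x \<in> R"
  shows "poly p x \<in> R \<and> \<phi> (poly p x) = poly (map_poly \<phi> p) (\<phi> x)"
  using assms
proof (induction p)
  case 0
  then show ?case using phi_01 one_R by simp
next
  case (pCons c p)
  have "c \<in> R" using pCons.prems(1)[of 0] by simp
  moreover have "coeff p i \<in> R" for i using pCons.prems(1)[of "Suc i"] by simp
  then have p: "poly p x \<in> R \<and> \<phi> (poly p x) = poly (map_poly \<phi> p) (\<phi> x)" by (rule pCons.IH[OF _ pCons.prems(2)])
  moreover have "x * poly p x \<in> R" using R pCons.prems(2) p by (simp add: subring_set_def)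
  ultimately show ?case using pCons.prems(2) subring_setD[OF R] by (simp add: map_poly_pCons phi_01 hom)
qed

lemma phi_root:
  assumes a: "\<And>i. i \<le> d \<Longrightarrow> a i \<in> R" and x: "x \<in> R" "poly (ring_gt_poly d a) x = 0" and nz: "\<phi> (poly (pderiv (ring_gt_poly d a)) x) \<noteq> 0"
  shows "order (\<phi> x) (gt_poly d (\<lambda>i. \<phi> (a i))) = 1"
proof -
  have c: "coeff (ring_gt_poly d a) i \<in> R" for i using a one_R by (simp add: coeff_ring_gt_poly)
  have m: "map_poly \<phi> (ring_gt_poly d a) = ring_gt_poly d (\<lambda>i. \<phi> (a i))" by (rule map_poly_ring_gt_poly[of \<phi>, OF phi_01])
  have dc: "coeff (pderiv (ring_gt_poly d a)) i \<in> R" for i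
    unfolding coeff_pderiv fps_of_nat[symmetric] using R c cR unfolding subring_set_def by simp
  have md: "map_poly \<phi> (pderiv (ring_gt_poly d a)) = pderiv (map_poly \<phi> (ring_gt_poly d a))"
    by (rule poly_eqI, simp only: coeff_map_poly phi_01 coeff_pderiv fps_of_nat[symmetric] hom(2)[OF cR c] const)
  show ?thesis unfolding order_gt_poly m[symmetric] md[symmetric]
    using phi_poly[OF c x(1)] phi_poly[OF dc x(1)] x(2) nz phi_01 by simp
qed

end

text \<open>The lifted sets contain t and satisfy the axioms inside the power series; a
  specialization brings them back to K. It fixes constants, so the old approximation survives, and
  the finite list of series below must stay nonzero.\<close>

lemma approx_base_extend:
  fixes E :: "nat \<Rightarrow> 'a::field_char_0 set"
  assumes large: "large_field TYPE('a)" and E: "approx_base e E"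
  shows "\<exists>E'. approx_base e E' \<and> (\<forall>n. E n \<subseteq> E' n) \<and> (\<exists>x\<in>E' N. x \<noteq> 0)"
proof -
  obtain L H where L: "N \<le> L" and ok: "\<forall>n. lift_ok E n (H n)" and st: "\<forall>n\<le>L. lift_step e n (H (Suc n)) (H n)"
    and X: "fps_X \<in> H N" and tr: "\<forall>n>L. H n = {0} \<and> E n = {0}"
    using ex_lift[OF E, of N] by (elim exE conjE)
  have ok': "finite (H n) \<and> fps_const ` E n \<subseteq> H n \<and> (\<forall>y\<in>H n. ps.alg y \<and> y $ 0 \<in> E n)" for n
    using spec[OF ok, of n] unfolding lift_ok_def .
  note fin = ok'[THEN conjunct1]
  have cons: "fps_const c \<in> H n" if "c \<in> E n" for c n
    by (rule subsetD[OF ok'[of n, THEN conjunct2, THEN conjunct1] imageI[OF that]])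
  have alg: "ps.alg y" if "y \<in> H n" for y n
    using ok'[of n, THEN conjunct2, THEN conjunct2] that by simp
  have c0: "y $ 0 \<in> E n" if "y \<in> H n" for y n
    using ok'[of n, THEN conjunct2, THEN conjunct2] that by simp
  \<comment> \<open>F1 keeps the image of t nonzero, F2 keeps the excluded \<open>e n\<close>
    outside, F3 keeps -1 outside, and F4 keeps the chosen roots simple. The level L + 1 suffices as
    bound, since all later sets are {0}.\<close>
  define F1 where "F1 = (\<Union>n\<le>Suc L. H n)"
  define F2 where "F2 = (\<Union>n\<le>Suc L. (\<lambda>y. y - fps_const (e n)) ` H n)"
  define F3 where "F3 = (\<Union>n\<le>Suc L. (\<lambda>y. y + 1) ` H n)"
  define F4 where "F4 = (\<Union>n\<le>L. \<Union>d\<le>n. (\<lambda>(y, a). poly (pderiv (ring_gt_poly d a)) (y - 1)) ` (H n \<times> PiE {..d} (\<lambda>_. H (Suc n))))"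
  have finF: "finite (F1 \<union> F2 \<union> F3 \<union> F4)"
    unfolding F1_def F2_def F3_def F4_def using fin by (auto intro!: finite_imageI finite_SigmaI finite_PiE)
  have algF: "ps.alg y" if y: "y \<in> F1 \<union> F2 \<union> F3 \<union> F4" for y
  proof -
    consider "y \<in> F1" | "y \<in> F2" | "y \<in> F3" | "y \<in> F4" using y by auto
    then show ?thesis
    proof cases
      case 1
      then show ?thesis unfolding F1_def using alg by auto
    next
      case 2
      then show ?thesis unfolding F2_def using ps.alg_ring(2)[OF alg alg_const] by auto
    next
      case 3
      then show ?thesis unfolding F3_def using ps.alg_ring(1)[OF alg alg_1] by auto
    next
      case 4
      then obtain n d u a where q: "u \<in> H n" "a \<in> PiE {..d} (\<lambda>_. H (Suc n))" "y = poly (pderiv (ring_gt_poly d a)) (u - 1)"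
        unfolding F4_def by auto
      have "ps.alg (a i)" if "i \<le> d" for i by (rule alg[of _ "Suc n"]) (use PiE_mem[OF q(2), of i] that in simp)
      then show ?thesis unfolding q(3) by (intro alg_poly alg_coeff_pderiv alg_coeff_ring_gt_poly ps.alg_ring(2)[OF alg[OF q(1)] alg_1])
    qed
  qed
  have "\<exists>R \<phi>. subring_set R \<and> F1 \<union> F2 \<union> F3 \<union> F4 \<subseteq> R \<and> range fps_const \<subseteq> R \<and>
      (\<forall>x\<in>R. \<forall>y\<in>R. \<phi> (x + y) = \<phi> x + \<phi> y \<and> \<phi> (x * y) = \<phi> x * \<phi> y) \<and> (\<forall>c. \<phi> (fps_const c) = c) \<and>
      (\<forall>y\<in>F1 \<union> F2 \<union> F3 \<union> F4. y \<noteq> 0 \<longrightarrow> \<phi> y \<noteq> 0)"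
    by (rule large_specialization[OF large finF algF])
  then obtain R \<phi> where sp: "subring_set R" "F1 \<union> F2 \<union> F3 \<union> F4 \<subseteq> R" "range fps_const \<subseteq> R"
    "\<forall>x\<in>R. \<forall>y\<in>R. \<phi> (x + y) = \<phi> x + \<phi> y \<and> \<phi> (x * y) = \<phi> x * \<phi> y" "\<forall>c. \<phi> (fps_const c) = c"
    "\<forall>y\<in>F1 \<union> F2 \<union> F3 \<union> F4. y \<noteq> 0 \<longrightarrow> \<phi> y \<noteq> 0"
    by (elim exE conjE)
  interpret fps_specialization R \<phi> by unfold_locales (use sp in auto)
  have nzF: "y = 0" if "y \<in> F1 \<union> F2 \<union> F3 \<union> F4" "\<phi> y = 0" for y
    using bspec[OF sp(6) that(1)] that(2) by (cases "y = 0") simp_all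
  have HR: "y \<in> R" if "y \<in> H n" for y n
  proof (cases "n \<le> Suc L")
    case True
    then have "y \<in> F1" unfolding F1_def using that by auto
    then show ?thesis using sp(2) by auto
  next
    case False
    then show ?thesis using that tr one_R(2) by simp
  qed
  define E' where "E' = (\<lambda>n. \<phi> ` H n)"
  have E'I: "y \<in> H n \<Longrightarrow> \<phi> y \<in> E' n" for y n by (simp add: E'_def)
  have E'0: "E' n = {0}" if "n > L" for n using tr that by (simp add: E'_def phi_01)
  have sub: "E n \<subseteq> E' n" for n
  proof
    fix c assume "c \<in> E n"
    from E'I[OF cons[OF this]] show "c \<in> E' n" by (simp add: const)
  qed
  have "approx_base e E'" unfolding approx_base_def
  proof (intro conjI allI)
    show "finite (E' n)" for n using fin by (simp add: E'_def)
    show "0 \<in> E' n" for n using sub approx_baseD(2)[OF E] by auto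
    show "\<exists>L. \<forall>n\<ge>L. E' n = {0}" using E'0 by (intro exI[of _ "Suc L"]) simp
    have Hn: "\<exists>u\<in>H n. x = \<phi> u" if "x \<in> E' n" for x n using that by (auto simp: E'_def)
    fix n
    show "\<forall>x\<in>E' (Suc n). \<forall>y\<in>E' (Suc n). x - y \<in> E' n \<and> x * y \<in> E' n"
    proof (cases "n \<le> L")
      case True
      then have s: "lift_step e n (H (Suc n)) (H n)" using st by simp
      show ?thesis
      proof (intro ballI)
        fix x y assume "x \<in> E' (Suc n)" "y \<in> E' (Suc n)"
        then obtain u v where uv: "u \<in> H (Suc n)" "x = \<phi> u" "v \<in> H (Suc n)" "y = \<phi> v" unfolding E'_def by (elim imageE)
        have "u - v \<in> H n" "u * v \<in> H n" using s uv unfolding lift_step_def by simp_all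
        from this[THEN E'I] show "x - y \<in> E' n \<and> x * y \<in> E' n"
          using phi_diff[OF HR[OF uv(1)] HR[OF uv(3)]] hom(2)[OF HR[OF uv(1)] HR[OF uv(3)]] by (simp add: uv)
      qed
    qed (simp add: E'0)
    show "i \<le> n \<longrightarrow> (\<forall>x\<in>E' (Suc n). e i * x \<in> E' n)" for i
    proof (cases "n \<le> L")
      case True
      then have s: "lift_step e n (H (Suc n)) (H n)" using st by simp
      show ?thesis
      proof (intro impI ballI)
        fix x assume i: "i \<le> n" and "x \<in> E' (Suc n)"
        then obtain u where u: "u \<in> H (Suc n)" "x = \<phi> u" unfolding E'_def by (elim imageE)
        have "fps_const (e i) * u \<in> H n" using s u i unfolding lift_step_def by simp
        from E'I[OF this] show "e i * x \<in> E' n" using hom(2)[OF cR[of "e i"] HR[OF u(1)]] by (simp add: u const)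
      qed
    qed (simp add: E'0)
    show "\<forall>x\<in>E' (Suc n). inverse (1 + x) - 1 \<in> E' n"
    proof (cases "n \<le> L")
      case True
      then have s: "lift_step e n (H (Suc n)) (H n)" using st by simp
      show ?thesis
      proof
        fix x assume "x \<in> E' (Suc n)"
        then obtain u where u: "u \<in> H (Suc n)" "x = \<phi> u" unfolding E'_def by (elim imageE)
        obtain z where z: "z \<in> H n" "(1 + u) * (1 + z) = 1" using s u(1) unfolding lift_step_def by auto
        have r: "1 + u \<in> R" "1 + z \<in> R" using subring_setD[OF R] one_R HR[OF u(1)] HR[OF z(1)] by auto
        have "(1 + x) * (1 + \<phi> z) = \<phi> ((1 + u) * (1 + z))"
          unfolding hom(2)[OF r] hom(1)[OF one_R(1) HR[OF u(1)]] hom(1)[OF one_R(1) HR[OF z(1)]] phi_01 u(2) ..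
        then have "(1 + x) * (1 + \<phi> z) = 1" unfolding z(2) phi_01 .
        then have "inverse (1 + x) = 1 + \<phi> z" by (rule inverse_unique)
        then show "inverse (1 + x) - 1 \<in> E' n" using E'I[OF z(1)] by simp
      qed
    qed (simp add: E'0)
    show "d \<le> n \<longrightarrow> (\<forall>a. (\<forall>i\<le>d. a i \<in> E' (Suc n)) \<longrightarrow> (\<exists>x. x + 1 \<in> E' n \<and> order x (gt_poly d a) = 1))" for d
    proof (intro allI impI)
      fix a assume d: "d \<le> n" and a: "\<forall>i\<le>d. a i \<in> E' (Suc n)"
      show "\<exists>x. x + 1 \<in> E' n \<and> order x (gt_poly d a) = 1"
      proof (cases "n \<le> L")
        case True
        then have s: "lift_step e n (H (Suc n)) (H n)" using st by simp
        have "\<forall>i\<in>{..d}. \<exists>u. u \<in> H (Suc n) \<and> a i = \<phi> u"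
        proof
          fix i assume "i \<in> {..d}"
          then have "a i \<in> E' (Suc n)" using a by simp
          then obtain u where "u \<in> H (Suc n)" "a i = \<phi> u" unfolding E'_def by (elim imageE)
          then show "\<exists>u. u \<in> H (Suc n) \<and> a i = \<phi> u" by (intro exI[of _ u] conjI)
        qed
        from bchoice[OF this] obtain b0 where b0: "\<forall>i\<in>{..d}. b0 i \<in> H (Suc n) \<and> a i = \<phi> (b0 i)" by (elim exE)
        define b where "b = restrict b0 {..d}"
        have b: "\<And>i. i \<le> d \<Longrightarrow> b i \<in> H (Suc n)" "\<And>i. i \<le> d \<Longrightarrow> a i = \<phi> (b i)" "b \<in> PiE {..d} (\<lambda>_. H (Suc n))"
          using b0 by (auto simp: b_def)
        have "\<exists>x. x + 1 \<in> H n \<and> poly (ring_gt_poly d b) x = 0 \<and> poly (pderiv (ring_gt_poly d b)) x \<noteq> 0"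
          using s d b(1) unfolding lift_step_def by simp
        then obtain x where x: "x + 1 \<in> H n" "poly (ring_gt_poly d b) x = 0" "poly (pderiv (ring_gt_poly d b)) x \<noteq> 0" by (elim exE conjE)
        have "poly (pderiv (ring_gt_poly d b)) ((x + 1) - 1) \<in> F4" unfolding F4_def
          by (rule UN_I[of n], use True in simp, rule UN_I[of d], use d in simp, rule image_eqI[of _ _ "(x + 1, b)"])
            (use x(1) b(3) in simp_all)
        then have nz: "\<phi> (poly (pderiv (ring_gt_poly d b)) x) \<noteq> 0" using sp(6) x(3) by simp
        have xR: "x \<in> R" using diff_R[OF HR[OF x(1)] one_R(1)] by simp
        have "order (\<phi> x) (gt_poly d (\<lambda>i. \<phi> (b i))) = 1" by (rule phi_root[OF HR[OF b(1)] xR x(2) nz])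
        moreover have "gt_poly d (\<lambda>i. \<phi> (b i)) = gt_poly d a" unfolding gt_poly_ring_gt_poly by (rule ring_gt_poly_cong) (simp add: b(2))
        moreover have "\<phi> x + 1 \<in> E' n" using E'I[OF x(1)] hom(1)[OF xR one_R(1)] by (simp add: phi_01)
        ultimately show ?thesis by (intro exI[of _ "\<phi> x"]) simp
      next
        case False
        then have "\<And>i. i \<le> d \<Longrightarrow> a i = 0" using a by (simp add: E'0)
        from gt_poly_zero_root[of d a, OF this] show ?thesis using False by (intro exI[of _ "- 1"]) (simp add: E'0)
      qed
    qed
    show "e n \<noteq> 0 \<longrightarrow> e n \<notin> E' n"
    proof (intro impI notI)
      assume en: "e n \<noteq> 0" "e n \<in> E' n"
      then have n: "n \<le> Suc L" using E'0[of n] by (cases "n \<le> Suc L") auto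
      obtain u where u: "u \<in> H n" "e n = \<phi> u" using Hn[OF en(2)] by (elim bexE)
      have "u - fps_const (e n) \<in> F2" unfolding F2_def using u(1) n by auto
      moreover have "\<phi> (u - fps_const (e n)) = 0" unfolding phi_diff[OF HR[OF u(1)] cR] const using u(2) by simp
      ultimately have "u - fps_const (e n) = 0" by (intro nzF) (simp_all only: Un_iff simp_thms)
      \<comment> \<open>A series specializing to the excluded element is that constant, so its
        constant term would already violate the exclusion in E.\<close>
      then have "u $ 0 = e n" by simp
      then show False using c0[OF u(1)] approx_baseD(9)[OF E en(1)] by simp
    qed
    show "- 1 \<notin> E' n"
    proof
      assume m: "- 1 \<in> E' n"
      then have n: "n \<le> Suc L" using E'0[of n] by (cases "n \<le> Suc L") auto
      obtain u where u: "u \<in> H n" "- 1 = \<phi> u" using Hn[OF m] by (elim bexE)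
      have "u + 1 \<in> F3" unfolding F3_def using u(1) n by auto
      moreover have "\<phi> (u + 1) = 0" unfolding hom(1)[OF HR[OF u(1)] one_R(1)] phi_01 u(2)[symmetric] by simp
      ultimately have "u + 1 = 0" by (intro nzF) (simp_all only: Un_iff simp_thms)
      then have "(u + 1) $ 0 = 0" by simp
      then have "u $ 0 = - 1" by (simp add: eq_neg_iff_add_eq_0)
      then show False using c0[OF u(1)] approx_baseD(10)[OF E, of n] by simp
    qed
  qed
  moreover have "\<exists>x\<in>E' N. x \<noteq> 0"
  proof (rule bexI[OF _ E'I[OF X]])
    have "fps_X \<in> F1" unfolding F1_def by (rule UN_I[of N]) (use L X in simp_all)
    then have "fps_X \<in> F1 \<union> F2 \<union> F3 \<union> F4" by (intro UnI1)
    from nzF[OF this] show "\<phi> fps_X \<noteq> 0" using fps_X_neq_zero by (elim contrapos_nn) simp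
  qed
  ultimately show ?thesis using sub by (intro exI[of _ E']) simp
qed

text \<open>At stage s a nonzero element is added to level s; the union of the stages at each level
  is the neighbourhood. Every axiom concerns finitely many elements, hence holds at some
  stage.\<close>

theorem large_countable_gt_base:
  assumes large: "large_field TYPE('a::field_char_0)" and cnt: "countable (UNIV :: 'a set)"
  shows "\<exists>B :: 'a set set. gt_base B"
proof -
  define e :: "nat \<Rightarrow> 'a" where "e = from_nat_into UNIV"
  have e: "range e = UNIV" unfolding e_def using cnt by (rule range_from_nat_into[OF UNIV_not_empty])
  have "\<exists>f. \<forall>E. approx_base e E \<longrightarrow> approx_base e (f E) \<and> (\<forall>n. E n \<subseteq> f E n) \<and> (\<exists>x\<in>f E N. x \<noteq> 0)" for N
    by (rule choice) (use approx_base_extend[OF large] in simp)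
  then have "\<forall>N. \<exists>f. \<forall>E. approx_base e E \<longrightarrow> approx_base e (f E) \<and> (\<forall>n. E n \<subseteq> f E n) \<and> (\<exists>x\<in>f E N. x \<noteq> 0)" by simp
  from choice[OF this] obtain f where f: "\<forall>N E. approx_base e E \<longrightarrow>
      approx_base e (f N E) \<and> (\<forall>n. E n \<subseteq> f N E n) \<and> (\<exists>x\<in>f N E N. x \<noteq> 0)" by (elim exE)
  \<comment> \<open>Only one nonzero element per level is required, so each level needs to be
    treated at a single stage.\<close>
  define Es where "Es = rec_nat (\<lambda>_ :: nat. {0 :: 'a}) f"
  have Es: "Es (Suc s) = f s (Es s)" for s by (simp add: Es_def)
  have ap: "approx_base e (Es s)" for s
    by (induction s) (use f approx_base_zero in \<open>simp_all add: Es_def\<close>)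
  have suc: "Es k n \<subseteq> Es (Suc k) n" for k n
    unfolding Es by (rule f[THEN spec, THEN spec, THEN mp, OF ap, THEN conjunct2, THEN conjunct1, THEN spec])
  have mono: "Es s n \<subseteq> Es t n" if st: "s \<le> t" for s t n
    by (rule lift_Suc_mono_le[of "\<lambda>s. Es s n", OF suc st])
  define U where "U = (\<lambda>n. \<Union>s. Es s n)"
  have UI: "x \<in> Es s n \<Longrightarrow> x \<in> U n" for x s n by (auto simp: U_def)
  have UE: "\<exists>s. x \<in> Es s n" if "x \<in> U n" for x n using that by (auto simp: U_def)
  have anti: "U n \<subseteq> U m" if "m \<le> n" for m n
    unfolding U_def by (intro UN_mono order_refl approx_base_antimono[OF ap that])
  \<comment> \<open>A polynomial has finitely many coefficients, so all of them are present at a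
    common stage.\<close>
  have fam: "\<exists>s. \<forall>i\<le>d. a i \<in> Es s n" if a: "\<forall>i\<le>d. a i \<in> U n" for a n and d :: nat
  proof -
    have "\<forall>i\<in>{..d}. \<exists>s. a i \<in> Es s n" using a UE by simp
    from bchoice[OF this] obtain s where s: "\<forall>i\<in>{..d}. a i \<in> Es (s i) n" by (elim exE)
    have "a i \<in> Es (Max (s ` {..d})) n" if i: "i \<le> d" for i
      by (rule subsetD[OF mono[OF Max_ge] bspec[OF s]]) (use i in auto)
    then show ?thesis by (intro exI[of _ "Max (s ` {..d})"]) simp
  qed
  have two: "\<exists>s. x \<in> Es s n \<and> y \<in> Es s n" if xy: "x \<in> U n" "y \<in> U n" for x y n
  proof -
    have "\<forall>i\<le>1. (if i = (0 :: nat) then x else y) \<in> U n" using xy by simp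
    from fam[OF this] obtain s where "\<forall>i\<le>1. (if i = (0 :: nat) then x else y) \<in> Es s n" by (elim exE)
    from this[rule_format, of 0] this[rule_format, of 1] show ?thesis by (intro exI[of _ s]) simp
  qed
  have "field_base (range U)" unfolding field_base_def
  proof (intro conjI)
    show "range U \<noteq> {}" by simp
    show "\<forall>V\<in>range U. 0 \<in> V" by (intro ballI, elim rangeE) (simp only: UI[OF approx_baseD(2)[OF ap]])
    show "\<forall>V\<in>range U. \<forall>W\<in>range U. \<exists>Z\<in>range U. Z \<subseteq> V \<and> Z \<subseteq> W"
    proof (intro ballI)
      fix V W assume "V \<in> range U" "W \<in> range U"
      then obtain m n where "V = U m" "W = U n" by (elim rangeE)
      then show "\<exists>Z\<in>range U. Z \<subseteq> V \<and> Z \<subseteq> W" using anti[of m "max m n"] anti[of n "max m n"] by (intro bexI[of _ "U (max m n)"]) simp_all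
    qed
    have 1: "x - y \<in> U n \<and> x * y \<in> U n" if U1: "x \<in> U (Suc n)" "y \<in> U (Suc n)" for x y n
    proof -
      obtain s where xy: "x \<in> Es s (Suc n)" "y \<in> Es s (Suc n)" using two[OF U1] by (elim exE conjE)
      show ?thesis by (rule conjI[OF UI[OF approx_baseD(4)[OF ap xy]] UI[OF approx_baseD(5)[OF ap xy]]])
    qed
    show "\<forall>V\<in>range U. \<exists>W\<in>range U. \<forall>x\<in>W. \<forall>y\<in>W. x - y \<in> V"
    proof
      fix V assume "V \<in> range U"
      then obtain n where V: "V = U n" by (elim rangeE)
      show "\<exists>W\<in>range U. \<forall>x\<in>W. \<forall>y\<in>W. x - y \<in> V"
        unfolding V by (rule bexI[OF _ rangeI[of U "Suc n"]]) (simp add: 1)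
    qed
    show "\<forall>V\<in>range U. \<exists>W\<in>range U. \<forall>x\<in>W. \<forall>y\<in>W. x * y \<in> V"
    proof
      fix V assume "V \<in> range U"
      then obtain n where V: "V = U n" by (elim rangeE)
      show "\<exists>W\<in>range U. \<forall>x\<in>W. \<forall>y\<in>W. x * y \<in> V"
        unfolding V by (rule bexI[OF _ rangeI[of U "Suc n"]]) (simp add: 1)
    qed
    show "\<forall>V\<in>range U. \<forall>a. \<exists>W\<in>range U. \<forall>x\<in>W. a * x \<in> V"
    proof (intro ballI allI)
      fix V a assume "V \<in> range U"
      then obtain n where V: "V = U n" by (elim rangeE)
      have "a \<in> range e" unfolding e by (rule UNIV_I)
      then obtain i where i: "a = e i" by (elim rangeE)
      \<comment> \<open>The approximations treat the scalar \<open>e i\<close> only from level i on,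
        hence the maximum.\<close>
      have "a * x \<in> V" if x: "x \<in> U (Suc (max n i))" for x
      proof -
        obtain s where s: "x \<in> Es s (Suc (max n i))" using UE[OF x] by (elim exE)
        have "a * x \<in> U (max n i)" unfolding i by (rule UI[OF approx_baseD(6)[OF ap _ s]]) simp
        then show ?thesis unfolding V by (rule subsetD[OF anti, rotated]) simp
      qed
      then show "\<exists>W\<in>range U. \<forall>x\<in>W. a * x \<in> V" by (intro bexI[OF _ rangeI[of U "Suc (max n i)"]]) simp
    qed
    show "\<forall>V\<in>range U. \<exists>W\<in>range U. \<forall>x\<in>W. inverse (1 + x) - 1 \<in> V"
    proof
      fix V assume "V \<in> range U"
      then obtain n where V: "V = U n" by (elim rangeE)
      have "inverse (1 + x) - 1 \<in> V" if x: "x \<in> U (Suc n)" for x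
      proof -
        obtain s where s: "x \<in> Es s (Suc n)" using UE[OF x] by (elim exE)
        show ?thesis unfolding V by (rule UI[OF approx_baseD(7)[OF ap s]])
      qed
      then show "\<exists>W\<in>range U. \<forall>x\<in>W. inverse (1 + x) - 1 \<in> V" by (intro bexI[OF _ rangeI[of U "Suc n"]]) simp
    qed
    show "\<forall>x. x \<noteq> 0 \<longrightarrow> (\<exists>V\<in>range U. x \<notin> V)"
    proof (intro allI impI)
      fix x :: 'a assume x: "x \<noteq> 0"
      have "x \<in> range e" unfolding e by (rule UNIV_I)
      then obtain i where i: "x = e i" by (elim rangeE)
      have "e i \<noteq> 0" using x unfolding i .
      then have "x \<notin> U i" unfolding i U_def by (simp add: approx_baseD(9)[OF ap])
      then show "\<exists>V\<in>range U. x \<notin> V" by (intro bexI[OF _ rangeI[of U i]])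
    qed
  qed
  moreover have "\<forall>V\<in>range U. \<exists>x\<in>V. x \<noteq> 0"
  proof
    fix V assume "V \<in> range U"
    then obtain n where V: "V = U n" by (elim rangeE)
    have "\<exists>x\<in>Es (Suc n) n. x \<noteq> 0"
      unfolding Es by (rule f[THEN spec, THEN spec, THEN mp, OF ap, THEN conjunct2, THEN conjunct2])
    then obtain x where x: "x \<in> Es (Suc n) n" "x \<noteq> 0" by (elim bexE)
    show "\<exists>x\<in>V. x \<noteq> 0" unfolding V by (rule bexI[of _ x]) (rule x(2), rule UI[OF x(1)])
  qed
  moreover have "\<forall>V\<in>range U. \<forall>d. \<exists>W\<in>range U. \<forall>a. (\<forall>i\<le>d. a i \<in> W) \<longrightarrow> (\<exists>x. x + 1 \<in> V \<and> order x (gt_poly d a) = 1)"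
  proof (intro ballI allI)
    fix V and d :: nat assume "V \<in> range U"
    then obtain n where V: "V = U n" by (elim rangeE)
    have "\<exists>x. x + 1 \<in> V \<and> order x (gt_poly d a) = 1" if a: "\<forall>i\<le>d. a i \<in> U (Suc (max n d))" for a
    proof -
      obtain s where s: "\<forall>i\<le>d. a i \<in> Es s (Suc (max n d))" using fam[OF a] by (elim exE)
      have "\<exists>x. x + 1 \<in> Es s (max n d) \<and> order x (gt_poly d a) = 1"
        by (rule approx_baseD(8)[OF ap]) (use s in simp_all)
      then obtain x where x: "x + 1 \<in> Es s (max n d)" "order x (gt_poly d a) = 1" by (elim exE conjE)
      have "x + 1 \<in> V" unfolding V by (rule subsetD[OF anti UI[OF x(1)]]) simp
      then show ?thesis using x(2) by (intro exI[of _ x]) simp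
    qed
    then show "\<exists>W\<in>range U. \<forall>a. (\<forall>i\<le>d. a i \<in> W) \<longrightarrow> (\<exists>x. x + 1 \<in> V \<and> order x (gt_poly d a) = 1)"
      by (intro bexI[OF _ rangeI[of U "Suc (max n d)"]]) simp
  qed
  ultimately have "gt_base (range U)" unfolding gt_base_def by (intro conjI)
  then show ?thesis by (rule exI)
qed

section \<open>Assembly of the four claims\<close>

lemma second_countable_weight:
  assumes w: "weight T \<le>o |UNIV :: 'a set|" and cnt: "countable (UNIV :: 'a set)"
  shows "second_countable T"
proof -
  obtain C where C: "topology_basis T C" "weight T = |C|" "\<forall>C'. topology_basis T C' \<longrightarrow> |C| \<le>o |C'|"
    by (rule minimal_basis)
  have "|C| \<le>o |UNIV :: 'a set|" using w unfolding C(2) .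
  then obtain f :: "_ \<Rightarrow> 'a" where f: "inj_on f C" unfolding card_of_ordLeq[symmetric] by (elim exE conjE)
  have "countable C" by (rule countable_image_inj_on[OF countable_subset[OF subset_UNIV cnt] f])
  moreover have "\<exists>V\<in>C. x \<in> V \<and> V \<subseteq> U" if U: "openin T U" "x \<in> U" for U x
  proof -
    obtain D where D: "D \<subseteq> C" "U = \<Union>D" using C(1) U(1) unfolding topology_basis_def by (elim conjE allE[of _ U] impE exE)
    then obtain V where "V \<in> D" "x \<in> V" using U(2) by auto
    then show ?thesis using D by (intro bexI[of _ V]) auto
  qed
  moreover have "\<forall>V\<in>C. openin T V" using C(1) by (simp add: topology_basis_def)
  ultimately show ?thesis unfolding second_countable_def by (intro exI[of _ C]) simp
qed

lemma exist_pairwise_incomparable_cong: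
  "exist_pairwise_incomparable \<kappa> P \<Longrightarrow> \<kappa> =o \<kappa>' \<Longrightarrow> exist_pairwise_incomparable \<kappa>' P"
  unfolding exist_pairwise_incomparable_def using ordIso_transitive by (elim exE conjE) (intro exI conjI, assumption+)

text \<open>Any base will do here, since the refinements need not refine the original topology;
  \<open>gt_base_small\<close> may therefore coarsen it first.\<close>

lemma many_topologies:
  fixes B :: "'a::field_char_0 set set"
  assumes td: "infinite_transcendence_degree TYPE('a)" and B: "gt_base B"
  shows "exist_pairwise_incomparable (ctwo ^c (ctwo ^c |UNIV :: 'a set| )) (\<lambda>\<sigma> :: 'a topology. gt_henselian \<sigma>)"
    "exist_pairwise_incomparable (ctwo ^c |UNIV :: 'a set| )
      (\<lambda>\<sigma> :: 'a topology. gt_henselian \<sigma> \<and> weight \<sigma> \<le>o |UNIV :: 'a set| )"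
proof -
  obtain N :: "'a \<Rightarrow> 'a set" where N: "gt_base (range N)" by (rule gt_base_small[OF B])
  show "exist_pairwise_incomparable (ctwo ^c (ctwo ^c |UNIV :: 'a set| )) (\<lambda>\<sigma> :: 'a topology. gt_henselian \<sigma>)"
    by (rule exist_pairwise_incomparable_mono[OF many_refinements[OF td N]]) simp
  show "exist_pairwise_incomparable (ctwo ^c |UNIV :: 'a set| )
      (\<lambda>\<sigma> :: 'a topology. gt_henselian \<sigma> \<and> weight \<sigma> \<le>o |UNIV :: 'a set| )"
    by (rule exist_pairwise_incomparable_mono[OF many_small[OF td N]]) simp
qed

lemma card_countable:
  assumes "countable (UNIV :: 'a::field_char_0 set)"
  shows "ctwo ^c |UNIV :: 'a set| =o ctwo ^c natLeq" "ctwo ^c (ctwo ^c |UNIV :: 'a set| ) =o ctwo ^c (ctwo ^c natLeq)"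
proof -
  have "|UNIV :: 'a set| =o |UNIV :: nat set|"
    by (rule card_of_ordIsoI[OF to_nat_on_infinite[OF assms infinite_UNIV_char_0]])
  then have "|UNIV :: 'a set| =o natLeq" by (rule ordIso_transitive[OF _ card_of_nat])
  then show 1: "ctwo ^c |UNIV :: 'a set| =o ctwo ^c natLeq"
    by (rule cexp_cong2[OF _ Card_order_ctwo card_of_Card_order])
  show "ctwo ^c (ctwo ^c |UNIV :: 'a set| ) =o ctwo ^c (ctwo ^c natLeq)"
    by (rule cexp_cong2[OF 1 Card_order_ctwo Card_order_cexp])
qed

theorem theorem1p2:
  assumes "infinite_transcendence_degree TYPE('a::field_char_0)"
  shows
    "((\<exists>\<tau> :: 'a topology. gt_henselian \<tau>) \<longrightarrow>
        exist_pairwise_incomparable (ctwo ^c (ctwo ^c |UNIV :: 'a set| ))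
          (\<lambda>\<sigma> :: 'a topology. gt_henselian \<sigma>) \<and>
        exist_pairwise_incomparable (ctwo ^c |UNIV :: 'a set| )
          (\<lambda>\<sigma> :: 'a topology. gt_henselian \<sigma> \<and> weight \<sigma> \<le>o |UNIV :: 'a set| )) \<and>
     (\<forall>\<tau> :: 'a topology. gt_henselian \<tau> \<and> weight \<tau> \<le>o |UNIV :: 'a set| \<longrightarrow>
        exist_pairwise_incomparable (ctwo ^c (ctwo ^c |UNIV :: 'a set| ))
          (\<lambda>\<sigma>. gt_henselian \<sigma> \<and> refines_topology \<sigma> \<tau>)) \<and>
     (\<forall>\<tau> :: 'a topology. gt_henselian \<tau> \<and> locally_bounded \<tau> \<longrightarrow>
        exist_pairwise_incomparable (ctwo ^c |UNIV :: 'a set| )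
          (\<lambda>\<sigma>. gt_henselian \<sigma> \<and> locally_bounded \<sigma> \<and> refines_topology \<sigma> \<tau>)) \<and>
     (large_field TYPE('a) \<and> countable (UNIV :: 'a set) \<longrightarrow>
        exist_pairwise_incomparable (ctwo ^c (ctwo ^c natLeq))
          (\<lambda>\<sigma> :: 'a topology. gt_henselian \<sigma>) \<and>
        exist_pairwise_incomparable (ctwo ^c natLeq)
          (\<lambda>\<sigma> :: 'a topology. gt_henselian \<sigma> \<and> second_countable \<sigma>))"
proof (intro conjI allI impI)
  note td = assms
  {
    assume "\<exists>\<tau> :: 'a topology. gt_henselian \<tau>"
    then obtain \<tau> :: "'a topology" where "gt_henselian \<tau>" by (elim exE)
    then have "gt_base {U. nbhd \<tau> 0 U}" by (rule gt_base_of_nbhd_base(1)[OF _ nbhd_base_all])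
    note many = many_topologies[OF td this]
    show "exist_pairwise_incomparable (ctwo ^c (ctwo ^c |UNIV :: 'a set| )) (\<lambda>\<sigma> :: 'a topology. gt_henselian \<sigma>)"
      by (rule many(1))
    show "exist_pairwise_incomparable (ctwo ^c |UNIV :: 'a set| )
        (\<lambda>\<sigma> :: 'a topology. gt_henselian \<sigma> \<and> weight \<sigma> \<le>o |UNIV :: 'a set| )"
      by (rule many(2))
  }
  {
    fix \<tau> :: "'a topology" assume \<tau>: "gt_henselian \<tau> \<and> weight \<tau> \<le>o |UNIV :: 'a set|"
    obtain N :: "'a \<Rightarrow> 'a set" where N: "gt_base (range N)" "base_topology (range N) = \<tau>"
      by (rule small_weight_base[OF \<tau>[THEN conjunct1] \<tau>[THEN conjunct2]])
    show "exist_pairwise_incomparable (ctwo ^c (ctwo ^c |UNIV :: 'a set| )) (\<lambda>\<sigma>. gt_henselian \<sigma> \<and> refines_topology \<sigma> \<tau>)"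
      using many_refinements[OF td N(1)] unfolding N(2) .
  }
  {
    fix \<tau> :: "'a topology" assume \<tau>: "gt_henselian \<tau> \<and> locally_bounded \<tau>"
    obtain N :: "'a \<Rightarrow> 'a set" where N: "gt_base (range N)" "base_topology (range N) = \<tau>"
      and b: "\<exists>U\<in>range N. \<forall>W\<in>range N. \<exists>c. c \<noteq> 0 \<and> (\<forall>x\<in>U. c * x \<in> W)"
      by (rule locally_bounded_small_base[OF \<tau>[THEN conjunct1] \<tau>[THEN conjunct2]])
    show "exist_pairwise_incomparable (ctwo ^c |UNIV :: 'a set| )
        (\<lambda>\<sigma>. gt_henselian \<sigma> \<and> locally_bounded \<sigma> \<and> refines_topology \<sigma> \<tau>)"
      by (rule exist_pairwise_incomparable_mono[OF many_small[OF td N(1)]]) (use b in \<open>simp add: N(2)\<close>)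
  }
  {
    assume large: "large_field TYPE('a) \<and> countable (UNIV :: 'a set)"
    obtain B :: "'a set set" where "gt_base B"
      using large_countable_gt_base[OF large[THEN conjunct1] large[THEN conjunct2]] by (elim exE)
    note many = many_topologies[OF td this] and card = card_countable[OF large[THEN conjunct2]]
    show "exist_pairwise_incomparable (ctwo ^c (ctwo ^c natLeq)) (\<lambda>\<sigma> :: 'a topology. gt_henselian \<sigma>)"
      by (rule exist_pairwise_incomparable_cong[OF many(1) card(2)])
    have sc: "second_countable \<sigma>" if "weight \<sigma> \<le>o |UNIV :: 'a set|" for \<sigma> :: "'a topology"
      by (rule second_countable_weight[OF that large[THEN conjunct2]])
    show "exist_pairwise_incomparable (ctwo ^c natLeq) (\<lambda>\<sigma> :: 'a topology. gt_henselian \<sigma> \<and> second_countable \<sigma>)"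
      by (rule exist_pairwise_incomparable_cong[OF exist_pairwise_incomparable_mono[OF many(2)] card(1)]) (simp add: sc)
  }
qed

end
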